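(* Let $\omega\subset\mathbb{R}^2$ be an open, bounded, simply connected domain, let $f\in L^\infty(\omega,\mathbb{R})$ and let $\alpha\in(0,1)$. Then the set of $\mathcal{C}^{1,\alpha}(\bar\omega,\mathbb{R}^2)$ weak solutions $v=(v^1,v^2)$ to $$\det\nabla^2v^1+\det\nabla^2v^2=\langle\partial^2_{11}v,\partial^2_{22}v\rangle-|\partial^2_{12}v|^2=f\quad\text{ in }\omega$$ is dense in $\mathcal{C}^0(\bar\omega,\mathbb{R}^2)$. Namely, every $v\in\mathcal{C}^0(\bar\omega,\mathbb{R}^2)$ is the uniform limit on $\bar\omega$ of some sequence $\{v_n\in\mathcal{C}^{1,\alpha}(\bar\omega,\mathbb{R}^2)\}_{n=1}^\infty$ such that each $v_n$, $n\ge1$, is a weak solution of $\langle\partial^2_{11}v_n,\partial^2_{22}v_n\rangle-|\partial^2_{12}v_n|^2=f$ on $\omega$.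
   Context: Weak solution: $v\in H^1(\omega,\mathbb{R}^2)$ is a weak solution of the equation $\langle\partial^2_{11}v,\partial^2_{22}v\rangle-|\partial^2_{12}v|^2=f$ in $\omega$ if $-\frac12\,\mathrm{curl}\,\mathrm{curl}\big((\nabla v)^T\nabla v\big)=f$ in the sense of distributions on $\omega$, where $(\nabla v)^T\nabla v$ is the symmetric matrix field with entries $\langle\partial_iv,\partial_jv\rangle$ and, for a symmetric $2\times 2$ matrix field $B$, $\mathrm{curl}\,\mathrm{curl}\,B=\partial_{11}B_{22}+\partial_{22}B_{11}-2\partial_{12}B_{12}$. Explicitly: $$-\tfrac12\big(\partial_{11}|\partial_2v|^2+\partial_{22}|\partial_1v|^2-2\partial_{12}\langle\partial_1v,\partial_2v\rangle\big)=f\quad\text{in }\mathcal{D}'(\omega).$$ The space $\mathcal{C}^{m,\alpha}(\bar\omega,\mathbb{R}^2)$ consists of the restrictions to $\bar\omega$ of all functions in $\mathcal{C}^{m,\alpha}(\mathbb{R}^2,\mathbb{R}^2)$, and $\mathcal{C}^0(\bar\omega,\mathbb{R}^2)$ carries the supremum norm. *)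

theory Defs
  imports "HOL-Analysis.Analysis"
begin

definition partial_deriv :: "2 \<Rightarrow> (real^2 \<Rightarrow> 'b::real_normed_vector) \<Rightarrow> real^2 \<Rightarrow> 'b" where
  "partial_deriv i u x = frechet_derivative u (at x) (axis i 1)"

fun C_diff :: "nat \<Rightarrow> (real^2 \<Rightarrow> 'b::real_normed_vector) \<Rightarrow> bool" where
  "C_diff 0 u \<longleftrightarrow> continuous_on UNIV u"
| "C_diff (Suc k) u \<longleftrightarrow> u differentiable_on UNIV \<and> (\<forall>i. C_diff k (partial_deriv i u))"

definition test_functions :: "(real^2) set \<Rightarrow> (real^2 \<Rightarrow> real) set" where
  "test_functions \<omega> =
     {\<phi>. (\<forall>k. C_diff k \<phi>) \<and> compact (closure {x. \<phi> x \<noteq> 0}) \<and> closure {x. \<phi> x \<noteq> 0} \<subseteq> \<omega>}"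

(* Finite C^{m,\<alpha>} norm on the whole plane: all derivatives of order at most m exist and are
   bounded, and those of order m are globally \<alpha>-Hoelder continuous. *)
fun Hoelder_plane :: "nat \<Rightarrow> real \<Rightarrow> (real^2 \<Rightarrow> 'b::real_normed_vector) \<Rightarrow> bool" where
  "Hoelder_plane 0 \<alpha> u \<longleftrightarrow> bounded (range u) \<and>
     (\<exists>C. \<forall>x y. norm (u x - u y) \<le> C * norm (x - y) powr \<alpha>)"
| "Hoelder_plane (Suc m) \<alpha> u \<longleftrightarrow> bounded (range u) \<and> u differentiable_on UNIV \<and>
     (\<forall>i. Hoelder_plane m \<alpha> (partial_deriv i u))"

(* Functions on closure \<omega> are represented by their extensional versions, as in cfunspace. *)
definition Hoelder_space ::
    "nat \<Rightarrow> real \<Rightarrow> (real^2) set \<Rightarrow> (real^2 \<Rightarrow> 'b::real_normed_vector) set" where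
  "Hoelder_space m \<alpha> \<omega> = (\<lambda>w. restrict w (closure \<omega>)) ` {w. Hoelder_plane m \<alpha> w}"

definition C0_space :: "(real^2) set \<Rightarrow> (real^2 \<Rightarrow> 'b::real_normed_vector) metric" where
  "C0_space \<omega> = cfunspace (top_of_set (closure \<omega>)) euclidean_metric"

lemma mspace_C0_space:
  assumes "bounded \<omega>"
  shows "mspace (C0_space \<omega>) =
    {v :: real^2 \<Rightarrow> 'b::real_normed_vector. v \<in> extensional (closure \<omega>) \<and> continuous_on (closure \<omega>) v}"
proof -
  have "Metric_space.mbounded UNIV dist (v ` closure \<omega>)"
    if "continuous_on (closure \<omega>) v" for v :: "real^2 \<Rightarrow> 'b"
  proof -
    have "bounded (v ` closure \<omega>)"
      using assms that by (simp add: compact_continuous_image compact_imp_bounded)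
    then show ?thesis
      by simp
  qed
  then show ?thesis
    unfolding C0_space_def by auto
qed

definition L_infty :: "(real^2) set \<Rightarrow> (real^2 \<Rightarrow> real) set" where
  "L_infty \<omega> = {f. f \<in> borel_measurable (lebesgue_on \<omega>) \<and>
                    (\<exists>C. AE x in lebesgue_on \<omega>. \<bar>f x\<bar> \<le> C)}"

definition L2_space :: "(real^2) set \<Rightarrow> (real^2 \<Rightarrow> 'b::euclidean_space) set" where
  "L2_space \<omega> = {u. u \<in> borel_measurable (lebesgue_on \<omega>) \<and>
                     integrable (lebesgue_on \<omega>) (\<lambda>x. (norm (u x))\<^sup>2)}"

(* G x is the matrix whose i-th column is the weak partial derivative of v in direction i.
   Square integrability is required because Bochner integrals of non-integrable functions are 0. *)
definition L2_weak_gradient :: "(real^2) set \<Rightarrow> (real^2 \<Rightarrow> real^2) \<Rightarrow> (real^2 \<Rightarrow> real^2^2) \<Rightarrow> bool" where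
  "L2_weak_gradient \<omega> v G \<longleftrightarrow> v \<in> L2_space \<omega> \<and> G \<in> L2_space \<omega> \<and>
     (\<forall>\<phi>\<in>test_functions \<omega>. \<forall>i.
        (LINT x|lebesgue_on \<omega>. partial_deriv i \<phi> x *\<^sub>R v x) =
        - (LINT x|lebesgue_on \<omega>. \<phi> x *\<^sub>R column i (G x)))"

definition H1_space :: "(real^2) set \<Rightarrow> (real^2 \<Rightarrow> real^2) set" where
  "H1_space \<omega> = {v. \<exists>G. L2_weak_gradient \<omega> v G}"

(* The distribution curl curl B = d11 B22 + d22 B11 - 2 d12 B12, evaluated at the test function \<phi>. *)
definition curl_curl :: "(real^2) set \<Rightarrow> (real^2 \<Rightarrow> real^2^2) \<Rightarrow> (real^2 \<Rightarrow> real) \<Rightarrow> real" where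
  "curl_curl \<omega> B \<phi> = (LINT x|lebesgue_on \<omega>.
       B x $ 2 $ 2 * partial_deriv 1 (partial_deriv 1 \<phi>) x
     + B x $ 1 $ 1 * partial_deriv 2 (partial_deriv 2 \<phi>) x
     - 2 * (B x $ 1 $ 2 * partial_deriv 1 (partial_deriv 2 \<phi>) x))"

(* Weak gradients are unique up to null sets, so the choice of G is immaterial. *)
definition weak_solution :: "(real^2) set \<Rightarrow> (real^2 \<Rightarrow> real) \<Rightarrow> (real^2 \<Rightarrow> real^2) \<Rightarrow> bool" where
  "weak_solution \<omega> f v \<longleftrightarrow> v \<in> H1_space \<omega> \<and>
     (\<exists>G. L2_weak_gradient \<omega> v G \<and>
       (\<forall>\<phi>\<in>test_functions \<omega>.
          - (1/2) * curl_curl \<omega> (\<lambda>x. transpose (G x) ** G x) \<phi>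
          = (LINT x|lebesgue_on \<omega>. f x * \<phi> x)))"

end

theory Submission
  imports Defs "HOL-Probability.Sinc_Integral"
begin

text \<open>
  Convex integration in two alternating directions. On a torus of side \<open>l\<close> containing the domain, approximate
  \<open>v\<close> by trigonometric polynomials and write the defect as
  \<open>\<Sum>\<^sub>c det \<nabla>\<^sup>2 u\<^sup>c = f\<^sub>k - \<partial>\<^sub>1\<^sub>1 G\<^sub>1 - \<partial>\<^sub>2\<^sub>2 G\<^sub>2\<close>, where \<open>f\<^sub>k\<close> is a band-limited mollification of \<open>f\<close>. Adding
  \<open>(w + \<beta>) sin (\<lambda> x\<^sub>i) / \<lambda>\<close> with \<open>\<beta> = - 2 G\<^sub>j / w\<close> to the component \<open>u\<^sup>i\<close> produces the term \<open>\<partial>\<^sub>j\<^sub>j G\<^sub>j\<close>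
  that cancels one of the two defects; all other terms are again of the form \<open>\<partial>\<^sub>1\<^sub>1 X + \<partial>\<^sub>2\<^sub>2 Y\<close>, where the
  oscillating ones are integrated twice in direction \<open>i\<close> and gain two powers of \<open>\<lambda>\<close>. The second derivatives
  \<open>\<partial>\<^sub>j\<^sub>j u\<^sup>i\<close> stay moderate, as component \<open>u\<^sup>i\<close> only ever oscillates in direction \<open>i\<close>. With frequencies growing
  like \<open>\<sigma>^k\<close> and amplitudes \<open>w\<^sub>k\<close> decaying like \<open>(2400 / \<sigma>)^k\<close>, the gradients converge in the Hoelder space of
  exponent \<open>\<alpha>\<close> as soon as \<open>2400 \<sigma> powr (\<alpha> - 1) < 1\<close>, while the defects tend to 0.

  No derivative is ever lost, because all functions are kept band-limited: every order-n partial derivative is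
  at most \<open>C N^n\<close>, a condition that is stable under products and averages.
\<close>

subsection \<open>Periodic functions of exponential type\<close>

text \<open>Three obstacles shape the construction. Squaring the corrugation leaves, besides
  oscillating terms, the Hessian determinant of \<open>\<beta>\<close>, which contains a mixed
  derivative; turning that into pure second derivatives costs a logarithm. The cost is the number
  \<open>J\<close> of octaves. It grows linearly with the stage, whereas the quotient of defect and
  squared amplitude decays like \<open>(2 / 2400)^k\<close>, so one smallness condition at the start
  pays for all stages. Next, on a torus only functions of mean zero are sums of second derivatives,
  which dictates how \<open>f\<close> is extended. Finally \<open>f\<close> is merely bounded, so it
  enters in portions: every stage admits a finer mollification, and the increment joins the defects.
  The number 2400 comes from the bound \<open>H\<close> on the second derivatives across the
  corrugations. With \<open>Q = 2400\<close> this bound at most doubles per stage.\<close>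

abbreviation pd :: "2 \<Rightarrow> (real^2 \<Rightarrow> real) \<Rightarrow> real^2 \<Rightarrow> real" where
  "pd \<equiv> partial_deriv"

section \<open>Partial derivatives and Taylor bounds in the plane\<close>

lemma vec2_decomp: "(h::real^2) = h $ 1 *\<^sub>R axis 1 1 + h $ 2 *\<^sub>R axis 2 1"
  by (simp add: vec_eq_iff axis_def forall_2)

lemma axis2_inner_simps [simp]: "axis (1::2) (c::real) $ 1 = c" "axis (1::2) c $ 2 = 0"
  "axis (2::2) c $ 1 = 0" "axis (2::2) c $ 2 = c"
  by (simp_all add: axis_def)

lemma partial_deriv_eq:
  "(g has_derivative D) (at x) \<Longrightarrow> partial_deriv i g x = D (axis i 1)"
  unfolding partial_deriv_def using frechet_derivative_at by metis

lemma has_derivative_pd: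
  fixes g :: "real^2 \<Rightarrow> real"
  assumes "g differentiable at x"
  shows "(g has_derivative (\<lambda>h. h $ 1 * pd 1 g x + h $ 2 * pd 2 g x)) (at x)"
proof -
  have d: "(g has_derivative frechet_derivative g (at x)) (at x)"
    using assms frechet_derivative_works by blast
  have lin: "linear (frechet_derivative g (at x))"
    using d has_derivative_linear by blast
  have "frechet_derivative g (at x) = (\<lambda>h. h $ 1 * pd 1 g x + h $ 2 * pd 2 g x)"
  proof
    fix h :: "real^2"
    have "frechet_derivative g (at x) h = frechet_derivative g (at x) (h $ 1 *\<^sub>R axis 1 1 + h $ 2 *\<^sub>R axis 2 1)"
      using vec2_decomp[of h] by simp
    also have "\<dots> = h $ 1 * pd 1 g x + h $ 2 * pd 2 g x"
      unfolding partial_deriv_def using lin by (simp add: linear_add linear_scale)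
    finally show "frechet_derivative g (at x) h = h $ 1 * pd 1 g x + h $ 2 * pd 2 g x" .
  qed
  with d show ?thesis by simp
qed

lemma pd_unique:
  fixes g :: "real^2 \<Rightarrow> real"
  assumes "(g has_derivative (\<lambda>h. h $ 1 * a + h $ 2 * b)) (at x)"
  shows "pd 1 g x = a" "pd 2 g x = b"
  using partial_deriv_eq[OF assms] by simp_all

lemma pd_const [simp]: "pd i (\<lambda>x. c) = (\<lambda>x. 0)"
  by (rule ext) (simp add: partial_deriv_def frechet_derivative_const)

lemma pd_axis: "axis i (1::real) $ 1 * pd 1 g x + axis i 1 $ 2 * pd 2 g x = pd i g x"
  using exhaust_2[of i] by auto

lemma pd_add:
  assumes "f differentiable at x" "g differentiable at x"
  shows "pd i (\<lambda>x. f x + g x) x = pd i f x + pd i g x"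
  by (subst partial_deriv_eq[OF has_derivative_add[OF has_derivative_pd[OF assms(1)] has_derivative_pd[OF assms(2)]]])
    (simp only: pd_axis)

lemma pd_cmult:
  assumes "f differentiable at x"
  shows "pd i (\<lambda>x. c * f x) x = c * pd i f x"
  by (subst partial_deriv_eq[OF has_derivative_mult_right[OF has_derivative_pd[OF assms]]])
    (simp only: pd_axis)

lemma pd_mult:
  assumes "f differentiable at x" "g differentiable at x"
  shows "pd i (\<lambda>x. f x * g x) x = pd i f x * g x + f x * pd i g x"
  by (subst partial_deriv_eq[OF has_derivative_mult[OF has_derivative_pd[OF assms(1)] has_derivative_pd[OF assms(2)]]])
    (simp only: pd_axis add.commute)

lemma line_has_derivative:
  fixes g :: "real^2 \<Rightarrow> real"
  assumes "g differentiable at (x + t *\<^sub>R h)"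
  shows "((\<lambda>t. g (x + t *\<^sub>R h)) has_real_derivative
     (h $ 1 * pd 1 g (x + t *\<^sub>R h) + h $ 2 * pd 2 g (x + t *\<^sub>R h))) (at t)"
proof -
  have "((\<lambda>t. x + t *\<^sub>R h) has_derivative (\<lambda>s. s *\<^sub>R h)) (at t)"
    by (auto intro!: derivative_eq_intros)
  from has_derivative_compose[OF this has_derivative_pd[OF assms]]
  show ?thesis
    unfolding has_field_derivative_def
    by (rule has_derivative_eq_rhs) (simp add: fun_eq_iff algebra_simps)
qed

lemma axis_line_has_derivative:
  fixes g :: "real^2 \<Rightarrow> real"
  assumes "g differentiable at (x + t *\<^sub>R axis i 1)"
  shows "((\<lambda>t. g (x + t *\<^sub>R axis i 1)) has_real_derivative (pd i g (x + t *\<^sub>R axis i 1))) (at t)"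
  using line_has_derivative[OF assms] exhaust_2[of i] by (auto simp: axis_def)

text \<open>The second difference over a square of side \<open>s\<close> is symmetric in the two
  directions. The mean value theorem, applied twice, equates it with either mixed derivative at a
  point near \<open>x\<close>, and continuity compares both with the value at
  \<open>x\<close>.\<close>

lemma pd_commute:
  fixes g :: "real^2 \<Rightarrow> real"
  assumes g: "\<And>x. g differentiable at x" and g1: "\<And>i x. pd i g differentiable at x"
    and c: "\<And>i j. continuous_on UNIV (pd i (pd j g))"
  shows "pd i (pd j g) x = pd j (pd i g) x"
proof -
  have quot: "\<exists>a b. 0 < a \<and> a < s \<and> 0 < b \<and> b < s \<and>
     g (x + s *\<^sub>R axis i 1 + s *\<^sub>R axis j 1) - g (x + s *\<^sub>R axis i 1) - g (x + s *\<^sub>R axis j 1) + g x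
     = s * s * pd j (pd i g) (x + a *\<^sub>R axis i 1 + b *\<^sub>R axis j 1)" if "s > 0" for s and i j :: 2
  proof -
    let ?p = "\<lambda>t. g (x + s *\<^sub>R axis j 1 + t *\<^sub>R axis i 1) - g (x + t *\<^sub>R axis i 1)"
    have "\<exists>a. 0 < a \<and> a < s \<and> ?p s - ?p 0 = (s - 0) *
       (pd i g (x + s *\<^sub>R axis j 1 + a *\<^sub>R axis i 1) - pd i g (x + a *\<^sub>R axis i 1))"
      by (rule MVT2[OF that]) (intro derivative_intros axis_line_has_derivative g)
    then obtain a where a: "0 < a" "a < s" "?p s - ?p 0 = s *
       (pd i g (x + s *\<^sub>R axis j 1 + a *\<^sub>R axis i 1) - pd i g (x + a *\<^sub>R axis i 1))" by auto
    let ?q = "\<lambda>t. pd i g (x + a *\<^sub>R axis i 1 + t *\<^sub>R axis j 1)"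
    have "\<exists>b. 0 < b \<and> b < s \<and> ?q s - ?q 0 = (s - 0) * pd j (pd i g) (x + a *\<^sub>R axis i 1 + b *\<^sub>R axis j 1)"
      by (rule MVT2[OF that]) (intro axis_line_has_derivative g1)
    then obtain b where b: "0 < b" "b < s" "?q s - ?q 0 = s * pd j (pd i g) (x + a *\<^sub>R axis i 1 + b *\<^sub>R axis j 1)"
      by auto
    show ?thesis
      using a b by (intro exI[of _ a] exI[of _ b]) (simp add: algebra_simps)
  qed
  have close: "\<bar>pd i (pd j g) x - pd j (pd i g) x\<bar> \<le> e" if e: "e > 0" for e
  proof -
    have cc: "\<exists>d>0. \<forall>y. dist y x < d \<longrightarrow> dist (pd i (pd j g) y) (pd i (pd j g) x) < e/2" for i j
      using c[of i j] e unfolding continuous_on_iff by (metis UNIV_I half_gt_zero)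
    obtain d1 where d1: "d1>0" "\<And>y. dist y x < d1 \<Longrightarrow> dist (pd i (pd j g) y) (pd i (pd j g) x) < e/2" using cc by blast
    obtain d2 where d2: "d2>0" "\<And>y. dist y x < d2 \<Longrightarrow> dist (pd j (pd i g) y) (pd j (pd i g) x) < e/2" using cc by blast
    define s where "s = min d1 d2 / 2"
    have s: "s > 0" "2 * s \<le> d1" "2 * s \<le> d2" using d1 d2 by (auto simp: s_def)
    have dd: "dist (x + a *\<^sub>R axis k 1 + b *\<^sub>R axis m 1) x < 2 * s" if "0 < a" "a < s" "0 < b" "b < s"
      for a b and k m :: 2
    proof -
      have "dist (x + a *\<^sub>R axis k 1 + b *\<^sub>R axis m 1) x \<le> norm (a *\<^sub>R axis k (1::real)) + norm (b *\<^sub>R axis m (1::real))"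
        by (metis (no_types, lifting) add.assoc add_diff_cancel_left' dist_norm norm_triangle_ineq)
      then show ?thesis using that by (simp add: norm_axis_1)
    qed
    obtain a b where ab: "0 < a" "a < s" "0 < b" "b < s"
      "g (x + s *\<^sub>R axis i 1 + s *\<^sub>R axis j 1) - g (x + s *\<^sub>R axis i 1) - g (x + s *\<^sub>R axis j 1) + g x
     = s * s * pd j (pd i g) (x + a *\<^sub>R axis i 1 + b *\<^sub>R axis j 1)" using quot[OF s(1)] by blast
    obtain a' b' where ab': "0 < a'" "a' < s" "0 < b'" "b' < s"
      "g (x + s *\<^sub>R axis j 1 + s *\<^sub>R axis i 1) - g (x + s *\<^sub>R axis j 1) - g (x + s *\<^sub>R axis i 1) + g x
     = s * s * pd i (pd j g) (x + a' *\<^sub>R axis j 1 + b' *\<^sub>R axis i 1)" using quot[OF s(1)] by blast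
    have "s * s * pd j (pd i g) (x + a *\<^sub>R axis i 1 + b *\<^sub>R axis j 1) = s * s * pd i (pd j g) (x + a' *\<^sub>R axis j 1 + b' *\<^sub>R axis i 1)"
    proof -
      have xe: "x + s *\<^sub>R axis j 1 + s *\<^sub>R axis i 1 = x + s *\<^sub>R axis i 1 + s *\<^sub>R axis j 1" by simp
      have sw: "g (x + s *\<^sub>R axis j 1 + s *\<^sub>R axis i 1) - g (x + s *\<^sub>R axis j 1) - g (x + s *\<^sub>R axis i 1) + g x
        = g (x + s *\<^sub>R axis i 1 + s *\<^sub>R axis j 1) - g (x + s *\<^sub>R axis i 1) - g (x + s *\<^sub>R axis j 1) + g x" by (simp only: xe)
      show ?thesis by (rule trans[OF ab(5)[symmetric] trans[OF sw[symmetric] ab'(5)]])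
    qed
    then have eq: "pd j (pd i g) (x + a *\<^sub>R axis i 1 + b *\<^sub>R axis j 1) = pd i (pd j g) (x + a' *\<^sub>R axis j 1 + b' *\<^sub>R axis i 1)"
      using s by simp
    have "dist (pd j (pd i g) (x + a *\<^sub>R axis i 1 + b *\<^sub>R axis j 1)) (pd j (pd i g) x) < e/2"
      by (rule d2(2), rule less_le_trans[OF dd[OF ab(1-4)] s(3)])
    moreover have "dist (pd i (pd j g) (x + a' *\<^sub>R axis j 1 + b' *\<^sub>R axis i 1)) (pd i (pd j g) x) < e/2"
      by (rule d1(2), rule less_le_trans[OF dd[OF ab'(1-4)] s(2)])
    ultimately show ?thesis using eq unfolding dist_real_def by argo
  qed
  then show ?thesis
    using field_le_epsilon[of "\<bar>pd i (pd j g) x - pd j (pd i g) x\<bar>" 0] by auto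
qed

text \<open>An explicit constant instead of a limit: integrated over a parameter, this remainder is
  what justifies differentiation under the integral. The 4 counts the second derivatives, with both
  components of \<open>h\<close> bounded by its norm.\<close>

lemma taylor2_bound:
  fixes g :: "real^2 \<Rightarrow> real"
  assumes g: "\<And>x. g differentiable at x" and g1: "\<And>i x. pd i g differentiable at x"
    and B: "\<And>i j t. 0 \<le> t \<Longrightarrow> t \<le> 1 \<Longrightarrow> \<bar>pd i (pd j g) (x + t *\<^sub>R h)\<bar> \<le> B"
  shows "\<bar>g (x + h) - g x - (h $ 1 * pd 1 g x + h $ 2 * pd 2 g x)\<bar> \<le> 4 * B * (norm h)\<^sup>2"
proof -
  let ?d = "\<lambda>t. h $ 1 * pd 1 g (x + t *\<^sub>R h) + h $ 2 * pd 2 g (x + t *\<^sub>R h)"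
  have "\<exists>t>0. t < 1 \<and> g (x + 1 *\<^sub>R h) - g (x + 0 *\<^sub>R h) = (1 - 0) * ?d t"
    by (rule MVT2) (auto intro!: line_has_derivative g)
  then obtain t where t: "0 < t" "t < 1" "g (x + h) - g x = ?d t" by auto
  let ?e = "\<lambda>s. h $ 1 * (h $ 1 * pd 1 (pd 1 g) (x + s *\<^sub>R h) + h $ 2 * pd 2 (pd 1 g) (x + s *\<^sub>R h))
      + h $ 2 * (h $ 1 * pd 1 (pd 2 g) (x + s *\<^sub>R h) + h $ 2 * pd 2 (pd 2 g) (x + s *\<^sub>R h))"
  have "\<exists>s>0. s < t \<and> ?d t - ?d 0 = (t - 0) * ?e s"
    by (rule MVT2[OF t(1)]) (intro DERIV_add DERIV_cmult line_has_derivative g1)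
  then obtain s where s: "0 < s" "s < t" "?d t - ?d 0 = t * ?e s" by auto
  have hh: "\<bar>h $ i\<bar> \<le> norm h" for i by (rule component_le_norm_cart)
  have B': "\<bar>pd i (pd j g) (x + s *\<^sub>R h)\<bar> \<le> B" for i j using B[of s i j] s t by auto
  have B0: "B \<ge> 0" using B'[of 1 1] by auto
  have trm: "\<bar>h $ k * (h $ m * pd i (pd j g) (x + s *\<^sub>R h))\<bar> \<le> norm h * (norm h * B)" for k m i j
    unfolding abs_mult by (intro mult_mono hh B') (auto simp: B0)
  have "\<bar>?e s\<bar> \<le> 4 * (norm h * (norm h * B))"
    unfolding distrib_left using trm[of 1 1 1 1] trm[of 1 2 2 1] trm[of 2 1 1 2] trm[of 2 2 2 2] by linarith
  moreover have "\<bar>t * ?e s\<bar> \<le> 1 * \<bar>?e s\<bar>" unfolding abs_mult using t by (intro mult_right_mono) auto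
  ultimately have "\<bar>?d t - ?d 0\<bar> \<le> 4 * B * (norm h)\<^sup>2"
    using s(3) by (simp add: power2_eq_square mult_ac)
  then show ?thesis using t(3) by simp
qed

lemma has_derivative_quadratic_bound:
  fixes g :: "real^2 \<Rightarrow> real"
  assumes D: "bounded_linear D" and b: "\<And>h. norm h \<le> 1 \<Longrightarrow> \<bar>g (x + h) - g x - D h\<bar> \<le> K * (norm h)\<^sup>2"
  shows "(g has_derivative D) (at x)"
  unfolding has_derivative_at
proof (intro conjI D)
  have lim: "((\<lambda>h. \<bar>K\<bar> * norm (h::real^2)) \<longlongrightarrow> 0) (at 0)"
    by (intro tendsto_mult_right_zero tendsto_norm_zero tendsto_ident_at)
  show "(\<lambda>h. norm (g (x + h) - g x - D h) / norm h) \<midarrow>0\<rightarrow> 0"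
  proof (rule Lim_null_comparison[OF _ lim])
    have "\<forall>\<^sub>F h in at (0::real^2). dist h 0 < 1"
      unfolding eventually_at by (rule exI[of _ 1]) auto
    then show "\<forall>\<^sub>F h in at 0. norm (norm (g (x + h) - g x - D h) / norm h) \<le> \<bar>K\<bar> * norm h"
    proof (rule eventually_mono)
      fix h :: "real^2" assume "dist h 0 < 1"
      then have "\<bar>g (x + h) - g x - D h\<bar> \<le> K * (norm h)\<^sup>2" using b by simp
      also have "\<dots> \<le> \<bar>K\<bar> * norm h * norm h" unfolding power2_eq_square mult.assoc by (intro mult_right_mono) auto
      finally show "norm (norm (g (x + h) - g x - D h) / norm h) \<le> \<bar>K\<bar> * norm h"
        by (cases "h = 0") (auto simp: divide_le_eq)
    qed
  qed
qed

section \<open>Classes defined by Bernstein bounds, and their algebra\<close>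

fun bw :: "real \<Rightarrow> nat \<Rightarrow> real \<Rightarrow> real \<Rightarrow> (real^2 \<Rightarrow> real) \<Rightarrow> bool" where
  "bw l 0 C N g \<longleftrightarrow> (\<forall>x. \<bar>g x\<bar> \<le> C) \<and> (\<forall>x i. g (x + axis i l) = g x)"
| "bw l (Suc n) C N g \<longleftrightarrow> (\<forall>x. \<bar>g x\<bar> \<le> C) \<and> (\<forall>x i. g (x + axis i l) = g x) \<and>
     (\<forall>x. g differentiable at x) \<and> (\<forall>i. bw l n (C * N) N (pd i g))"

text \<open>The Bernstein inequalities of a bounded function whose spectrum lies in
  \<open>[- N, N]\<close> in each variable, taken as the definition. Products, averages and
  derivatives can then be handled by induction on the order, without Fourier transforms.\<close>

definition BL :: "real \<Rightarrow> real \<Rightarrow> real \<Rightarrow> (real^2 \<Rightarrow> real) \<Rightarrow> bool" where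
  "BL l C N g \<longleftrightarrow> 0 \<le> N \<and> (\<forall>n. bw l n C N g)"

lemma bw_bound: "bw l n C N g \<Longrightarrow> \<bar>g x\<bar> \<le> C"
  by (cases n) auto

lemma bw_periodic: "bw l n C N g \<Longrightarrow> g (x + axis i l) = g x"
  by (cases n) auto

lemma BL_bound: "BL l C N g \<Longrightarrow> \<bar>g x\<bar> \<le> C"
  unfolding BL_def using bw_bound by blast

lemma BL_periodic: "BL l C N g \<Longrightarrow> g (x + axis i l) = g x"
  unfolding BL_def using bw_periodic by blast

lemma BL_nonneg: "BL l C N g \<Longrightarrow> 0 \<le> C" "BL l C N g \<Longrightarrow> 0 \<le> N"
  using BL_bound[of l C N g 0] by (auto simp: BL_def)

lemma BL_differentiable [intro]: "BL l C N g \<Longrightarrow> g differentiable at x"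
  unfolding BL_def using bw.simps(2)[of l 0 C N g] by blast

lemma BL_pd: "BL l C N g \<Longrightarrow> BL l (C * N) N (pd i g)"
  unfolding BL_def using bw.simps(2)[of l _ C N g] by blast

lemma BL_continuous: "BL l C N g \<Longrightarrow> continuous_on UNIV g"
  by (intro differentiable_imp_continuous_on) (simp add: differentiable_on_def BL_differentiable)

lemma BL_pd_commute: "BL l C N g \<Longrightarrow> pd i (pd j g) = pd j (pd i g)"
  by (rule ext, rule pd_commute) (auto intro!: BL_continuous BL_pd BL_differentiable)

lemma bw_mono: "bw l n C N g \<Longrightarrow> C \<le> C' \<Longrightarrow> 0 \<le> N \<Longrightarrow> N \<le> N' \<Longrightarrow> bw l n C' N' g"
proof (induction n arbitrary: C C' g)
  case 0
  then show ?case by (auto intro: order_trans)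
next
  case (Suc n)
  have "0 \<le> C" using bw_bound[OF Suc.prems(1), of 0] by auto
  then have "C * N \<le> C' * N'" using Suc.prems by (intro mult_mono) auto
  then have "bw l n (C' * N') N' (pd i g)" for i
    using Suc.IH[of "C * N" "pd i g" "C' * N'"] Suc.prems by simp
  with Suc.prems show ?case by (auto intro: order_trans)
qed

lemma BL_mono: "BL l C N g \<Longrightarrow> C \<le> C' \<Longrightarrow> N \<le> N' \<Longrightarrow> BL l C' N' g"
  unfolding BL_def using bw_mono by (metis order_trans)

lemma BL_const: "BL l \<bar>c\<bar> 0 (\<lambda>x. c)"
proof -
  have "bw l n \<bar>c\<bar> 0 (\<lambda>x. c)" for n c
  proof (induction n arbitrary: c)
    case (Suc n)
    from Suc[of 0] show ?case by simp
  qed simp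
  then show ?thesis by (auto simp: BL_def)
qed

lemma pd_add_BL: "BL l C N f \<Longrightarrow> BL l' C' N' g \<Longrightarrow> pd i (\<lambda>x. f x + g x) = (\<lambda>x. pd i f x + pd i g x)"
  by (rule ext, rule pd_add) auto

lemma pd_cmult_BL: "BL l C N f \<Longrightarrow> pd i (\<lambda>x. c * f x) = (\<lambda>x. c * pd i f x)"
  by (rule ext, rule pd_cmult) auto

lemma pd_mult_BL: "BL l C N f \<Longrightarrow> BL l' C' N' g \<Longrightarrow>
    pd i (\<lambda>x. f x * g x) = (\<lambda>x. pd i f x * g x + f x * pd i g x)"
  by (rule ext, rule pd_mult) auto

lemma bw_add: "bw l n C N f \<Longrightarrow> bw l n C' N g \<Longrightarrow> bw l n (C + C') N (\<lambda>x. f x + g x)"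
proof (induction n arbitrary: C C' f g)
  case 0
  then show ?case by (auto intro!: order_trans[OF abs_triangle_ineq] add_mono)
next
  case (Suc n)
  have "pd i (\<lambda>x. f x + g x) = (\<lambda>x. pd i f x + pd i g x)" for i
    by (rule ext, rule pd_add) (use Suc.prems in auto)
  moreover have "bw l n ((C + C') * N) N (\<lambda>x. pd i f x + pd i g x)" for i
    unfolding distrib_right by (rule Suc.IH) (use Suc.prems in auto)
  moreover have "\<bar>f x + g x\<bar> \<le> C + C'" for x
    using bw_bound[OF Suc.prems(1), of x] bw_bound[OF Suc.prems(2), of x] by linarith
  ultimately show ?case using Suc.prems by simp
qed

lemma BL_add: "BL l C N f \<Longrightarrow> BL l C' N g \<Longrightarrow> BL l (C + C') N (\<lambda>x. f x + g x)"
  unfolding BL_def using bw_add by blast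

lemma bw_cmult: "bw l n C N f \<Longrightarrow> bw l n (\<bar>c\<bar> * C) N (\<lambda>x. c * f x)"
proof (induction n arbitrary: C f)
  case 0
  then show ?case by (auto simp: abs_mult intro!: mult_left_mono)
next
  case (Suc n)
  have "pd i (\<lambda>x. c * f x) = (\<lambda>x. c * pd i f x)" for i
    by (rule ext, rule pd_cmult) (use Suc.prems in auto)
  moreover have "bw l n (\<bar>c\<bar> * C * N) N (\<lambda>x. c * pd i f x)" for i
    unfolding mult.assoc by (rule Suc.IH) (use Suc.prems in auto)
  moreover have "\<bar>c * f x\<bar> \<le> \<bar>c\<bar> * C" for x
    using bw_bound[OF Suc.prems, of x] by (simp add: abs_mult mult_left_mono)
  ultimately show ?case using Suc.prems by simp
qed

lemma BL_cmult: "BL l C N f \<Longrightarrow> BL l (\<bar>c\<bar> * C) N (\<lambda>x. c * f x)"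
  unfolding BL_def using bw_cmult by blast

text \<open>The Leibniz rule gives \<open>C * N * C' + C * (C' * N')\<close>, which is exactly
  \<open>C * C' * (N + N')\<close>: frequencies add and no combinatorial constant appears, so the
  induction closes.\<close>

lemma bw_mult: "bw l n C N f \<Longrightarrow> bw l n C' N' g \<Longrightarrow> 0 \<le> N \<Longrightarrow> 0 \<le> N' \<Longrightarrow>
    bw l n (C * C') (N + N') (\<lambda>x. f x * g x)"
proof (induction n arbitrary: C C' f g)
  case 0
  have "\<bar>f x * g x\<bar> \<le> C * C'" for x
    unfolding abs_mult using bw_bound[OF 0(1), of x] bw_bound[OF 0(2), of x]
    by (intro mult_mono) auto
  with 0 show ?case by simp
next
  case (Suc n)
  have e: "pd i (\<lambda>x. f x * g x) = (\<lambda>x. pd i f x * g x + f x * pd i g x)" for i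
    by (rule ext, rule pd_mult) (use Suc.prems in auto)
  have lower: "bw l n C N g" if "bw l (Suc n) C N g" for n C N g
    using that
  proof (induction n arbitrary: C g)
    case (Suc m)
    have "bw l m (C * N) N (pd i g)" for i
      by (rule Suc.IH) (use Suc.prems in simp)
    with Suc.prems show ?case by simp
  qed simp
  have "bw l n (C * N * C') (N + N') (\<lambda>x. pd i f x * g x)" for i
    by (rule Suc.IH[OF _ lower[OF Suc.prems(2)] Suc.prems(3,4)]) (use Suc.prems(1) in simp)
  moreover have "bw l n (C * (C' * N')) (N + N') (\<lambda>x. f x * pd i g x)" for i
    by (rule Suc.IH[OF lower[OF Suc.prems(1)] _ Suc.prems(3,4)]) (use Suc.prems(2) in simp)
  ultimately have "bw l n (C * N * C' + C * (C' * N')) (N + N') (\<lambda>x. pd i f x * g x + f x * pd i g x)" for i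
    by (rule bw_add)
  moreover have "C * N * C' + C * (C' * N') = C * C' * (N + N')" by (simp add: algebra_simps)
  ultimately have "bw l n (C * C' * (N + N')) (N + N') (pd i (\<lambda>x. f x * g x))" for i
    by (simp only: e)
  moreover have "\<bar>f x * g x\<bar> \<le> C * C'" for x
    unfolding abs_mult using bw_bound[OF Suc.prems(1), of x] bw_bound[OF Suc.prems(2), of x]
    by (intro mult_mono) auto
  ultimately show ?case using Suc.prems by simp
qed

lemma BL_mult: "BL l C N f \<Longrightarrow> BL l C' N' g \<Longrightarrow> BL l (C * C') (N + N') (\<lambda>x. f x * g x)"
  unfolding BL_def using bw_mult by auto

text \<open>Iterated derivatives along a word of directions. They allow measurability in a parameter
  to be assumed for all orders at once.\<close>

fun pds :: "2 list \<Rightarrow> (real^2 \<Rightarrow> real) \<Rightarrow> real^2 \<Rightarrow> real" where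
  "pds [] g = g"
| "pds (i # is) g = pds is (pd i g)"

lemma BL_pds: "BL l C N g \<Longrightarrow> BL l (C * N ^ length is) N (pds is g)"
proof (induction "is" arbitrary: C g)
  case (Cons i "is")
  from Cons.IH[OF BL_pd[OF Cons.prems, of i]] show ?case by (simp add: mult_ac)
qed simp

lemma BL_taylor:
  assumes "BL l C N g"
  shows "\<bar>g (x + h) - g x - (h $ 1 * pd 1 g x + h $ 2 * pd 2 g x)\<bar> \<le> 4 * (C * N * N) * (norm h)\<^sup>2"
  by (rule taylor2_bound)
    (use assms in \<open>auto intro!: BL_differentiable BL_pd BL_bound\<close>)

section \<open>Parameter integrals, series and translation averages\<close>

lemma integrable_BL_family:
  fixes g :: "'z \<Rightarrow> real^2 \<Rightarrow> real"
  assumes "\<And>\<zeta>. BL l (c \<zeta>) N (g \<zeta>)" "integrable M c" "(\<lambda>\<zeta>. g \<zeta> x) \<in> borel_measurable M"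
  shows "integrable M (\<lambda>\<zeta>. g \<zeta> x)"
proof (rule Bochner_Integration.integrable_bound[OF assms(2,3)], rule AE_I2)
  fix \<zeta>
  show "norm (g \<zeta> x) \<le> norm (c \<zeta>)" using BL_bound[OF assms(1), of \<zeta> x] by simp
qed

text \<open>The quadratic remainder is integrated together with the family, so the derivative of the
  integral comes with a remainder of the same form and no limit theorem is invoked.\<close>

lemma has_derivative_integral_family:
  fixes g :: "'z \<Rightarrow> real^2 \<Rightarrow> real"
  assumes b: "\<And>\<zeta> h. norm h \<le> 1 \<Longrightarrow> \<bar>g \<zeta> (x + h) - g \<zeta> x - (h $ 1 * a \<zeta> + h $ 2 * b \<zeta>)\<bar> \<le> w \<zeta> * (norm h)\<^sup>2"
    and i: "\<And>y. integrable M (\<lambda>\<zeta>. g \<zeta> y)" "integrable M a" "integrable M b" "integrable M w"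
  shows "((\<lambda>x. \<integral>\<zeta>. g \<zeta> x \<partial>M) has_derivative (\<lambda>h. h $ 1 * (\<integral>\<zeta>. a \<zeta> \<partial>M) + h $ 2 * (\<integral>\<zeta>. b \<zeta> \<partial>M))) (at x)"
proof (rule has_derivative_quadratic_bound[where K="\<integral>\<zeta>. w \<zeta> \<partial>M"])
  show "bounded_linear (\<lambda>h::real^2. h $ 1 * (\<integral>\<zeta>. a \<zeta> \<partial>M) + h $ 2 * (\<integral>\<zeta>. b \<zeta> \<partial>M))"
    by (intro bounded_linear_add bounded_linear_mult_const bounded_linear_vec_nth)
  fix h :: "real^2" assume h: "norm h \<le> 1"
  have "(\<integral>\<zeta>. g \<zeta> (x + h) \<partial>M) - (\<integral>\<zeta>. g \<zeta> x \<partial>M) - (h $ 1 * (\<integral>\<zeta>. a \<zeta> \<partial>M) + h $ 2 * (\<integral>\<zeta>. b \<zeta> \<partial>M))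
    = (\<integral>\<zeta>. g \<zeta> (x + h) - g \<zeta> x - (h $ 1 * a \<zeta> + h $ 2 * b \<zeta>) \<partial>M)"
    using i by simp
  also have "\<bar>\<dots>\<bar> \<le> (\<integral>\<zeta>. \<bar>g \<zeta> (x + h) - g \<zeta> x - (h $ 1 * a \<zeta> + h $ 2 * b \<zeta>)\<bar> \<partial>M)"
    by (rule integral_abs_bound)
  also have "\<dots> \<le> (\<integral>\<zeta>. w \<zeta> * (norm h)\<^sup>2 \<partial>M)"
    by (rule integral_mono) (use i b[OF h] in auto)
  also have "\<dots> = (\<integral>\<zeta>. w \<zeta> \<partial>M) * (norm h)\<^sup>2" by simp
  finally show "\<bar>(\<integral>\<zeta>. g \<zeta> (x + h) \<partial>M) - (\<integral>\<zeta>. g \<zeta> x \<partial>M) - (h $ 1 * (\<integral>\<zeta>. a \<zeta> \<partial>M) + h $ 2 * (\<integral>\<zeta>. b \<zeta> \<partial>M))\<bar>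
    \<le> (\<integral>\<zeta>. w \<zeta> \<partial>M) * (norm h)\<^sup>2" .
qed

text \<open>Only the constants \<open>c\<close> are integrated; the common type \<open>N\<close> is
  untouched. Measurability is required for every word \<open>is\<close> because the induction on the
  order replaces the family by its derivatives.\<close>

lemma BL_integral:
  fixes g :: "'z \<Rightarrow> real^2 \<Rightarrow> real"
  assumes "\<And>\<zeta>. BL l (c \<zeta>) N (g \<zeta>)" "integrable M c" "0 \<le> N"
    and "\<And>is x. (\<lambda>\<zeta>. pds is (g \<zeta>) x) \<in> borel_measurable M"
  shows BL_integral_BL: "BL l (\<integral>\<zeta>. c \<zeta> \<partial>M) N (\<lambda>x. \<integral>\<zeta>. g \<zeta> x \<partial>M)"
    and pd_integral_BL: "pd i (\<lambda>x. \<integral>\<zeta>. g \<zeta> x \<partial>M) = (\<lambda>x. \<integral>\<zeta>. pd i (g \<zeta>) x \<partial>M)"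
proof -
  have int: "integrable M (\<lambda>\<zeta>. g \<zeta> x)"
    if "\<And>\<zeta>. BL l (c \<zeta>) N (g \<zeta>)" "integrable M c" "\<And>is x. (\<lambda>\<zeta>. pds is (g \<zeta>) x) \<in> borel_measurable M"
    for c x and g :: "'z \<Rightarrow> real^2 \<Rightarrow> real"
    by (rule integrable_BL_family[OF that(1,2)]) (use that(3)[of "[]"] in simp)
  have pm: "(\<lambda>\<zeta>. pds is (pd i (g \<zeta>)) x) \<in> borel_measurable M"
    if "\<And>is x. (\<lambda>\<zeta>. pds is (g \<zeta>) x) \<in> borel_measurable M"
    for "is" i x and g :: "'z \<Rightarrow> real^2 \<Rightarrow> real"
    using that[of "i # is"] by simp
  have der: "((\<lambda>x. \<integral>\<zeta>. g \<zeta> x \<partial>M) has_derivative (\<lambda>h. h $ 1 * (\<integral>\<zeta>. pd 1 (g \<zeta>) x \<partial>M) + h $ 2 * (\<integral>\<zeta>. pd 2 (g \<zeta>) x \<partial>M))) (at x)"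
    if g: "\<And>\<zeta>. BL l (c \<zeta>) N (g \<zeta>)" "integrable M c" "\<And>is x. (\<lambda>\<zeta>. pds is (g \<zeta>) x) \<in> borel_measurable M"
    for c x and g :: "'z \<Rightarrow> real^2 \<Rightarrow> real"
  proof (rule has_derivative_integral_family[where w="\<lambda>\<zeta>. 4 * (c \<zeta> * N * N)"])
    show "integrable M (\<lambda>\<zeta>. g \<zeta> y)" for y by (rule int[OF g])
    have "integrable M (\<lambda>\<zeta>. pd i (g \<zeta>) x)" for i
      by (rule int[OF BL_pd[OF g(1)] _ pm[OF g(3)]]) (use g(2) in simp)
    then show "integrable M (\<lambda>\<zeta>. pd 1 (g \<zeta>) x)" "integrable M (\<lambda>\<zeta>. pd 2 (g \<zeta>) x)" by blast+
    show "integrable M (\<lambda>\<zeta>. 4 * (c \<zeta> * N * N))" using g(2) by simp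
  qed (rule BL_taylor[OF g(1)])
  have pdi: "pd i (\<lambda>x. \<integral>\<zeta>. g \<zeta> x \<partial>M) = (\<lambda>x. \<integral>\<zeta>. pd i (g \<zeta>) x \<partial>M)"
    if g: "\<And>\<zeta>. BL l (c \<zeta>) N (g \<zeta>)" "integrable M c" "\<And>is x. (\<lambda>\<zeta>. pds is (g \<zeta>) x) \<in> borel_measurable M"
    for c i and g :: "'z \<Rightarrow> real^2 \<Rightarrow> real"
  proof
    fix x
    show "pd i (\<lambda>x. \<integral>\<zeta>. g \<zeta> x \<partial>M) x = (\<integral>\<zeta>. pd i (g \<zeta>) x \<partial>M)"
      using pd_unique[OF der[OF g, of x]] exhaust_2[of i] by auto
  qed
  have "bw l n (\<integral>\<zeta>. c \<zeta> \<partial>M) N (\<lambda>x. \<integral>\<zeta>. g \<zeta> x \<partial>M)"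
    if g: "\<And>\<zeta>. BL l (c \<zeta>) N (g \<zeta>)" "integrable M c" "\<And>is x. (\<lambda>\<zeta>. pds is (g \<zeta>) x) \<in> borel_measurable M"
    for n c and g :: "'z \<Rightarrow> real^2 \<Rightarrow> real"
    using g
  proof (induction n arbitrary: c g)
    case base: 0
    have "\<bar>\<integral>\<zeta>. g \<zeta> x \<partial>M\<bar> \<le> (\<integral>\<zeta>. c \<zeta> \<partial>M)" for x
      by (rule order_trans[OF integral_abs_bound integral_mono])
        (use int[OF base] base(2) BL_bound[OF base(1)] in auto)
    moreover have "(\<integral>\<zeta>. g \<zeta> (x + axis i l) \<partial>M) = (\<integral>\<zeta>. g \<zeta> x \<partial>M)" for x i
      by (simp only: BL_periodic[OF base(1)])
    ultimately show ?case by simp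
  next
    case (Suc n)
    have "\<bar>\<integral>\<zeta>. g \<zeta> x \<partial>M\<bar> \<le> (\<integral>\<zeta>. c \<zeta> \<partial>M)" for x
      by (rule order_trans[OF integral_abs_bound integral_mono])
        (use int[OF Suc.prems] Suc.prems(2) BL_bound[OF Suc.prems(1)] in auto)
    moreover have "(\<integral>\<zeta>. g \<zeta> (x + axis i l) \<partial>M) = (\<integral>\<zeta>. g \<zeta> x \<partial>M)" for x i
      by (simp only: BL_periodic[OF Suc.prems(1)])
    moreover have "(\<lambda>x. \<integral>\<zeta>. g \<zeta> x \<partial>M) differentiable at x" for x
      using der[OF Suc.prems, of x] by (auto simp: differentiable_def)
    moreover have "bw l n (\<integral>\<zeta>. c \<zeta> * N \<partial>M) N (\<lambda>x. \<integral>\<zeta>. pd i (g \<zeta>) x \<partial>M)" for i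
      by (rule Suc.IH[OF BL_pd[OF Suc.prems(1)] _ pm[OF Suc.prems(3)]]) (use Suc.prems(2) in simp)
    ultimately show ?case by (simp add: pdi[OF Suc.prems])
  qed
  then show "BL l (\<integral>\<zeta>. c \<zeta> \<partial>M) N (\<lambda>x. \<integral>\<zeta>. g \<zeta> x \<partial>M)"
    using assms by (simp add: BL_def)
  show "pd i (\<lambda>x. \<integral>\<zeta>. g \<zeta> x \<partial>M) = (\<lambda>x. \<integral>\<zeta>. pd i (g \<zeta>) x \<partial>M)"
    by (rule pdi[OF assms(1,2,4)])
qed

text \<open>Reduced to the integral over the counting measure. All terms share one type; the series
  of corrugations, whose frequencies grow, is treated separately in
  \<open>C1_series\<close>.\<close>

lemma BL_series:
  assumes g: "\<And>m. BL l (c m) N (g m)" and c: "summable c"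
  shows BL_series_BL: "BL l (\<Sum>m. c m) N (\<lambda>x. \<Sum>m. g m x)"
    and pd_series_BL: "pd i (\<lambda>x. \<Sum>m. g m x) = (\<lambda>x. \<Sum>m. pd i (g m) x)"
proof -
  have cc: "summable (\<lambda>m. norm (c m))" "integrable (count_space UNIV) c"
    using c BL_nonneg[OF g] by (auto simp: integrable_count_space_nat_iff)
  have sm: "summable (\<lambda>m. norm (g m x))"
    if "\<And>m. BL l (c m) N (g m)" "summable c" for c N x and g :: "nat \<Rightarrow> real^2 \<Rightarrow> real"
    by (rule summable_comparison_test'[OF that(2), of 0]) (use BL_bound[OF that(1)] in auto)
  have e: "(\<integral>m. g m x \<partial>count_space UNIV) = (\<Sum>m. g m x)" for x
    by (rule integral_count_space_nat) (use sm[OF g c] in \<open>simp add: integrable_count_space_nat_iff\<close>)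
  have ci: "summable (\<lambda>m. c m * N)" using c by (rule summable_mult2)
  have e': "(\<integral>m. pd i (g m) x \<partial>count_space UNIV) = (\<Sum>m. pd i (g m) x)" for x
    by (rule integral_count_space_nat) (use sm[OF BL_pd[OF g] ci] in \<open>simp add: integrable_count_space_nat_iff\<close>)
  have ec: "(\<integral>m. c m \<partial>count_space UNIV) = (\<Sum>m. c m)"
    by (rule integral_count_space_nat[OF cc(2)])
  have N: "0 \<le> N" using BL_nonneg(2)[OF g] .
  show "BL l (\<Sum>m. c m) N (\<lambda>x. \<Sum>m. g m x)"
    using BL_integral_BL[OF g cc(2) N] by (simp add: e ec)
  show "pd i (\<lambda>x. \<Sum>m. g m x) = (\<lambda>x. \<Sum>m. pd i (g m) x)"
    using pd_integral_BL[OF g cc(2) N, of i] by (simp add: e e')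
qed

lemma pd_translate:
  assumes "\<And>x. g differentiable at x"
  shows "pd i (\<lambda>x. g (x - a)) = (\<lambda>x. pd i g (x - a))" "(\<lambda>x. g (x - a)) differentiable at x"
proof -
  have "((\<lambda>x. g (x - a)) has_derivative (\<lambda>h. h $ 1 * pd 1 g (x - a) + h $ 2 * pd 2 g (x - a))) (at x)" for x
  proof -
    have "((\<lambda>x. x - a) has_derivative (\<lambda>h. h)) (at x)" by (auto intro!: derivative_eq_intros)
    from has_derivative_compose[OF this has_derivative_pd[OF assms]] show ?thesis .
  qed
  note d = this
  show "pd i (\<lambda>x. g (x - a)) = (\<lambda>x. pd i g (x - a))"
    by (rule ext, subst partial_deriv_eq[OF d]) (rule pd_axis)
  show "(\<lambda>x. g (x - a)) differentiable at x"
    using d by (auto simp: differentiable_def)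
qed

lemma BL_translate:
  assumes "BL l C N g" shows "BL l C N (\<lambda>x. g (x - a))"
proof -
  have "bw l n C N (\<lambda>x. g (x - a))" if "BL l C N g" for n C g
    using that
  proof (induction n arbitrary: C g)
    case 0
    have "g (x + axis i l - a) = g (x - a)" for x i
      using BL_periodic[OF 0, of "x - a" i] by (simp add: algebra_simps)
    then show ?case using BL_bound[OF 0] by simp
  next
    case (Suc n)
    have "g (x + axis i l - a) = g (x - a)" for x i
      using BL_periodic[OF Suc.prems, of "x - a" i] by (simp add: algebra_simps)
    then show ?case using BL_bound[OF Suc.prems] Suc.IH[OF BL_pd[OF Suc.prems]]
        pd_translate[OF BL_differentiable[OF Suc.prems]] by simp
  qed
  then show ?thesis using assms by (auto simp: BL_def)
qed

lemma pds_translate: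
  assumes "BL l C N g"
  shows "pds is (\<lambda>x. r * g (x - a)) = (\<lambda>x. r * pds is g (x - a))"
  using assms
proof (induction "is" arbitrary: g C)
  case (Cons i "is")
  show ?case using Cons.IH[OF BL_pd[OF Cons.prems]]
    by (simp add: pd_cmult_BL[OF BL_translate[OF Cons.prems]] pd_translate(1)[OF BL_differentiable[OF Cons.prems]])
qed simp

text \<open>The density \<open>r\<close> may change sign and \<open>\<tau>\<close> is an arbitrary
  measurable displacement, so that this covers mollifiers as well as the integral remainders of
  Taylor expansions.\<close>

lemma BL_average:
  assumes g: "BL l C N g" and r: "integrable M r" and t: "\<tau> \<in> borel_measurable M"
  shows BL_average_BL: "BL l (C * (\<integral>\<zeta>. \<bar>r \<zeta>\<bar> \<partial>M)) N (\<lambda>x. \<integral>\<zeta>. r \<zeta> * g (x - \<tau> \<zeta>) \<partial>M)"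
    and pd_average_BL: "pd i (\<lambda>x. \<integral>\<zeta>. r \<zeta> * g (x - \<tau> \<zeta>) \<partial>M) = (\<lambda>x. \<integral>\<zeta>. r \<zeta> * pd i g (x - \<tau> \<zeta>) \<partial>M)"
    and integrable_average_BL: "integrable M (\<lambda>\<zeta>. r \<zeta> * g (x - \<tau> \<zeta>))"
proof -
  have b: "BL l (\<bar>r \<zeta>\<bar> * C) N (\<lambda>x. r \<zeta> * g (x - \<tau> \<zeta>))" for \<zeta>
    by (rule BL_cmult[OF BL_translate[OF g]])
  have i: "integrable M (\<lambda>\<zeta>. \<bar>r \<zeta>\<bar> * C)" using r by simp
  have m: "(\<lambda>\<zeta>. pds is (\<lambda>x. r \<zeta> * g (x - \<tau> \<zeta>)) x) \<in> borel_measurable M" for "is" x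
  proof -
    have [measurable]: "pds is g \<in> borel_measurable borel"
      by (rule borel_measurable_continuous_onI[OF BL_continuous[OF BL_pds[OF g]]])
    note [measurable] = t borel_measurable_integrable[OF r]
    show ?thesis unfolding pds_translate[OF g] by measurable
  qed
  show "BL l (C * (\<integral>\<zeta>. \<bar>r \<zeta>\<bar> \<partial>M)) N (\<lambda>x. \<integral>\<zeta>. r \<zeta> * g (x - \<tau> \<zeta>) \<partial>M)"
    using BL_integral_BL[OF b i BL_nonneg(2)[OF g] m] by (simp add: mult.commute)
  show "pd i (\<lambda>x. \<integral>\<zeta>. r \<zeta> * g (x - \<tau> \<zeta>) \<partial>M) = (\<lambda>x. \<integral>\<zeta>. r \<zeta> * pd i g (x - \<tau> \<zeta>) \<partial>M)"
    using pd_integral_BL[OF b i BL_nonneg(2)[OF g] m, of i]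
    by (simp add: pd_cmult_BL[OF BL_translate[OF g]] pd_translate(1)[OF BL_differentiable[OF g]])
  show "integrable M (\<lambda>\<zeta>. r \<zeta> * g (x - \<tau> \<zeta>))"
    by (rule integrable_BL_family[OF b i]) (use m[of "[]" x] in simp)
qed

text \<open>Differentiation turns the phase by a quarter, so cosines with arbitrary phase form a
  family closed under \<open>pd\<close> and the induction needs no sine.\<close>

lemma BL_cos:
  assumes "\<mu> * l = 2 * pi * of_int k"
  shows BL_cos_BL: "BL l 1 \<bar>\<mu>\<bar> (\<lambda>x. cos (\<mu> * x $ i + \<phi>))"
    and pd_cos: "pd j (\<lambda>x. cos (\<mu> * x $ i + \<phi>)) = (if j = i then (\<lambda>x. \<mu> * cos (\<mu> * x $ i + (\<phi> + pi/2))) else (\<lambda>x. 0))"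
proof -
  have d: "((\<lambda>x. cos (\<mu> * x $ i + \<phi>)) has_derivative (\<lambda>h. - sin (\<mu> * x $ i + \<phi>) * (\<mu> * h $ i))) (at x)" for x :: "real^2" and \<phi>
    by (auto intro!: derivative_eq_intros bounded_linear_imp_has_derivative bounded_linear_vec_nth)
  have pdc: "pd j (\<lambda>x. cos (\<mu> * x $ i + \<phi>)) = (if j = i then (\<lambda>x. \<mu> * cos (\<mu> * x $ i + (\<phi> + pi/2))) else (\<lambda>x. 0))" for j \<phi>
    using partial_deriv_eq[OF d, of j] by (auto simp: fun_eq_iff axis_def cos_add sin_add)
  show "pd j (\<lambda>x. cos (\<mu> * x $ i + \<phi>)) = (if j = i then (\<lambda>x. \<mu> * cos (\<mu> * x $ i + (\<phi> + pi/2))) else (\<lambda>x. 0))"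
    by (rule pdc)
  have per: "cos (\<mu> * (x + axis j l) $ i + \<phi>) = cos (\<mu> * x $ i + \<phi>)" for x j \<phi>
  proof (cases "j = i")
    case True
    have "\<mu> * (x + axis j l) $ i + \<phi> = (\<mu> * x $ i + \<phi>) + 2 * pi * of_int k"
      using True assms by (simp add: axis_def algebra_simps)
    then show ?thesis by (simp only: cos_add[of "\<mu> * x $ i + \<phi>"] cos_int_2pin sin_int_2pin)
  qed (simp add: axis_def)
  have "bw l n 1 \<bar>\<mu>\<bar> (\<lambda>x. cos (\<mu> * x $ i + \<phi>))" for n \<phi>
  proof (induction n arbitrary: \<phi>)
    case 0
    show ?case using per by simp
  next
    case (Suc n)
    have z: "bw l n \<bar>\<mu>\<bar> \<bar>\<mu>\<bar> (\<lambda>x. 0)"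
      using bw_mono[of l n 0 0 "\<lambda>x. 0" "\<bar>\<mu>\<bar>" "\<bar>\<mu>\<bar>"] BL_const[of l 0] by (simp add: BL_def)
    have "bw l n \<bar>\<mu>\<bar> \<bar>\<mu>\<bar> (\<lambda>x. \<mu> * cos (\<mu> * x $ i + (\<phi> + pi/2)))"
      using bw_cmult[OF Suc.IH, of \<mu>] by simp
    then have "bw l n \<bar>\<mu>\<bar> \<bar>\<mu>\<bar> (pd j (\<lambda>x. cos (\<mu> * x $ i + \<phi>)))" for j
      using z by (simp only: pdc split: if_split) simp
    moreover have "(\<lambda>x. cos (\<mu> * x $ i + \<phi>)) differentiable at x" for x :: "real^2"
      using d[of \<phi> x] unfolding differentiable_def by blast
    ultimately show ?case using per by simp
  qed
  then show "BL l 1 \<bar>\<mu>\<bar> (\<lambda>x. cos (\<mu> * x $ i + \<phi>))" by (simp add: BL_def)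
qed

section \<open>Exact inversion of two derivatives on oscillating functions\<close>

lemma BL_pd_funpow: "BL l C N A \<Longrightarrow> BL l (C * N ^ n) N ((pd i ^^ n) A)"
proof (induction n)
  case (Suc n)
  from BL_pd[OF Suc.IH[OF Suc.prems], of i] show ?case by (simp add: mult_ac)
qed simp

text \<open>With the shift operator \<open>E\<close> the summand is \<open>(n + 1) * (- E)^n\<close>
  applied to \<open>(1 + E)^2 z\<close>, and the sum of \<open>(n + 1) * (- E)^n\<close> over
  \<open>n\<close> is the power series of \<open>(1 + E)\<close> to the power -2. This is the
  resulting identity at index 0.\<close>

lemma telescope_alternating_sums:
  fixes z :: "nat \<Rightarrow> real"
  assumes "\<And>n. \<bar>z n\<bar> \<le> C * (1/2) ^ n"
  shows "(\<lambda>n. (real n + 1) * (- 1) ^ n * (z (n + 2) + 2 * z (n + 1) + z n)) sums z 0"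
proof -
  let ?t = "\<lambda>n. (real n + 1) * (- 1) ^ n * (z (n + 2) + 2 * z (n + 1) + z n)"
  have part: "(\<Sum>n<Suc m. ?t n) = z 0 + (- 1) ^ m * ((real m + 1) * z (m + 2) + (real m + 2) * z (m + 1))" for m
    by (induction m) (simp_all add: algebra_simps)
  have lim: "(\<lambda>m. (real m + 2) * (2 * C * (1/2) ^ m)) \<longlonglongrightarrow> 0"
  proof -
    have "(\<lambda>m. real m * (1/2) ^ m) \<longlonglongrightarrow> (0::real)"
      using powser_times_n_limit_0[of "1/2::real"] by (simp add: real_norm_def)
    moreover have "(\<lambda>m. (1/2) ^ m) \<longlonglongrightarrow> (0::real)" by (rule LIMSEQ_power_zero) simp
    ultimately have "(\<lambda>m. 2 * C * (real m * (1/2) ^ m) + 4 * C * (1/2) ^ m) \<longlonglongrightarrow> 2 * C * 0 + 4 * C * 0"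
      by (intro tendsto_add tendsto_mult_left)
    then show ?thesis by (simp add: algebra_simps)
  qed
  have "(\<lambda>m. (- 1) ^ m * ((real m + 1) * z (m + 2) + (real m + 2) * z (m + 1))) \<longlonglongrightarrow> 0"
  proof (rule Lim_null_comparison[OF _ lim], rule always_eventually, rule allI)
    fix m
    have C: "0 \<le> C" using assms[of 0] by simp
    have p: "C * (1/2)^(m+2) \<le> C * (1/2)^m" "C * (1/2)^(m+1) \<le> C * (1/2)^m"
      using C by (auto intro!: mult_left_mono power_decreasing)
    have a: "(real m + 1) * \<bar>z (m + 2)\<bar> \<le> (real m + 2) * (C * (1/2)^m)"
      using assms[of "m+2"] p by (intro mult_mono) auto
    have b: "(real m + 2) * \<bar>z (m + 1)\<bar> \<le> (real m + 2) * (C * (1/2)^m)"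
      using assms[of "m+1"] p by (intro mult_left_mono) auto
    have "\<bar>(real m + 1) * z (m + 2) + (real m + 2) * z (m + 1)\<bar> \<le> (real m + 1) * \<bar>z (m + 2)\<bar> + (real m + 2) * \<bar>z (m + 1)\<bar>"
      by (rule order_trans[OF abs_triangle_ineq]) (simp add: abs_mult)
    also have "\<dots> \<le> (real m + 2) * (2 * C * (1/2) ^ m)" using a b by (simp add: algebra_simps)
    finally show "norm ((- 1) ^ m * ((real m + 1) * z (m + 2) + (real m + 2) * z (m + 1))) \<le> (real m + 2) * (2 * C * (1/2) ^ m)"
      by (simp add: abs_mult)
  qed
  then have "(\<lambda>m. \<Sum>n<Suc m. ?t n) \<longlonglongrightarrow> z 0 + 0"
    unfolding part by (intro tendsto_intros)
  then show ?thesis unfolding sums_def using filterlim_sequentially_Suc[of "\<lambda>m. \<Sum>n<m. ?t n" "nhds (z 0)"] by simp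
qed

text \<open>Repeated integration by parts: each step moves one derivative onto the amplitude and
  costs a factor \<open>N / \<mu> \<le> 1/2\<close>. The amplitude being band-limited, the expansion
  can be summed to the end and leaves no remainder.\<close>

lemma osc_inverse:
  assumes A: "BL l C N A" and \<mu>: "0 < \<mu>" "2 * N \<le> \<mu>" and per: "\<mu> * l = 2 * pi * of_int k"
  shows "\<exists>X. BL l (4 * C / \<mu>\<^sup>2) (N + \<mu>) X \<and> pd i (pd i X) = (\<lambda>x. A x * cos (\<mu> * x $ i + \<phi>))"
proof -
  define a where "a n = (pd i ^^ n) A" for n
  \<comment> \<open>An \<open>n\<close>-fold antiderivative of the cosine in direction
    \<open>i\<close>: each integration divides by \<open>\<mu>\<close> and turns the phase back by a
    quarter.\<close>
  define c where "c n x = (1 / \<mu> ^ n) * cos (\<mu> * x $ i + (\<phi> - real n * (pi/2)))" for n x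
  have a: "BL l (C * N ^ n) N (a n)" for n unfolding a_def by (rule BL_pd_funpow[OF A])
  have pda: "pd i (a n) = a (Suc n)" for n by (simp add: a_def)
  have c: "BL l (1 / \<mu> ^ n) \<mu> (c n)" for n
    using BL_cmult[OF BL_cos_BL[OF per, of i "\<phi> - real n * (pi/2)"], of "1 / \<mu> ^ n"] \<mu>(1)
    by (simp add: c_def[abs_def])
  have pdc: "pd i (c (Suc n)) = c n" for n
  proof -
    have "pd i (c (Suc n)) = (\<lambda>x. (1 / \<mu> ^ Suc n) * (\<mu> * cos (\<mu> * x $ i + ((\<phi> - real (Suc n) * (pi/2)) + pi/2))))"
      unfolding c_def[abs_def] by (subst pd_cmult_BL[OF BL_cos_BL[OF per]]) (simp add: pd_cos[OF per])
    also have "\<dots> = c n"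
    proof
      fix x
      have e: "\<phi> - real (Suc n) * (pi/2) + pi/2 = \<phi> - real n * (pi/2)" by (simp add: field_simps)
      show "(1 / \<mu> ^ Suc n) * (\<mu> * cos (\<mu> * x $ i + ((\<phi> - real (Suc n) * (pi/2)) + pi/2))) = c n x"
        unfolding e using \<mu>(1) by (simp add: c_def)
    qed
    finally show ?thesis .
  qed
  \<comment> \<open>Coefficients of the expansion of \<open>(1 + E)\<close> to the power -2, where
    \<open>E\<close> raises the indices of \<open>a\<close> and \<open>c\<close> by one. The offset
    \<open>n + 2\<close> in \<open>c\<close> accounts for the two integrations.\<close>
  define g where "g n x = ((real n + 1) * (- 1) ^ n) * (a n x * c (n + 2) x)" for n x
  have g0: "BL l ((real n + 1) * ((C * N ^ n) * (1 / \<mu> ^ (n + 2)))) (N + \<mu>) (g n)" for n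
    using BL_cmult[OF BL_mult[OF a[of n] c[of "n + 2"]], of "(real n + 1) * (- 1) ^ n"]
    by (simp add: g_def[abs_def] abs_mult)
  have C: "0 \<le> C" "0 \<le> N" using BL_nonneg[OF A] .
  have Nm: "N ^ n \<le> (1/2) ^ n * \<mu> ^ n" for n
  proof -
    have "N ^ n \<le> ((1/2) * \<mu>) ^ n" using C \<mu> by (intro power_mono) auto
    then show ?thesis by (simp only: power_mult_distrib)
  qed
  have g: "BL l (C / \<mu>\<^sup>2 * (real (Suc n) * (1/2) ^ n)) (N + \<mu>) (g n)" for n
  proof (rule BL_mono[OF g0])
    have "C * N ^ n * (1 / \<mu> ^ (n + 2)) \<le> C * ((1/2) ^ n * \<mu> ^ n) * (1 / \<mu> ^ (n + 2))"
      using C \<mu> Nm by (intro mult_right_mono mult_left_mono) auto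
    also have "\<dots> = C / \<mu>\<^sup>2 * (1/2) ^ n" using \<mu>(1) by (simp add: power_add field_simps power2_eq_square)
    finally have "(real n + 1) * (C * N ^ n * (1 / \<mu> ^ (n + 2))) \<le> (real n + 1) * (C / \<mu>\<^sup>2 * (1/2) ^ n)"
      by (intro mult_left_mono) auto
    then show "(real n + 1) * (C * N ^ n * (1 / \<mu> ^ (n + 2))) \<le> C / \<mu>\<^sup>2 * (real (Suc n) * (1/2) ^ n)"
      by (simp only: of_nat_Suc mult.left_commute add.commute)
  qed simp
  \<comment> \<open>The value is \<open>1 / (1 - 1/2)^2\<close>, the origin of the 4 in the bound
    for \<open>X\<close>.\<close>
  have s: "(\<lambda>n. real (Suc n) * (1/2) ^ n) sums 4"
    using geometric_deriv_sums[of "1/2::real"] by (simp add: power2_eq_square)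
  have s': "summable (\<lambda>n. C / \<mu>\<^sup>2 * (real (Suc n) * (1/2) ^ n))" "(\<Sum>n. C / \<mu>\<^sup>2 * (real (Suc n) * (1/2) ^ n)) = 4 * C / \<mu>\<^sup>2"
    using sums_mult[OF s, of "C / \<mu>\<^sup>2"] by (auto simp: sums_iff)
  define X where "X x = (\<Sum>n. g n x)" for x
  have BX: "BL l (4 * C / \<mu>\<^sup>2) (N + \<mu>) X"
    using BL_series_BL[OF g s'(1)] unfolding s'(2) X_def[abs_def] .
  have pd2g: "pd i (pd i (g n)) x = (real n + 1) * (- 1) ^ n * (a (n+2) x * c (n+2) x + 2 * (a (n+1) x * c (n+1) x) + a n x * c n x)" for n x
  proof -
    let ?r = "(real n + 1) * (- 1) ^ n"
    have 1: "pd i (\<lambda>x. a n x * c (n + 2) x) = (\<lambda>x. a (n+1) x * c (n+2) x + a n x * c (n+1) x)"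
      using pd_mult_BL[OF a[of n] c[of "n + 2"], of i] pda[of n] pdc[of "n+1"] by simp
    have 2: "pd i (\<lambda>x. a (n+1) x * c (n+2) x + a n x * c (n+1) x)
      = (\<lambda>x. (a (n+2) x * c (n+2) x + a (n+1) x * c (n+1) x) + (a (n+1) x * c (n+1) x + a n x * c n x))"
      using pd_add_BL[OF BL_mult[OF a[of "n+1"] c[of "n+2"]] BL_mult[OF a[of n] c[of "n+1"]], of i]
        pd_mult_BL[OF a[of "n+1"] c[of "n+2"], of i] pd_mult_BL[OF a[of n] c[of "n+1"], of i]
        pda[of n] pda[of "n+1"] pdc[of "n+1"] pdc[of n] by simp
    have 3: "pd i (g n) = (\<lambda>x. ?r * (a (n+1) x * c (n+2) x + a n x * c (n+1) x))"
      unfolding g_def[abs_def] pd_cmult_BL[OF BL_mult[OF a[of n] c[of "n + 2"]]] 1 ..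
    have B: "BL l (C * N ^ n * (1 / \<mu> ^ (n + 2)) * (N + \<mu>)) (N + \<mu>) (\<lambda>x. a (n+1) x * c (n+2) x + a n x * c (n+1) x)"
      using BL_pd[OF BL_mult[OF a[of n] c[of "n + 2"]], of i] unfolding 1 .
    show ?thesis unfolding 3 pd_cmult_BL[OF B] 2 by simp
  qed
  have "pd i X = (\<lambda>x. \<Sum>n. pd i (g n) x)"
    unfolding X_def[abs_def] by (rule pd_series_BL[OF g s'(1)])
  moreover have "pd i (\<lambda>x. \<Sum>n. pd i (g n) x) = (\<lambda>x. \<Sum>n. pd i (pd i (g n)) x)"
    by (rule pd_series_BL[OF BL_pd[OF g] summable_mult2[OF s'(1)]])
  moreover have "(\<Sum>n. pd i (pd i (g n)) x) = A x * cos (\<mu> * x $ i + \<phi>)" for x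
  proof -
    have "\<bar>a n x * c n x\<bar> \<le> C * (1/2) ^ n" for n
    proof -
      have "\<bar>a n x * c n x\<bar> \<le> (C * N ^ n) * (1 / \<mu> ^ n)" by (rule BL_bound[OF BL_mult[OF a c]])
      also have "\<dots> \<le> (C * ((1/2) ^ n * \<mu> ^ n)) * (1 / \<mu> ^ n)"
        using C \<mu> Nm by (intro mult_right_mono mult_left_mono) auto
      also have "\<dots> = C * (1/2) ^ n" using \<mu>(1) by simp
      finally show ?thesis .
    qed
    from telescope_alternating_sums[OF this]
    have "(\<lambda>n. pd i (pd i (g n)) x) sums (a 0 x * c 0 x)" unfolding pd2g by (simp add: mult.assoc)
    then show ?thesis by (simp add: sums_iff a_def c_def)
  qed
  ultimately have "pd i (pd i X) = (\<lambda>x. A x * cos (\<mu> * x $ i + \<phi>))" by simp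
  with BX show ?thesis by blast
qed

subsection \<open>A band-limited mollifier\<close>

text \<open>\<open>sincd 0\<close> is the sinc function, written as the mean of
  \<open>cos (s * t)\<close> over the unit interval, and \<open>sincd j\<close> is its
  \<open>j\<close>-th derivative. The integral needs no case distinction at 0 and bounds all
  derivatives uniformly.\<close>

definition sincd :: "nat \<Rightarrow> real \<Rightarrow> real" where
  "sincd j s = integral {0..1} (\<lambda>t. t ^ j * cos (s * t + real j * (pi/2)))"

lemma sincd_deriv: "(sincd j has_real_derivative sincd (Suc j) s) (at s)"
proof -
  have "((\<lambda>s. integral (cbox 0 1) (\<lambda>t. t ^ j * cos (s * t + real j * (pi/2)))) has_field_derivative
     integral (cbox 0 1) (\<lambda>t. - (t ^ j * (sin (s * t + real j * (pi/2)) * t)))) (at s within UNIV)"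
    by (rule leibniz_rule_field_derivative)
      (auto intro!: derivative_eq_intros integrable_continuous_real continuous_intros simp: case_prod_beta)
  moreover have e: "- (t ^ j * (sin (s * t + real j * (pi/2)) * t)) = t ^ Suc j * cos (s * t + real (Suc j) * (pi/2))" for t
  proof -
    have "s * t + real (Suc j) * (pi/2) = (s * t + real j * (pi/2)) + pi/2" by (simp add: field_simps)
    then show ?thesis by (simp only: cos_add) simp
  qed
  ultimately show ?thesis by (simp only: sincd_def[abs_def] e cbox_interval)
qed

lemma integral_power_01: "integral {0..1} (\<lambda>t. t ^ j) = 1 / (real j + 1)"
proof -
  have "((\<lambda>t. t ^ j) has_integral (1 ^ Suc j / real (Suc j) - 0 ^ Suc j / real (Suc j))) {0..1::real}"
  proof (rule fundamental_theorem_of_calculus)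
    fix x :: real
    have "((\<lambda>t. t ^ Suc j / real (Suc j)) has_real_derivative x ^ j) (at x within {0..1})"
      by (rule DERIV_cong[OF DERIV_cdivide[OF DERIV_power[OF DERIV_ident]]]) (simp del: of_nat_Suc power_Suc)
    then show "((\<lambda>t. t ^ Suc j / real (Suc j)) has_vector_derivative x ^ j) (at x within {0..1})"
      by (simp only: has_real_derivative_iff_has_vector_derivative)
  qed simp
  then show ?thesis by (simp add: integral_unique add.commute)
qed

lemma sincd_bound: "\<bar>sincd j s\<bar> \<le> 1 / (real j + 1)"
proof -
  have "norm (sincd j s) \<le> integral {0..1} (\<lambda>t. t ^ j)"
    unfolding sincd_def
    by (rule integral_norm_bound_integral)
      (auto intro!: integrable_continuous_real continuous_intros simp: abs_mult mult_left_le)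
  then show ?thesis by (simp add: integral_power_01)
qed

lemma sincd_bound_1: "\<bar>sincd j s\<bar> \<le> 1"
  by (rule order_trans[OF sincd_bound]) (simp add: field_simps)

text \<open>Integrating the derivative of \<open>t ^ j * sin (s * t + j * pi / 2)\<close> over the unit interval gives
  \<open>s * sincd j s + j * sincd (j - 1) s\<close>, so all derivatives of the sinc function decay like \<open>1 / s\<close>.\<close>

lemma sincd_decay: "\<bar>s * sincd j s\<bar> \<le> 2"
proof (cases j)
  case 0
  have "((\<lambda>t. s * cos (s * t)) has_integral (sin (s * 1) - sin (s * 0))) {0..1}"
    by (rule fundamental_theorem_of_calculus)
      (auto intro!: derivative_eq_intros simp: has_real_derivative_iff_has_vector_derivative[symmetric])
  then have "integral {0..1} (\<lambda>t. s * cos (s * t)) = sin s" by (simp only: integral_unique) simp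
  then have "s * sincd 0 s = sin s" by (simp add: sincd_def)
  then show ?thesis using 0 abs_sin_le_one[of s] by (simp del: abs_sin_le_one)
next
  case (Suc k)
  let ?f = "\<lambda>t. t ^ k * cos (s * t + real k * (pi/2))"
  let ?g = "\<lambda>t. t ^ j * cos (s * t + real j * (pi/2))"
  have e: "sin (s * t + real j * (pi/2)) = cos (s * t + real k * (pi/2))" for t
  proof -
    have "s * t + real j * (pi/2) = (s * t + real k * (pi/2)) + pi/2" using Suc by (simp add: field_simps)
    then show ?thesis by (simp only: sin_add) simp
  qed
  have "((\<lambda>t. real j * ?f t + s * ?g t) has_integral
    (1 ^ j * sin (s * 1 + real j * (pi/2)) - 0 ^ j * sin (s * 0 + real j * (pi/2)))) {0..1}"
  proof (rule fundamental_theorem_of_calculus)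
    fix t :: real
    have p: "((\<lambda>t. t ^ j) has_real_derivative real j * t ^ k) (at t within {0..1})"
      using DERIV_pow[of j t] Suc by simp
    have q: "((\<lambda>t. sin (s * t + real j * (pi/2))) has_real_derivative s * cos (s * t + real j * (pi/2))) (at t within {0..1})"
      by (auto intro!: derivative_eq_intros)
    have "((\<lambda>t. t ^ j * sin (s * t + real j * (pi/2))) has_real_derivative
       real j * (t ^ k * sin (s * t + real j * (pi/2))) + s * (t ^ j * cos (s * t + real j * (pi/2)))) (at t within {0..1})"
      by (rule DERIV_cong[OF DERIV_mult[OF p q]]) (simp only: mult_ac)
    then show "((\<lambda>t. t ^ j * sin (s * t + real j * (pi/2))) has_vector_derivative
       real j * ?f t + s * ?g t) (at t within {0..1})"
      unfolding e has_real_derivative_iff_has_vector_derivative by simp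
  qed simp
  then have "integral {0..1} (\<lambda>t. real j * ?f t + s * ?g t) = sin (s + real j * (pi/2))"
    using Suc by (simp add: integral_unique)
  moreover have "integral {0..1} (\<lambda>t. real j * ?f t + s * ?g t) = real j * sincd k s + s * sincd j s"
    unfolding sincd_def
    by (subst integral_add) (auto intro!: integrable_continuous_real continuous_intros)
  ultimately have "s * sincd j s = sin (s + real j * (pi/2)) - real j * sincd k s" by simp
  moreover have "\<bar>real j * sincd k s\<bar> \<le> real j * (1 / (real k + 1))"
    unfolding abs_mult using mult_left_mono[OF sincd_bound[of k s], of "real j"]
    by (simp only: abs_of_nat of_nat_0_le_iff)
  moreover have "real j * (1 / (real k + 1)) = 1" using Suc by simp
  ultimately show ?thesis using abs_sin_le_one[of "s + real j * (pi/2)"] by linarith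
qed

section \<open>Weighted derivative bounds for powers of the sinc function\<close>

fun wk :: "nat \<Rightarrow> real \<Rightarrow> real \<Rightarrow> (real \<Rightarrow> real) \<Rightarrow> (real \<Rightarrow> real) \<Rightarrow> bool" where
  "wk 0 C N w k \<longleftrightarrow> (\<forall>s. \<bar>k s\<bar> \<le> C * w s)"
| "wk (Suc n) C N w k \<longleftrightarrow> (\<forall>s. \<bar>k s\<bar> \<le> C * w s) \<and> (\<exists>k'. (\<forall>s. (k has_real_derivative k' s) (at s)) \<and> wk n (C * N) N w k')"

lemma wk_bound: "wk n C N w k \<Longrightarrow> \<bar>k s\<bar> \<le> C * w s"
  by (cases n) auto

lemma wk_lower: "wk (Suc n) C N w k \<Longrightarrow> wk n C N w k"
proof (induction n arbitrary: C k)
  case (Suc n)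
  then show ?case using wk.simps(2) by metis
qed simp

lemma wk_add: "wk n C N w k \<Longrightarrow> wk n C' N w m \<Longrightarrow> wk n (C + C') N w (\<lambda>s. k s + m s)"
proof (induction n arbitrary: C C' k m)
  case 0
  have "\<bar>k s + m s\<bar> \<le> (C + C') * w s" for s
    using wk_bound[OF 0(1), of s] wk_bound[OF 0(2), of s] by (simp add: distrib_right)
  then show ?case by simp
next
  case (Suc n)
  obtain k' where k': "\<forall>s. (k has_real_derivative k' s) (at s)" "wk n (C * N) N w k'" using Suc.prems by auto
  obtain m' where m': "\<forall>s. (m has_real_derivative m' s) (at s)" "wk n (C' * N) N w m'" using Suc.prems by auto
  have "wk n ((C + C') * N) N w (\<lambda>s. k' s + m' s)" unfolding distrib_right by (rule Suc.IH[OF k'(2) m'(2)])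
  moreover have "\<forall>s. ((\<lambda>s. k s + m s) has_real_derivative (k' s + m' s)) (at s)"
    using k'(1) m'(1) by (auto intro: DERIV_add)
  moreover have "\<bar>k s + m s\<bar> \<le> (C + C') * w s" for s
    using wk_bound[OF Suc.prems(1), of s] wk_bound[OF Suc.prems(2), of s] by (simp add: distrib_right)
  ultimately show ?case by auto
qed

text \<open>\<open>wk\<close> is the counterpart of \<open>bw\<close> on the line with a decaying
  weight in place of a constant. Types add under products as before, and the weights multiply, which
  is how powers of sinc gain decay.\<close>

lemma wk_mult: "wk n C N w k \<Longrightarrow> wk n C' N' w' m \<Longrightarrow>
    wk n (C * C') (N + N') (\<lambda>s. w s * w' s) (\<lambda>s. k s * m s)"
proof (induction n arbitrary: C C' k m)
  case 0
  have "\<bar>k s * m s\<bar> \<le> (C * w s) * (C' * w' s)" for s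
    unfolding abs_mult using wk_bound[OF 0(1), of s] wk_bound[OF 0(2), of s] by (intro mult_mono) auto
  then show ?case by (simp add: mult_ac)
next
  case (Suc n)
  obtain k' where k': "\<forall>s. (k has_real_derivative k' s) (at s)" "wk n (C * N) N w k'" using Suc.prems by auto
  obtain m' where m': "\<forall>s. (m has_real_derivative m' s) (at s)" "wk n (C' * N') N' w' m'" using Suc.prems by auto
  have "wk n (C * N * C' + C * (C' * N')) (N + N') (\<lambda>s. w s * w' s) (\<lambda>s. k' s * m s + k s * m' s)"
    by (intro wk_add Suc.IH k'(2) m'(2) wk_lower[OF Suc.prems(1)] wk_lower[OF Suc.prems(2)])
  moreover have "C * N * C' + C * (C' * N') = C * C' * (N + N')" by (simp add: algebra_simps)
  moreover have "\<forall>s. ((\<lambda>s. k s * m s) has_real_derivative (k' s * m s + k s * m' s)) (at s)"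
    using k'(1) m'(1) by (auto intro!: derivative_eq_intros)
  moreover have "\<bar>k s * m s\<bar> \<le> (C * w s) * (C' * w' s)" for s
    unfolding abs_mult using wk_bound[OF Suc.prems(1), of s] wk_bound[OF Suc.prems(2), of s]
    by (intro mult_mono) auto
  ultimately show ?case by (auto simp: mult_ac)
qed

text \<open>The weight merges the bounds 1 for \<open>sincd j s\<close> and 2 for
  \<open>s * sincd j s\<close>, whose squares sum to 5. It is the same for all \<open>j\<close>, so
  the induction can pass to \<open>Suc j\<close>.\<close>

lemma wk_sincd: "wk n 1 1 (\<lambda>s. sqrt (5 / (1 + s\<^sup>2))) (sincd j)"
proof -
  have b: "\<bar>sincd j s\<bar> \<le> sqrt (5 / (1 + s\<^sup>2))" for j s
  proof -
    have "(sincd j s)\<^sup>2 \<le> 1" using sincd_bound_1[of j s] by (simp add: abs_square_le_1)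
    moreover have "\<bar>s * sincd j s\<bar>\<^sup>2 \<le> 2\<^sup>2" by (intro power_mono sincd_decay) simp
    ultimately have "(sincd j s)\<^sup>2 * (1 + s\<^sup>2) \<le> 5" by (simp add: power_mult_distrib algebra_simps)
    moreover have "0 < 1 + s\<^sup>2" by (rule add_pos_nonneg) auto
    ultimately have "(sincd j s)\<^sup>2 \<le> 5 / (1 + s\<^sup>2)" by (simp add: pos_le_divide_eq)
    then show ?thesis by (rule real_le_rsqrt[of "\<bar>sincd j s\<bar>", simplified])
  qed
  show ?thesis
  proof (induction n arbitrary: j)
    case 0 show ?case using b by simp
  next
    case (Suc n)
    show ?case using b Suc[of "Suc j"] sincd_deriv[of j] by auto
  qed
qed

text \<open>\<open>kap a\<close> is the a-th derivative of the fourth power of the sinc function, whose Fourier transform is supported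
  in \<open>[-4, 4]\<close>; this is where the type \<open>4 * \<mu>\<close> of the mollified functions comes from.\<close>

definition kap :: "nat \<Rightarrow> real \<Rightarrow> real" where
  "kap a = (deriv ^^ a) (\<lambda>s. sincd 0 s * sincd 0 s * (sincd 0 s * sincd 0 s))"

text \<open>The fourth power of the weight in \<open>wk_sincd\<close>. The kernel must be
  nonnegative and have a finite second moment: an even power of sinc gives the former, and the
  square would miss the latter.\<close>

definition kw :: "real \<Rightarrow> real" where "kw s = 25 / (1 + s\<^sup>2)\<^sup>2"

lemma kap:
  shows kap_bound: "\<bar>kap a s\<bar> \<le> 4 ^ a * kw s"
    and kap_deriv: "(kap a has_real_derivative kap (Suc a) s) (at s)"
proof -
  have w: "sqrt (5 / (1 + s\<^sup>2)) * sqrt (5 / (1 + s\<^sup>2)) * (sqrt (5 / (1 + s\<^sup>2)) * sqrt (5 / (1 + s\<^sup>2))) = kw s" for s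
    by (simp add: kw_def power2_eq_square real_sqrt_mult_self)
  have k0: "wk n 1 4 kw (kap 0)" for n
    using wk_mult[OF wk_mult[OF wk_sincd wk_sincd] wk_mult[OF wk_sincd wk_sincd], of n 0 0 0 0]
    unfolding w by (simp add: kap_def)
  have step: "\<forall>n. wk n (4 ^ a) 4 kw (kap a)" for a
  proof (induction a)
    case (Suc a)
    show ?case
    proof
      fix n
      obtain k' where k': "\<forall>s. (kap a has_real_derivative k' s) (at s)" "wk n (4 ^ a * 4) 4 kw k'"
        using spec[OF Suc, of "Suc n"] by auto
      have "kap (Suc a) = k'" using k'(1) by (auto simp: kap_def fun_eq_iff intro: DERIV_imp_deriv)
      then show "wk n (4 ^ Suc a) 4 kw (kap (Suc a))" using k'(2) by (simp add: mult.commute)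
    qed
  qed (use k0 in simp)
  show "\<bar>kap a s\<bar> \<le> 4 ^ a * kw s" using wk_bound step by blast
  obtain k' where k': "\<forall>s. (kap a has_real_derivative k' s) (at s)"
    using spec[OF step[of a], of "Suc 0"] by auto
  have "kap (Suc a) = k'" using k'(1) by (auto simp: kap_def fun_eq_iff intro: DERIV_imp_deriv)
  then show "(kap a has_real_derivative kap (Suc a) s) (at s)" using k' by simp
qed

lemma kw_pos: "0 < kw s"
proof -
  have "0 < 1 + s\<^sup>2" by (rule add_pos_nonneg) auto
  then show ?thesis by (simp add: kw_def)
qed

text \<open>The Taylor remainder of the kernel is evaluated at intermediate points; this moves the
  weight back to the base point at the cost of a constant.\<close>

lemma kw_shift: assumes "\<bar>z\<bar> \<le> 1" shows "kw (s + z) \<le> 9 * kw s"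
proof -
  have p: "0 < 1 + s\<^sup>2" "0 < 1 + (s+z)\<^sup>2" by (rule add_pos_nonneg; simp)+
  have z: "z\<^sup>2 \<le> 1" using assms by (simp add: abs_square_le_1)
  have "0 \<le> (s + 2 * z)\<^sup>2 + (s+z)\<^sup>2" by simp
  have "1 + s\<^sup>2 \<le> 3 * (1 + (s+z)\<^sup>2)"
  proof -
    have "0 \<le> (2 * s + 3 * z)\<^sup>2" by simp
    then have "0 \<le> 4 * s\<^sup>2 + 12 * s * z + 9 * z\<^sup>2" by (simp add: power2_eq_square algebra_simps)
    with z show ?thesis by (simp add: power2_eq_square algebra_simps)
  qed
  then have "(1 + s\<^sup>2)\<^sup>2 \<le> (3 * (1 + (s+z)\<^sup>2))\<^sup>2" using p by (intro power_mono) auto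
  moreover have "(3 * (1 + (s+z)\<^sup>2))\<^sup>2 = 9 * (1 + (s+z)\<^sup>2)\<^sup>2" by (simp only: power_mult_distrib) simp
  ultimately have "(1 + s\<^sup>2)\<^sup>2 \<le> 9 * (1 + (s+z)\<^sup>2)\<^sup>2" by (rule ord_le_eq_trans)
  then show ?thesis using p by (simp add: kw_def field_simps)
qed

lemma kw_integrable: "integrable lborel kw" "integrable lborel (\<lambda>s. kw s * s\<^sup>2)"
proof -
  have i: "integrable lborel (\<lambda>s::real. 25 * inverse (1 + s\<^sup>2))"
    using integrable_inverse_1_plus_square by (simp add: set_integrable_def)
  have m: "kw \<in> borel_measurable lborel" unfolding kw_def by measurable
  have p: "1 \<le> 1 + s\<^sup>2" "0 < 1 + s\<^sup>2" for s :: real by (auto intro: add_pos_nonneg)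
  have k: "kw s = 25 * inverse (1 + s\<^sup>2) * inverse (1 + s\<^sup>2)" for s
    using p[of s] by (simp add: kw_def divide_simps power2_eq_square)
  have a: "kw s \<le> 25 * inverse (1 + s\<^sup>2)" for s
    unfolding k using p[of s] by (intro mult_left_le) (auto simp: inverse_le_1_iff)
  have "s\<^sup>2 * inverse (1 + s\<^sup>2) \<le> 1" for s :: real using p[of s] by (simp add: divide_simps)
  then have b: "kw s * s\<^sup>2 \<le> 25 * inverse (1 + s\<^sup>2)" for s
    using mult_left_le[of "s\<^sup>2 * inverse (1 + s\<^sup>2)" "25 * inverse (1 + s\<^sup>2)"] p[of s]
    by (simp add: k mult_ac)
  show "integrable lborel kw"
    by (rule Bochner_Integration.integrable_bound[OF i m]) (use a kw_pos in \<open>auto simp: less_imp_le intro!: AE_I2\<close>)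
  show "integrable lborel (\<lambda>s. kw s * s\<^sup>2)"
    by (rule Bochner_Integration.integrable_bound[OF i]) (use b kw_pos m in \<open>auto simp: less_imp_le intro!: AE_I2\<close>)
qed

section \<open>The product kernel in the plane and its convolutions\<close>

lemma integrable_prod2:
  fixes F G :: "real \<Rightarrow> real"
  assumes F: "integrable lborel F" and G: "integrable lborel G" and nn: "\<And>s. 0 \<le> F s" "\<And>s. 0 \<le> G s"
  shows "integrable lborel (\<lambda>y::real^2. F (y $ 1) * G (y $ 2))"
proof (rule integrableI_nonneg)
  note [measurable] = borel_measurable_integrable[OF F] borel_measurable_integrable[OF G]
  show "(\<lambda>y::real^2. F (y $ 1) * G (y $ 2)) \<in> borel_measurable lborel" by measurable
  show "AE y::real^2 in lborel. 0 \<le> F (y $ 1) * G (y $ 2)" using nn by simp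
  define f where "f b s = (if b = axis 1 1 then F s else G s)" for b :: "real^2" and s
  have B: "(Basis :: (real^2) set) = {axis 1 1, axis 2 1}"
    by (auto simp: Basis_vec_def UNIV_2)
  have ne: "axis 1 1 \<noteq> (axis 2 1 :: real^2)" by (simp add: axis_eq_axis)
  have "(\<integral>\<^sup>+y. ennreal (F ((y::real^2) $ 1) * G (y $ 2)) \<partial>lborel) = (\<integral>\<^sup>+y. (\<Prod>b\<in>(Basis::(real^2) set). ennreal (f b (y \<bullet> b))) \<partial>lborel)"
    using nn ne by (intro nn_integral_cong) (simp add: B f_def inner_axis ennreal_mult)
  also have "\<dots> = (\<Prod>b\<in>(Basis::(real^2) set). (\<integral>\<^sup>+s. ennreal (f b s) \<partial>lborel))"
    by (rule nn_integral_lborel_prod) (auto simp: f_def)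
  also have "\<dots> = (\<integral>\<^sup>+s. ennreal (F s) \<partial>lborel) * (\<integral>\<^sup>+s. ennreal (G s) \<partial>lborel)"
    using ne by (simp add: B f_def)
  also have "\<dots> < \<infinity>"
    using F G nn by (simp add: integrable_iff_bounded ennreal_mult_less_top)
  finally show "(\<integral>\<^sup>+y. ennreal (F ((y::real^2) $ 1) * G (y $ 2)) \<partial>lborel) < \<infinity>" .
qed

definition W2 :: "real^2 \<Rightarrow> real" where "W2 y = kw (y $ 1) * kw (y $ 2)"

text \<open>The partial derivative of order \<open>(a, b)\<close> of the kernel
  \<open>K2 0 0\<close>, so that \<open>pd\<close> acts on the family by raising an index.\<close>

definition K2 :: "nat \<Rightarrow> nat \<Rightarrow> real^2 \<Rightarrow> real" where "K2 a b y = kap a (y $ 1) * kap b (y $ 2)"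

lemma W2_integrable: "integrable lborel W2" "integrable lborel (\<lambda>y. W2 y * (y $ i)\<^sup>2)"
proof -
  show "integrable lborel W2"
    unfolding W2_def[abs_def] by (rule integrable_prod2[OF kw_integrable(1,1)]) (simp_all add: kw_pos less_imp_le)
  have "integrable lborel (\<lambda>y::real^2. kw (y $ 1) * (y $ 1)\<^sup>2 * kw (y $ 2))"
    by (rule integrable_prod2[OF kw_integrable(2,1)]) (simp_all add: kw_pos less_imp_le)
  moreover have "integrable lborel (\<lambda>y::real^2. kw (y $ 1) * (kw (y $ 2) * (y $ 2)\<^sup>2))"
    by (rule integrable_prod2[OF kw_integrable(1,2)]) (simp_all add: kw_pos less_imp_le)
  ultimately show "integrable lborel (\<lambda>y. W2 y * (y $ i)\<^sup>2)"
    using exhaust_2[of i] by (auto simp: W2_def mult_ac)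
qed

lemma W2_nonneg: "0 \<le> W2 y" by (simp add: W2_def kw_pos less_imp_le)

lemma W2_shift: assumes "norm z \<le> 1" shows "W2 (y + z) \<le> 81 * W2 y"
proof -
  have "\<bar>z $ i\<bar> \<le> 1" for i using component_le_norm_cart[of z i] assms by simp
  then have "kw (y $ 1 + z $ 1) * kw (y $ 2 + z $ 2) \<le> (9 * kw (y $ 1)) * (9 * kw (y $ 2))"
    by (intro mult_mono kw_shift) (auto simp: kw_pos less_imp_le)
  then show ?thesis by (simp add: W2_def)
qed

lemma K2_bound: "\<bar>K2 a b y\<bar> \<le> 4 ^ (a + b) * W2 y"
proof -
  have "\<bar>K2 a b y\<bar> \<le> (4 ^ a * kw (y $ 1)) * (4 ^ b * kw (y $ 2))"
    unfolding K2_def abs_mult by (intro mult_mono kap_bound) (auto simp: kw_pos less_imp_le)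
  then show ?thesis by (simp add: W2_def power_add mult_ac)
qed

lemma K2_deriv: "(K2 a b has_derivative (\<lambda>h. h $ 1 * K2 (Suc a) b y + h $ 2 * K2 a (Suc b) y)) (at y)"
proof -
  have k: "((\<lambda>y::real^2. kap a (y $ i)) has_derivative (\<lambda>h. h $ i * kap (Suc a) (y $ i))) (at y)" for a i
    using has_derivative_compose[OF bounded_linear_imp_has_derivative[OF bounded_linear_vec_nth]
        kap_deriv[of a "y $ i", unfolded has_field_derivative_def]] by (simp add: mult.commute)
  show ?thesis unfolding K2_def[abs_def]
    by (rule has_derivative_eq_rhs[OF has_derivative_mult[OF k k]]) (auto simp: fun_eq_iff algebra_simps)
qed

lemma K2_pd: "pd 1 (K2 a b) = K2 (Suc a) b" "pd 2 (K2 a b) = K2 a (Suc b)" "K2 a b differentiable at y"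
  using pd_unique[OF K2_deriv] differentiableI[OF K2_deriv] by (auto simp: fun_eq_iff)

lemma K2_measurable [measurable]: "K2 a b \<in> borel_measurable borel"
  by (rule borel_measurable_continuous_onI, intro differentiable_imp_continuous_on)
    (simp add: differentiable_on_def K2_pd(3))

lemma K2_taylor:
  assumes "norm h \<le> 1"
  shows "\<bar>K2 a b (y + h) - K2 a b y - (h $ 1 * K2 (Suc a) b y + h $ 2 * K2 a (Suc b) y)\<bar>
    \<le> 4 * (4 ^ (a + b + 2) * (81 * W2 y)) * (norm h)\<^sup>2"
proof -
  have b: "\<bar>pd i (pd j (K2 a b)) (y + t *\<^sub>R h)\<bar> \<le> 4 ^ (a + b + 2) * (81 * W2 y)" if "0 \<le> t" "t \<le> 1" for i j t
  proof -
    have "norm (t *\<^sub>R h) \<le> 1" using that assms by (simp add: mult_le_one)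
    then have w: "W2 (y + t *\<^sub>R h) \<le> 81 * W2 y" by (rule W2_shift)
    obtain a' b' where ab: "pd i (pd j (K2 a b)) = K2 a' b'" "a' + b' = a + b + 2"
      using exhaust_2[of i] exhaust_2[of j] by (auto simp: K2_pd)
    have "\<bar>K2 a' b' (y + t *\<^sub>R h)\<bar> \<le> 4 ^ (a' + b') * W2 (y + t *\<^sub>R h)" by (rule K2_bound)
    also have "\<dots> \<le> 4 ^ (a' + b') * (81 * W2 y)" by (intro mult_left_mono w) simp
    finally show ?thesis using ab by simp
  qed
  have d: "pd i (K2 a b) differentiable at x" for i x
    using exhaust_2[of i] by (auto simp: K2_pd)
  from taylor2_bound[of "K2 a b" y h, OF K2_pd(3) d b] show ?thesis by (simp add: K2_pd)
qed

text \<open>The signs are independent: flipping both gives the reflection used for convolutions,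
  flipping one gives the evenness in a single variable that makes first moments vanish.\<close>

lemma lborel_integral_flip:
  fixes g :: "real^2 \<Rightarrow> real" and t :: "real^2" and c1 c2 :: real
  assumes "\<bar>c1\<bar> = 1" "\<bar>c2\<bar> = 1" and g: "g \<in> borel_measurable borel"
  defines "T \<equiv> \<lambda>y::real^2. t + (c1 * y $ 1) *\<^sub>R axis 1 1 + (c2 * y $ 2) *\<^sub>R axis 2 1"
  shows lborel_integral_flip_eq: "(\<integral>y. g (T y) \<partial>lborel) = (\<integral>y. g y \<partial>lborel)"
    and lborel_integrable_flip: "integrable lborel g \<Longrightarrow> integrable lborel (\<lambda>y. g (T y))"
proof -
  define c where "c j = (if j = axis 1 1 then c1 else c2)" for j :: "real^2"
  have B: "(Basis :: (real^2) set) = {axis 1 1, axis 2 1}" by (auto simp: Basis_vec_def UNIV_2)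
  have ne: "axis 1 1 \<noteq> (axis 2 1 :: real^2)" by (simp add: axis_eq_axis)
  have T: "T y = t + (\<Sum>j\<in>Basis. (c j * (y \<bullet> j)) *\<^sub>R j)" for y
    using ne by (simp add: T_def B c_def inner_axis)
  have Tm [measurable]: "T \<in> borel_measurable borel" unfolding T_def by measurable
  have "lborel = density (distr lborel borel (\<lambda>x. t + (\<Sum>j\<in>Basis. (c j * (x \<bullet> j)) *\<^sub>R j))) (\<lambda>_. (\<Prod>j\<in>Basis. \<bar>c j\<bar>))"
    by (rule lborel_affine_euclidean) (use assms(1,2) in \<open>auto simp: c_def\<close>)
  also have "(\<Prod>j\<in>Basis. \<bar>c j\<bar>) = 1" using assms(1,2) ne by (simp add: B c_def)
  finally have d: "lborel = distr lborel borel T" by (simp add: density_1 T[abs_def])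
  show "(\<integral>y. g (T y) \<partial>lborel) = (\<integral>y. g y \<partial>lborel)"
    using integral_distr[of T lborel borel g] g d by simp
  show "integrable lborel g \<Longrightarrow> integrable lborel (\<lambda>y. g (T y))"
    using integrable_distr_eq[of T lborel borel g] g d by simp
qed

lemma lborel_integral_reflect:
  fixes g :: "real^2 \<Rightarrow> real" and x :: "real^2"
  assumes g: "g \<in> borel_measurable borel"
  shows "(\<integral>y. g (x - y) \<partial>lborel) = (\<integral>y. g y \<partial>lborel)"
    "integrable lborel g \<Longrightarrow> integrable lborel (\<lambda>y. g (x - y))"
proof -
  have e: "x + (- 1 * y $ 1) *\<^sub>R axis 1 1 + (- 1 * y $ 2) *\<^sub>R axis 2 1 = x - y" for y :: "real^2"
    using vec2_decomp[of y] by (simp add: algebra_simps)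
  show "(\<integral>y. g (x - y) \<partial>lborel) = (\<integral>y. g y \<partial>lborel)"
    using lborel_integral_flip_eq[where ?c1.0 = "-1" and ?c2.0 = "-1" and g = g and t = x] g by (simp only: e)
  show "integrable lborel g \<Longrightarrow> integrable lborel (\<lambda>y. g (x - y))"
    using lborel_integrable_flip[where ?c1.0 = "-1" and ?c2.0 = "-1" and g = g and t = x] g by (simp only: e)
qed

text \<open>\<open>f\<close> is only measurable, so \<open>x\<close> is moved into the kernel, where
  all derivatives fall on \<open>K2\<close>. Periodicity is read off from the other form, in which
  \<open>x\<close> sits in \<open>f\<close>.\<close>

lemma K2_conv_BL:
  fixes f :: "real^2 \<Rightarrow> real"
  assumes f [measurable]: "f \<in> borel_measurable borel" and b: "\<And>x. \<bar>f x\<bar> \<le> F" and per: "\<And>x i. f (x + axis i l) = f x"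
  shows "BL l (F * (\<integral>y. W2 y \<partial>lborel)) 4 (\<lambda>x. \<integral>y. K2 0 0 y * f (x - y) \<partial>lborel)"
proof -
  have F: "0 \<le> F" using b[of 0] by linarith
  define G where "G a b x = (\<integral>y. K2 a b (x - y) * f y \<partial>lborel)" for a b x
  have Wm [measurable]: "W2 \<in> borel_measurable borel" using W2_integrable(1) by (simp add: integrable_iff_bounded)
  have iW: "integrable lborel (\<lambda>y. W2 (x - y))" for x by (rule lborel_integral_reflect(2)[OF Wm W2_integrable(1)])
  have iG: "integrable lborel (\<lambda>y. K2 a b (x - y) * f y)" for a b x
  proof (rule Bochner_Integration.integrable_bound)
    show "integrable lborel (\<lambda>y. 4 ^ (a + b) * W2 (x - y) * F)" using iW by simp
    show "AE y in lborel. norm (K2 a b (x - y) * f y) \<le> norm (4 ^ (a + b) * W2 (x - y) * F)"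
    proof (rule AE_I2)
      fix y
      have "\<bar>K2 a b (x - y)\<bar> * \<bar>f y\<bar> \<le> (4 ^ (a + b) * W2 (x - y)) * F"
        by (intro mult_mono K2_bound b) (auto simp: W2_nonneg)
      then show "norm (K2 a b (x - y) * f y) \<le> norm (4 ^ (a + b) * W2 (x - y) * F)"
        using F W2_nonneg[of "x - y"] by (simp add: abs_mult)
    qed
  qed measurable
  have G_eq: "G a b x = (\<integral>y. K2 a b y * f (x - y) \<partial>lborel)" for a b x
    using lborel_integral_reflect(1)[of "\<lambda>y. K2 a b y * f (x - y)" x] by (simp add: G_def)
  have iG': "integrable lborel (\<lambda>y. K2 a b y * f (x - y))" for a b x
    using lborel_integral_reflect(2)[OF _ iG[of a b x], of x] by simp
  have G_per: "G a b (x + axis i l) = G a b x" for a b x i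
  proof -
    have "f (x + axis i l - y) = f (x - y)" for y using per[of "x - y" i] by (simp add: algebra_simps)
    then show ?thesis by (simp add: G_eq)
  qed
  have G_bound: "\<bar>G a b x\<bar> \<le> 4 ^ (a + b) * (F * (\<integral>y. W2 y \<partial>lborel))" for a b x
  proof -
    have "\<bar>G a b x\<bar> \<le> (\<integral>y. \<bar>K2 a b y * f (x - y)\<bar> \<partial>lborel)" unfolding G_eq by (rule integral_abs_bound)
    also have "\<dots> \<le> (\<integral>y. 4 ^ (a + b) * F * W2 y \<partial>lborel)"
    proof (rule integral_mono)
      fix y
      have "\<bar>K2 a b y\<bar> * \<bar>f (x - y)\<bar> \<le> (4 ^ (a + b) * W2 y) * F"
        by (intro mult_mono K2_bound b) (auto simp: W2_nonneg b)
      then show "\<bar>K2 a b y * f (x - y)\<bar> \<le> 4 ^ (a + b) * F * W2 y" by (simp add: abs_mult mult_ac)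
    qed (use iG' W2_integrable(1) in auto)
    finally show ?thesis by (simp add: mult_ac)
  qed
  have G_deriv: "(G a b has_derivative (\<lambda>h. h $ 1 * G (Suc a) b x + h $ 2 * G a (Suc b) x)) (at x)" for a b x
    unfolding G_def
  proof (rule has_derivative_integral_family[where w="\<lambda>y. 4 * (4 ^ (a + b + 2) * (81 * W2 (x - y))) * F"])
    fix y and h :: "real^2" assume h: "norm h \<le> 1"
    have "K2 a b (x + h - y) * f y - K2 a b (x - y) * f y - (h $ 1 * (K2 (Suc a) b (x - y) * f y) + h $ 2 * (K2 a (Suc b) (x - y) * f y))
      = (K2 a b ((x - y) + h) - K2 a b (x - y) - (h $ 1 * K2 (Suc a) b (x - y) + h $ 2 * K2 a (Suc b) (x - y))) * f y"
      by (simp add: algebra_simps)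
    also have "\<bar>\<dots>\<bar> \<le> (4 * (4 ^ (a + b + 2) * (81 * W2 (x - y))) * (norm h)\<^sup>2) * F"
      unfolding abs_mult by (intro mult_mono K2_taylor[OF h] b) (auto simp: W2_nonneg)
    finally show "\<bar>K2 a b (x + h - y) * f y - K2 a b (x - y) * f y - (h $ 1 * (K2 (Suc a) b (x - y) * f y) + h $ 2 * (K2 a (Suc b) (x - y) * f y))\<bar>
      \<le> 4 * (4 ^ (a + b + 2) * (81 * W2 (x - y))) * F * (norm h)\<^sup>2" by (simp add: mult_ac)
  qed (use iG iW in auto)
  have "bw l n (4 ^ (a + b) * (F * (\<integral>y. W2 y \<partial>lborel))) 4 (G a b)" for n a b
  proof (induction n arbitrary: a b)
    case 0 show ?case using G_bound G_per by simp
  next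
    case (Suc n)
    have "pd 1 (G a b) = G (Suc a) b" "pd 2 (G a b) = G a (Suc b)"
      using pd_unique[OF G_deriv] by (auto simp: fun_eq_iff)
    then have "bw l n (4 ^ (a + b) * (F * (\<integral>y. W2 y \<partial>lborel)) * 4) 4 (pd i (G a b))" for i
      using Suc[of "Suc a" b] Suc[of a "Suc b"] exhaust_2[of i] by (auto simp: mult_ac)
    moreover have "G a b differentiable at x" for x using G_deriv[of a b x] by (auto simp: differentiable_def)
    ultimately show ?case using G_bound G_per by simp
  qed
  from this[of _ 0 0] have "BL l (F * (\<integral>y. W2 y \<partial>lborel)) 4 (G 0 0)" by (simp add: BL_def)
  then show ?thesis by (simp add: G_eq[abs_def])
qed

text \<open>Serves twice: for the total mass of the kernel, and for a mollification that has to be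
  positive because the mollified function is 1 near the point in question.\<close>

lemma integral_pos_near_0:
  fixes h :: "real^2 \<Rightarrow> real"
  assumes i: "integrable lborel h" and nn: "\<And>y. 0 \<le> h y" and c: "continuous_on UNIV h" and h0: "0 < h 0"
    and U: "open U" "0 \<in> U"
  shows "0 < (\<integral>y. h y * indicator U y \<partial>lborel)"
proof -
  have "isCont h 0" using c by (simp add: continuous_on_eq_continuous_at)
  then obtain d where d: "d > 0" "\<And>y. dist y 0 < d \<Longrightarrow> dist (h y) (h 0) < h 0 / 2"
    unfolding continuous_at_eps_delta using h0 by (metis half_gt_zero dist_norm diff_zero)
  obtain e where e: "e > 0" "ball 0 e \<subseteq> U" using U open_contains_ball by blast
  define r where "r = min d e"
  have r: "r > 0" "ball 0 r \<subseteq> U" using d e by (auto simp: r_def)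
  have hh: "h 0 / 2 \<le> h y" if "y \<in> ball 0 r" for y
  proof -
    have "dist y 0 < d" using that by (simp add: r_def dist_commute)
    from d(2)[OF this] have "\<bar>h y - h 0\<bar> < h 0 / 2" by (simp only: dist_real_def)
    then show ?thesis by linarith
  qed
  have Um: "U \<in> sets lborel" using U by simp
  have "0 < h 0 / 2 * measure lborel (ball (0::real^2) r)"
    using h0 r(1) content_ball_pos[of r "0::real^2"] by simp
  also have "\<dots> = (\<integral>y. h 0 / 2 * indicator (ball (0::real^2) r) y \<partial>lborel)"
    by simp
  also have "\<dots> \<le> (\<integral>y. h y * indicator U y \<partial>lborel)"
  proof (rule integral_mono)
    show "integrable lborel (\<lambda>y. h y * indicator U y)" using i Um by (simp add: integrable_real_mult_indicator mult.commute)
    show "integrable lborel (\<lambda>y::real^2. h 0 / 2 * indicator (ball 0 r) y)"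
      using emeasure_bounded_finite[OF bounded_ball, of "0::real^2" r]
      by (intro integrable_mult_right integrable_real_indicator) auto
    show "h 0 / 2 * indicator (ball 0 r) y \<le> h y * indicator U y" for y
      using hh[of y] r(2) nn[of y] by (auto simp: indicator_def)
  qed
  finally show ?thesis .
qed

lemma kap_0: "kap 0 s = sincd 0 s * sincd 0 s * (sincd 0 s * sincd 0 s)" by (simp add: kap_def)

lemma K2_nonneg: "0 \<le> K2 0 0 y" by (simp add: K2_def kap_0)

lemma K2_integrable: "integrable lborel (K2 a b)" "integrable lborel (\<lambda>y. K2 a b y * (y $ i)\<^sup>2)"
proof -
  have a: "integrable lborel (\<lambda>y. 4 ^ (a + b) * W2 y)" "integrable lborel (\<lambda>y. 4 ^ (a + b) * (W2 y * (y $ i)\<^sup>2))"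
    using W2_integrable by auto
  show "integrable lborel (K2 a b)"
    by (rule Bochner_Integration.integrable_bound[OF a(1)]) (auto simp: abs_mult W2_nonneg intro!: AE_I2 K2_bound)
  have "\<bar>K2 a b y\<bar> * (y $ i)\<^sup>2 \<le> 4 ^ (a + b) * W2 y * (y $ i)\<^sup>2" for y
    by (intro mult_right_mono K2_bound) simp
  then show "integrable lborel (\<lambda>y. K2 a b y * (y $ i)\<^sup>2)"
    by (intro Bochner_Integration.integrable_bound[OF a(2)]) (auto simp: abs_mult W2_nonneg mult.assoc intro!: AE_I2)
qed

lemma K2_continuous: "continuous_on UNIV (K2 a b)"
  by (intro differentiable_imp_continuous_on) (simp add: differentiable_on_def K2_pd(3))

lemma K2_zero: "K2 0 0 0 = 1" by (simp add: K2_def kap_0 sincd_def)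

lemma K2_integral_pos: "0 < (\<integral>y. K2 0 0 y * indicator U y \<partial>lborel)" if "open U" "0 \<in> U"
  by (rule integral_pos_near_0[OF K2_integrable(1) K2_nonneg K2_continuous _ that]) (simp add: K2_zero)

definition kn :: "real^2 \<Rightarrow> real" where "kn y = K2 0 0 y / (\<integral>y. K2 0 0 y \<partial>lborel)"

lemma Z_pos: "0 < (\<integral>y. K2 0 0 y \<partial>lborel)"
  using K2_integral_pos[of UNIV] by simp

lemma kn_nonneg: "0 \<le> kn y" using K2_nonneg Z_pos by (simp add: kn_def less_imp_le)

lemma kn_integrable: "integrable lborel kn" "integrable lborel (\<lambda>y. kn y * (y $ i)\<^sup>2)"
  using K2_integrable[of 0 0] by (auto simp: kn_def[abs_def])

lemma kn_integral: "(\<integral>y. kn y \<partial>lborel) = 1" using Z_pos by (simp add: kn_def)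

lemma kn_measurable [measurable]: "kn \<in> borel_measurable borel"
  unfolding kn_def[abs_def] by measurable

lemma kn_integrable_1: "integrable lborel (\<lambda>y. kn y * y $ i)"
proof (rule Bochner_Integration.integrable_bound)
  show "integrable lborel (\<lambda>y. kn y + kn y * (y $ i)\<^sup>2)" using kn_integrable by auto
  have "kn y * \<bar>y $ i\<bar> \<le> kn y * (1 + (y $ i)\<^sup>2)" for y
  proof (rule mult_left_mono[OF _ kn_nonneg])
    have "0 \<le> (\<bar>y $ i\<bar> - 1)\<^sup>2 + 1 + \<bar>y $ i\<bar>\<^sup>2" by simp
    then show "\<bar>y $ i\<bar> \<le> 1 + (y $ i)\<^sup>2" by (simp add: power2_eq_square algebra_simps)
  qed
  then show "AE y in lborel. norm (kn y * y $ i) \<le> norm (kn y + kn y * (y $ i)\<^sup>2)"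
    using kn_nonneg by (intro AE_I2) (simp add: abs_mult distrib_left)
qed measurable

lemma kn_flip:
  assumes "\<bar>c1\<bar> = 1" "\<bar>c2\<bar> = 1"
  shows "kn (0 + (c1 * y $ 1) *\<^sub>R axis 1 1 + (c2 * y $ 2) *\<^sub>R axis 2 1) = kn y"
proof -
  have e: "sincd 0 (- s) = sincd 0 s" for s by (simp add: sincd_def)
  have "c1 = 1 \<or> c1 = -1" "c2 = 1 \<or> c2 = -1" using assms by (auto simp: abs_if split: if_splits)
  then show ?thesis by (auto simp: kn_def K2_def kap_0 e)
qed

text \<open>The change of variables equates the integral with its negative. Since the reflection may
  act on one coordinate alone, \<open>h\<close> may depend on the other coordinate in any
  way.\<close>

lemma kn_odd_zero:
  fixes h :: "real^2 \<Rightarrow> real"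
  assumes c: "\<bar>c1\<bar> = 1" "\<bar>c2\<bar> = 1" and h: "h \<in> borel_measurable borel"
    and odd: "\<And>y. h (0 + (c1 * y $ 1) *\<^sub>R axis 1 1 + (c2 * y $ 2) *\<^sub>R axis 2 1) = - h y"
  shows "(\<integral>y. kn y * h y \<partial>lborel) = 0"
proof -
  have [measurable]: "h \<in> borel_measurable borel" by (rule h)
  have "(\<integral>y. kn y * h y \<partial>lborel) = (\<integral>y. - (kn y * h y) \<partial>lborel)"
    using lborel_integral_flip_eq[OF c, of "\<lambda>y. kn y * h y" 0]
    unfolding kn_flip[OF c] odd by simp
  then show ?thesis by simp
qed

section \<open>The mollifier at scale \<open>1 / \<mu>\<close>\<close>

definition Pm :: "real \<Rightarrow> (real^2 \<Rightarrow> real) \<Rightarrow> real^2 \<Rightarrow> real" where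
  "Pm \<mu> f x = (\<integral>y. kn y * f (x - (1/\<mu>) *\<^sub>R y) \<partial>lborel)"

text \<open>Sup norms do not grow under \<open>Pm\<close>, see \<open>Pm_sup\<close>, but the
  derivative bounds use the weight \<open>W2\<close> in place of the kernel and cost this factor.
  For this reason \<open>mixed_decomposition\<close> carries a sup bound \<open>S\<close> and a
  band-limited bound \<open>cP * S\<close> side by side; a single constant would deteriorate with
  every octave.\<close>

definition cP :: real where "cP = (\<integral>y. W2 y \<partial>lborel) / (\<integral>y. K2 0 0 y \<partial>lborel)"

lemma cP_ge_1: "1 \<le> cP"
proof -
  have "(\<integral>y. K2 0 0 y \<partial>lborel) \<le> (\<integral>y. W2 y \<partial>lborel)"
    by (rule integral_mono[OF K2_integrable(1) W2_integrable(1)]) (use K2_bound[of 0 0] in \<open>simp add: abs_le_iff\<close>)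
  then show ?thesis using Z_pos by (simp add: cP_def)
qed

lemma Pm_pd: assumes "BL l C N f" shows "pd i (Pm \<mu> f) = Pm \<mu> (pd i f)"
  using pd_average_BL[OF assms kn_integrable(1), of "\<lambda>y. (1/\<mu>) *\<^sub>R y" i] by (simp add: Pm_def[abs_def])

lemma Pm_integrable:
  assumes f [measurable]: "f \<in> borel_measurable borel" and b: "\<And>x. \<bar>f x\<bar> \<le> F"
  shows "integrable lborel (\<lambda>y. kn y * f (x - (1/\<mu>) *\<^sub>R y))"
proof (rule Bochner_Integration.integrable_bound)
  show "integrable lborel (\<lambda>y. kn y * F)" using kn_integrable(1) by simp
  have "\<bar>kn y * f (x - (1/\<mu>) *\<^sub>R y)\<bar> \<le> \<bar>kn y * F\<bar>" for y
    unfolding abs_mult using b by (intro mult_left_mono) (auto intro: order_trans[OF _ abs_ge_self])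
  then show "AE y in lborel. norm (kn y * f (x - (1/\<mu>) *\<^sub>R y)) \<le> norm (kn y * F)"
    by (intro AE_I2) simp
qed measurable

lemma Pm_sup:
  assumes f: "f \<in> borel_measurable borel" and b: "\<And>x. \<bar>f x\<bar> \<le> F"
  shows "\<bar>Pm \<mu> f x\<bar> \<le> F"
proof -
  have "\<bar>Pm \<mu> f x\<bar> \<le> (\<integral>y. \<bar>kn y * f (x - (1/\<mu>) *\<^sub>R y)\<bar> \<partial>lborel)" unfolding Pm_def by (rule integral_abs_bound)
  also have "\<dots> \<le> (\<integral>y. kn y * F \<partial>lborel)"
  proof (rule integral_mono)
    show "\<bar>kn y * f (x - (1/\<mu>) *\<^sub>R y)\<bar> \<le> kn y * F" for y
      unfolding abs_mult using b kn_nonneg by (simp add: mult_left_mono)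
  qed (use Pm_integrable[OF f b] kn_integrable(1) in auto)
  finally show ?thesis by (simp add: kn_integral)
qed

lemma pd_dilate:
  assumes "\<And>x. g differentiable at x"
  shows "pd i (\<lambda>x. g (\<mu> *\<^sub>R x)) = (\<lambda>x. \<mu> * pd i g (\<mu> *\<^sub>R x))" "(\<lambda>x. g (\<mu> *\<^sub>R x)) differentiable at x"
proof -
  have d: "((\<lambda>x. g (\<mu> *\<^sub>R x)) has_derivative (\<lambda>h. h $ 1 * (\<mu> * pd 1 g (\<mu> *\<^sub>R x)) + h $ 2 * (\<mu> * pd 2 g (\<mu> *\<^sub>R x)))) (at x)" for x
  proof -
    have "((\<lambda>x. \<mu> *\<^sub>R x) has_derivative (\<lambda>h. \<mu> *\<^sub>R h)) (at x)" by (auto intro!: derivative_eq_intros)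
    from has_derivative_compose[OF this has_derivative_pd[OF assms]]
    show ?thesis by (rule has_derivative_eq_rhs) (simp add: fun_eq_iff)
  qed
  show "pd i (\<lambda>x. g (\<mu> *\<^sub>R x)) = (\<lambda>x. \<mu> * pd i g (\<mu> *\<^sub>R x))"
    using pd_unique[OF d] exhaust_2[of i] by auto
  show "(\<lambda>x. g (\<mu> *\<^sub>R x)) differentiable at x" by (rule differentiableI[OF d])
qed

lemma BL_dilate:
  assumes "BL (\<mu> * l) C N g" "0 < \<mu>" shows "BL l C (N * \<mu>) (\<lambda>x. g (\<mu> *\<^sub>R x))"
proof -
  have per: "g (\<mu> *\<^sub>R (x + axis i l)) = g (\<mu> *\<^sub>R x)" if "BL (\<mu> * l) C N g" for x i C g
  proof -
    have "\<mu> *\<^sub>R (x + axis i l) = \<mu> *\<^sub>R x + axis i (\<mu> * l)" by (simp add: vec_eq_iff axis_def distrib_left)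
    then show ?thesis using BL_periodic[OF that] by simp
  qed
  have "bw l n C (N * \<mu>) (\<lambda>x. g (\<mu> *\<^sub>R x))" if "BL (\<mu> * l) C N g" for n C g
    using that
  proof (induction n arbitrary: C g)
    case 0
    then show ?case using BL_bound[OF 0] per[OF 0] by simp
  next
    case (Suc n)
    have "bw l n (C * (N * \<mu>)) (N * \<mu>) (pd i (\<lambda>x. g (\<mu> *\<^sub>R x)))" for i
      using bw_cmult[OF Suc.IH[OF BL_pd[OF Suc.prems, of i]], of \<mu>] assms(2)
      by (simp add: pd_dilate(1)[OF BL_differentiable[OF Suc.prems]] mult_ac)
    then show ?case using BL_bound[OF Suc.prems] per[OF Suc.prems] pd_dilate(2)[OF BL_differentiable[OF Suc.prems]]
      by simp
  qed
  then show ?thesis using assms by (auto simp: BL_def)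
qed

lemma Pm_smooth:
  fixes f :: "real^2 \<Rightarrow> real"
  assumes f [measurable]: "f \<in> borel_measurable borel" and b: "\<And>x. \<bar>f x\<bar> \<le> F" and per: "\<And>x i. f (x + axis i l) = f x"
    and \<mu>: "0 < \<mu>"
  shows "BL l (cP * F) (4 * \<mu>) (Pm \<mu> f)"
proof -
  have m: "(\<lambda>z. f ((1/\<mu>) *\<^sub>R z)) \<in> borel_measurable borel" by measurable
  have p: "f ((1/\<mu>) *\<^sub>R (x + axis i (\<mu> * l))) = f ((1/\<mu>) *\<^sub>R x)" for x i
  proof -
    have "(1/\<mu>) *\<^sub>R (x + axis i (\<mu> * l)) = (1/\<mu>) *\<^sub>R x + axis i l"
      using \<mu> by (simp add: vec_eq_iff axis_def distrib_left)
    then show ?thesis using per by simp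
  qed
  let ?Z = "\<integral>y. K2 0 0 y \<partial>lborel"
  have "BL l (F * (\<integral>y. W2 y \<partial>lborel)) (4 * \<mu>) (\<lambda>x. \<integral>y. K2 0 0 y * f ((1/\<mu>) *\<^sub>R (\<mu> *\<^sub>R x - y)) \<partial>lborel)"
    by (rule BL_dilate[OF K2_conv_BL[OF m b p] \<mu>])
  from BL_cmult[OF this, of "1 / ?Z"]
  have "BL l (cP * F) (4 * \<mu>) (\<lambda>x. 1 / ?Z * (\<integral>y. K2 0 0 y * f ((1/\<mu>) *\<^sub>R (\<mu> *\<^sub>R x - y)) \<partial>lborel))"
    using Z_pos by (simp add: cP_def mult.commute)
  moreover have "1 / ?Z * (\<integral>y. K2 0 0 y * f ((1/\<mu>) *\<^sub>R (\<mu> *\<^sub>R x - y)) \<partial>lborel) = Pm \<mu> f x" for x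
    using \<mu> by (simp add: Pm_def kn_def scaleR_diff_right)
  ultimately show ?thesis by simp
qed

text \<open>Fubini. Commutation is what turns the difference of two mollifications of a rough
  function into a difference of two Taylor remainders in \<open>Pm_difference\<close>.\<close>

lemma Pm_commute:
  fixes f :: "real^2 \<Rightarrow> real"
  assumes f [measurable]: "f \<in> borel_measurable borel" and b: "\<And>x. \<bar>f x\<bar> \<le> F"
  shows "Pm \<mu> (Pm \<nu> f) x = Pm \<nu> (Pm \<mu> f) x"
proof -
  have F: "0 \<le> F" using b[of 0] by linarith
  let ?h = "\<lambda>y z. kn y * (kn z * f (x - (1/\<mu>) *\<^sub>R y - (1/\<nu>) *\<^sub>R z))"
  have hb: "\<bar>?h y z\<bar> \<le> kn y * (kn z * F)" for y z
    unfolding abs_mult using b by (intro mult_mono) (auto simp: kn_nonneg)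
  have i1: "integrable lborel (\<lambda>z. ?h y z)" for y
    by (rule Bochner_Integration.integrable_bound[of _ "\<lambda>z. kn y * (kn z * F)"])
      (use kn_integrable(1) hb F kn_nonneg in \<open>auto intro!: AE_I2\<close>)
  have i2: "integrable lborel (\<lambda>y. \<integral>z. norm (?h y z) \<partial>lborel)"
  proof (rule Bochner_Integration.integrable_bound[of _ "\<lambda>y. kn y * F"])
    have "(\<integral>z. norm (?h y z) \<partial>lborel) \<le> kn y * F" for y
    proof -
      have "(\<integral>z. norm (?h y z) \<partial>lborel) \<le> (\<integral>z. kn y * (kn z * F) \<partial>lborel)"
        by (rule integral_mono) (use i1[of y] kn_integrable(1) hb in auto)
      then show ?thesis by (simp add: kn_integral)
    qed
    then show "AE y in lborel. norm (\<integral>z. norm (?h y z) \<partial>lborel) \<le> norm (kn y * F)"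
      using F kn_nonneg by (intro AE_I2) (simp add: integral_nonneg_AE)
  qed (use kn_integrable(1) in auto)
  have "integrable (lborel \<Otimes>\<^sub>M lborel) (\<lambda>(y, z). ?h y z)"
    by (rule lborel_pair.Fubini_integrable) (use i1 i2 in auto)
  from lborel_pair.Fubini_integral[OF this]
  have "(\<integral>z. (\<integral>y. ?h y z \<partial>lborel) \<partial>lborel) = (\<integral>y. (\<integral>z. ?h y z \<partial>lborel) \<partial>lborel)" by simp
  moreover have "(\<integral>y. (\<integral>z. ?h y z \<partial>lborel) \<partial>lborel) = Pm \<mu> (Pm \<nu> f) x" by (simp add: Pm_def)
  moreover have "(\<integral>y. ?h y z \<partial>lborel) = kn z * (\<integral>y. kn y * f (x - (1/\<nu>) *\<^sub>R z - (1/\<mu>) *\<^sub>R y) \<partial>lborel)" for z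
  proof -
    have "?h y z = kn z * (kn y * f (x - (1/\<nu>) *\<^sub>R z - (1/\<mu>) *\<^sub>R y))" for y
    proof -
      have d: "x - (1/\<mu>) *\<^sub>R y - (1/\<nu>) *\<^sub>R z = x - (1/\<nu>) *\<^sub>R z - (1/\<mu>) *\<^sub>R y" by (simp add: diff_diff_eq add.commute)
      show ?thesis unfolding d by (rule mult.left_commute)
    qed
    then show ?thesis by (simp only: integral_mult_right_zero)
  qed
  ultimately show ?thesis by (simp add: Pm_def)
qed

section \<open>Second-order expansion of the mollifier\<close>

definition rho :: "real \<Rightarrow> real" where "rho r = indicator {0..1} r * (1 - r)"

lemma rho: "integrable lborel rho" "(\<integral>r. \<bar>rho r\<bar> \<partial>lborel) \<le> 1"
proof -
  have i: "integrable lborel (indicator {0..1} :: real \<Rightarrow> real)" by simp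
  have m: "rho \<in> borel_measurable lborel" unfolding rho_def[abs_def] by measurable
  have b: "\<bar>rho r\<bar> \<le> indicator {0..1} r" for r by (auto simp: rho_def indicator_def)
  show *: "integrable lborel rho"
    by (rule Bochner_Integration.integrable_bound[OF i m]) (use b in \<open>auto intro!: AE_I2 simp: indicator_def\<close>)
  have "(\<integral>r. \<bar>rho r\<bar> \<partial>lborel) \<le> (\<integral>r. indicator {0..1::real} r \<partial>lborel)"
    by (rule integral_mono) (use * i b in auto)
  then show "(\<integral>r. \<bar>rho r\<bar> \<partial>lborel) \<le> 1" by simp
qed

text \<open>\<open>rho\<close> carries both the factor \<open>1 - r\<close> and the interval of
  Taylor's integral remainder, so the remainder is a translation average over the whole line, to
  which \<open>BL_average\<close> applies.\<close>

lemma taylor_axis: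
  assumes g: "BL l C N g"
  shows "g (x - a *\<^sub>R axis i 1) = g x - a * pd i g x + a\<^sup>2 * (\<integral>r. rho r * pd i (pd i g) (x - (r * a) *\<^sub>R axis i 1) \<partial>lborel)"
proof -
  let ?e = "axis i 1 :: real^2"
  have e: "x - (r * a) *\<^sub>R ?e = x + (r * - a) *\<^sub>R ?e" for r by simp
  have d: "((\<lambda>r. h (x - (r * a) *\<^sub>R ?e)) has_real_derivative (- a * pd i h (x - (r * a) *\<^sub>R ?e))) (at r)"
    if "BL l C' N' h" for h r C' N'
    unfolding e
    using DERIV_chain'[OF DERIV_cmult_right[OF DERIV_ident, of "- a" r] axis_line_has_derivative[OF BL_differentiable[OF that], where x = x and t = "r * - a" and i = i]]
    by (simp add: mult.commute)
  have c: "isCont (\<lambda>r. (1 - r) * (a\<^sup>2 * pd i (pd i g) (x - (r * a) *\<^sub>R ?e))) r" for r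
    using DERIV_isCont[OF d[OF BL_pd[OF BL_pd[OF g]]]] by (intro continuous_intros) auto
  \<comment> \<open>The integration by parts is built in: the function displayed is an
    antiderivative of the remainder's integrand.\<close>
  have D: "((\<lambda>r. g (x - (r * a) *\<^sub>R ?e) + (1 - r) * (- a * pd i g (x - (r * a) *\<^sub>R ?e))) has_real_derivative
     (1 - r) * (a\<^sup>2 * pd i (pd i g) (x - (r * a) *\<^sub>R ?e))) (at r)" for r
    by (rule DERIV_cong[OF DERIV_add[OF d[OF g] DERIV_mult[OF DERIV_diff[OF DERIV_const DERIV_ident] DERIV_cmult[OF d[OF BL_pd[OF g]]]]]])
      (simp add: algebra_simps power2_eq_square)
  have "(\<integral>r. (1 - r) * (a\<^sup>2 * pd i (pd i g) (x - (r * a) *\<^sub>R ?e)) * indicator {0..1} r \<partial>lborel)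
    = (g (x - (1 * a) *\<^sub>R ?e) + (1 - 1) * (- a * pd i g (x - (1 * a) *\<^sub>R ?e))) - (g (x - (0 * a) *\<^sub>R ?e) + (1 - 0) * (- a * pd i g (x - (0 * a) *\<^sub>R ?e)))"
    by (rule integral_FTC_Icc_real[OF _ D c]) simp
  moreover have "(\<integral>r. (1 - r) * (a\<^sup>2 * pd i (pd i g) (x - (r * a) *\<^sub>R ?e)) * indicator {0..1} r \<partial>lborel)
    = a\<^sup>2 * (\<integral>r. rho r * pd i (pd i g) (x - (r * a) *\<^sub>R ?e) \<partial>lborel)"
    unfolding integral_mult_right_zero[symmetric] by (intro Bochner_Integration.integral_cong) (auto simp: rho_def)
  ultimately show ?thesis by simp
qed

lemma pds_average:
  assumes "BL l C N g" "integrable M r" "\<tau> \<in> borel_measurable M"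
  shows "pds is (\<lambda>x. \<integral>\<zeta>. r \<zeta> * g (x - \<tau> \<zeta>) \<partial>M) = (\<lambda>x. \<integral>\<zeta>. r \<zeta> * pds is g (x - \<tau> \<zeta>) \<partial>M)"
  using assms(1)
proof (induction "is" arbitrary: g C)
  case (Cons i "is")
  show ?case using Cons.IH[OF BL_pd[OF Cons.prems]] by (simp add: pd_average_BL[OF Cons.prems assms(2,3)])
qed simp

lemma pds_cmult: "BL l C N g \<Longrightarrow> pds is (\<lambda>x. c * g x) = (\<lambda>x. c * pds is g x)"
proof (induction "is" arbitrary: g C)
  case (Cons i "is")
  show ?case using Cons.IH[OF BL_pd[OF Cons.prems]] by (simp add: pd_cmult_BL[OF Cons.prems])
qed simp

text \<open>The shape of the remainders in \<open>Pm_taylor\<close>: an outer average over the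
  kernel variable and an inner one over the Taylor parameter. The inner one has total weight at most
  1, so only the mass of \<open>k\<close> enters the constant.\<close>

lemma double_average:
  fixes k :: "real^2 \<Rightarrow> real" and u :: "real^2 \<Rightarrow> real^2" and v :: "real^2 \<Rightarrow> real"
  assumes f: "BL l C N f" and k: "integrable lborel k" and u [measurable]: "u \<in> borel_measurable borel"
    and v [measurable]: "v \<in> borel_measurable borel"
  shows double_average_BL: "BL l (C * (\<integral>y. \<bar>k y\<bar> \<partial>lborel)) N
      (\<lambda>x. \<integral>y. k y * (\<integral>r. rho r * f (x - (u y + (r * v y) *\<^sub>R axis i 1)) \<partial>lborel) \<partial>lborel)" (is ?A)
    and pd_double_average: "pd j (\<lambda>x. \<integral>y. k y * (\<integral>r. rho r * f (x - (u y + (r * v y) *\<^sub>R axis i 1)) \<partial>lborel) \<partial>lborel)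
      = (\<lambda>x. \<integral>y. k y * (\<integral>r. rho r * pd j f (x - (u y + (r * v y) *\<^sub>R axis i 1)) \<partial>lborel) \<partial>lborel)" (is ?B)
    and integrable_double_average: "integrable lborel (\<lambda>y. k y * (\<integral>r. rho r * f (x - (u y + (r * v y) *\<^sub>R axis i 1)) \<partial>lborel))" (is ?C)
proof -
  have tm: "(\<lambda>r. u y + (r * v y) *\<^sub>R axis i 1) \<in> borel_measurable lborel" for y by measurable
  define I where "I y x = (\<integral>r. rho r * f (x - (u y + (r * v y) *\<^sub>R axis i 1)) \<partial>lborel)" for y x
  have I: "BL l C N (I y)" for y
  proof (rule BL_mono)
    show "BL l (C * (\<integral>r. \<bar>rho r\<bar> \<partial>lborel)) N (I y)"
      unfolding I_def[abs_def] by (rule BL_average_BL[OF f rho(1) tm])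
    show "C * (\<integral>r. \<bar>rho r\<bar> \<partial>lborel) \<le> C" using rho(2) BL_nonneg(1)[OF f] by (rule mult_left_le)
  qed simp
  have b: "BL l (\<bar>k y\<bar> * C) N (\<lambda>x. k y * I y x)" for y by (rule BL_cmult[OF I])
  have ik: "integrable lborel (\<lambda>y. \<bar>k y\<bar> * C)" using k by simp
  have m: "(\<lambda>y. pds is (\<lambda>x. k y * I y x) x) \<in> borel_measurable lborel" for "is" x
  proof -
    have [measurable]: "pds is f \<in> borel_measurable borel"
      by (rule borel_measurable_continuous_onI[OF BL_continuous[OF BL_pds[OF f]]])
    note [measurable] = borel_measurable_integrable[OF k] borel_measurable_integrable[OF rho(1)]
    show ?thesis unfolding pds_cmult[OF I] unfolding I_def[abs_def] pds_average[OF f rho(1) tm] by measurable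
  qed
  show ?A using BL_integral_BL[OF b ik BL_nonneg(2)[OF f] m] by (simp add: I_def mult.commute)
  have pI: "pd j (I y) x = (\<integral>r. rho r * pd j f (x - (u y + (r * v y) *\<^sub>R axis i 1)) \<partial>lborel)" for y x
  proof -
    have "I y = (\<lambda>x. \<integral>r. rho r * f (x - (u y + (r * v y) *\<^sub>R axis i 1)) \<partial>lborel)" by (simp add: I_def fun_eq_iff)
    then show ?thesis by (simp only: pd_average_BL[OF f rho(1) tm])
  qed
  have "pd j (\<lambda>x. \<integral>y. k y * I y x \<partial>lborel) = (\<lambda>x. \<integral>y. pd j (\<lambda>x. k y * I y x) x \<partial>lborel)"
    by (rule pd_integral_BL[OF b ik BL_nonneg(2)[OF f] m])
  also have "\<dots> = (\<lambda>x. \<integral>y. k y * pd j (I y) x \<partial>lborel)"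
    by (simp only: pd_cmult_BL[OF I])
  finally have B: "pd j (\<lambda>x. \<integral>y. k y * I y x \<partial>lborel) = (\<lambda>x. \<integral>y. k y * pd j (I y) x \<partial>lborel)" .
  show ?B using B unfolding pI unfolding I_def .
  have "integrable lborel (\<lambda>y. k y * I y x)"
    by (rule integrable_BL_family[OF b ik]) (use m[of "[]" x] in \<open>simp only: pds.simps\<close>)
  then show ?C by (simp only: I_def)
qed

definition mom2 :: real where "mom2 = (\<integral>y. kn y * (y $ 1)\<^sup>2 \<partial>lborel) + (\<integral>y. kn y * (y $ 2)\<^sup>2 \<partial>lborel)"

lemma mom2: "0 \<le> mom2" "(\<integral>y. kn y * (y $ i)\<^sup>2 \<partial>lborel) \<le> mom2"
proof -
  have "0 \<le> (\<integral>y. kn y * (y $ i)\<^sup>2 \<partial>lborel)" for i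
    by (rule integral_nonneg_AE) (simp add: kn_nonneg)
  then show "0 \<le> mom2" "(\<integral>y. kn y * (y $ i)\<^sup>2 \<partial>lborel) \<le> mom2"
    using exhaust_2[of i] by (auto simp: mom2_def add_nonneg_nonneg)
qed

text \<open>The first moments of the kernel vanish, so \<open>1 - Pm \<mu>\<close> is a sum of pure second derivatives of operators
  of size \<open>1 / \<mu>\<^sup>2\<close>. The variables are treated one after the other to avoid the mixed derivative.\<close>

lemma Pm_taylor:
  assumes f: "BL l C N f" and \<mu>: "0 < \<mu>"
  shows "\<exists>X Y. BL l (mom2 * C / \<mu>\<^sup>2) N X \<and> BL l (mom2 * C / \<mu>\<^sup>2) N Y \<and>
    (\<forall>x. f x = Pm \<mu> f x + pd 1 (pd 1 X) x + pd 2 (pd 2 Y) x)"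
proof -
  define a where "a y = (1/\<mu>) * y $ 1" for y :: "real^2"
  define b where "b y = (1/\<mu>) * y $ 2" for y :: "real^2"
  define u where "u y = a y *\<^sub>R (axis 1 1 :: real^2)" for y :: "real^2"
  have [measurable]: "a \<in> borel_measurable borel" "b \<in> borel_measurable borel" "u \<in> borel_measurable borel"
    unfolding a_def[abs_def] b_def[abs_def] u_def[abs_def] by measurable
  have ka: "kn y * (a y)\<^sup>2 = (1/\<mu>\<^sup>2) * (kn y * (y $ 1)\<^sup>2)" "kn y * (b y)\<^sup>2 = (1/\<mu>\<^sup>2) * (kn y * (y $ 2)\<^sup>2)" for y
    by (simp_all add: a_def b_def power_divide)
  have ki: "integrable lborel (\<lambda>y. kn y * (a y)\<^sup>2)" "integrable lborel (\<lambda>y. kn y * (b y)\<^sup>2)"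
    unfolding ka using kn_integrable(2) by auto
  have kb: "(\<integral>y. \<bar>kn y * (a y)\<^sup>2\<bar> \<partial>lborel) \<le> mom2 / \<mu>\<^sup>2" "(\<integral>y. \<bar>kn y * (b y)\<^sup>2\<bar> \<partial>lborel) \<le> mom2 / \<mu>\<^sup>2"
  proof -
    have "(\<integral>y. \<bar>kn y * (a y)\<^sup>2\<bar> \<partial>lborel) = (1/\<mu>\<^sup>2) * (\<integral>y. kn y * (y $ 1)\<^sup>2 \<partial>lborel)"
      "(\<integral>y. \<bar>kn y * (b y)\<^sup>2\<bar> \<partial>lborel) = (1/\<mu>\<^sup>2) * (\<integral>y. kn y * (y $ 2)\<^sup>2 \<partial>lborel)"
      unfolding ka by (simp_all add: kn_nonneg)
    then show "(\<integral>y. \<bar>kn y * (a y)\<^sup>2\<bar> \<partial>lborel) \<le> mom2 / \<mu>\<^sup>2" "(\<integral>y. \<bar>kn y * (b y)\<^sup>2\<bar> \<partial>lborel) \<le> mom2 / \<mu>\<^sup>2"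
      using mom2(2) by (simp_all add: divide_right_mono)
  qed
  \<comment> \<open>\<open>Q1\<close> collects the remainders of the expansion in the first
    variable. \<open>Q2\<close> belongs to the second variable, where the expansion starts at the
    point already displaced by \<open>u y\<close>.\<close>
  define Q1 where "Q1 f x = (\<integral>y. kn y * (a y)\<^sup>2 * (\<integral>r. rho r * f (x - (0 + (r * a y) *\<^sub>R axis 1 1)) \<partial>lborel) \<partial>lborel)"
    for f :: "real^2 \<Rightarrow> real" and x
  define Q2 where "Q2 f x = (\<integral>y. kn y * (b y)\<^sup>2 * (\<integral>r. rho r * f (x - (u y + (r * b y) *\<^sub>R axis 2 1)) \<partial>lborel) \<partial>lborel)"
    for f :: "real^2 \<Rightarrow> real" and x
  have C: "0 \<le> C" by (rule BL_nonneg(1)[OF f])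
  have Q1: "BL l (mom2 * C / \<mu>\<^sup>2) N (Q1 f)"
    unfolding Q1_def[abs_def]
    by (rule BL_mono[OF double_average_BL[OF f ki(1)]]) (use mult_left_mono[OF kb(1) C] in \<open>auto simp: mult_ac\<close>)
  have Q2: "BL l (mom2 * C / \<mu>\<^sup>2) N (Q2 f)"
    unfolding Q2_def[abs_def]
    by (rule BL_mono[OF double_average_BL[OF f ki(2)]]) (use mult_left_mono[OF kb(2) C] in \<open>auto simp: mult_ac\<close>)
  have Q1pd: "pd j (Q1 g) = Q1 (pd j g)" if "BL l C' N g" for j g C'
    unfolding Q1_def[abs_def] by (rule pd_double_average[OF that ki(1)]) measurable
  have Q2pd: "pd j (Q2 g) = Q2 (pd j g)" if "BL l C' N g" for j g C'
    unfolding Q2_def[abs_def] by (rule pd_double_average[OF that ki(2)]) measurable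
  have f11: "BL l (C * N * N) N (pd i (pd i f))" for i by (intro BL_pd f)
  have main: "Pm \<mu> f x = f x + Q1 (pd 1 (pd 1 f)) x + Q2 (pd 2 (pd 2 f)) x" for x
  proof -
    let ?J1 = "\<lambda>y. kn y * (a y)\<^sup>2 * (\<integral>r. rho r * pd 1 (pd 1 f) (x - (0 + (r * a y) *\<^sub>R axis 1 1)) \<partial>lborel)"
    let ?J2 = "\<lambda>y. kn y * (b y)\<^sup>2 * (\<integral>r. rho r * pd 2 (pd 2 f) (x - (u y + (r * b y) *\<^sub>R axis 2 1)) \<partial>lborel)"
    have e: "kn y * f (x - (1/\<mu>) *\<^sub>R y) = kn y * f x - pd 1 f x * (1/\<mu>) * (kn y * y $ 1) + ?J1 y
       - (1/\<mu>) * (kn y * (y $ 2 * pd 2 f (x - u y))) + ?J2 y" for y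
    proof -
      have "(1/\<mu>) *\<^sub>R y = u y + b y *\<^sub>R axis 2 1"
        using vec2_decomp[of y] by (metis a_def b_def u_def scaleR_add_right scaleR_scaleR)
      then have "f (x - (1/\<mu>) *\<^sub>R y) = f ((x - u y) - b y *\<^sub>R axis 2 1)" by (simp add: algebra_simps)
      also have "\<dots> = f (x - u y) - b y * pd 2 f (x - u y) + (b y)\<^sup>2 * (\<integral>r. rho r * pd 2 (pd 2 f) (x - u y - (r * b y) *\<^sub>R axis 2 1) \<partial>lborel)"
        by (rule taylor_axis[OF f])
      also have "f (x - u y) = f x - a y * pd 1 f x + (a y)\<^sup>2 * (\<integral>r. rho r * pd 1 (pd 1 f) (x - (r * a y) *\<^sub>R axis 1 1) \<partial>lborel)"
        unfolding u_def by (rule taylor_axis[OF f])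
      finally have fe: "f (x - (1/\<mu>) *\<^sub>R y) = f x - a y * pd 1 f x + (a y)\<^sup>2 * (\<integral>r. rho r * pd 1 (pd 1 f) (x - (r * a y) *\<^sub>R axis 1 1) \<partial>lborel)
        - b y * pd 2 f (x - u y) + (b y)\<^sup>2 * (\<integral>r. rho r * pd 2 (pd 2 f) (x - u y - (r * b y) *\<^sub>R axis 2 1) \<partial>lborel)" .
      have "a y * pd 1 f x = pd 1 f x * (1/\<mu>) * y $ 1" "b y * pd 2 f (x - u y) = (1/\<mu>) * (y $ 2 * pd 2 f (x - u y))"
        by (simp_all add: a_def b_def)
      then show ?thesis unfolding fe by (simp add: algebra_simps)
    qed
    have pm: "pd 2 f \<in> borel_measurable borel"
      by (rule borel_measurable_continuous_onI[OF BL_continuous[OF BL_pd[OF f]]])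
    have i3: "integrable lborel (\<lambda>y. kn y * (y $ 2 * pd 2 f (x - u y)))"
    proof (rule Bochner_Integration.integrable_bound)
      note [measurable] = pm
      show "integrable lborel (\<lambda>y. (C * N) * (kn y * y $ 2))" using kn_integrable_1 by simp
      show "(\<lambda>y. kn y * (y $ 2 * pd 2 f (x - u y))) \<in> borel_measurable lborel" by measurable
      have "\<bar>kn y * (y $ 2 * pd 2 f (x - u y))\<bar> \<le> \<bar>C * N * (kn y * y $ 2)\<bar>" for y
      proof -
        have "\<bar>pd 2 f (x - u y)\<bar> \<le> \<bar>C * N\<bar>" using BL_bound[OF BL_pd[OF f], of 2 "x - u y"] by linarith
        then have "\<bar>kn y * y $ 2\<bar> * \<bar>pd 2 f (x - u y)\<bar> \<le> \<bar>kn y * y $ 2\<bar> * \<bar>C * N\<bar>" by (rule mult_left_mono) simp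
        then show ?thesis by (simp add: abs_mult mult_ac)
      qed
      then show "AE y in lborel. norm (kn y * (y $ 2 * pd 2 f (x - u y))) \<le> norm (C * N * (kn y * y $ 2))"
        by (intro AE_I2) simp
    qed
    have i1: "integrable lborel ?J1" by (rule integrable_double_average[OF f11 ki(1)]) measurable
    have i2: "integrable lborel ?J2" by (rule integrable_double_average[OF f11 ki(2)]) measurable
    have z1: "(\<integral>y. kn y * y $ 1 \<partial>lborel) = 0"
      by (rule kn_odd_zero[of "-1" 1]) auto
    \<comment> \<open>The coefficient \<open>pd 2 f (x - u y)\<close> depends on
      \<open>y $ 1\<close> only, so flipping the sign of \<open>y $ 2\<close> makes the integrand
      odd.\<close>
    have z2: "(\<integral>y. kn y * (y $ 2 * pd 2 f (x - u y)) \<partial>lborel) = 0"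
      by (rule kn_odd_zero[of 1 "-1"]) (use pm in \<open>auto simp: u_def a_def\<close>)
    have "Pm \<mu> f x = (\<integral>y. kn y * f x \<partial>lborel) - (\<integral>y. pd 1 f x * (1/\<mu>) * (kn y * y $ 1) \<partial>lborel) + (\<integral>y. ?J1 y \<partial>lborel)
       - (\<integral>y. (1/\<mu>) * (kn y * (y $ 2 * pd 2 f (x - u y))) \<partial>lborel) + (\<integral>y. ?J2 y \<partial>lborel)"
      unfolding Pm_def e using i1 i2 i3 kn_integrable(1) kn_integrable_1 by simp
    then show ?thesis by (simp add: z1 z2 kn_integral Q1_def Q2_def)
  qed
  have X: "BL l (mom2 * C / \<mu>\<^sup>2) N (\<lambda>x. - 1 * Q1 f x)" "BL l (mom2 * C / \<mu>\<^sup>2) N (\<lambda>x. - 1 * Q2 f x)"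
    using BL_cmult[OF Q1, of "-1"] BL_cmult[OF Q2, of "-1"] by simp_all
  have "pd 1 (pd 1 (\<lambda>x. - 1 * Q1 f x)) = (\<lambda>x. - 1 * Q1 (pd 1 (pd 1 f)) x)"
    unfolding pd_cmult_BL[OF Q1] Q1pd[OF f] pd_cmult_BL[OF BL_pd[OF Q1, of 1, unfolded Q1pd[OF f]]] Q1pd[OF BL_pd[OF f]] ..
  moreover have "pd 2 (pd 2 (\<lambda>x. - 1 * Q2 f x)) = (\<lambda>x. - 1 * Q2 (pd 2 (pd 2 f)) x)"
    unfolding pd_cmult_BL[OF Q2] Q2pd[OF f] pd_cmult_BL[OF BL_pd[OF Q2, of 2, unfolded Q2pd[OF f]]] Q2pd[OF BL_pd[OF f]] ..
  ultimately show ?thesis using X main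
    by (intro exI[of _ "\<lambda>x. - 1 * Q1 f x"] exI[of _ "\<lambda>x. - 1 * Q2 f x"]) simp
qed

text \<open>By periodicity and Rolle, \<open>pd i g\<close> vanishes at distance less than
  \<open>l\<close> from any point, hence is at most \<open>l\<close> times the bound of the next
  derivative. Iterating gives the factor \<open>(l * N) ^ m\<close>, which tends to 0.\<close>

lemma BL_low_frequency:
  assumes g: "BL l C N g" and l: "0 < l" "l * N < 1"
  shows "pd i g = (\<lambda>x. 0)"
proof -
  have N: "0 \<le> N" by (rule BL_nonneg(2)[OF g])
  have b: "\<bar>pd i g x\<bar> \<le> C * N * (l * N) ^ m" if "BL l C N g" for m C x g
    using that
  proof (induction m arbitrary: C x g)
    case 0
    then show ?case using BL_bound[OF BL_pd[OF 0]] by simp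
  next
    case (Suc m)
    have d: "((\<lambda>t. h (x + t *\<^sub>R axis i 1)) has_real_derivative (pd i h (x + t *\<^sub>R axis i 1))) (at t)" if "BL l C' N h" for t h C'
      by (rule axis_line_has_derivative[OF BL_differentiable[OF that]])
    have "\<exists>s>0. s < l \<and> g (x + l *\<^sub>R axis i 1) - g (x + 0 *\<^sub>R axis i 1) = (l - 0) * pd i g (x + s *\<^sub>R axis i 1)"
      by (rule MVT2[OF l(1)]) (rule d[OF Suc.prems])
    then obtain s where s: "0 < s" "s < l" "g (x + l *\<^sub>R axis i 1) - g x = l * pd i g (x + s *\<^sub>R axis i 1)" by auto
    have "l *\<^sub>R axis i (1::real) = axis i l" by (simp add: vec_eq_iff axis_def)
    then have z: "pd i g (x + s *\<^sub>R axis i 1) = 0" using s l BL_periodic[OF Suc.prems] by simp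
    have "\<exists>t>0. t < s \<and> pd i g (x + s *\<^sub>R axis i 1) - pd i g (x + 0 *\<^sub>R axis i 1) = (s - 0) * pd i (pd i g) (x + t *\<^sub>R axis i 1)"
      by (rule MVT2[OF s(1)]) (rule d[OF BL_pd[OF Suc.prems]])
    then obtain t where t: "- pd i g x = s * pd i (pd i g) (x + t *\<^sub>R axis i 1)" using z by auto
    have "\<bar>pd i g x\<bar> = s * \<bar>pd i (pd i g) (x + t *\<^sub>R axis i 1)\<bar>" using arg_cong[OF t, of abs] s(1) by (simp add: abs_mult)
    also have "\<dots> \<le> l * (C * N * N * (l * N) ^ m)"
      by (intro mult_mono Suc.IH[OF BL_pd[OF Suc.prems]]) (use s l in auto)
    finally show ?case by (simp add: mult_ac)
  qed
  have lim: "(\<lambda>m. C * N * (l * N) ^ m) \<longlonglongrightarrow> C * N * 0"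
    by (intro tendsto_mult_left LIMSEQ_power_zero) (use l N in auto)
  have "\<bar>pd i g x\<bar> \<le> 0" for x
    by (rule LIMSEQ_le_const[OF lim[unfolded mult_zero_right]]) (use b[OF g] in auto)
  then show ?thesis by auto
qed

lemma BL_low_frequency_const:
  assumes g: "BL l C N g" and l: "0 < l" "l * N < 1"
  shows "g x = g y"
proof -
  have "(g has_derivative (\<lambda>h. 0)) (at x)" for x
    using has_derivative_pd[OF BL_differentiable[OF g], of x] BL_low_frequency[OF assms] by simp
  then show ?thesis using has_derivative_zero_constant[of UNIV g] by (metis UNIV_I convex_UNIV has_derivative_at_withinI)
qed

lemma BL_zero: "BL l 0 N (\<lambda>x. 0)" if "0 \<le> N"
  using BL_mono[OF BL_const[of l 0]] that by simp

text \<open>Littlewood-Paley telescoping: each dyadic block of the mixed derivative costs the same constant, so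
  only the number \<open>j\<close> of octaves enters, and a periodic function of type below \<open>1 / l\<close> is constant.\<close>

lemma mixed_decomposition:
  assumes l: "0 < l"
  shows "\<lbrakk>\<And>x. \<bar>G x\<bar> \<le> S; BL l (cP * S) (2 ^ j * (1 / (2 * l))) G\<rbrakk> \<Longrightarrow>
    \<exists>X Y. BL l (64 * mom2 * cP * real j * S) (2 ^ j * (1 / (2 * l))) X \<and> BL l (64 * mom2 * cP * real j * S) (2 ^ j * (1 / (2 * l))) Y \<and>
      (\<forall>x. pd 1 (pd 2 G) x = pd 1 (pd 1 X) x + pd 2 (pd 2 Y) x)"
proof (induction j arbitrary: G)
  case 0
  \<comment> \<open>The type is now \<open>1 / (2 * l)\<close>, so its product with \<open>l\<close>
    is one half.\<close>
  have "pd 2 G = (\<lambda>x. 0)" by (rule BL_low_frequency[OF 0(2) l]) (use l in simp)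
  then show ?case using BL_zero[of "1/(2*l)" l] l by (intro exI[of _ "\<lambda>x. 0"]) simp
next
  case (Suc j)
  define n where "n = 2 ^ j * (1 / (2 * l))"
  have n: "0 < n" "2 ^ Suc j * (1 / (2 * l)) = 2 * n" using l by (auto simp: n_def)
  have G: "BL l (cP * S) (2 * n) G" using Suc.prems(2) n by simp
  have Gm: "G \<in> borel_measurable borel" by (rule borel_measurable_continuous_onI[OF BL_continuous[OF G]])
  have S: "0 \<le> S" using Suc.prems(1)[of 0] by linarith
  \<comment> \<open>Mollifying at \<open>n / 4\<close> produces type \<open>n\<close>, one octave
    below \<open>G\<close>, and keeps the sup bound \<open>S\<close>; these are the two hypotheses
    at \<open>j\<close>.\<close>
  have 1: "BL l (cP * S) (4 * (n / 4)) (Pm (n/4) G)"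
    by (rule Pm_smooth[OF Gm Suc.prems(1) BL_periodic[OF G]]) (use n in auto)
  obtain X Y where XY: "BL l (64 * mom2 * cP * real j * S) n X" "BL l (64 * mom2 * cP * real j * S) n Y"
      "\<And>x. pd 1 (pd 2 (Pm (n/4) G)) x = pd 1 (pd 1 X) x + pd 2 (pd 2 Y) x"
    using Suc.IH[of "Pm (n/4) G", OF Pm_sup[OF Gm Suc.prems(1)]] 1 unfolding n_def[symmetric] by auto
  have G12: "BL l (cP * S * (2 * n) * (2 * n)) (2 * n) (pd 1 (pd 2 G))" by (intro BL_pd G)
  obtain X' Y' where XY': "BL l (mom2 * (cP * S * (2 * n) * (2 * n)) / (n/4)\<^sup>2) (2 * n) X'"
      "BL l (mom2 * (cP * S * (2 * n) * (2 * n)) / (n/4)\<^sup>2) (2 * n) Y'"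
      "\<And>x. pd 1 (pd 2 G) x = Pm (n/4) (pd 1 (pd 2 G)) x + pd 1 (pd 1 X') x + pd 2 (pd 2 Y') x"
    using Pm_taylor[OF G12, of "n/4"] n by auto
  \<comment> \<open>64 = 2 * 2 * 4 * 4: two derivatives at type \<open>2 * n\<close>, divided by the
    squared scale \<open>n / 4\<close>. The frequency cancels, so every octave costs the
    same.\<close>
  have c: "mom2 * (cP * S * (2 * n) * (2 * n)) / (n/4)\<^sup>2 = 64 * mom2 * cP * S"
    using n by (simp add: power2_eq_square)
  have Pe: "Pm (n/4) (pd 1 (pd 2 G)) = pd 1 (pd 2 (Pm (n/4) G))"
    by (simp add: Pm_pd[OF G] Pm_pd[OF BL_pd[OF G]])
  have nn: "n \<le> 2 * n" using n by simp
  have XX: "BL l (64 * mom2 * cP * real j * S) (2*n) X" "BL l (64 * mom2 * cP * real j * S) (2*n) Y"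
    using BL_mono[OF XY(1) order_refl nn] BL_mono[OF XY(2) order_refl nn] by auto
  have ce: "64 * mom2 * cP * real j * S + 64 * mom2 * cP * S = 64 * mom2 * cP * real (Suc j) * S" by (simp add: algebra_simps)
  have "BL l (64 * mom2 * cP * real (Suc j) * S) (2 * n) (\<lambda>x. X x + X' x)"
    using BL_add[OF XX(1) XY'(1)[unfolded c]] unfolding ce .
  moreover have "BL l (64 * mom2 * cP * real (Suc j) * S) (2 * n) (\<lambda>x. Y x + Y' x)"
    using BL_add[OF XX(2) XY'(2)[unfolded c]] unfolding ce .
  moreover have "pd 1 (pd 1 (\<lambda>x. X x + X' x)) = (\<lambda>x. pd 1 (pd 1 X) x + pd 1 (pd 1 X') x)"
    unfolding pd_add_BL[OF XX(1) XY'(1)] by (rule pd_add_BL[OF BL_pd[OF XX(1)] BL_pd[OF XY'(1)]])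
  moreover have "pd 2 (pd 2 (\<lambda>x. Y x + Y' x)) = (\<lambda>x. pd 2 (pd 2 Y) x + pd 2 (pd 2 Y') x)"
    unfolding pd_add_BL[OF XX(2) XY'(2)] by (rule pd_add_BL[OF BL_pd[OF XX(2)] BL_pd[OF XY'(2)]])
  ultimately show ?case unfolding n(2) using XY(3) XY'(3) unfolding Pe
    by (intro exI[of _ "\<lambda>x. X x + X' x"] exI[of _ "\<lambda>x. Y x + Y' x"]) simp
qed

subsection \<open>The corrugation step\<close>

text \<open>Differentiability without constants, so that the simplifier can differentiate long
  products by \<open>pd_dif\<close> and \<open>dif_intros\<close>; the quantitative bounds are
  derived separately.\<close>

definition dif :: "(real^2 \<Rightarrow> real) \<Rightarrow> bool" where "dif f \<longleftrightarrow> (\<forall>x. f differentiable at x)"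

lemma dif_intros:
  "dif (\<lambda>x. c)" "dif f \<Longrightarrow> dif g \<Longrightarrow> dif (\<lambda>x. f x + g x)"
  "dif f \<Longrightarrow> dif g \<Longrightarrow> dif (\<lambda>x. f x * g x)"
  by (auto simp: dif_def)

lemma pd_dif:
  "dif f \<Longrightarrow> dif g \<Longrightarrow> pd i (\<lambda>x. f x + g x) = (\<lambda>x. pd i f x + pd i g x)"
  "dif f \<Longrightarrow> dif g \<Longrightarrow> pd i (\<lambda>x. f x * g x) = (\<lambda>x. pd i f x * g x + f x * pd i g x)"
  by (auto simp: dif_def fun_eq_iff pd_add pd_mult)

lemma BL_dif: "BL l C N g \<Longrightarrow> dif g"
  by (auto simp: dif_def)

text \<open>Products of phases are sorted by harmonics: \<open>S\<close> and \<open>C\<close> are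
  sine and cosine of the phase, \<open>2 * (S * C)\<close> and \<open>1 - 2 * (S * S)\<close> those
  of the doubled phase. Free of phase remain the old determinant, the mean
  \<open>- w * b22 / 2 = g22\<close>, a quarter of the second derivative of the squared
  \<open>b\<close>, subtracted, and the Hessian determinant of \<open>b\<close> with a factor
  \<open>m\<^sup>2 / 2\<close>. Differences appear as \<open>- 1 *\<close> because the rules for
  \<open>BL\<close> treat sums and multiples only.\<close>

lemma step_identity:
  fixes S C m q :: real
  assumes "S * S + C * C = 1" "m * q = 1" "w * b22 = - 2 * g22"
  shows "(u11 + (m * (b11 * S + 2 * (b1 * (q * C)) + (w + b) * (q * (- q * S))))) * (u22 + m * (b22 * S))
     - (u12 + m * (b12 * S + b2 * (q * C)))\<^sup>2
   = (u11 * u22 - u12\<^sup>2) + g22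
     + ((u22 * (- q * (w + b) + m * b11) + (m * (u11 * b22) + (- 2 * m) * (u12 * b12))) * S
       + 2 * (u22 * b1 + - 1 * (u12 * b2)) * C
       + (1/2 * (w * b22) + (1/2 * (b * b22 + - 1 * (b2 * b2)) + (- m\<^sup>2 / 2) * (b11 * b22 + - 1 * (b12 * b12)))) * (1 - 2 * (S * S))
       + (m * (b1 * b22 + - 1 * (b2 * b12))) * (2 * (S * C)))
     + (- 1/4) * (2 * (b2 * b2 + b * b22)) + m\<^sup>2 / 2 * (b11 * b22 - b12 * b12)"
proof -
  have C2: "C * C = 1 - S * S" using assms(1) by linarith
  have M: "m * (b11 * S + 2 * (b1 * (q * C)) + (w + b) * (q * (- q * S))) = m * b11 * S + 2 * b1 * C * (m * q) - (w + b) * q * S * (m * q)"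
    "m * (b12 * S + b2 * (q * C)) = m * b12 * S + b2 * C * (m * q)"
    by (simp_all add: algebra_simps)
  have L: "m * (b11 * S + 2 * (b1 * (q * C)) + (w + b) * (q * (- q * S))) = m * b11 * S + 2 * b1 * C - (w + b) * q * S"
    "m * (b12 * S + b2 * (q * C)) = m * b12 * S + b2 * C"
    unfolding M assms(2) by simp_all
  have 1: "(u11 + (m * b11 * S + 2 * b1 * C - (w + b) * q * S)) * (u22 + m * (b22 * S)) - (u12 + (m * b12 * S + b2 * C))\<^sup>2
    = (u11 * u22 - u12\<^sup>2) + u22 * (m * b11 * S + 2 * b1 * C - (w + b) * q * S) + u11 * (m * (b22 * S)) - 2 * u12 * (m * b12 * S + b2 * C)
     + (m * m * (b11 * b22 - b12 * b12)) * (S * S) + (2 * m * (b1 * b22 - b2 * b12)) * (S * C) - (m * q) * ((w + b) * b22) * (S * S) - b2 * b2 * (C * C)"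
    by (simp add: power2_eq_square algebra_simps)
  show ?thesis
    unfolding L 1 unfolding C2 assms(2) using assms(3)
    by (simp add: power2_eq_square field_simps)
qed

text \<open>\<open>H\<close>, \<open>T\<close> and \<open>L\<close> bound the second derivatives
  across the corrugation, mixed, and along it; they are kept apart because they grow at different
  rates. Every error in \<open>X\<close> carries a negative power of \<open>q\<close>. In
  \<open>Y\<close> the term \<open>b\<^sup>2\<close> does not, and is small only because it is
  quadratic in the defect.\<close>

lemma corrugation_step:
  fixes i j :: 2
  assumes ij: "i \<noteq> j" and l: "0 < l"
    and u: "BL l Cu N u" and ujj: "BL l H N (pd j (pd j u))" and uij: "BL l T N (pd i (pd j u))"
    and uii: "BL l L N (pd i (pd i u))" and g: "BL l \<gamma> N g"
    and w: "0 < w" "2 * \<gamma> \<le> w * w" and q: "0 < q" "8 * N \<le> q" and per: "q * l = 2 * pi * of_int k"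
    and J: "2 * N \<le> 2 ^ J * (1 / (2 * l))" "2 ^ J * (1 / (2 * l)) \<le> 3 * q"
  defines "b \<equiv> 2 * \<gamma> / w" and "\<kappa> \<equiv> 64 * mom2 * cP * real J"
  shows "\<exists>\<psi> X Y. BL l (2 * w / q) (3 * q) \<psi> \<and>
     BL l (b * N * N / q) (3 * q) (pd j (pd j \<psi>)) \<and> BL l (2 * b * N) (3 * q) (pd i (pd j \<psi>)) \<and>
     BL l (3 * w * q) (3 * q) (pd i (pd i \<psi>)) \<and>
     BL l (13 * H * w / q + 4 * L * b * N\<^sup>2 / q^3 + 9 * T * b * N / q\<^sup>2 + 3 * w * b * N\<^sup>2 / q\<^sup>2 + (1 + \<kappa>) * b\<^sup>2 * N\<^sup>2 / q\<^sup>2) (3 * q) X \<and>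
     BL l (b\<^sup>2 + (1 + \<kappa>) * b\<^sup>2 * N\<^sup>2 / q\<^sup>2) (3 * q) Y \<and>
     (\<forall>x. pd i (pd i (\<lambda>x. u x + \<psi> x)) x * pd j (pd j (\<lambda>x. u x + \<psi> x)) x - (pd i (pd j (\<lambda>x. u x + \<psi> x)) x)\<^sup>2
        = pd i (pd i u) x * pd j (pd j u) x - (pd i (pd j u) x)\<^sup>2 + pd j (pd j g) x + pd i (pd i X) x + pd j (pd j Y) x)"
proof -
  define \<beta> where "\<beta> x = (- 2 / w) * g x" for x
  have \<beta>: "BL l b N \<beta>" unfolding \<beta>_def[abs_def]
    using BL_cmult[OF g, of "- 2 / w"] w by (simp add: b_def)
  have N: "0 \<le> N" and \<gamma>: "0 \<le> \<gamma>" using BL_nonneg[OF g] by auto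
  have HTL: "0 \<le> H" "0 \<le> T" "0 \<le> L" using BL_nonneg(1)[OF ujj] BL_nonneg(1)[OF uij] BL_nonneg(1)[OF uii] by auto
  have b0: "0 \<le> b" using \<gamma> w by (simp add: b_def)
  have bw: "b \<le> w" using w by (simp add: b_def divide_le_eq)
  define m where "m = 1 / q"
  have m: "0 < m" "m * q = 1" using q by (auto simp: m_def)
  define b1 where "b1 = pd i \<beta>"
  define b2 where "b2 = pd j \<beta>"
  define b11 where "b11 = pd i b1"
  define b12 where "b12 = pd i b2"
  define b22 where "b22 = pd j b2"
  have B1: "BL l (b * N) N b1" "BL l (b * N) N b2" unfolding b1_def b2_def by (intro BL_pd \<beta>)+
  have B2: "BL l (b * N * N) N b11" "BL l (b * N * N) N b12" "BL l (b * N * N) N b22"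
    unfolding b11_def b12_def b22_def by (intro BL_pd B1)+
  have pdb: "pd i \<beta> = b1" "pd j \<beta> = b2" "pd i b1 = b11" "pd i b2 = b12" "pd j b2 = b22" "pd j b1 = b12"
    "pd j b11 = pd i b12" "pd j b12 = pd i b22"
    using BL_pd_commute[OF \<beta>, of j i] BL_pd_commute[OF B1(1), of j i] BL_pd_commute[OF B1(2), of j i]
    by (simp_all add: b1_def b2_def b11_def b12_def b22_def)
  have difs: "dif \<beta>" "dif b1" "dif b2" "dif b11" "dif b12" "dif b22" "dif g" "dif (pd j g)"
    using BL_dif[OF \<beta>] BL_dif[OF B1(1)] BL_dif[OF B1(2)] BL_dif[OF B2(1)] BL_dif[OF B2(2)] BL_dif[OF B2(3)] BL_dif[OF g] BL_dif[OF BL_pd[OF g]]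
    by blast+
  \<comment> \<open>The sine is written as a shifted cosine, so that \<open>BL_cos\<close> and
    \<open>osc_inverse\<close> cover all harmonics.\<close>
  define S where "S x = cos (q * x $ i + (- pi/2))" for x :: "real^2"
  define C where "C x = cos (q * x $ i + 0)" for x :: "real^2"
  have BS: "BL l 1 q S" "BL l 1 q C"
    using BL_cos_BL[OF per, of i "- pi/2"] BL_cos_BL[OF per, of i 0] q unfolding S_def[abs_def] C_def[abs_def] by auto
  have Se: "S x = sin (q * x $ i)" for x by (simp add: S_def cos_diff)
  have pdS: "pd i S = (\<lambda>x. q * C x)" "pd j S = (\<lambda>x. 0)" "pd i C = (\<lambda>x. - q * S x)" "pd j C = (\<lambda>x. 0)"
    using pd_cos[OF per, of i i "- pi/2"] pd_cos[OF per, of j i "- pi/2"] pd_cos[OF per, of i i 0] pd_cos[OF per, of j i 0] ij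
    unfolding S_def[abs_def, symmetric] C_def[abs_def, symmetric]
    by (auto simp: C_def Se cos_add fun_eq_iff)
  have difS: "dif S" "dif C" using BS BL_dif by blast+
  have SC: "S x * S x + C x * C x = 1" for x
    using sin_cos_squared_add[of "q * x $ i"] by (simp add: Se C_def power2_eq_square)
  define \<psi> where "\<psi> x = m * ((w + \<beta> x) * S x)" for x
  have Ba: "BL l (2 * w) N (\<lambda>x. w + \<beta> x)"
    by (rule BL_mono[OF BL_add[OF BL_mono[OF BL_const[of l w] order_refl N] \<beta>]]) (use w bw in auto)
  have B\<psi>: "BL l (2 * w / q) (N + q) \<psi>" unfolding \<psi>_def[abs_def]
    using BL_cmult[OF BL_mult[OF Ba BS(1)], of m] m by (simp add: m_def)
  note ds = pd_dif dif_intros difs difS pdb pdS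
  have p2: "pd j \<psi> = (\<lambda>x. m * (b2 x * S x))" unfolding \<psi>_def[abs_def] by (simp add: ds)
  have p22: "pd j (pd j \<psi>) = (\<lambda>x. m * (b22 x * S x))" unfolding p2 by (simp add: ds)
  have p12: "pd i (pd j \<psi>) = (\<lambda>x. m * (b12 x * S x + b2 x * (q * C x)))" unfolding p2 by (simp add: ds)
  have p11: "pd i (pd i \<psi>) = (\<lambda>x. m * (b11 x * S x + 2 * (b1 x * (q * C x)) + (w + \<beta> x) * (q * (- q * S x))))"
    unfolding \<psi>_def[abs_def] by (simp add: ds fun_eq_iff algebra_simps)
  have Nq: "N \<le> q / 8" "N + q \<le> 3 * q" "2 * N + q \<le> 3 * q" "2 * N + 2 * q \<le> 3 * q" "2 * N \<le> 3 * q" using q N by auto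
  have D22: "BL l (b * N * N / q) (3 * q) (pd j (pd j \<psi>))"
    unfolding p22 by (rule BL_mono[OF BL_cmult[OF BL_mult[OF B2(3) BS(1)]]]) (use Nq m in \<open>auto simp: m_def\<close>)
  have D12: "BL l (2 * b * N) (3 * q) (pd i (pd j \<psi>))"
  proof (rule BL_mono[of l "\<bar>m\<bar> * (b * N * 1) * (N + q)" "N + q"])
    show "BL l (\<bar>m\<bar> * (b * N * 1) * (N + q)) (N + q) (pd i (pd j \<psi>))"
      unfolding p2 by (intro BL_pd BL_cmult BL_mult B1 BS)
    have "m * (N + q) \<le> 2" using Nq q by (simp add: m_def divide_le_eq)
    then have "(b * N) * (m * (N + q)) \<le> (b * N) * 2" using b0 N by (intro mult_left_mono) auto
    then show "\<bar>m\<bar> * (b * N * 1) * (N + q) \<le> 2 * b * N" using m by (simp add: mult_ac)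
  qed (rule Nq)
  have D11: "BL l (3 * w * q) (3 * q) (pd i (pd i \<psi>))"
  proof (rule BL_mono[OF BL_pd[OF BL_pd[OF B\<psi>]]])
    have "(N + q) * (N + q) \<le> (9/8 * q) * (9/8 * q)" using Nq N q by (intro mult_mono) auto
    then have "(2 * w / q) * ((N + q) * (N + q)) \<le> (2 * w / q) * ((9/8 * q) * (9/8 * q))" using w q by (intro mult_left_mono) auto
    also have "\<dots> = (81/32) * (w * q)" using q by simp
    also have "\<dots> \<le> 3 * (w * q)" using w q by (intro mult_right_mono) auto
    finally show "2 * w / q * (N + q) * (N + q) \<le> 3 * w * q" by (simp add: mult.assoc)
  qed (rule Nq)
  define u11 where "u11 = pd i (pd i u)"
  define u12 where "u12 = pd i (pd j u)"
  define u22 where "u22 = pd j (pd j u)"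
  have U: "BL l L N u11" "BL l T N u12" "BL l H N u22" using uii uij ujj by (auto simp: u11_def u12_def u22_def)
  \<comment> \<open>Amplitudes of the four harmonics in \<open>step_identity\<close>. Their type is
    at most \<open>2 * N\<close>, far enough below the frequency of the phase for
    \<open>osc_inverse\<close>.\<close>
  define A1 where "A1 x = u22 x * (- q * (w + \<beta> x) + m * b11 x) + (m * (u11 x * b22 x) + (- 2 * m) * (u12 x * b12 x))" for x
  define A2 where "A2 x = 2 * (u22 x * b1 x + - 1 * (u12 x * b2 x))" for x
  define A3 where "A3 x = 1/2 * (w * b22 x) + (1/2 * (\<beta> x * b22 x + - 1 * (b2 x * b2 x)) + (- m\<^sup>2 / 2) * (b11 x * b22 x + - 1 * (b12 x * b12 x)))" for x
  define A4 where "A4 x = m * (b1 x * b22 x + - 1 * (b2 x * b12 x))" for x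
  \<comment> \<open>These constants are spelled as the rules for sums and products produce them;
    they are simplified only when \<open>CX\<close> is estimated.\<close>
  define C1 where "C1 = H * (\<bar>- q\<bar> * (2 * w) + \<bar>m\<bar> * (b * N * N)) + (\<bar>m\<bar> * (L * (b * N * N)) + \<bar>- 2 * m\<bar> * (T * (b * N * N)))"
  define C2 where "C2 = \<bar>2\<bar> * (H * (b * N) + \<bar>- 1\<bar> * (T * (b * N)))"
  define C3 where "C3 = \<bar>1/2\<bar> * (\<bar>w\<bar> * (b * N * N)) + (\<bar>1/2\<bar> * (b * (b * N * N) + \<bar>- 1\<bar> * (b * N * (b * N))) + \<bar>- m\<^sup>2 / 2\<bar> * ((b * N * N) * (b * N * N) + \<bar>- 1\<bar> * ((b * N * N) * (b * N * N))))"
  define C4 where "C4 = \<bar>m\<bar> * (b * N * (b * N * N) + \<bar>- 1\<bar> * (b * N * (b * N * N)))"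
  have BA1: "BL l C1 (N + N) A1" unfolding A1_def[abs_def] C1_def
    by (intro BL_add BL_mult BL_cmult U Ba B2)
  have BA2: "BL l C2 (N + N) A2" unfolding A2_def[abs_def] C2_def
    by (intro BL_add BL_mult BL_cmult U B1)
  have w22: "BL l (\<bar>w\<bar> * (b * N * N)) (N + N) (\<lambda>x. w * b22 x)"
    by (rule BL_mono[OF BL_cmult[OF B2(3)]]) (use N in auto)
  have BA3: "BL l C3 (N + N) A3" unfolding A3_def[abs_def] C3_def
    by (intro BL_add BL_cmult w22 BL_mult B1 B2 \<beta>)
  have BA4: "BL l C4 (N + N) A4" unfolding A4_def[abs_def] C4_def
    by (intro BL_add BL_mult BL_cmult B1 B2)
  have q4: "2 * (N + N) \<le> q" "2 * (N + N) \<le> 2 * q" "0 < 2 * q" using q N by auto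
  have per2: "2 * q * l = 2 * pi * of_int (2 * k)"
  proof -
    have "2 * q * l = 2 * (q * l)" by simp
    also have "\<dots> = 2 * pi * of_int (2 * k)" unfolding per by simp
    finally show ?thesis .
  qed
  obtain X1 where X1: "BL l (4 * C1 / q\<^sup>2) (N + N + q) X1" "pd i (pd i X1) = (\<lambda>x. A1 x * cos (q * x $ i + (- pi/2)))"
    using osc_inverse[OF BA1 q(1) q4(1) per] by blast
  obtain X2 where X2: "BL l (4 * C2 / q\<^sup>2) (N + N + q) X2" "pd i (pd i X2) = (\<lambda>x. A2 x * cos (q * x $ i + 0))"
    using osc_inverse[OF BA2 q(1) q4(1) per] by blast
  obtain X3 where X3: "BL l (4 * C3 / (2 * q)\<^sup>2) (N + N + 2 * q) X3" "pd i (pd i X3) = (\<lambda>x. A3 x * cos (2 * q * x $ i + 0))"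
    using osc_inverse[OF BA3 q4(3) q4(2) per2] by blast
  obtain X4 where X4: "BL l (4 * C4 / (2 * q)\<^sup>2) (N + N + 2 * q) X4" "pd i (pd i X4) = (\<lambda>x. A4 x * cos (2 * q * x $ i + (- pi/2)))"
    using osc_inverse[OF BA4 q4(3) q4(2) per2] by blast
  \<comment> \<open>The Hessian determinant of \<open>\<beta>\<close> is the mixed derivative of
    \<open>b1 * b2\<close> minus half of the second derivatives of \<open>b2 * b2\<close> along
    \<open>i\<close> and of \<open>b1 * b1\<close> along \<open>j\<close>. The latter two already
    have the right form; the first is the only mixed derivative of the step and is split into
    \<open>XR\<close> and \<open>YR\<close>.\<close>
  define G where "G x = b1 x * b2 x" for x
  have BG: "BL l (b * N * (b * N)) (N + N) G" unfolding G_def[abs_def] by (intro BL_mult B1)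
  define s where "s = b * N * (b * N)"
  have s0: "0 \<le> s" using b0 N by (simp add: s_def)
  have BG': "BL l (cP * s) (2 ^ J * (1 / (2 * l))) G"
    by (rule BL_mono[OF BG]) (use J cP_ge_1 s0 mult_right_mono[OF cP_ge_1 s0] in \<open>auto simp: s_def\<close>)
  obtain X0 Y0 where XY0: "BL l (\<kappa> * s) (2 ^ J * (1 / (2 * l))) X0" "BL l (\<kappa> * s) (2 ^ J * (1 / (2 * l))) Y0"
      "\<And>x. pd 1 (pd 2 G) x = pd 1 (pd 1 X0) x + pd 2 (pd 2 Y0) x"
    using mixed_decomposition[OF l _ BG'] BL_bound[OF BG] unfolding s_def[symmetric] \<kappa>_def by blast
  obtain XR YR where XR: "BL l (\<kappa> * s) (3 * q) XR" and YR: "BL l (\<kappa> * s) (3 * q) YR"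
    and XYR: "\<And>x. pd i (pd j G) x = pd i (pd i XR) x + pd j (pd j YR) x"
  \<comment> \<open>\<open>mixed_decomposition\<close> fixes the order of the directions; for
    \<open>i = 2\<close> its two outputs exchange their roles.\<close>
  proof (cases "i = 1")
    case True
    then have "j = 2" using ij exhaust_2[of j] by auto
    then show ?thesis using that[of X0 Y0] XY0 True BL_mono[OF _ order_refl J(2)] by blast
  next
    case False
    then have "i = 2" "j = 1" using ij exhaust_2[of i] exhaust_2[of j] by auto
    moreover have "pd 2 (pd 1 G) = pd 1 (pd 2 G)" by (rule BL_pd_commute[OF BG])
    ultimately show ?thesis using that[of Y0 X0] XY0 BL_mono[OF _ order_refl J(2)] by (metis add.commute)
  qed
  define X where "X x = ((X1 x + X2 x) + (X3 x + X4 x)) + ((- m\<^sup>2 / 4) * (b2 x * b2 x) + m\<^sup>2 / 2 * XR x)" for x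
  define Y where "Y x = (- 1/4) * (\<beta> x * \<beta> x) + ((- m\<^sup>2 / 4) * (b1 x * b1 x) + m\<^sup>2 / 2 * YR x)" for x
  have up: "BL l K (3 * q) h" if "BL l K M h" "M \<le> 3 * q" for K M h by (rule BL_mono[OF that(1) order_refl that(2)])
  have up': "N + N + q \<le> 3 * q" "N + N + 2 * q \<le> 3 * q" "N + N \<le> 3 * q" using Nq by auto
  define CX where "CX = ((4 * C1 / q\<^sup>2 + 4 * C2 / q\<^sup>2) + (4 * C3 / (2 * q)\<^sup>2 + 4 * C4 / (2 * q)\<^sup>2)) + (\<bar>- m\<^sup>2 / 4\<bar> * s + \<bar>m\<^sup>2 / 2\<bar> * (\<kappa> * s))"
  have BX: "BL l CX (3 * q) X" unfolding X_def[abs_def] CX_def s_def[symmetric]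
    by (intro BL_add BL_cmult XR up[OF X1(1) up'(1)] up[OF X2(1) up'(1)] up[OF X3(1) up'(2)] up[OF X4(1) up'(2)]
        up[OF BL_mult[OF B1(2) B1(2)] up'(3), folded s_def])
  define CY where "CY = \<bar>- 1/4\<bar> * (b * b) + (\<bar>- m\<^sup>2 / 4\<bar> * s + \<bar>m\<^sup>2 / 2\<bar> * (\<kappa> * s))"
  have BY: "BL l CY (3 * q) Y" unfolding Y_def[abs_def] CY_def
    by (intro BL_add BL_cmult YR up[OF BL_mult[OF \<beta> \<beta>] up'(3)] up[OF BL_mult[OF B1(1) B1(1)] up'(3), folded s_def])
  have dX: "dif X1" "dif X2" "dif X3" "dif X4" "dif XR" "dif YR" "dif (pd i X1)" "dif (pd i X2)" "dif (pd i X3)" "dif (pd i X4)" "dif (pd i XR)" "dif (pd j YR)"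
    using BL_dif[OF X1(1)] BL_dif[OF X2(1)] BL_dif[OF X3(1)] BL_dif[OF X4(1)] BL_dif[OF XR] BL_dif[OF YR]
      BL_dif[OF BL_pd[OF X1(1)]] BL_dif[OF BL_pd[OF X2(1)]] BL_dif[OF BL_pd[OF X3(1)]] BL_dif[OF BL_pd[OF X4(1)]]
      BL_dif[OF BL_pd[OF XR]] BL_dif[OF BL_pd[OF YR]] by blast+
  have Xii: "pd i (pd i X) x = (A1 x * S x + A2 x * C x + A3 x * (1 - 2 * (S x * S x)) + A4 x * (2 * (S x * C x)))
     + (- m\<^sup>2 / 4) * (2 * (b12 x * b12 x + b2 x * pd i b12 x)) + m\<^sup>2 / 2 * pd i (pd i XR) x" for x
  proof -
    have c: "cos (2 * q * x $ i + 0) = 1 - 2 * (S x * S x)" "cos (2 * q * x $ i + (- pi/2)) = 2 * (S x * C x)"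
      using cos_double_sin[of "q * x $ i"] sin_double[of "q * x $ i"]
      by (simp_all add: Se C_def power2_eq_square cos_diff mult.assoc)
    have "pd i (pd i X) x = ((pd i (pd i X1) x + pd i (pd i X2) x) + (pd i (pd i X3) x + pd i (pd i X4) x))
       + ((- m\<^sup>2 / 4) * (2 * (b12 x * b12 x + b2 x * pd i b12 x)) + m\<^sup>2 / 2 * pd i (pd i XR) x)"
      unfolding X_def[abs_def] by (simp only: ds dX pd_const mult_zero_left mult_zero_right add_0_left add_0_right) (simp add: algebra_simps)
    then show ?thesis unfolding X1(2) X2(2) X3(2) X4(2) c S_def[symmetric] C_def[symmetric] by simp
  qed
  have Yjj: "pd j (pd j Y) x = (- 1/4) * (2 * (b2 x * b2 x + \<beta> x * b22 x)) + (- m\<^sup>2 / 4) * (2 * (b12 x * b12 x + b1 x * pd i b22 x))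
      + m\<^sup>2 / 2 * pd j (pd j YR) x" for x
    unfolding Y_def[abs_def] by (simp only: ds dX pd_const mult_zero_left mult_zero_right add_0_left add_0_right) (simp add: algebra_simps)
  have Gij: "pd i (pd j G) x = b2 x * pd i b12 x + b12 x * b12 x + b11 x * b22 x + b1 x * pd i b22 x" for x
    unfolding G_def[abs_def] by (simp add: ds algebra_simps)
  have g22: "w * b22 x = - 2 * pd j (pd j g) x" for x
  proof -
    have "b22 = pd j (pd j \<beta>)" by (simp add: b22_def b2_def)
    also have "\<dots> = (\<lambda>x. (- 2 / w) * pd j (pd j g) x)"
      unfolding \<beta>_def[abs_def] by (simp only: ds pd_const mult_zero_left add_0_left)
    finally show ?thesis using w by simp
  qed
  have du: "dif u" "dif \<psi>" "dif (pd i u)" "dif (pd j u)" "dif (pd i \<psi>)" "dif (pd j \<psi>)"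
    using BL_dif[OF u] BL_dif[OF B\<psi>] BL_dif[OF BL_pd[OF u]] BL_dif[OF BL_pd[OF B\<psi>]] by blast+
  have main: "pd i (pd i (\<lambda>x. u x + \<psi> x)) x * pd j (pd j (\<lambda>x. u x + \<psi> x)) x - (pd i (pd j (\<lambda>x. u x + \<psi> x)) x)\<^sup>2
        = pd i (pd i u) x * pd j (pd j u) x - (pd i (pd j u) x)\<^sup>2 + pd j (pd j g) x + pd i (pd i X) x + pd j (pd j Y) x" for x
  proof -
    have e: "pd i (pd i (\<lambda>x. u x + \<psi> x)) x = u11 x + pd i (pd i \<psi>) x" "pd j (pd j (\<lambda>x. u x + \<psi> x)) x = u22 x + pd j (pd j \<psi>) x"
      "pd i (pd j (\<lambda>x. u x + \<psi> x)) x = u12 x + pd i (pd j \<psi>) x"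
      by (simp_all add: pd_dif du u11_def u12_def u22_def)
    have XYe: "m\<^sup>2 / 2 * pd i (pd i XR) x + m\<^sup>2 / 2 * pd j (pd j YR) x = m\<^sup>2 / 2 * (b2 x * pd i b12 x + b12 x * b12 x + b11 x * b22 x + b1 x * pd i b22 x)"
      using XYR[of x] Gij[of x] by (simp add: distrib_left[symmetric])
    show ?thesis
      unfolding e p11 p12 p22 u11_def[symmetric] u12_def[symmetric] u22_def[symmetric]
        step_identity[OF SC m(2) g22] Xii Yjj A1_def A2_def A3_def A4_def
      using XYe by (simp add: algebra_simps)
  qed
  \<comment> \<open>Terms of lower order are absorbed through \<open>N / q \<le> 1/8\<close>. What
    is left are 12 + 1 parts of \<open>H * w / q\<close> and 1 + 8 parts of
    \<open>T * b * N / q\<^sup>2\<close>, whence the 13 and the 9 in the bound for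
    \<open>X\<close>.\<close>
  have mN: "m * N \<le> 1/8" "0 \<le> m * N" using Nq q N by (auto simp: m_def divide_le_eq)
  have q2: "4 * a / q\<^sup>2 = 4 * a * m\<^sup>2" "4 * a / (2 * q)\<^sup>2 = a * m\<^sup>2" for a
    by (simp_all add: m_def power_divide power2_eq_square)
  have \<kappa>0: "0 \<le> \<kappa>" using mom2(1) cP_ge_1 by (simp add: \<kappa>_def)
  have ms: "0 \<le> m\<^sup>2 * s" using s0 by simp
  have CX': "CX \<le> 13 * H * w / q + 4 * L * b * N\<^sup>2 / q^3 + 9 * T * b * N / q\<^sup>2 + 3 * w * b * N\<^sup>2 / q\<^sup>2 + (1 + \<kappa>) * b\<^sup>2 * N\<^sup>2 / q\<^sup>2"
  proof -
    have qm: "1 / q = m" "x / q = x * m" "x / q\<^sup>2 = x * m\<^sup>2" "x / q ^ 3 = x * (m * m\<^sup>2)" for x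
      by (simp_all add: m_def power_divide power2_eq_square power3_eq_cube)
    have mN2: "m * m * (N * N) \<le> 1/64" using mult_mono[OF mN(1) mN(1)] mN(2) by (simp add: mult_ac)
    have Hw: "0 \<le> H * w * m" using HTL w m by simp
    have t1: "4 * (H * (q * (2 * w) + m * (b * N * N))) * m\<^sup>2 \<le> 12 * (H * w * m)"
    proof -
      have "0 \<le> m * m * (N * N)" using m N by simp
      then have "b * (m * m * (N * N)) \<le> w * 1" using bw mN2 w b0 by (intro mult_mono) auto
      moreover have "m * m * (b * N * N) = b * (m * m * (N * N))" by (simp only: mult_ac)
      ultimately have "m * m * (b * N * N) \<le> w" by (simp only: mult_1_right)
      then have h1: "H * m * (m * m * (b * N * N)) \<le> H * m * w" using HTL m by (intro mult_left_mono) auto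
      have "H * (q * (2 * w)) * m\<^sup>2 = 2 * (H * w * m) * (m * q)" by (simp add: power2_eq_square)
      then have h2: "H * (q * (2 * w)) * m\<^sup>2 = 2 * (H * w * m)" unfolding m(2) by simp
      have h3: "4 * (H * (q * (2 * w) + m * (b * N * N))) * m\<^sup>2 = 4 * (H * (q * (2 * w)) * m\<^sup>2) + 4 * (H * m * (m * m * (b * N * N)))"
        by (simp add: power2_eq_square algebra_simps)
      have "H * m * w = H * w * m" by simp
      then show ?thesis unfolding h3 h2 using h1 Hw by linarith
    qed
    have t2: "4 * (m * (L * (b * N * N))) * m\<^sup>2 = 4 * L * b * N\<^sup>2 * (m * m\<^sup>2)" by (simp add: power2_eq_square)
    have TbN: "0 \<le> T * b * N" using HTL b0 N by simp
    have t3: "4 * (2 * m * (T * (b * N * N))) * m\<^sup>2 \<le> T * b * N * m\<^sup>2"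
    proof -
      have "(T * b * N * m\<^sup>2) * (8 * (m * N)) \<le> (T * b * N * m\<^sup>2) * 1"
        using mN TbN by (intro mult_left_mono) auto
      then show ?thesis by (simp add: mult_ac)
    qed
    have t4: "4 * (2 * (H * (b * N))) * m\<^sup>2 \<le> H * w * m"
    proof -
      have "b * (8 * (m * N)) \<le> w * 1" using bw mN b0 w by (intro mult_mono) auto
      then have "(H * m) * (b * (8 * (m * N))) \<le> (H * m) * (w * 1)" using HTL m by (intro mult_left_mono) auto
      then show ?thesis by (simp add: power2_eq_square mult_ac)
    qed
    have t5: "4 * (2 * (T * (b * N))) * m\<^sup>2 = 8 * T * b * N * m\<^sup>2" by simp
    have wbN: "0 \<le> w * b * N\<^sup>2 * m\<^sup>2" using w b0 by simp
    have t6: "C3 * m\<^sup>2 \<le> 2 * (w * b * N\<^sup>2 * m\<^sup>2)"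
    proof -
      have "b * b * N\<^sup>2 * m\<^sup>2 \<le> w * b * N\<^sup>2 * m\<^sup>2" using bw b0 by (intro mult_right_mono) auto
      moreover have "m\<^sup>2 * (b * N * N * (b * N * N)) * m\<^sup>2 \<le> (w * b * N\<^sup>2 * m\<^sup>2) * (1/64)"
      proof -
        have "(b * b * N\<^sup>2 * m\<^sup>2) * (m * m * (N * N)) \<le> (w * b * N\<^sup>2 * m\<^sup>2) * (1/64)"
          using bw b0 mN2 w by (intro mult_mono mult_right_mono) auto
        then show ?thesis by (simp add: power2_eq_square mult_ac)
      qed
      ultimately show ?thesis using w wbN
        by (simp add: C3_def power2_eq_square algebra_simps)
    qed
    have t7: "C4 * m\<^sup>2 \<le> w * b * N\<^sup>2 * m\<^sup>2"
    proof -
      have "(b * b * N\<^sup>2 * m\<^sup>2) * (2 * (m * N)) \<le> (w * b * N\<^sup>2 * m\<^sup>2) * 1"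
        using bw b0 mN w by (intro mult_mono mult_right_mono) auto
      then show ?thesis using m by (simp add: C4_def power2_eq_square mult_ac)
    qed
    have t8: "m\<^sup>2 / 4 * s + m\<^sup>2 / 2 * (\<kappa> * s) \<le> (1 + \<kappa>) * b\<^sup>2 * N\<^sup>2 * m\<^sup>2"
    proof -
      have "m\<^sup>2 / 4 * s \<le> m\<^sup>2 * s" "m\<^sup>2 / 2 * (\<kappa> * s) \<le> \<kappa> * (m\<^sup>2 * s)" using s0 \<kappa>0 by (auto intro!: mult_nonneg_nonneg)
      then show ?thesis by (simp add: s_def power2_eq_square algebra_simps)
    qed
    have C1e: "C1 = H * (q * (2 * w) + m * (b * N * N)) + (m * (L * (b * N * N)) + 2 * m * (T * (b * N * N)))"
      using q m by (simp add: C1_def abs_mult)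
    have C2e: "C2 = 2 * (H * (b * N)) + 2 * (T * (b * N))" by (simp add: C2_def)
    have s1: "4 * C1 * m\<^sup>2 \<le> 12 * (H * w * m) + 4 * L * b * N\<^sup>2 * (m * m\<^sup>2) + T * b * N * m\<^sup>2"
    proof -
      have "4 * C1 * m\<^sup>2 = 4 * (H * (q * (2 * w) + m * (b * N * N))) * m\<^sup>2 + 4 * (m * (L * (b * N * N))) * m\<^sup>2 + 4 * (2 * m * (T * (b * N * N))) * m\<^sup>2"
        unfolding C1e by (simp only: distrib_left distrib_right)
      then show ?thesis using t1 t2 t3 by linarith
    qed
    have s2: "4 * C2 * m\<^sup>2 \<le> H * w * m + 8 * T * b * N * m\<^sup>2"
    proof -
      have "4 * C2 * m\<^sup>2 = 4 * (2 * (H * (b * N))) * m\<^sup>2 + 4 * (2 * (T * (b * N))) * m\<^sup>2"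
        unfolding C2e by (simp only: distrib_left distrib_right)
      then show ?thesis using t4 t5 by linarith
    qed
    have am: "\<bar>- m\<^sup>2 / 4\<bar> = m\<^sup>2 / 4" "\<bar>m\<^sup>2 / 2\<bar> = m\<^sup>2 / 2" by auto
    have fin: "13 * H * w * m = 12 * (H * w * m) + H * w * m" "9 * T * b * N * m\<^sup>2 = T * b * N * m\<^sup>2 + 8 * T * b * N * m\<^sup>2"
      "3 * w * b * N\<^sup>2 * m\<^sup>2 = 2 * (w * b * N\<^sup>2 * m\<^sup>2) + w * b * N\<^sup>2 * m\<^sup>2" by simp_all
    show ?thesis unfolding CX_def q2 qm am fin using s1 s2 t6 t7 t8 by linarith
  qed
  have CY': "CY \<le> b\<^sup>2 + (1 + \<kappa>) * b\<^sup>2 * N\<^sup>2 / q\<^sup>2"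
  proof -
    have am: "\<bar>- m\<^sup>2 / 4\<bar> = m\<^sup>2 / 4" "\<bar>m\<^sup>2 / 2\<bar> = m\<^sup>2 / 2" "x / q\<^sup>2 = x * m\<^sup>2" for x by (auto simp: m_def power_divide)
    have "m\<^sup>2 / 4 * s \<le> m\<^sup>2 * s" "m\<^sup>2 / 2 * (\<kappa> * s) \<le> \<kappa> * (m\<^sup>2 * s)" using s0 \<kappa>0 by (auto intro!: mult_nonneg_nonneg)
    moreover have "(1 + \<kappa>) * b\<^sup>2 * N\<^sup>2 * m\<^sup>2 = m\<^sup>2 * s + \<kappa> * (m\<^sup>2 * s)" by (simp add: s_def power2_eq_square algebra_simps)
    moreover have "\<bar>- 1/4\<bar> * (b * b) \<le> b\<^sup>2" by (simp add: power2_eq_square)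
    ultimately show ?thesis unfolding CY_def am by linarith
  qed
  show ?thesis
    using BL_mono[OF B\<psi> order_refl Nq(2)] D22 D12 D11 BL_mono[OF BX CX' order_refl] BL_mono[OF BY CY' order_refl] main
    by blast
qed

lemma step_bounds:
  fixes Q \<sigma> \<gamma> w q H T \<kappa> :: real
  assumes Q: "Q = 2400" "Q \<le> \<sigma>" and pos: "0 \<le> \<gamma>" "0 < w" "0 < q" "0 \<le> H" "0 \<le> T" "0 \<le> \<kappa>"
    and r3: "\<gamma> * Q * q = 130 * H * w * \<sigma>\<^sup>2" and r5: "540 * T * \<sigma> \<le> Q * (w * q)" and r6: "1560 * H * \<sigma> \<le> T * Q"
    and E: "4 * (\<gamma> / w\<^sup>2) * (2 + \<kappa>) \<le> Q\<^sup>2 / \<sigma>^4"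
  defines "b \<equiv> 2 * \<gamma> / w" and "N \<equiv> 3 * q / \<sigma>"
  shows "13 * H * w / q + 4 * (2 * w * q) * b * N\<^sup>2 / q^3 + 9 * T * b * N / q\<^sup>2 + 3 * w * b * N\<^sup>2 / q\<^sup>2 + (1 + \<kappa>) * b\<^sup>2 * N\<^sup>2 / q\<^sup>2
     \<le> \<gamma> * (2 * Q / \<sigma>\<^sup>2) / 4"
    "b\<^sup>2 + (1 + \<kappa>) * b\<^sup>2 * N\<^sup>2 / q\<^sup>2 \<le> \<gamma> * (2 * Q / \<sigma>\<^sup>2)\<^sup>2 / 4"
    "b * N * N / q \<le> H" "2 * b * N \<le> T" "2 * \<gamma> \<le> w * w"
proof -
  have s: "0 < \<sigma>" using Q by simp
  \<comment> \<open>One fifth of \<open>\<gamma> * (2 * Q / \<sigma>\<^sup>2) / 4\<close>.\<close>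
  define e where "e = \<gamma> * Q / (10 * \<sigma>\<^sup>2)"
  define r where "r = \<gamma> / w\<^sup>2"
  have r: "0 \<le> r" "\<gamma> = r * w\<^sup>2" using pos by (auto simp: r_def)
  have E': "4 * (2 + \<kappa>) * r \<le> Q\<^sup>2 / \<sigma>^4" using E by (simp add: r_def mult_ac)
  have "Q * Q \<le> \<sigma> * \<sigma>" using Q by (intro mult_mono) auto
  then have "Q\<^sup>2 * \<sigma>\<^sup>2 \<le> \<sigma>\<^sup>2 * \<sigma>\<^sup>2" by (intro mult_right_mono) (auto simp: power2_eq_square)
  then have "Q\<^sup>2 / \<sigma>^4 \<le> 1 / \<sigma>\<^sup>2" using s by (simp add: field_simps)
  moreover have "1 / \<sigma>\<^sup>2 \<le> 1 / Q\<^sup>2" using Q by (intro divide_left_mono power_mono mult_pos_pos) auto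
  ultimately have E1: "4 * (2 + \<kappa>) * r \<le> 1 / Q\<^sup>2" using E' by linarith
  have kr: "0 \<le> \<kappa> * r" using pos r by simp
  have a: "13 * H * w / q = e"
  proof -
    have "H * w = \<gamma> * Q * q / (130 * \<sigma>\<^sup>2)" using r3 s by (simp add: field_simps)
    then have "13 * H * w / q = 13 * (\<gamma> * Q * q / (130 * \<sigma>\<^sup>2)) / q" by (simp add: mult.assoc)
    also have "\<dots> = e" using pos by (simp add: e_def)
    finally show ?thesis .
  qed
  have b: "4 * (2 * w * q) * b * N\<^sup>2 / q^3 \<le> e"
  proof -
    have "4 * (2 * w * q) * b * N\<^sup>2 / q^3 = 144 * (\<gamma> / \<sigma>\<^sup>2)"
      using pos s by (simp add: b_def N_def field_simps power2_eq_square power3_eq_cube)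
    also have "\<dots> \<le> (Q / 10) * (\<gamma> / \<sigma>\<^sup>2)" using Q pos by (intro mult_right_mono) auto
    finally show ?thesis by (simp add: e_def mult.commute)
  qed
  have c: "9 * T * b * N / q\<^sup>2 \<le> e"
  proof -
    have "9 * T * b * N / q\<^sup>2 = (540 * T * \<sigma>) * (\<gamma> / (10 * w * q * \<sigma>\<^sup>2))"
      using pos s by (simp add: b_def N_def field_simps power2_eq_square)
    also have "\<dots> \<le> (Q * (w * q)) * (\<gamma> / (10 * w * q * \<sigma>\<^sup>2))" using r5 pos by (intro mult_right_mono) auto
    also have "\<dots> = e" using pos by (simp add: e_def)
    finally show ?thesis .
  qed
  have d: "3 * w * b * N\<^sup>2 / q\<^sup>2 \<le> e"
  proof -
    have "3 * w * b * N\<^sup>2 / q\<^sup>2 = 54 * (\<gamma> / \<sigma>\<^sup>2)"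
      using pos s by (simp add: b_def N_def field_simps power2_eq_square)
    also have "\<dots> \<le> (Q / 10) * (\<gamma> / \<sigma>\<^sup>2)" using Q pos by (intro mult_right_mono) auto
    finally show ?thesis by (simp add: e_def mult.commute)
  qed
  have bN: "b\<^sup>2 * N\<^sup>2 / q\<^sup>2 = 36 * r * (\<gamma> / \<sigma>\<^sup>2)"
    using pos s by (simp add: b_def N_def r_def field_simps power2_eq_square)
  have f: "(1 + \<kappa>) * b\<^sup>2 * N\<^sup>2 / q\<^sup>2 \<le> e"
  proof -
    have "(1 + \<kappa>) * b\<^sup>2 * N\<^sup>2 / q\<^sup>2 = (36 * ((1 + \<kappa>) * r)) * (\<gamma> / \<sigma>\<^sup>2)"
    proof -
      have "(1 + \<kappa>) * b\<^sup>2 * N\<^sup>2 / q\<^sup>2 = (1 + \<kappa>) * (b\<^sup>2 * N\<^sup>2 / q\<^sup>2)" by simp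
      then show ?thesis unfolding bN by simp
    qed
    also have "\<dots> \<le> (Q / 10) * (\<gamma> / \<sigma>\<^sup>2)"
    proof (rule mult_right_mono)
      have "36 * ((1 + \<kappa>) * r) \<le> 9 * (4 * (2 + \<kappa>) * r)" using r kr by (simp add: algebra_simps)
      also have "\<dots> \<le> 9 * (1 / Q\<^sup>2)" using E1 by simp
      also have "\<dots> \<le> Q / 10" using Q by simp
      finally show "36 * ((1 + \<kappa>) * r) \<le> Q / 10" .
    qed (use pos in auto)
    finally show ?thesis by (simp add: e_def mult.commute)
  qed
  have "\<gamma> * (2 * Q / \<sigma>\<^sup>2) / 4 = 5 * e" by (simp add: e_def)
  then show "13 * H * w / q + 4 * (2 * w * q) * b * N\<^sup>2 / q^3 + 9 * T * b * N / q\<^sup>2 + 3 * w * b * N\<^sup>2 / q\<^sup>2 + (1 + \<kappa>) * b\<^sup>2 * N\<^sup>2 / q\<^sup>2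
     \<le> \<gamma> * (2 * Q / \<sigma>\<^sup>2) / 4"
    using a b c d f by linarith
  show "b\<^sup>2 + (1 + \<kappa>) * b\<^sup>2 * N\<^sup>2 / q\<^sup>2 \<le> \<gamma> * (2 * Q / \<sigma>\<^sup>2)\<^sup>2 / 4"
  proof -
    have "36 / \<sigma>\<^sup>2 \<le> 36 / Q\<^sup>2" using Q by (intro divide_left_mono power_mono mult_pos_pos) auto
    also have "36 / Q\<^sup>2 \<le> 4" using Q(1) by simp
    finally have s36: "36 / \<sigma>\<^sup>2 \<le> 4" .
    have k1: "0 \<le> (1 + \<kappa>) * r * \<gamma>" using pos r by simp
    have "b\<^sup>2 + (1 + \<kappa>) * b\<^sup>2 * N\<^sup>2 / q\<^sup>2 = 4 * r * \<gamma> + ((1 + \<kappa>) * r * \<gamma>) * (36 / \<sigma>\<^sup>2)"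
    proof -
      have "(1 + \<kappa>) * b\<^sup>2 * N\<^sup>2 / q\<^sup>2 = (1 + \<kappa>) * (b\<^sup>2 * N\<^sup>2 / q\<^sup>2)" by simp
      moreover have "b\<^sup>2 = 4 * r * \<gamma>" by (simp add: b_def r_def power2_eq_square)
      ultimately show ?thesis unfolding bN by simp
    qed
    also have "\<dots> \<le> 4 * r * \<gamma> + ((1 + \<kappa>) * r * \<gamma>) * 4" using s36 k1 by (intro add_left_mono mult_left_mono) auto
    also have "\<dots> = \<gamma> * (4 * (2 + \<kappa>) * r)" by (simp add: algebra_simps)
    also have "\<dots> \<le> \<gamma> * (Q\<^sup>2 / \<sigma>^4)" using E' pos by (intro mult_left_mono) auto
    also have "\<dots> = \<gamma> * (2 * Q / \<sigma>\<^sup>2)\<^sup>2 / 4" by (simp add: power_divide power_mult_distrib)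
    finally show ?thesis .
  qed
  have bNe: "b * N = 6 * \<gamma> * q / (w * \<sigma>)" by (simp add: b_def N_def)
  have g: "\<gamma> * q = 130 * H * w * \<sigma>\<^sup>2 / Q" using r3 Q by (simp add: field_simps)
  have "b * N * N / q = 18 * (\<gamma> * q) / (w * \<sigma>\<^sup>2)"
    unfolding bNe using pos s by (simp add: N_def power2_eq_square)
  \<comment> \<open>2340 = 18 * 130; this is the tightest demand on \<open>Q\<close> in the lemma.
    In the same way 1560 = 12 * 130 arises below for the mixed derivative.\<close>
  also have "\<dots> = (2340 / Q) * H" unfolding g using pos s by (simp add: field_simps)
  also have "\<dots> \<le> 1 * H" using Q pos by (intro mult_right_mono) auto
  finally show "b * N * N / q \<le> H" by simp
  have "2 * b * N = 12 * (\<gamma> * q) / (w * \<sigma>)" using bNe by simp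
  also have "\<dots> = 1560 * H * \<sigma> / Q" unfolding g using pos s by (simp add: field_simps power2_eq_square)
  also have "\<dots> \<le> T" using r6 Q by (simp add: divide_le_eq)
  finally show "2 * b * N \<le> T" .
  have "4 * r \<le> 4 * (2 + \<kappa>) * r" using r kr by (simp add: algebra_simps)
  also have "\<dots> \<le> 1 / Q\<^sup>2" by (rule E1)
  also have "\<dots> \<le> 1" using Q by simp
  finally have "2 * r \<le> 1" by simp
  then have "2 * r * w\<^sup>2 \<le> 1 * w\<^sup>2" by (intro mult_right_mono) auto
  then show "2 * \<gamma> \<le> w * w" using r by (simp add: power2_eq_square)
qed

section \<open>The induction over the stages\<close>

definition hdet :: "(real^2 \<Rightarrow> real) \<Rightarrow> real^2 \<Rightarrow> real" where
  "hdet u x = pd 1 (pd 1 u) x * pd 2 (pd 2 u) x - (pd 1 (pd 2 u) x)\<^sup>2"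

lemma hdet_eq:
  assumes "BL l C N u" "i \<noteq> j"
  shows "pd i (pd i u) x * pd j (pd j u) x - (pd i (pd j u) x)\<^sup>2 = hdet u x"
proof -
  have "(i = 1 \<and> j = 2) \<or> (i = 2 \<and> j = 1)" using assms(2) exhaust_2[of i] exhaust_2[of j] by auto
  then show ?thesis using BL_pd_commute[OF assms(1), of 1 2] by (auto simp: hdet_def)
qed

text \<open>At stage \<open>k\<close>: frequency \<open>lam\<close>, amplitude of the gradient \<open>wt\<close>, size of the defects \<open>gam\<close>, bound \<open>Hk\<close> for the second
  derivatives across the corrugations, bound \<open>Tk\<close> for the mixed ones, and type \<open>NN\<close> of everything constructed so
  far. The next corrugation of \<open>U (dir k)\<close> runs in direction \<open>dir k\<close> and cancels \<open>G (oth k)\<close>.\<close>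

locale scheme =
  fixes l \<sigma> lam0 w0 H0 T0 gam0 Q :: real and f :: "nat \<Rightarrow> real^2 \<Rightarrow> real"
  assumes l: "0 < l" and Q: "Q = 2400" "Q \<le> \<sigma>" and Q_less: "Q < \<sigma>"
    and pos: "0 < lam0" "0 < w0" "0 < H0" "0 < T0" "0 < gam0"
    and gam_eq: "gam0 * Q * lam0 = 130 * H0 * w0 * \<sigma>\<^sup>2"
    and T0: "1560 * H0 * \<sigma> \<le> T0 * Q" "540 * T0 * \<sigma> \<le> Q * (w0 * lam0)"
    and J: "\<And>k. \<exists>J. 2 * (3 * (lam0 * \<sigma>^k) / \<sigma>) \<le> 2 ^ J * (1 / (2 * l)) \<and> 2 ^ J * (1 / (2 * l)) \<le> 3 * (lam0 * \<sigma>^k)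
      \<and> 4 * (gam0 * (2 * Q / \<sigma>\<^sup>2)^k / (w0 * (Q / \<sigma>)^k)\<^sup>2) * (2 + 64 * mom2 * cP * real J) \<le> Q\<^sup>2 / \<sigma>^4"
    and per: "\<And>k. \<exists>z. lam0 * \<sigma>^k * l = 2 * pi * of_int z"
    and f: "\<And>k. \<exists>F :: 2 \<Rightarrow> real^2 \<Rightarrow> real. (\<forall>c. BL l (gam0 * (2 * Q / \<sigma>\<^sup>2)^(k+2) / 4) (3 * (lam0 * \<sigma>^k)) (F c)) \<and>
      (\<forall>x. f (Suc k) x = f k x + pd 1 (pd 1 (F 1)) x + pd 2 (pd 2 (F 2)) x)"
begin

definition lam where "lam k = lam0 * \<sigma>^k"
definition wt where "wt k = w0 * (Q / \<sigma>)^k"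
definition gam where "gam k = gam0 * (2 * Q / \<sigma>\<^sup>2)^k"
definition Hk where "Hk k = H0 * 2^k"
definition Tk where "Tk k = T0 * 2^k"
text \<open>Three times the preceding frequency. Stage 0 obeys the same formula with the fictitious
  predecessor \<open>lam0 / \<sigma>\<close>, which spares a case distinction.\<close>

definition NN where "NN k = 3 * lam k / \<sigma>"
definition dir :: "nat \<Rightarrow> 2" where "dir k = (if even k then 1 else 2)"
definition oth :: "nat \<Rightarrow> 2" where "oth k = (if even k then 2 else 1)"

lemma sigma_pos: "0 < \<sigma>" using Q by simp

lemma Q_ge: "0 < Q" "2400 \<le> Q" "Q \<le> \<sigma>" using Q by auto

lemma dir_oth: "dir k \<noteq> oth k" "dir (Suc k) = oth k" "oth (Suc k) = dir k" "c = dir k \<or> c = oth k"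
  using exhaust_2[of c] by (auto simp: dir_def oth_def)

lemma seq_pos: "0 < lam k" "0 < wt k" "0 < gam k" "0 < Hk k" "0 < Tk k"
  using pos sigma_pos Q_ge(1) by (auto simp: lam_def wt_def gam_def Hk_def Tk_def)

lemma seq_Suc: "lam (Suc k) = lam k * \<sigma>" "wt (Suc k) = wt k * (Q / \<sigma>)" "gam (Suc k) = gam k * (2 * Q / \<sigma>\<^sup>2)"
  "Hk (Suc k) = 2 * Hk k" "Tk (Suc k) = 2 * Tk k" "NN (Suc k) = 3 * lam k"
  using sigma_pos by (auto simp: lam_def wt_def gam_def Hk_def Tk_def NN_def)

text \<open>Both sides gain the factor \<open>2 * Q / \<sigma>\<close> per stage. The decay rates
  are matched so that the leading error \<open>Hk * wt / lam\<close> stays in a fixed proportion to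
  the next defect.\<close>

lemma gam_relation: "gam k * Q * lam k = 130 * Hk k * wt k * \<sigma>\<^sup>2"
proof (induction k)
  case 0
  then show ?case using gam_eq by (simp add: gam_def lam_def Hk_def wt_def)
next
  case (Suc k)
  have "gam (Suc k) * Q * lam (Suc k) = (gam k * Q * lam k) * (2 * Q / \<sigma>)"
    using sigma_pos by (simp add: seq_Suc power2_eq_square)
  also have "\<dots> = 130 * Hk (Suc k) * wt (Suc k) * \<sigma>\<^sup>2" unfolding Suc by (simp add: seq_Suc)
  finally show ?case .
qed

text \<open>In the first inequality the left side doubles per stage while
  \<open>wt k * lam k\<close> grows by the factor \<open>Q\<close>; in the second both sides
  double.\<close>

lemma T_relation: "540 * Tk k * \<sigma> \<le> Q * (wt k * lam k)" "1560 * Hk k * \<sigma> \<le> Tk k * Q"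
proof -
  have e: "wt k * lam k = w0 * lam0 * Q^k" using sigma_pos by (simp add: wt_def lam_def power_divide)
  have "(540 * T0 * \<sigma>) * 2^k \<le> (Q * (w0 * lam0)) * Q^k"
    by (rule mult_mono[OF T0(2)], rule power_mono) (use pos Q_ge in auto)
  then show "540 * Tk k * \<sigma> \<le> Q * (wt k * lam k)" unfolding e by (simp add: Tk_def mult_ac)
  show "1560 * Hk k * \<sigma> \<le> Tk k * Q" using mult_right_mono[OF T0(1), of "2^k"] by (simp add: Tk_def Hk_def mult_ac)
qed

text \<open>The two defects have different ages. The one in direction \<open>oth k\<close> is
  cancelled now and has size \<open>gam k\<close>. The other was renewed one stage earlier, is
  cancelled one stage later, and must therefore already fit into \<open>gam (Suc k)\<close>; the
  half leaves room for what the present stage adds to it.\<close>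

definition state :: "nat \<Rightarrow> (2 \<Rightarrow> real^2 \<Rightarrow> real) \<times> (2 \<Rightarrow> real^2 \<Rightarrow> real) \<Rightarrow> bool" where
  "state k S \<longleftrightarrow> (case S of (U, G) \<Rightarrow>
     (\<forall>c. \<exists>C. BL l C (NN k) (U c)) \<and>
     (\<forall>c d. c \<noteq> d \<longrightarrow> BL l (Hk k) (NN k) (pd d (pd d (U c))) \<and> BL l (Tk k) (NN k) (pd c (pd d (U c))) \<and>
        BL l (2 * wt k * lam k) (NN k) (pd c (pd c (U c)))) \<and>
     BL l (gam k) (NN k) (G (oth k)) \<and> BL l (gam (Suc k) / 2) (NN k) (G (dir k)) \<and>
     (\<forall>x. hdet (U 1) x + hdet (U 2) x = f k x - pd 1 (pd 1 (G 1)) x - pd 2 (pd 2 (G 2)) x))"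

lemma state_step:
  assumes "state k (U, G)"
  shows "\<exists>U' G'. state (Suc k) (U', G') \<and> (\<forall>c. \<exists>\<psi>. BL l (2 * wt k / lam k) (3 * lam k) \<psi> \<and> (\<forall>x. U' c x = U c x + \<psi> x))"
proof -
  let ?i = "dir k" and ?j = "oth k"
  have ij: "?i \<noteq> ?j" by (rule dir_oth)
  obtain C where U: "BL l C (NN k) (U ?i)" using assms unfolding state_def prod.case by blast
  have U2: "BL l (Hk k) (NN k) (pd d (pd d (U c)))" "BL l (Tk k) (NN k) (pd c (pd d (U c)))"
     "BL l (2 * wt k * lam k) (NN k) (pd c (pd c (U c)))" if "c \<noteq> d" for c d
    using assms that by (auto simp: state_def)
  have G: "BL l (gam k) (NN k) (G ?j)" "BL l (gam (Suc k) / 2) (NN k) (G ?i)" using assms by (auto simp: state_def)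
  have eq: "hdet (U 1) x + hdet (U 2) x = f k x - pd 1 (pd 1 (G 1)) x - pd 2 (pd 2 (G 2)) x" for x
    using assms by (auto simp: state_def)
  obtain J where J: "2 * NN k \<le> 2 ^ J * (1 / (2 * l))" "2 ^ J * (1 / (2 * l)) \<le> 3 * lam k"
     "4 * (gam k / (wt k)\<^sup>2) * (2 + 64 * mom2 * cP * real J) \<le> Q\<^sup>2 / \<sigma>^4"
    using J[of k] by (auto simp: NN_def lam_def wt_def gam_def)
  define \<kappa> where "\<kappa> = 64 * mom2 * cP * real J"
  have \<kappa>: "0 \<le> \<kappa>" using mom2(1) cP_ge_1 by (simp add: \<kappa>_def)
  note sb = step_bounds[OF Q _ seq_pos(2)[of k] seq_pos(1)[of k] _ _ \<kappa> gam_relation[of k] T_relation(1)[of k] T_relation(2)[of k]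
      J(3)[folded \<kappa>_def], folded NN_def, OF less_imp_le[OF seq_pos(3)] less_imp_le[OF seq_pos(4)] less_imp_le[OF seq_pos(5)]]
  obtain z where z: "lam k * l = 2 * pi * of_int z" using per[of k] by (auto simp: lam_def)
  have N8: "8 * NN k \<le> lam k"
  proof -
    have "24 * lam k \<le> \<sigma> * lam k" using Q_ge seq_pos(1)[of k] by (intro mult_right_mono) auto
    then show ?thesis using sigma_pos by (simp add: NN_def divide_le_eq mult.commute)
  qed
  define b where "b = 2 * gam k / wt k"
  obtain \<psi> X Y where psi: "BL l (2 * wt k / lam k) (3 * lam k) \<psi>"
     "BL l (b * NN k * NN k / lam k) (3 * lam k) (pd ?j (pd ?j \<psi>))" "BL l (2 * b * NN k) (3 * lam k) (pd ?i (pd ?j \<psi>))"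
     "BL l (3 * wt k * lam k) (3 * lam k) (pd ?i (pd ?i \<psi>))"
    and X: "BL l (13 * Hk k * wt k / lam k + 4 * (2 * wt k * lam k) * b * (NN k)\<^sup>2 / (lam k)^3 + 9 * Tk k * b * NN k / (lam k)\<^sup>2 + 3 * wt k * b * (NN k)\<^sup>2 / (lam k)\<^sup>2 + (1 + \<kappa>) * b\<^sup>2 * (NN k)\<^sup>2 / (lam k)\<^sup>2) (3 * lam k) X"
    and Y: "BL l (b\<^sup>2 + (1 + \<kappa>) * b\<^sup>2 * (NN k)\<^sup>2 / (lam k)\<^sup>2) (3 * lam k) Y"
    and det: "\<And>x. pd ?i (pd ?i (\<lambda>x. U ?i x + \<psi> x)) x * pd ?j (pd ?j (\<lambda>x. U ?i x + \<psi> x)) x - (pd ?i (pd ?j (\<lambda>x. U ?i x + \<psi> x)) x)\<^sup>2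
        = pd ?i (pd ?i (U ?i)) x * pd ?j (pd ?j (U ?i)) x - (pd ?i (pd ?j (U ?i)) x)\<^sup>2 + pd ?j (pd ?j (G ?j)) x + pd ?i (pd ?i X) x + pd ?j (pd ?j Y) x"
    using corrugation_step[OF ij l U U2(1)[OF ij] U2(2)[OF ij] U2(3)[OF ij] G(1) seq_pos(2) sb(5) seq_pos(1) N8 z J(1,2), folded b_def \<kappa>_def]
    by blast
  have X': "BL l (gam (Suc k) / 4) (3 * lam k) X"
    by (rule BL_mono[OF X]) (use sb(1) in \<open>simp_all add: seq_Suc b_def\<close>)
  have g2: "gam (Suc (Suc k)) = gam k * (2 * Q / \<sigma>\<^sup>2)\<^sup>2" by (simp add: seq_Suc power2_eq_square)
  have Y': "BL l (gam (Suc (Suc k)) / 4) (3 * lam k) Y"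
    by (rule BL_mono[OF Y]) (use sb(2) in \<open>simp_all add: g2 b_def\<close>)
  obtain F :: "2 \<Rightarrow> real^2 \<Rightarrow> real" where F: "\<And>c. BL l (gam (Suc (Suc k)) / 4) (3 * lam k) (F c)"
     "\<And>x. f (Suc k) x = f k x + pd 1 (pd 1 (F 1)) x + pd 2 (pd 2 (F 2)) x"
    using f[of k] unfolding gam_def lam_def add_2_eq_Suc' by blast
  have gle: "gam (Suc (Suc k)) \<le> gam (Suc k)"
  proof -
    have "2 * Q \<le> Q * Q" using Q_ge by (intro mult_right_mono) auto
    also have "\<dots> \<le> \<sigma>\<^sup>2" unfolding power2_eq_square using Q_ge by (intro mult_mono) auto
    finally have "2 * Q \<le> \<sigma>\<^sup>2" .
    then have "2 * Q / \<sigma>\<^sup>2 \<le> 1" using sigma_pos by (simp add: divide_le_eq)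
    then show ?thesis unfolding seq_Suc(3)[of "Suc k"] using seq_pos(3)[of "Suc k"] by (intro mult_left_le) auto
  qed
  have N3: "NN k \<le> 3 * lam k" using N8 seq_pos(1)[of k] by simp
  define U' where "U' c = (if c = ?i then (\<lambda>x. U ?i x + \<psi> x) else U c)" for c
  \<comment> \<open>The defect in direction \<open>?j\<close> is consumed and replaced by the fresh
    errors \<open>Y\<close> and \<open>F ?j\<close>; the one in direction \<open>?i\<close>
    accumulates \<open>X\<close> and \<open>F ?i\<close>.\<close>
  define G' where "G' c = (if c = ?i then (\<lambda>x. (G ?i x + - 1 * X x) + F ?i x) else (\<lambda>x. - 1 * Y x + F ?j x))" for c
  have N': "NN (Suc k) = 3 * lam k" by (rule seq_Suc)
  have up: "BL l K (3 * lam k) h" if "BL l K (NN k) h" for K h by (rule BL_mono[OF that order_refl N3])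
  have UB: "BL l (C + 2 * wt k / lam k) (3 * lam k) (\<lambda>x. U ?i x + \<psi> x)" by (rule BL_add[OF up[OF U] psi(1)])
  have Uup: "BL l K' (3 * lam k) h" if "BL l K (NN k) h" "K \<le> K'" for K K' h by (rule BL_mono[OF that N3])
  have H2: "Hk k \<le> Hk (Suc k)" "Tk k \<le> Tk (Suc k)" "2 * wt k * lam k \<le> 2 * wt (Suc k) * lam (Suc k)"
  proof -
    show "Hk k \<le> Hk (Suc k)" "Tk k \<le> Tk (Suc k)" using seq_pos[of k] by (auto simp: seq_Suc)
    have "2 * wt (Suc k) * lam (Suc k) = Q * (2 * wt k * lam k)" using sigma_pos by (simp add: seq_Suc)
    moreover have "1 * (2 * wt k * lam k) \<le> Q * (2 * wt k * lam k)" using Q_ge seq_pos[of k] by (intro mult_right_mono) auto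
    ultimately show "2 * wt k * lam k \<le> 2 * wt (Suc k) * lam (Suc k)" by simp
  qed
  have pds2: "pd a (pd c (\<lambda>x. U ?i x + \<psi> x)) = (\<lambda>x. pd a (pd c (U ?i)) x + pd a (pd c \<psi>) x)" for a c
    unfolding pd_add_BL[OF up[OF U] psi(1)] by (rule pd_add_BL[OF BL_pd[OF up[OF U]] BL_pd[OF psi(1)]])
  have A: "\<exists>C. BL l C (NN (Suc k)) (U' c)" for c
  proof (cases "c = ?i")
    case True then show ?thesis using UB by (auto simp: U'_def N')
  next
    case False
    obtain C' where "BL l C' (NN k) (U c)" using assms unfolding state_def prod.case by blast
    then show ?thesis using up False by (auto simp: U'_def N')
  qed
  have B: "BL l (Hk (Suc k)) (NN (Suc k)) (pd d (pd d (U' c))) \<and> BL l (Tk (Suc k)) (NN (Suc k)) (pd c (pd d (U' c))) \<and>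
        BL l (2 * wt (Suc k) * lam (Suc k)) (NN (Suc k)) (pd c (pd c (U' c)))" if cd: "c \<noteq> d" for c d
  proof (cases "c = ?i")
    case True
    then have d: "d = ?j" using dir_oth(4)[of d k] cd by auto
    have U'c: "U' c = (\<lambda>x. U ?i x + \<psi> x)" using True by (simp add: U'_def)
    have 1: "BL l (Hk (Suc k)) (3 * lam k) (pd ?j (pd ?j (\<lambda>x. U ?i x + \<psi> x)))"
      unfolding pds2 by (rule BL_mono[OF BL_add[OF up[OF U2(1)[OF ij]] psi(2)]]) (use sb(3) in \<open>simp_all add: seq_Suc b_def\<close>)
    have 2: "BL l (Tk (Suc k)) (3 * lam k) (pd ?i (pd ?j (\<lambda>x. U ?i x + \<psi> x)))"
      unfolding pds2 by (rule BL_mono[OF BL_add[OF up[OF U2(2)[OF ij]] psi(3)]]) (use sb(4) in \<open>simp_all add: seq_Suc b_def\<close>)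
    have 3: "BL l (2 * wt (Suc k) * lam (Suc k)) (3 * lam k) (pd ?i (pd ?i (\<lambda>x. U ?i x + \<psi> x)))"
      unfolding pds2
    proof (rule BL_mono[OF BL_add[OF up[OF U2(3)[OF ij]] psi(4)]])
      \<comment> \<open>The old bound and the new corrugation amount to 2 + 3 parts of
        \<open>wt k * lam k\<close>, against \<open>2 * Q\<close> parts available at the next
        stage.\<close>
      have "2 * wt (Suc k) * lam (Suc k) = Q * (2 * wt k * lam k)" using sigma_pos by (simp add: seq_Suc)
      moreover have "5 * (wt k * lam k) \<le> Q * 2 * (wt k * lam k)" using Q_ge seq_pos[of k] by (intro mult_right_mono) auto
      ultimately have "5 * (wt k * lam k) \<le> 2 * wt (Suc k) * lam (Suc k)" by linarith
      then show "2 * wt k * lam k + 3 * wt k * lam k \<le> 2 * wt (Suc k) * lam (Suc k)" by (simp only: mult.assoc)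
    qed simp
    show ?thesis unfolding U'c N' unfolding True d using 1 2 3 by blast
  next
    case False
    then have "U' c = U c" by (simp add: U'_def)
    then show ?thesis using Uup[OF U2(1)[OF cd] H2(1)] Uup[OF U2(2)[OF cd] H2(2)] Uup[OF U2(3)[OF cd] H2(3)] by (simp add: N')
  qed
  have BX1: "BL l (\<bar>- 1\<bar> * (gam (Suc k) / 4)) (3 * lam k) (\<lambda>x. - 1 * X x)" by (rule BL_cmult[OF X'])
  have BY1: "BL l (\<bar>- 1\<bar> * (gam (Suc (Suc k)) / 4)) (3 * lam k) (\<lambda>x. - 1 * Y x)" by (rule BL_cmult[OF Y'])
  note BGX = BL_add[OF up[OF G(2)] BX1]
  \<comment> \<open>The budget of \<open>gam (Suc k)\<close>: one half for the old defect, a quarter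
    for \<open>X\<close>, and a quarter for \<open>F\<close>, whose bound
    \<open>gam (Suc (Suc k)) / 4\<close> is smaller still.\<close>
  have Gi: "BL l (gam (Suc k)) (NN (Suc k)) (G' (oth (Suc k)))"
    unfolding dir_oth(3) N' G'_def if_True simp_thms
    by (simp, rule BL_mono[OF BL_add[OF BGX F(1)], simplified]) (use gle in simp_all)
  have Gj: "BL l (gam (Suc (Suc k)) / 2) (NN (Suc k)) (G' (dir (Suc k)))"
    unfolding dir_oth(2) N' G'_def using ij
    by (simp, intro BL_mono[OF BL_add[OF BY1 F(1)], simplified]) simp_all
  have dGi: "pd ?i (pd ?i (G' ?i)) x = pd ?i (pd ?i (G ?i)) x - pd ?i (pd ?i X) x + pd ?i (pd ?i (F ?i)) x" for x
  proof -
    have "dif (G ?i)" "dif X" "dif (F ?i)" "dif (pd ?i (G ?i))" "dif (pd ?i X)" "dif (pd ?i (F ?i))"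
      using BL_dif[OF G(2)] BL_dif[OF X] BL_dif[OF F(1)] BL_dif[OF BL_pd[OF G(2)]] BL_dif[OF BL_pd[OF X]] BL_dif[OF BL_pd[OF F(1)]] by blast+
    then show ?thesis unfolding G'_def by (simp only: if_True refl pd_dif dif_intros pd_const)
  qed
  have dGj: "pd ?j (pd ?j (G' ?j)) x = - pd ?j (pd ?j Y) x + pd ?j (pd ?j (F ?j)) x" for x
  proof -
    have "dif Y" "dif (F ?j)" "dif (pd ?j Y)" "dif (pd ?j (F ?j))"
      using BL_dif[OF Y] BL_dif[OF F(1)] BL_dif[OF BL_pd[OF Y]] BL_dif[OF BL_pd[OF F(1)]] by blast+
    moreover have "G' ?j = (\<lambda>x. - 1 * Y x + F ?j x)" using ij by (simp add: G'_def)
    ultimately show ?thesis by (simp only: pd_dif dif_intros pd_const; simp)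
  qed
  have sw: "P 1 + P 2 = P ?i + P ?j" for P :: "2 \<Rightarrow> real" by (simp add: dir_def oth_def)
  have E: "hdet (U' 1) x + hdet (U' 2) x = f (Suc k) x - pd 1 (pd 1 (G' 1)) x - pd 2 (pd 2 (G' 2)) x" for x
  proof -
    have h: "hdet (U' ?i) x = hdet (U ?i) x + pd ?j (pd ?j (G ?j)) x + pd ?i (pd ?i X) x + pd ?j (pd ?j Y) x" "hdet (U' ?j) x = hdet (U ?j) x"
      using det[of x] ij unfolding hdet_eq[OF UB ij] hdet_eq[OF U ij] by (simp_all add: U'_def)
    have "hdet (U' 1) x + hdet (U' 2) x = hdet (U' ?i) x + hdet (U' ?j) x" by (rule sw)
    also have "\<dots> = hdet (U ?i) x + hdet (U ?j) x + pd ?j (pd ?j (G ?j)) x + pd ?i (pd ?i X) x + pd ?j (pd ?j Y) x"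
      unfolding h by simp
    also have "hdet (U ?i) x + hdet (U ?j) x = f k x - (pd ?i (pd ?i (G ?i)) x + pd ?j (pd ?j (G ?j)) x)"
      using eq[of x] sw[of "\<lambda>c. hdet (U c) x"] sw[of "\<lambda>c. pd c (pd c (G c)) x"] by simp
    also have "f k x = f (Suc k) x - (pd ?i (pd ?i (F ?i)) x + pd ?j (pd ?j (F ?j)) x)"
      using F(2)[of x] sw[of "\<lambda>c. pd c (pd c (F c)) x"] by simp
    finally have "hdet (U' 1) x + hdet (U' 2) x = f (Suc k) x - (pd ?i (pd ?i (G' ?i)) x + pd ?j (pd ?j (G' ?j)) x)"
      unfolding dGi dGj by simp
    then show ?thesis using sw[of "\<lambda>c. pd c (pd c (G' c)) x"] by simp
  qed
  have S: "state (Suc k) (U', G')" unfolding state_def using A B Gi Gj E by blast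
  have "\<exists>\<psi>'. BL l (2 * wt k / lam k) (3 * lam k) \<psi>' \<and> (\<forall>x. U' c x = U c x + \<psi>' x)" for c
  proof (cases "c = ?i")
    case True then show ?thesis using psi(1) by (intro exI[of _ \<psi>]) (simp add: U'_def)
  next
    case False
    have "BL l (2 * wt k / lam k) (3 * lam k) (\<lambda>x. 0)"
      by (rule BL_mono[OF BL_zero[of "3 * lam k"]]) (use seq_pos[of k] in auto)
    then show ?thesis using False by (intro exI[of _ "\<lambda>x. 0"]) (simp add: U'_def)
  qed
  with S show ?thesis by blast
qed

lemma state_sequence:
  assumes "state 0 (U0, G0)"
  shows "\<exists>U G. U 0 = U0 \<and> (\<forall>k. state k (U k, G k)) \<and>
     (\<forall>k c. \<exists>\<psi>. BL l (2 * wt k / lam k) (3 * lam k) \<psi> \<and> (\<forall>x. U (Suc k) c x = U k c x + \<psi> x))"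
proof -
  have "\<exists>s. s 0 = (U0, G0) \<and> (\<forall>k. state k (s k) \<and> (\<forall>c. \<exists>\<psi>. BL l (2 * wt k / lam k) (3 * lam k) \<psi> \<and> (\<forall>x. fst (s (Suc k)) c x = fst (s k) c x + \<psi> x)))"
  proof -
    let ?R = "\<lambda>k s s'. \<forall>c. \<exists>\<psi>. BL l (2 * wt k / lam k) (3 * lam k) \<psi> \<and> (\<forall>x. fst s' c x = fst s c x + \<psi> x)"
    have "\<exists>s'. state (Suc k) s' \<and> ?R k s s'" if "state k s" for k s
    proof -
      obtain U G where s: "s = (U, G)" by (cases s)
      from state_step[of k U G] that show ?thesis unfolding s by fastforce
    qed
    \<comment> \<open>The prescribed start is made part of the predicate at index 0, so that
      dependent choice delivers a sequence beginning with \<open>(U0, G0)\<close>.\<close>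
    then have "\<exists>s. \<forall>k. (state k (s k) \<and> (k = 0 \<longrightarrow> s k = (U0, G0))) \<and> ?R k (s k) (s (Suc k))"
      using assms by (intro dependent_nat_choice[where P="\<lambda>k s. state k s \<and> (k = 0 \<longrightarrow> s = (U0, G0))"]) auto
    then show ?thesis by blast
  qed
  then obtain s where s: "s 0 = (U0, G0)" "\<And>k. state k (s k)"
    "\<And>k c. \<exists>\<psi>. BL l (2 * wt k / lam k) (3 * lam k) \<psi> \<and> (\<forall>x. fst (s (Suc k)) c x = fst (s k) c x + \<psi> x)" by blast
  show ?thesis using s by (intro exI[of _ "\<lambda>k. fst (s k)"] exI[of _ "\<lambda>k. snd (s k)"]) auto
qed

end

subsection \<open>Weak formulation and passage to the limit\<close>

lemma outside_support: "x \<notin> closure {x. \<phi> x \<noteq> 0} \<Longrightarrow> \<phi> x = (0::real)"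
  using closure_subset[of "{x. \<phi> x \<noteq> 0}"] by blast

lemma test_smooth:
  assumes "\<phi> \<in> test_functions \<omega>"
  shows test_differentiable: "\<phi> differentiable at x" and test_continuous: "continuous_on UNIV \<phi>"
    and test_compact: "compact (closure {x. \<phi> x \<noteq> 0})" "closure {x. \<phi> x \<noteq> 0} \<subseteq> \<omega>"
proof -
  have "C_diff (Suc 0) \<phi>" "C_diff 0 \<phi>" using assms unfolding test_functions_def by blast+
  then show "\<phi> differentiable at x" "continuous_on UNIV \<phi>" by (auto simp: differentiable_on_def)
  show "compact (closure {x. \<phi> x \<noteq> 0})" "closure {x. \<phi> x \<noteq> 0} \<subseteq> \<omega>"
    using assms unfolding test_functions_def by blast+
qed

lemma test_pd:
  assumes "\<phi> \<in> test_functions \<omega>"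
  shows "pd i \<phi> \<in> test_functions \<omega>"
proof -
  have C: "C_diff k (pd i \<phi>)" for k
  proof -
    have "C_diff (Suc k) \<phi>" using assms unfolding test_functions_def by blast
    then show ?thesis by simp
  qed
  have "{x. pd i \<phi> x \<noteq> 0} \<subseteq> closure {x. \<phi> x \<noteq> 0}"
  proof (rule ccontr)
    assume "\<not> ?thesis"
    then obtain x where x: "pd i \<phi> x \<noteq> 0" "x \<notin> closure {x. \<phi> x \<noteq> 0}" by blast
    have "(\<phi> has_derivative (\<lambda>h. 0)) (at x)"
    proof (rule has_derivative_transform_within_open[of "\<lambda>x. 0" _ x UNIV "- closure {x. \<phi> x \<noteq> 0}"])
      show "open (- closure {x. \<phi> x \<noteq> 0})" by (rule open_Compl) (rule closed_closure)
      show "x \<in> - closure {x. \<phi> x \<noteq> 0}" using x(2) by simp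
      show "0 = \<phi> y" if "y \<in> - closure {x. \<phi> x \<noteq> 0}" for y using outside_support[of y \<phi>] that by simp
    qed simp
    from partial_deriv_eq[OF this, of i] x show False by simp
  qed
  then have "closure {x. pd i \<phi> x \<noteq> 0} \<subseteq> closure {x. \<phi> x \<noteq> 0}"
    by (simp add: closure_minimal)
  moreover have "compact (closure {x. pd i \<phi> x \<noteq> 0})"
    unfolding compact_eq_bounded_closed
    using bounded_subset[OF compact_imp_bounded[OF test_compact(1)[OF assms]] calculation] by simp
  ultimately show ?thesis
    using C test_compact(2)[OF assms] unfolding test_functions_def by blast
qed

lemma integrable_compact_support:
  fixes h :: "real^2 \<Rightarrow> real"
  assumes c: "continuous_on UNIV h" and K: "compact K" and z: "\<And>x. x \<notin> K \<Longrightarrow> h x = 0"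
  shows "integrable lborel h"
proof -
  have "bounded (h ` K)"
    by (intro compact_imp_bounded compact_continuous_image continuous_on_subset[OF c] K) simp
  then obtain B where B: "0 < B" "\<And>x. x \<in> K \<Longrightarrow> \<bar>h x\<bar> \<le> B" unfolding bounded_pos by auto
  have i: "integrable lborel (\<lambda>x. B * indicator K x)"
    using K emeasure_bounded_finite[OF compact_imp_bounded[OF K]]
    by (intro integrable_mult_right integrable_real_indicator) (auto simp: compact_imp_closed)
  have hm: "h \<in> borel_measurable lborel" using borel_measurable_continuous_onI[OF c] by simp
  have "\<bar>h x\<bar> \<le> \<bar>B * indicator K x\<bar>" for x
    using B z[of x] by (cases "x \<in> K") auto
  then show ?thesis by (intro Bochner_Integration.integrable_bound[OF i hm] AE_I2) simp
qed

lemma integrable_test_mult: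
  assumes \<phi>: "\<phi> \<in> test_functions \<omega>" and F: "continuous_on UNIV F"
  shows "integrable lborel (\<lambda>x. \<phi> x * (F x :: real))"
proof (rule integrable_compact_support[OF continuous_on_mult[OF test_continuous[OF \<phi>] F] test_compact(1)[OF \<phi>]])
  fix x assume "x \<notin> closure {x. \<phi> x \<noteq> 0}"
  from outside_support[OF this] show "\<phi> x * F x = 0" by simp
qed

lemma lborel_integral_translate:
  fixes g :: "real^2 \<Rightarrow> real"
  assumes "g \<in> borel_measurable borel"
  shows "(\<integral>y. g (y + t) \<partial>lborel) = (\<integral>y. g y \<partial>lborel)" "integrable lborel g \<Longrightarrow> integrable lborel (\<lambda>y. g (y + t))"
proof -
  have d: "lborel = distr lborel borel ((+) t)" by (simp add: lborel_distr_plus)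
  show "(\<integral>y. g (y + t) \<partial>lborel) = (\<integral>y. g y \<partial>lborel)"
    using integral_distr[of "(+) t" lborel borel g] assms d by (simp add: add.commute)
  show "integrable lborel g \<Longrightarrow> integrable lborel (\<lambda>y. g (y + t))"
    using integrable_distr_eq[of "(+) t" lborel borel g] assms d by (simp add: add.commute)
qed

text \<open>Difference quotients have integral zero by translation invariance; the mean value
  theorem dominates them on a fixed ball, and they converge to the derivative.\<close>

lemma integral_pd_zero:
  fixes h :: "real^2 \<Rightarrow> real"
  assumes d: "\<And>x. h differentiable at x" and c: "continuous_on UNIV (pd i h)"
    and K: "compact K" and z: "\<And>x. x \<notin> K \<Longrightarrow> h x = 0"
  shows "(\<integral>x. pd i h x \<partial>lborel) = 0"
proof -
  have hc: "continuous_on UNIV h"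
    by (intro differentiable_imp_continuous_on) (simp add: differentiable_on_def d)
  obtain R where R: "R > 0" "\<And>x. x \<in> K \<Longrightarrow> norm x \<le> R" using compact_imp_bounded[OF K] bounded_pos by blast
  have hR: "h x = 0" if "norm x > R" for x using z[of x] R(2)[of x] that by (meson leD)
  obtain B where B: "\<And>x. x \<in> cball 0 (R + 2) \<Longrightarrow> \<bar>pd i h x\<bar> \<le> B"
  proof -
    have "bounded (pd i h ` cball 0 (R + 2))"
      by (intro compact_imp_bounded compact_continuous_image compact_cball continuous_on_subset[OF c]) simp
    then show ?thesis using that unfolding bounded_iff by (metis image_eqI real_norm_def)
  qed
  define e where "e n = inverse (real (Suc n))" for n
  have e: "0 < e n" "e n \<le> 1" for n by (auto simp: e_def field_simps)
  have e0: "e \<longlonglongrightarrow> 0" unfolding e_def by (rule LIMSEQ_inverse_real_of_nat)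
  define q where "q n x = (h (x + e n *\<^sub>R axis i 1) - h x) / e n" for n x
  have qi: "(\<integral>x. q n x \<partial>lborel) = 0" for n
  proof -
    have hm: "h \<in> borel_measurable borel" by (rule borel_measurable_continuous_onI[OF hc])
    have hi: "integrable lborel h" by (rule integrable_compact_support[OF hc K z])
    show ?thesis unfolding q_def
      using lborel_integral_translate[OF hm, of "e n *\<^sub>R axis i 1"] hi by simp
  qed
  have qlim: "(\<lambda>n. q n x) \<longlonglongrightarrow> pd i h x" for x
  proof -
    have "((\<lambda>t. h (x + t *\<^sub>R axis i 1)) has_real_derivative pd i h x) (at 0)"
      using axis_line_has_derivative[of h x 0 i] d by simp
    then have "((\<lambda>t. (h (x + t *\<^sub>R axis i 1) - h x) / t) \<longlongrightarrow> pd i h x) (at 0)"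
      by (simp add: has_field_derivative_iff)
    moreover have "filterlim e (at 0) sequentially"
      using e0 e by (auto simp: filterlim_at intro!: always_eventually less_imp_neq[symmetric])
    ultimately show ?thesis unfolding q_def by (rule filterlim_compose)
  qed
  \<comment> \<open>Increments are at most 1: the quotient vanishes beyond radius
    \<open>R + 1\<close>, and within it the intermediate point stays inside radius
    \<open>R + 2\<close>.\<close>
  have qb: "\<bar>q n x\<bar> \<le> B * indicator (cball 0 (R + 2)) x" for n x
  proof (cases "norm x \<le> R + 1")
    case True
    have "\<exists>s>0. s < e n \<and> h (x + e n *\<^sub>R axis i 1) - h (x + 0 *\<^sub>R axis i 1) = (e n - 0) * pd i h (x + s *\<^sub>R axis i 1)"
      by (rule MVT2[OF e(1)]) (rule axis_line_has_derivative[OF d])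
    then obtain s where s: "0 < s" "s < e n" "q n x = pd i h (x + s *\<^sub>R axis i 1)" using e(1)[of n] by (auto simp: q_def)
    have "norm (x + s *\<^sub>R axis i (1::real)) \<le> norm x + norm (s *\<^sub>R axis i (1::real))" by (rule norm_triangle_ineq)
    then have "norm (x + s *\<^sub>R axis i (1::real)) \<le> R + 2" using True s e(2)[of n] by (simp add: norm_axis_1)
    then show ?thesis using B[of "x + s *\<^sub>R axis i 1"] s True by (simp add: indicator_def)
  next
    case False
    have "norm x - norm (e n *\<^sub>R axis i (1::real)) \<le> norm (x + e n *\<^sub>R axis i (1::real))" by (metis add.commute norm_diff_ineq)
    then have "norm (x + e n *\<^sub>R axis i (1::real)) > R" using False e(2)[of n] e(1)[of n] by (simp add: norm_axis_1)
    then have "q n x = 0" using hR False by (simp add: q_def)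
    moreover have "0 \<le> B" using B[of 0] R(1) by force
    ultimately show ?thesis by simp
  qed
  have "(\<lambda>n. \<integral>x. q n x \<partial>lborel) \<longlonglongrightarrow> (\<integral>x. pd i h x \<partial>lborel)"
  proof (rule integral_dominated_convergence[where w="\<lambda>x. B * indicator (cball 0 (R + 2)) x"])
    show "pd i h \<in> borel_measurable lborel" using borel_measurable_continuous_onI[OF c] by simp
    show "q n \<in> borel_measurable lborel" for n
    proof -
      have [measurable]: "h \<in> borel_measurable borel" by (rule borel_measurable_continuous_onI[OF hc])
      show ?thesis unfolding q_def[abs_def] by measurable
    qed
    show "integrable lborel (\<lambda>x::real^2. B * indicator (cball 0 (R + 2)) x)"
      using emeasure_bounded_finite[OF bounded_cball, of "0::real^2" "R+2"]
      by (intro integrable_mult_right integrable_real_indicator) auto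
  qed (use qlim qb in auto)
  then show ?thesis using qi by (simp add: LIMSEQ_const_iff)
qed

lemma test_integration_by_parts:
  assumes \<phi>: "\<phi> \<in> test_functions \<omega>" and F: "\<And>x. F differentiable at x" "continuous_on UNIV (pd i F)"
  shows "(\<integral>x. pd i \<phi> x * F x \<partial>lborel) = - (\<integral>x. \<phi> x * pd i F x \<partial>lborel)"
proof -
  have Fc: "continuous_on UNIV F"
    by (intro differentiable_imp_continuous_on) (simp add: differentiable_on_def F)
  have e: "pd i (\<lambda>x. \<phi> x * F x) = (\<lambda>x. pd i \<phi> x * F x + \<phi> x * pd i F x)"
    by (rule ext, rule pd_mult[OF test_differentiable[OF \<phi>] F(1)])
  have "(\<integral>x. pd i (\<lambda>x. \<phi> x * F x) x \<partial>lborel) = 0"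
  proof (rule integral_pd_zero[OF _ _ test_compact(1)[OF \<phi>]])
    show "(\<lambda>x. \<phi> x * F x) differentiable at x" for x using test_differentiable[OF \<phi>] F(1) by auto
    show "continuous_on UNIV (pd i (\<lambda>x. \<phi> x * F x))" unfolding e
      by (intro continuous_intros test_continuous[OF \<phi>] test_continuous[OF test_pd[OF \<phi>]] F Fc)
    show "\<phi> x * F x = 0" if "x \<notin> closure {x. \<phi> x \<noteq> 0}" for x
      using that closure_subset[of "{x. \<phi> x \<noteq> 0}"] by auto
  qed
  then show ?thesis unfolding e
    using integrable_test_mult[OF test_pd[OF \<phi>, of i] Fc] integrable_test_mult[OF \<phi> F(2)] by simp
qed

lemma test_integration_by_parts_2:
  assumes \<phi>: "\<phi> \<in> test_functions \<omega>" and F: "BL l C N F"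
  shows "(\<integral>x. pd i (pd j \<phi>) x * F x \<partial>lborel) = (\<integral>x. \<phi> x * pd j (pd i F) x \<partial>lborel)"
  using test_integration_by_parts[where i=i and F=F, OF test_pd[OF \<phi>, of j] BL_differentiable[OF F] BL_continuous[OF BL_pd[OF F]]]
    test_integration_by_parts[where i=j and F="pd i F", OF \<phi> BL_differentiable[OF BL_pd[OF F]] BL_continuous[OF BL_pd[OF BL_pd[OF F]]]]
  by simp

lemma lebesgue_on_test:
  fixes h :: "real^2 \<Rightarrow> real"
  assumes "open \<omega>" "h \<in> borel_measurable borel" "\<And>x. x \<notin> \<omega> \<Longrightarrow> h x = 0"
  shows "(LINT x|lebesgue_on \<omega>. h x) = (\<integral>x. h x \<partial>lborel)"
proof -
  have "(LINT x|lebesgue_on \<omega>. h x) = (\<integral>x. indicator \<omega> x *\<^sub>R h x \<partial>lebesgue)"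
    using assms(1) by (intro integral_restrict_space) auto
  also have "\<dots> = (\<integral>x. h x \<partial>lebesgue)"
    using assms(3) by (intro Bochner_Integration.integral_cong) (auto simp: indicator_def)
  also have "\<dots> = (\<integral>x. h x \<partial>lborel)" using assms(2) by (intro integral_completion) simp
  finally show ?thesis .
qed

lemma test_zero: "\<phi> \<in> test_functions \<omega> \<Longrightarrow> x \<notin> \<omega> \<Longrightarrow> \<phi> x = 0"
  using test_compact(2)[of \<phi> \<omega>] closure_subset[of "{x. \<phi> x \<noteq> 0}"] by blast

text \<open>The third derivatives in \<open>curl curl\<close> of the gradient products cancel and
  leave \<open>- 2 * hdet u\<close>. With all derivatives moved onto the test function, the formula
  survives a limit in which only gradients converge.\<close>

lemma hdet_weak:
  assumes u: "BL l C N u" and \<phi>: "\<phi> \<in> test_functions \<omega>"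
  shows "(\<integral>x. (pd 2 u x * pd 2 u x) * pd 1 (pd 1 \<phi>) x + (pd 1 u x * pd 1 u x) * pd 2 (pd 2 \<phi>) x
      - 2 * ((pd 1 u x * pd 2 u x) * pd 1 (pd 2 \<phi>) x) \<partial>lborel) = - 2 * (\<integral>x. hdet u x * \<phi> x \<partial>lborel)"
proof -
  define a where "a x = pd 2 u x * pd 2 u x" for x
  define b where "b x = pd 1 u x * pd 1 u x" for x
  define c where "c x = pd 1 u x * pd 2 u x" for x
  have B: "BL l (C * N * (C * N)) (N + N) a" "BL l (C * N * (C * N)) (N + N) b" "BL l (C * N * (C * N)) (N + N) c"
    unfolding a_def[abs_def] b_def[abs_def] c_def[abs_def] by (intro BL_mult BL_pd u)+
  have i: "integrable lborel (\<lambda>x. pd i (pd j \<phi>) x * h x)" if "BL l K M h" for i j h K M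
    by (rule integrable_test_mult[OF test_pd[OF test_pd[OF \<phi>]] BL_continuous[OF that]])
  have i': "integrable lborel (\<lambda>x. \<phi> x * pd i (pd j h) x)" if "BL l K M h" for i j h K M
    by (rule integrable_test_mult[OF \<phi> BL_continuous[OF BL_pd[OF BL_pd[OF that]]]])
  have "(\<integral>x. a x * pd 1 (pd 1 \<phi>) x + b x * pd 2 (pd 2 \<phi>) x - 2 * (c x * pd 1 (pd 2 \<phi>) x) \<partial>lborel)
    = (\<integral>x. pd 1 (pd 1 \<phi>) x * a x \<partial>lborel) + (\<integral>x. pd 2 (pd 2 \<phi>) x * b x \<partial>lborel) - 2 * (\<integral>x. pd 1 (pd 2 \<phi>) x * c x \<partial>lborel)"
    using i[OF B(1), of 1 1] i[OF B(2), of 2 2] i[OF B(3), of 1 2] by (simp add: mult.commute)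
  also have "\<dots> = (\<integral>x. \<phi> x * pd 1 (pd 1 a) x \<partial>lborel) + (\<integral>x. \<phi> x * pd 2 (pd 2 b) x \<partial>lborel) - 2 * (\<integral>x. \<phi> x * pd 2 (pd 1 c) x \<partial>lborel)"
    unfolding test_integration_by_parts_2[OF \<phi> B(1)] test_integration_by_parts_2[OF \<phi> B(2)] test_integration_by_parts_2[OF \<phi> B(3)] ..
  also have "\<dots> = (\<integral>x. \<phi> x * pd 1 (pd 1 a) x + \<phi> x * pd 2 (pd 2 b) x - 2 * (\<phi> x * pd 2 (pd 1 c) x) \<partial>lborel)"
    using i'[OF B(1), of 1 1] i'[OF B(2), of 2 2] i'[OF B(3), of 2 1] by simp
  also have "\<dots> = (\<integral>x. - 2 * (hdet u x * \<phi> x) \<partial>lborel)"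
  proof (rule Bochner_Integration.integral_cong[OF refl])
    fix x
    have d: "dif (pd i u)" "dif (pd i (pd j u))" "dif (pd i (pd j (pd k u)))" for i j k
      using BL_dif[OF BL_pd[OF u]] BL_dif[OF BL_pd[OF BL_pd[OF u]]] BL_dif[OF BL_pd[OF BL_pd[OF BL_pd[OF u]]]] by blast+
    have cm: "pd 2 (pd 1 u) = pd 1 (pd 2 u)" "pd 2 (pd 1 (pd 1 u)) = pd 1 (pd 1 (pd 2 u))"
       "pd 2 (pd 1 (pd 2 u)) = pd 1 (pd 2 (pd 2 u))"
      using BL_pd_commute[OF u, of 2 1] BL_pd_commute[OF BL_pd[OF u], of 2 1] by simp_all
    have "pd 1 (pd 1 a) x + pd 2 (pd 2 b) x - 2 * pd 2 (pd 1 c) x = - 2 * hdet u x"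
      unfolding a_def[abs_def] b_def[abs_def] c_def[abs_def] hdet_def
      by (simp only: pd_dif d dif_intros cm) (simp add: algebra_simps power2_eq_square)
    then have "\<phi> x * (pd 1 (pd 1 a) x + pd 2 (pd 2 b) x - 2 * pd 2 (pd 1 c) x) = \<phi> x * (- 2 * hdet u x)" by simp
    then show "\<phi> x * pd 1 (pd 1 a) x + \<phi> x * pd 2 (pd 2 b) x - 2 * (\<phi> x * pd 2 (pd 1 c) x) = - 2 * (hdet u x * \<phi> x)"
      by (simp add: algebra_simps)
  qed
  finally show ?thesis by (simp add: a_def b_def c_def)
qed

lemma C1_series:
  assumes \<psi>: "\<And>m. BL l (a m) (M m) (\<psi> m)" and s: "summable a" "summable (\<lambda>m. a m * M m)"
  shows "((\<lambda>x. \<Sum>m. \<psi> m x) has_derivative (\<lambda>h. h $ 1 * (\<Sum>m. pd 1 (\<psi> m) x) + h $ 2 * (\<Sum>m. pd 2 (\<psi> m) x))) (at x)"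
proof -
  have ps: "summable (\<lambda>m. \<psi> m x)" for x
    by (rule summable_comparison_test'[OF s(1), of 0]) (use BL_bound[OF \<psi>] in auto)
  have pds: "summable (\<lambda>m. \<bar>pd i (\<psi> m) x\<bar>)" for i x
    by (rule summable_comparison_test'[OF s(2), of 0]) (use BL_bound[OF BL_pd[OF \<psi>]] in auto)
  have "\<exists>g. \<forall>x\<in>UNIV. (\<lambda>n. \<psi> n x) sums (g x) \<and> (g has_derivative (\<lambda>h. h $ 1 * (\<Sum>m. pd 1 (\<psi> m) x) + h $ 2 * (\<Sum>m. pd 2 (\<psi> m) x))) (at x within UNIV)"
  proof (rule has_derivative_series[where f'="\<lambda>n x h. h $ 1 * pd 1 (\<psi> n) x + h $ 2 * pd 2 (\<psi> n) x" and x=0])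
    show "(\<psi> n has_derivative (\<lambda>h. h $ 1 * pd 1 (\<psi> n) x + h $ 2 * pd 2 (\<psi> n) x)) (at x within UNIV)" for n x
      using has_derivative_pd[OF BL_differentiable[OF \<psi>]] by simp
    show "(\<lambda>n. \<psi> n 0) sums (\<Sum>n. \<psi> n 0)" by (rule summable_sums[OF ps])
    fix e :: real assume e: "0 < e"
    have "(\<lambda>n. \<Sum>m. a (m + n) * M (m + n)) \<longlonglongrightarrow> 0" by (rule suminf_exist_split2[OF s(2)])
    then have ev: "\<forall>\<^sub>F n in sequentially. (\<Sum>m. a (m + n) * M (m + n)) < e / 2"
      using e by (auto dest: order_tendstoD(2)[of _ _ _ "e/2"])
    have key: "norm ((\<Sum>i<n. h $ 1 * pd 1 (\<psi> i) x + h $ 2 * pd 2 (\<psi> i) x)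
       - (h $ 1 * (\<Sum>m. pd 1 (\<psi> m) x) + h $ 2 * (\<Sum>m. pd 2 (\<psi> m) x))) \<le> e * norm h"
      if n: "(\<Sum>m. a (m + n) * M (m + n)) < e / 2" for n x and h :: "real^2"
    proof -
      have t: "\<bar>(\<Sum>m. pd i (\<psi> m) x) - (\<Sum>m<n. pd i (\<psi> m) x)\<bar> \<le> e / 2" for i
      proof -
        have "(\<Sum>m. pd i (\<psi> m) x) - (\<Sum>m<n. pd i (\<psi> m) x) = (\<Sum>m. pd i (\<psi> (m + n)) x)"
          using suminf_minus_initial_segment[of "\<lambda>m. pd i (\<psi> m) x" n, OF summable_rabs_cancel[OF pds]] by simp
        also have "\<bar>\<dots>\<bar> \<le> (\<Sum>m. \<bar>pd i (\<psi> (m + n)) x\<bar>)"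
          by (rule summable_rabs) (use pds[THEN summable_ignore_initial_segment] in auto)
        also have "\<dots> \<le> (\<Sum>m. a (m + n) * M (m + n))"
          by (intro suminf_le) (use BL_bound[OF BL_pd[OF \<psi>]] pds s(2) in \<open>auto intro!: summable_ignore_initial_segment\<close>)
        finally show ?thesis using n by simp
      qed
      have "(\<Sum>i<n. h $ 1 * pd 1 (\<psi> i) x + h $ 2 * pd 2 (\<psi> i) x) - (h $ 1 * (\<Sum>m. pd 1 (\<psi> m) x) + h $ 2 * (\<Sum>m. pd 2 (\<psi> m) x))
        = - (h $ 1 * ((\<Sum>m. pd 1 (\<psi> m) x) - (\<Sum>m<n. pd 1 (\<psi> m) x)) + h $ 2 * ((\<Sum>m. pd 2 (\<psi> m) x) - (\<Sum>m<n. pd 2 (\<psi> m) x)))"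
        by (simp add: sum.distrib sum_distrib_left algebra_simps)
      also have "norm \<dots> \<le> norm h * (e / 2) + norm h * (e / 2)"
        unfolding real_norm_def abs_minus_cancel
        by (rule order_trans[OF abs_triangle_ineq add_mono]; unfold abs_mult; intro mult_mono component_le_norm_cart t) auto
      finally show ?thesis by (simp add: mult.commute)
    qed
    show "\<forall>\<^sub>F n in sequentially. \<forall>x\<in>UNIV. \<forall>h::real^2. norm ((\<Sum>i<n. h $ 1 * pd 1 (\<psi> i) x + h $ 2 * pd 2 (\<psi> i) x)
       - (h $ 1 * (\<Sum>m. pd 1 (\<psi> m) x) + h $ 2 * (\<Sum>m. pd 2 (\<psi> m) x))) \<le> e * norm h"
      using ev by (rule eventually_mono) (use key in blast)
  qed auto
  then obtain g where g: "\<And>x. (\<lambda>n. \<psi> n x) sums (g x)" "\<And>x. (g has_derivative (\<lambda>h. h $ 1 * (\<Sum>m. pd 1 (\<psi> m) x) + h $ 2 * (\<Sum>m. pd 2 (\<psi> m) x))) (at x)"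
    by auto
  have "g = (\<lambda>x. \<Sum>m. \<psi> m x)" using g(1) by (auto simp: sums_iff)
  with g(2) show ?thesis by simp
qed

section \<open>Hoelder estimates by interpolation\<close>

lemma BL_lipschitz:
  assumes "BL l C N g" shows "\<bar>g x - g y\<bar> \<le> 2 * (C * N) * norm (x - y)"
proof -
  have "\<exists>t>0. t < 1 \<and> g (y + 1 *\<^sub>R (x - y)) - g (y + 0 *\<^sub>R (x - y)) = (1 - 0) * ((x - y) $ 1 * pd 1 g (y + t *\<^sub>R (x - y)) + (x - y) $ 2 * pd 2 g (y + t *\<^sub>R (x - y)))"
    by (rule MVT2) (simp, rule line_has_derivative[OF BL_differentiable[OF assms]])
  then obtain t where t: "g x - g y = (x - y) $ 1 * pd 1 g (y + t *\<^sub>R (x - y)) + (x - y) $ 2 * pd 2 g (y + t *\<^sub>R (x - y))" by auto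
  have "\<bar>g x - g y\<bar> \<le> norm (x - y) * (C * N) + norm (x - y) * (C * N)" unfolding t
    by (rule order_trans[OF abs_triangle_ineq add_mono]; unfold abs_mult; intro mult_mono component_le_norm_cart BL_bound[OF BL_pd[OF assms]]) auto
  then show ?thesis by (simp add: mult_ac)
qed

text \<open>The minimum of 1 and \<open>z\<close> is at most \<open>z powr \<alpha>\<close>, applied
  to \<open>z = B * t\<close>: the sup bound serves large increments, the Lipschitz bound small
  ones.\<close>

lemma interpolate:
  fixes A B t \<alpha> :: real
  assumes "0 \<le> d" "d \<le> A" "d \<le> A * (B * t)" "0 \<le> A" "0 \<le> B" "0 \<le> t" "0 < \<alpha>" "\<alpha> < 1"
  shows "d \<le> A * B powr \<alpha> * t powr \<alpha>"
proof (cases "B * t \<ge> 1")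
  case True
  then have "1 \<le> (B * t) powr \<alpha>" using assms by (simp add: ge_one_powr_ge_zero)
  then have "A * 1 \<le> A * (B * t) powr \<alpha>" using assms by (intro mult_left_mono) auto
  then show ?thesis using assms by (simp add: powr_mult mult.assoc)
next
  case False
  then have "B * t \<le> (B * t) powr \<alpha>"
  proof (cases "B * t = 0")
    case False
    then have "0 < B * t" using assms by (simp add: less_le)
    then have "(B * t) powr 1 \<le> (B * t) powr \<alpha>" using assms \<open>\<not> B * t \<ge> 1\<close> by (intro powr_mono') auto
    then show ?thesis using \<open>0 < B * t\<close> by simp
  qed auto
  then have "A * (B * t) \<le> A * (B * t) powr \<alpha>" using assms by (intro mult_left_mono) auto
  then show ?thesis using assms by (simp add: powr_mult mult.assoc)
qed

context scheme begin

text \<open>The corrections shrink at least by half per stage, so their sum is at most twice the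
  first; this is the uniform distance from the starting functions. The gradients only have the ratio
  \<open>Q / \<sigma>\<close>, and here the strict inequality \<open>Q < \<sigma>\<close>
  matters.\<close>

lemma decay:
  shows "summable (\<lambda>m. 2 * wt m / lam m)" "(\<Sum>m. 2 * wt m / lam m) \<le> 4 * w0 / lam0" "summable (\<lambda>m. 6 * wt m)"
proof -
  have r: "0 < Q / \<sigma>" "Q / \<sigma>\<^sup>2 \<le> 1 / 2" "0 \<le> Q / \<sigma>\<^sup>2"
  proof -
    show "0 < Q / \<sigma>" "0 \<le> Q / \<sigma>\<^sup>2" using Q_ge sigma_pos by auto
    have "2 * Q \<le> \<sigma> * \<sigma>" using Q_ge by (intro mult_mono) auto
    then show "Q / \<sigma>\<^sup>2 \<le> 1/2" using sigma_pos by (simp add: divide_le_eq power2_eq_square)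
  qed
  have e: "2 * wt m / lam m = 2 * w0 / lam0 * (Q / \<sigma>\<^sup>2) ^ m" for m
    using pos sigma_pos by (simp add: wt_def lam_def power_divide power2_eq_square power_mult_distrib field_simps)
  have s: "(\<lambda>m. 2 * w0 / lam0 * (Q / \<sigma>\<^sup>2) ^ m) sums (2 * w0 / lam0 * (1 / (1 - Q / \<sigma>\<^sup>2)))"
  proof (intro sums_mult geometric_sums)
    show "norm (Q / \<sigma>\<^sup>2) < 1" unfolding real_norm_def abs_of_nonneg[OF r(3)] using r(2) by linarith
  qed
  show "summable (\<lambda>m. 2 * wt m / lam m)" unfolding e using s by (simp add: sums_iff)
  have "2 * w0 / lam0 * (1 / (1 - Q / \<sigma>\<^sup>2)) \<le> 2 * w0 / lam0 * 2"
    using pos r by (intro mult_left_mono) (auto simp: divide_le_eq)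
  then show "(\<Sum>m. 2 * wt m / lam m) \<le> 4 * w0 / lam0" unfolding e using s by (simp add: sums_iff)
  have "\<bar>Q / \<sigma>\<bar> < 1" using Q_less Q_ge(1) by (simp add: divide_less_eq)
  then show "summable (\<lambda>m. 6 * wt m)"
    unfolding wt_def by (intro summable_mult summable_geometric) simp
qed

end

lemma BL_holder:
  assumes "BL l C N g" "0 < \<alpha>" "\<alpha> < 1"
  shows "\<bar>g x - g y\<bar> \<le> 2 * C * N powr \<alpha> * norm (x - y) powr \<alpha>"
proof (rule interpolate)
  show "\<bar>g x - g y\<bar> \<le> 2 * C" using BL_bound[OF assms(1), of x] BL_bound[OF assms(1), of y] by linarith
  show "\<bar>g x - g y\<bar> \<le> 2 * C * (N * norm (x - y))" using BL_lipschitz[OF assms(1), of x y] by (simp add: mult_ac)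
qed (use BL_nonneg[OF assms(1)] assms in auto)

lemma holder_continuous:
  fixes g :: "real^2 \<Rightarrow> real"
  assumes h: "\<And>x y. \<bar>g x - g y\<bar> \<le> K * norm (x - y) powr \<alpha>" and \<alpha>: "0 < \<alpha>"
  shows "continuous_on UNIV g"
  unfolding continuous_on_eq_continuous_at[OF open_UNIV]
proof
  fix x :: "real^2"
  have lim: "((\<lambda>y. K * norm (y - x) powr \<alpha>) \<longlongrightarrow> K * 0) (at x)"
  proof (intro tendsto_mult_left tendsto_zero_powrI[where b=\<alpha>])
    show "((\<lambda>y. norm (y - x)) \<longlongrightarrow> 0) (at x)" by (intro tendsto_norm_zero) (simp add: LIM_zero_iff)
  qed (use \<alpha> in \<open>auto intro!: tendsto_const always_eventually\<close>)
  have "((\<lambda>y. g y - g x) \<longlongrightarrow> 0) (at x)"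
  proof (rule Lim_null_comparison)
    show "\<forall>\<^sub>F y in at x. norm (g y - g x) \<le> K * norm (y - x) powr \<alpha>"
      unfolding real_norm_def by (rule always_eventually) (intro allI h)
    show "((\<lambda>y. K * norm (y - x) powr \<alpha>) \<longlongrightarrow> 0) (at x)" using lim by (simp only: mult_zero_right)
  qed
  then show "isCont g x" by (simp add: isCont_def LIM_zero_iff)
qed

section \<open>Square integrability and stability of weak solutions\<close>

lemma bounded_on_integrable:
  fixes h :: "real^2 \<Rightarrow> 'b::euclidean_space"
  assumes \<omega>: "open \<omega>" "bounded \<omega>" and h: "continuous_on UNIV h" "\<And>x. norm (h x) \<le> K" and w: "\<And>x. x \<in> \<omega> \<Longrightarrow> w x = h x"
  shows "w \<in> borel_measurable (lebesgue_on \<omega>)" "integrable (lebesgue_on \<omega>) w"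
proof -
  have \<omega>m: "\<omega> \<in> sets lebesgue" using \<omega>(1) by auto
  have hm: "h \<in> borel_measurable (lebesgue_on \<omega>)"
    by (rule continuous_imp_measurable_on_sets_lebesgue[OF continuous_on_subset[OF h(1) subset_UNIV] \<omega>m])
  have *: "w \<in> borel_measurable (lebesgue_on \<omega>) \<longleftrightarrow> h \<in> borel_measurable (lebesgue_on \<omega>)"
    by (rule measurable_cong) (simp add: w)
  show wm: "w \<in> borel_measurable (lebesgue_on \<omega>)" using * hm by blast
  interpret finite_measure "lebesgue_on \<omega>"
    by (rule finite_measure_lebesgue_on) (use \<omega> in \<open>auto intro: lmeasurable_open\<close>)
  show "integrable (lebesgue_on \<omega>) w"
    by (rule integrable_const_bound[of _ K, OF _ wm]) (use h w in \<open>auto intro!: AE_I2\<close>)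
qed

lemma bounded_on_L2:
  fixes h :: "real^2 \<Rightarrow> 'b::euclidean_space"
  assumes \<omega>: "open \<omega>" "bounded \<omega>" and h: "continuous_on UNIV h" "\<And>x. norm (h x) \<le> K" and w: "\<And>x. x \<in> \<omega> \<Longrightarrow> w x = h x"
  shows "w \<in> L2_space \<omega>"
proof -
  have "integrable (lebesgue_on \<omega>) (\<lambda>x. (norm (w x))\<^sup>2)"
  proof (rule bounded_on_integrable(2)[OF \<omega>])
    show "continuous_on UNIV (\<lambda>x. (norm (h x))\<^sup>2)" by (intro continuous_intros h)
    show "norm ((norm (h x))\<^sup>2) \<le> K\<^sup>2" for x using h(2)[of x] by (simp add: power_mono)
  qed (simp add: w)
  then show ?thesis using bounded_on_integrable(1)[OF \<omega> h w] by (simp add: L2_space_def)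
qed

lemma vec2_norm_le: "norm (\<chi> c::2. (a c::real)) \<le> \<bar>a 1\<bar> + \<bar>a 2\<bar>"
  using norm_le_l1_cart[of "\<chi> c. a c"] by (simp add: sum_2)

lemma has_derivative_vec2:
  fixes f :: "2 \<Rightarrow> real^2 \<Rightarrow> real"
  assumes "\<And>c. (f c has_derivative D c) (at x)"
  shows "((\<lambda>x. \<chi> c. f c x) has_derivative (\<lambda>h. \<chi> c. D c h)) (at x)"
  by (subst has_derivative_componentwise_within) (use assms in \<open>auto simp: Basis_vec_def inner_axis\<close>)

lemma test_bounded:
  assumes "\<phi> \<in> test_functions \<omega>"
  shows "\<exists>K. \<forall>x. \<bar>\<phi> x\<bar> \<le> K"
proof -
  have "bounded (\<phi> ` closure {x. \<phi> x \<noteq> 0})"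
    by (intro compact_imp_bounded compact_continuous_image test_compact[OF assms] continuous_on_subset[OF test_continuous[OF assms]]) simp
  then obtain K where K: "0 < K" "\<And>x. x \<in> closure {x. \<phi> x \<noteq> 0} \<Longrightarrow> \<bar>\<phi> x\<bar> \<le> K"
    unfolding bounded_pos by auto
  have "\<bar>\<phi> x\<bar> \<le> K" for x
    using K outside_support[of x \<phi>] by (cases "x \<in> closure {x. \<phi> x \<noteq> 0}") auto
  then show ?thesis by blast
qed

text \<open>Stability of the weak formulation: gradients converge pointwise and boundedly, while the remaining error
  consists of second derivatives of uniformly vanishing functions.\<close>

lemma weak_solution_limit:
  fixes u :: "2 \<Rightarrow> real^2 \<Rightarrow> real" and D :: "2 \<Rightarrow> 2 \<Rightarrow> real^2 \<Rightarrow> real" and U G :: "nat \<Rightarrow> 2 \<Rightarrow> real^2 \<Rightarrow> real"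
  assumes \<omega>: "open \<omega>" "bounded \<omega>"
    and u: "\<And>c x. (u c has_derivative (\<lambda>h. h $ 1 * D 1 c x + h $ 2 * D 2 c x)) (at x)"
    and ub: "\<And>c x. \<bar>u c x\<bar> \<le> K" and Dc: "\<And>i c. continuous_on UNIV (D i c)" and Db: "\<And>i c x. \<bar>D i c x\<bar> \<le> B"
    and U: "\<And>k c. \<exists>C N. BL l C N (U k c)" and UD: "\<And>i c x. (\<lambda>k. pd i (U k c) x) \<longlonglongrightarrow> D i c x"
    and Ub: "\<And>k i c x. \<bar>pd i (U k c) x\<bar> \<le> B"
    and G: "\<And>k c. \<exists>C N. BL l C N (G k c)" and Gb: "\<And>k c x. \<bar>G k c x\<bar> \<le> \<gamma> k" and \<gamma>: "\<gamma> \<longlonglongrightarrow> 0"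
    and eq: "\<And>k x. hdet (U k 1) x + hdet (U k 2) x = f k x - pd 1 (pd 1 (G k 1)) x - pd 2 (pd 2 (G k 2)) x"
    and conv: "\<And>\<phi>. \<phi> \<in> test_functions \<omega> \<Longrightarrow> (\<lambda>k. \<integral>x. f k x * \<phi> x \<partial>lborel) \<longlonglongrightarrow> (LINT x|lebesgue_on \<omega>. fw x * \<phi> x)"
    and w: "\<And>x. x \<in> \<omega> \<Longrightarrow> w x = (\<chi> c. u c x)"
  shows "weak_solution \<omega> fw w"
proof -
  \<comment> \<open>Rows are indexed by the component and columns by the direction, as
    \<open>L2_weak_gradient\<close> expects.\<close>
  define M :: "real^2 \<Rightarrow> real^2^2" where "M x = (\<chi> c i. D i c x)" for x
  have uc: "continuous_on UNIV (u c)" for c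
    by (intro differentiable_imp_continuous_on) (auto simp: differentiable_on_def intro: differentiableI[OF u])
  have ud: "u c differentiable at x" for c x by (rule differentiableI[OF u])
  have pdu: "pd i (u c) = D i c" for i c
    using pd_unique[OF u] exhaust_2[of i] by (auto simp: fun_eq_iff)
  have vc: "continuous_on UNIV (\<lambda>x. \<chi> c. u c x)" by (intro continuous_on_vec_lambda uc)
  have norm_le_l1_cart': "norm (A::real^2^2) \<le> (\<Sum>c\<in>UNIV. norm (A $ c))" for A
    unfolding norm_vec_def by (rule L2_set_le_sum) simp
  have vb: "norm (\<chi> c. u c x) \<le> K + K" for x
    by (rule order_trans[OF vec2_norm_le add_mono]) (rule ub)+
  have wL: "w \<in> L2_space \<omega>" by (rule bounded_on_L2[OF \<omega> vc vb w])
  have Mc: "continuous_on UNIV M" unfolding M_def[abs_def] by (intro continuous_on_vec_lambda Dc)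
  have Mb: "norm (M x) \<le> 4 * B" for x
  proof -
    have "norm (M x) \<le> (\<Sum>c\<in>UNIV. norm (M x $ c))" by (rule norm_le_l1_cart')
    also have "\<dots> \<le> (\<Sum>c\<in>(UNIV::2 set). B + B)"
    proof (rule sum_mono)
      fix c :: 2
      show "norm (M x $ c) \<le> B + B"
        unfolding M_def vec_lambda_beta by (rule order_trans[OF vec2_norm_le add_mono]) (rule Db)+
    qed
    finally show ?thesis by (simp add: sum_2)
  qed
  have MG: "M \<in> L2_space \<omega>" by (rule bounded_on_L2[OF \<omega> Mc Mb refl])
  have colM: "column i (M x) = (\<chi> c. D i c x)" for i x by (simp add: column_def M_def)
  have ibp: "(LINT x|lebesgue_on \<omega>. pd i \<phi> x *\<^sub>R w x) = - (LINT x|lebesgue_on \<omega>. \<phi> x *\<^sub>R column i (M x))"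
    if \<phi>: "\<phi> \<in> test_functions \<omega>" for \<phi> i
  proof -
    obtain K1 where K1: "\<And>x. \<bar>\<phi> x\<bar> \<le> K1" using test_bounded[OF \<phi>] by blast
    obtain K2 where K2: "\<And>x. \<bar>pd i \<phi> x\<bar> \<le> K2" using test_bounded[OF test_pd[OF \<phi>]] by blast
    have i1: "integrable (lebesgue_on \<omega>) (\<lambda>x. pd i \<phi> x *\<^sub>R w x)"
    proof (rule bounded_on_integrable(2)[OF \<omega>])
      show "continuous_on UNIV (\<lambda>x. pd i \<phi> x *\<^sub>R (\<chi> c. u c x))"
        by (intro continuous_on_scaleR vc test_continuous[OF test_pd[OF \<phi>]])
      show "norm (pd i \<phi> x *\<^sub>R (\<chi> c. u c x)) \<le> K2 * (K + K)" for x
        unfolding norm_scaleR by (intro mult_mono K2 vb) (use K2[of x] in auto)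
    qed (simp add: w)
    have i2: "integrable (lebesgue_on \<omega>) (\<lambda>x. \<phi> x *\<^sub>R column i (M x))"
    proof (rule bounded_on_integrable(2)[OF \<omega>])
      show "continuous_on UNIV (\<lambda>x. \<phi> x *\<^sub>R column i (M x))" unfolding colM
        by (intro continuous_on_scaleR continuous_on_vec_lambda Dc test_continuous[OF \<phi>])
      show "norm (\<phi> x *\<^sub>R column i (M x)) \<le> K1 * (B + B)" for x
        unfolding norm_scaleR colM
        by (intro mult_mono K1 order_trans[OF vec2_norm_le add_mono] Db) (use K1[of x] in auto)
    qed simp
    have "(LINT x|lebesgue_on \<omega>. pd i \<phi> x *\<^sub>R w x) $ c = - (LINT x|lebesgue_on \<omega>. \<phi> x *\<^sub>R column i (M x)) $ c" for c
    proof -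
      have "(LINT x|lebesgue_on \<omega>. pd i \<phi> x *\<^sub>R w x) $ c = (LINT x|lebesgue_on \<omega>. (pd i \<phi> x *\<^sub>R w x) $ c)"
        by (rule integral_bounded_linear[OF bounded_linear_vec_nth i1, symmetric])
      also have "\<dots> = (LINT x|lebesgue_on \<omega>. pd i \<phi> x * u c x)"
        by (rule Bochner_Integration.integral_cong) (auto simp: w)
      also have "\<dots> = (\<integral>x. pd i \<phi> x * u c x \<partial>lborel)"
      proof (rule lebesgue_on_test[OF \<omega>(1)])
        show "(\<lambda>x. pd i \<phi> x * u c x) \<in> borel_measurable borel"
          by (intro borel_measurable_continuous_onI continuous_on_mult uc test_continuous[OF test_pd[OF \<phi>]])
      qed (simp add: test_zero[OF test_pd[OF \<phi>]])
      also have "\<dots> = - (\<integral>x. \<phi> x * D i c x \<partial>lborel)"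
        using test_integration_by_parts[OF \<phi> ud, of i c] Dc by (simp add: pdu)
      also have "(\<integral>x. \<phi> x * D i c x \<partial>lborel) = (LINT x|lebesgue_on \<omega>. \<phi> x * D i c x)"
      proof (rule lebesgue_on_test[OF \<omega>(1), symmetric])
        show "(\<lambda>x. \<phi> x * D i c x) \<in> borel_measurable borel"
          by (intro borel_measurable_continuous_onI continuous_on_mult Dc test_continuous[OF \<phi>])
      qed (simp add: test_zero[OF \<phi>])
      also have "\<dots> = (LINT x|lebesgue_on \<omega>. (\<phi> x *\<^sub>R column i (M x)) $ c)" by (simp add: colM)
      also have "\<dots> = (LINT x|lebesgue_on \<omega>. \<phi> x *\<^sub>R column i (M x)) $ c"
        by (rule integral_bounded_linear[OF bounded_linear_vec_nth i2])
      finally show ?thesis .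
    qed
    then show ?thesis by (simp add: vec_eq_iff)
  qed
  have wgrad: "L2_weak_gradient \<omega> w M" using wL MG ibp unfolding L2_weak_gradient_def by blast
  have main: "- (1/2) * curl_curl \<omega> (\<lambda>x. transpose (M x) ** M x) \<phi> = (LINT x|lebesgue_on \<omega>. fw x * \<phi> x)"
    if \<phi>: "\<phi> \<in> test_functions \<omega>" for \<phi>
  proof -
    \<comment> \<open>The integrand of \<open>curl_curl\<close> for gradient entries
      \<open>A i c\<close>, direction first and component second, split into the contributions of
      the two components.\<close>
    define E where "E A x = ((A 2 1 x * A 2 1 x) * pd 1 (pd 1 \<phi>) x + (A 1 1 x * A 1 1 x) * pd 2 (pd 2 \<phi>) x - 2 * ((A 1 1 x * A 2 1 x) * pd 1 (pd 2 \<phi>) x))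
       + ((A 2 2 x * A 2 2 x) * pd 1 (pd 1 \<phi>) x + (A 1 2 x * A 1 2 x) * pd 2 (pd 2 \<phi>) x - 2 * ((A 1 2 x * A 2 2 x) * pd 1 (pd 2 \<phi>) x))"
      for A :: "2 \<Rightarrow> 2 \<Rightarrow> real^2 \<Rightarrow> real" and x
    note p2 = test_pd[OF test_pd[OF \<phi>]]
    have Ec: "continuous_on UNIV (E A)" if "\<And>i c. continuous_on UNIV (A i c)" for A
      unfolding E_def by (intro continuous_intros that test_continuous[OF p2])
    have cc: "curl_curl \<omega> (\<lambda>x. transpose (M x) ** M x) \<phi> = (\<integral>x. E D x \<partial>lborel)"
    proof -
      have e: "(transpose (M x) ** M x) $ a $ b = D a 1 x * D b 1 x + D a 2 x * D b 2 x" for x a b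
        by (simp add: matrix_matrix_mult_def transpose_def M_def sum_2)
      have "curl_curl \<omega> (\<lambda>x. transpose (M x) ** M x) \<phi> = (LINT x|lebesgue_on \<omega>. E D x)"
        unfolding curl_curl_def e by (intro Bochner_Integration.integral_cong) (auto simp: E_def algebra_simps)
      also have "\<dots> = (\<integral>x. E D x \<partial>lborel)"
        by (rule lebesgue_on_test[OF \<omega>(1) borel_measurable_continuous_onI[OF Ec[OF Dc]]]) (simp add: E_def test_zero[OF p2])
      finally show ?thesis .
    qed
    define A where "A k i c = pd i (U k c)" for k i c
    have Ac: "continuous_on UNIV (A k i c)" for k i c
      using U[of k c] BL_continuous BL_pd unfolding A_def by blast
    have Bn: "0 \<le> B" using Db[of 1 1 0] by linarith
    have lim: "(\<lambda>k. \<integral>x. E (A k) x \<partial>lborel) \<longlonglongrightarrow> (\<integral>x. E D x \<partial>lborel)"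
    \<comment> \<open>The 8 is the sum of the absolute coefficients in \<open>E\<close>, 1 + 1 + 2
      for each component.\<close>
    proof (rule integral_dominated_convergence[where w="\<lambda>x. 8 * (B * B) * (\<bar>pd 1 (pd 1 \<phi>) x\<bar> + \<bar>pd 2 (pd 2 \<phi>) x\<bar> + \<bar>pd 1 (pd 2 \<phi>) x\<bar>)"])
      show "E D \<in> borel_measurable lborel" using borel_measurable_continuous_onI[OF Ec[OF Dc]] by simp
      show "E (A k) \<in> borel_measurable lborel" for k using borel_measurable_continuous_onI[OF Ec[OF Ac]] by simp
      have "integrable lborel (pd i (pd j \<phi>))" for i j
        using integrable_test_mult[OF p2, of "\<lambda>x. 1" i j] by simp
      then show "integrable lborel (\<lambda>x. 8 * (B * B) * (\<bar>pd 1 (pd 1 \<phi>) x\<bar> + \<bar>pd 2 (pd 2 \<phi>) x\<bar> + \<bar>pd 1 (pd 2 \<phi>) x\<bar>))" by auto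
      show "AE x in lborel. (\<lambda>k. E (A k) x) \<longlonglongrightarrow> E D x"
        unfolding E_def A_def by (intro AE_I2 tendsto_intros UD)
      show "AE x in lborel. norm (E (A k) x) \<le> 8 * (B * B) * (\<bar>pd 1 (pd 1 \<phi>) x\<bar> + \<bar>pd 2 (pd 2 \<phi>) x\<bar> + \<bar>pd 1 (pd 2 \<phi>) x\<bar>)" for k
      proof (rule AE_I2)
        fix x
        have t: "\<bar>(A k i c x * A k j c x) * p\<bar> \<le> (B * B) * \<bar>p\<bar>" for i j c p
          unfolding abs_mult A_def by (intro mult_right_mono mult_mono Ub) (auto simp: Bn)
        show "norm (E (A k) x) \<le> 8 * (B * B) * (\<bar>pd 1 (pd 1 \<phi>) x\<bar> + \<bar>pd 2 (pd 2 \<phi>) x\<bar> + \<bar>pd 1 (pd 2 \<phi>) x\<bar>)"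
          unfolding E_def real_norm_def distrib_left
          using t[of 2 1 2 "pd 1 (pd 1 \<phi>) x"] t[of 1 1 1 "pd 2 (pd 2 \<phi>) x"] t[of 1 1 2 "pd 1 (pd 2 \<phi>) x"]
            t[of 2 2 2 "pd 1 (pd 1 \<phi>) x"] t[of 1 2 1 "pd 2 (pd 2 \<phi>) x"] t[of 1 2 2 "pd 1 (pd 2 \<phi>) x"]
            t[of 1 1 1 "pd 1 (pd 1 \<phi>) x"] t[of 1 1 1 "pd 1 (pd 2 \<phi>) x"] t[of 2 1 2 "pd 1 (pd 1 \<phi>) x"] t[of 2 1 1 "pd 1 (pd 2 \<phi>) x"]
          by (simp add: abs_le_iff)
      qed
    qed
    \<comment> \<open>At a fixed stage everything is smooth: \<open>hdet_weak\<close> yields the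
      determinants, \<open>eq\<close> replaces them, and the second derivatives of
      \<open>G k\<close> pass to the test function, so that only the sup norm of \<open>G k\<close>
      matters afterwards.\<close>
    have Ek: "(\<integral>x. E (A k) x \<partial>lborel) = - 2 * ((\<integral>x. f k x * \<phi> x \<partial>lborel) - (\<integral>x. pd 1 (pd 1 \<phi>) x * G k 1 x \<partial>lborel) - (\<integral>x. pd 2 (pd 2 \<phi>) x * G k 2 x \<partial>lborel))" for k
    proof -
      obtain C1 N1 where U1: "BL l C1 N1 (U k 1)" using U by blast
      obtain C2 N2 where U2: "BL l C2 N2 (U k 2)" using U by blast
      obtain C3 N3 where G1: "BL l C3 N3 (G k 1)" using G by blast
      obtain C4 N4 where G2: "BL l C4 N4 (G k 2)" using G by blast
      have iE: "integrable lborel (\<lambda>x. (A k 2 c x * A k 2 c x) * pd 1 (pd 1 \<phi>) x + (A k 1 c x * A k 1 c x) * pd 2 (pd 2 \<phi>) x - 2 * ((A k 1 c x * A k 2 c x) * pd 1 (pd 2 \<phi>) x))" for c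
      proof -
        have "integrable lborel (\<lambda>x. (A k i c x * A k j c x) * pd a (pd b \<phi>) x)" for i j a b
          using integrable_test_mult[OF p2 continuous_on_mult[OF Ac Ac], of a b k i c k j c] by (simp add: mult.commute)
        then show ?thesis by auto
      qed
      have hc: "continuous_on UNIV (hdet (U k c))" for c
      proof -
        obtain C N where B: "BL l C N (U k c)" using U by blast
        have "continuous_on UNIV (pd i (pd j (U k c)))" for i j by (rule BL_continuous[OF BL_pd[OF BL_pd[OF B]]])
        then show ?thesis unfolding hdet_def[abs_def] by (intro continuous_intros)
      qed
      have ih: "integrable lborel (\<lambda>x. \<phi> x * hdet (U k c) x)" for c by (rule integrable_test_mult[OF \<phi> hc])
      have iG: "integrable lborel (\<lambda>x. \<phi> x * pd i (pd i (G k i)) x)" for i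
      proof -
        obtain C N where B: "BL l C N (G k i)" using G by blast
        show ?thesis by (rule integrable_test_mult[OF \<phi> BL_continuous[OF BL_pd[OF BL_pd[OF B]]]])
      qed
      have "(\<integral>x. E (A k) x \<partial>lborel) = - 2 * (\<integral>x. hdet (U k 1) x * \<phi> x \<partial>lborel) + - 2 * (\<integral>x. hdet (U k 2) x * \<phi> x \<partial>lborel)"
        unfolding E_def using iE[of 1] iE[of 2] hdet_weak[OF U1 \<phi>] hdet_weak[OF U2 \<phi>] by (simp add: A_def)
      also have "\<dots> = - 2 * ((\<integral>x. hdet (U k 1) x * \<phi> x + hdet (U k 2) x * \<phi> x \<partial>lborel))"
        using ih[of 1] ih[of 2] by (simp add: mult.commute)
      also have "(\<integral>x. hdet (U k 1) x * \<phi> x + hdet (U k 2) x * \<phi> x \<partial>lborel) =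
          (\<integral>x. f k x * \<phi> x - \<phi> x * pd 1 (pd 1 (G k 1)) x - \<phi> x * pd 2 (pd 2 (G k 2)) x \<partial>lborel)"
      proof (rule Bochner_Integration.integral_cong[OF refl])
        fix x
        have "hdet (U k 1) x * \<phi> x + hdet (U k 2) x * \<phi> x = (hdet (U k 1) x + hdet (U k 2) x) * \<phi> x" by (simp add: distrib_right)
        then show "hdet (U k 1) x * \<phi> x + hdet (U k 2) x * \<phi> x = f k x * \<phi> x - \<phi> x * pd 1 (pd 1 (G k 1)) x - \<phi> x * pd 2 (pd 2 (G k 2)) x"
          unfolding eq by (simp add: algebra_simps)
      qed
      also have "\<dots> = (\<integral>x. f k x * \<phi> x \<partial>lborel) - (\<integral>x. \<phi> x * pd 1 (pd 1 (G k 1)) x \<partial>lborel) - (\<integral>x. \<phi> x * pd 2 (pd 2 (G k 2)) x \<partial>lborel)"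
      proof -
        have "integrable lborel (\<lambda>x. f k x * \<phi> x)"
        proof -
          have "f k x = hdet (U k 1) x + hdet (U k 2) x + pd 1 (pd 1 (G k 1)) x + pd 2 (pd 2 (G k 2)) x" for x using eq[of k x] by simp
          then have "f k x * \<phi> x = \<phi> x * hdet (U k 1) x + \<phi> x * hdet (U k 2) x + \<phi> x * pd 1 (pd 1 (G k 1)) x + \<phi> x * pd 2 (pd 2 (G k 2)) x" for x
            by (simp add: algebra_simps)
          then show ?thesis using ih iG by simp
        qed
        then show ?thesis using iG by simp
      qed
      also have "(\<integral>x. \<phi> x * pd 1 (pd 1 (G k 1)) x \<partial>lborel) = (\<integral>x. pd 1 (pd 1 \<phi>) x * G k 1 x \<partial>lborel)"
        by (rule test_integration_by_parts_2[OF \<phi> G1, symmetric])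
      also have "(\<integral>x. \<phi> x * pd 2 (pd 2 (G k 2)) x \<partial>lborel) = (\<integral>x. pd 2 (pd 2 \<phi>) x * G k 2 x \<partial>lborel)"
        by (rule test_integration_by_parts_2[OF \<phi> G2, symmetric])
      finally show ?thesis .
    qed
    have Glim: "(\<lambda>k. \<integral>x. pd i (pd i \<phi>) x * G k i x \<partial>lborel) \<longlonglongrightarrow> 0" for i
    proof (rule Lim_null_comparison)
      show "\<forall>\<^sub>F k in sequentially. norm (\<integral>x. pd i (pd i \<phi>) x * G k i x \<partial>lborel) \<le> (\<integral>x. \<bar>pd i (pd i \<phi>) x\<bar> \<partial>lborel) * \<gamma> k"
      proof (rule always_eventually, rule allI)
        fix k
        obtain C N where B: "BL l C N (G k i)" using G by blast
        have ig: "integrable lborel (\<lambda>x. pd i (pd i \<phi>) x * G k i x)" by (rule integrable_test_mult[OF p2 BL_continuous[OF B]])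
        have ip: "integrable lborel (\<lambda>x. \<bar>pd i (pd i \<phi>) x\<bar>)" using integrable_test_mult[OF p2, of "\<lambda>x. 1" i i] by simp
        have "\<bar>\<integral>x. pd i (pd i \<phi>) x * G k i x \<partial>lborel\<bar> \<le> (\<integral>x. \<bar>pd i (pd i \<phi>) x * G k i x\<bar> \<partial>lborel)" by (rule integral_abs_bound)
        also have "\<dots> \<le> (\<integral>x. \<bar>pd i (pd i \<phi>) x\<bar> * \<gamma> k \<partial>lborel)"
        proof (rule integral_mono)
          show "integrable lborel (\<lambda>x. \<bar>pd i (pd i \<phi>) x * G k i x\<bar>)" by (rule integrable_abs[OF ig])
          show "integrable lborel (\<lambda>x. \<bar>pd i (pd i \<phi>) x\<bar> * \<gamma> k)" using ip by simp
          show "\<bar>pd i (pd i \<phi>) x * G k i x\<bar> \<le> \<bar>pd i (pd i \<phi>) x\<bar> * \<gamma> k" for x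
            unfolding abs_mult by (intro mult_left_mono Gb) simp
        qed
        finally show "norm (\<integral>x. pd i (pd i \<phi>) x * G k i x \<partial>lborel) \<le> (\<integral>x. \<bar>pd i (pd i \<phi>) x\<bar> \<partial>lborel) * \<gamma> k" by simp
      qed
      show "(\<lambda>k. (\<integral>x. \<bar>pd i (pd i \<phi>) x\<bar> \<partial>lborel) * \<gamma> k) \<longlonglongrightarrow> 0" using \<gamma> by (rule tendsto_mult_right_zero)
    qed
    have "(\<lambda>k. \<integral>x. E (A k) x \<partial>lborel) \<longlonglongrightarrow> - 2 * ((LINT x|lebesgue_on \<omega>. fw x * \<phi> x) - 0 - 0)"
      unfolding Ek by (intro tendsto_mult tendsto_const tendsto_diff conv[OF \<phi>] Glim)
    from LIMSEQ_unique[OF lim this] show ?thesis unfolding cc by simp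
  qed
  show ?thesis using wgrad main unfolding weak_solution_def H1_space_def by blast
qed

section \<open>The limit of the scheme\<close>

context scheme begin

lemma scheme_limit:
  fixes \<omega> :: "(real^2) set"
  assumes st: "state 0 (U0, G0)" and \<alpha>: "0 < \<alpha>" "\<alpha> < 1" and qs: "Q / \<sigma> * \<sigma> powr \<alpha> < 1"
    and \<omega>: "open \<omega>" "bounded \<omega>"
    and conv: "\<And>\<phi>. \<phi> \<in> test_functions \<omega> \<Longrightarrow> (\<lambda>k. \<integral>x. f k x * \<phi> x \<partial>lborel) \<longlonglongrightarrow> (LINT x|lebesgue_on \<omega>. fw x * \<phi> x)"
  shows "\<exists>v :: real^2 \<Rightarrow> real^2. Hoelder_plane 1 \<alpha> v \<and> weak_solution \<omega> fw (restrict v (closure \<omega>)) \<and>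
    (\<forall>c x. \<bar>v x $ c - U0 c x\<bar> \<le> 4 * w0 / lam0)"
proof -
  obtain U G where UG: "U 0 = U0" "\<And>k. state k (U k, G k)"
    "\<And>k c. \<exists>\<psi>. BL l (2 * wt k / lam k) (3 * lam k) \<psi> \<and> (\<forall>x. U (Suc k) c x = U k c x + \<psi> x)"
    using state_sequence[OF st] by blast
  obtain \<psi> where \<psi>: "\<And>k c. BL l (2 * wt k / lam k) (3 * lam k) (\<psi> k c)" "\<And>k c x. U (Suc k) c x = U k c x + \<psi> k c x"
    using UG(3) by metis
  have UB: "\<exists>C. BL l C (NN k) (U k c)" for k c using UG(2)[of k] unfolding state_def prod.case by blast
  define a where "a m = 2 * wt m / lam m" for m
  have aM: "a m * (3 * lam m) = 6 * wt m" for m using seq_pos(1)[of m] by (simp add: a_def)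
  have sa: "summable a" "summable (\<lambda>m. a m * (3 * lam m))"
  proof -
    show "summable a" using decay(1) by (simp add: a_def[abs_def])
    show "summable (\<lambda>m. a m * (3 * lam m))" unfolding aM by (rule decay(3))
  qed
  have \<psi>': "BL l (a k) (3 * lam k) (\<psi> k c)" for k c using \<psi>(1) by (simp add: a_def)
  have p\<psi>: "BL l (6 * wt k) (3 * lam k) (pd i (\<psi> k c))" for i k c using BL_pd[OF \<psi>'[of k c], of i] unfolding aM .
  define u where "u c x = U0 c x + (\<Sum>m. \<psi> m c x)" for c x
  define D where "D i c x = pd i (U0 c) x + (\<Sum>m. pd i (\<psi> m c) x)" for i c x
  have U0: "\<exists>C. BL l C (NN 0) (U0 c)" for c using UB[of 0 c] UG(1) by simp
  have ud: "(u c has_derivative (\<lambda>h. h $ 1 * D 1 c x + h $ 2 * D 2 c x)) (at x)" for c x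
  proof -
    obtain C where "BL l C (NN 0) (U0 c)" using U0 by blast
    from has_derivative_add[OF has_derivative_pd[OF BL_differentiable[OF this]] C1_series[OF \<psi>'[of _ c] sa]]
    show ?thesis unfolding u_def[abs_def] D_def by (rule has_derivative_eq_rhs) (simp add: fun_eq_iff algebra_simps)
  qed
  have sp: "summable (\<lambda>m. \<bar>\<psi> m c x\<bar>)" for c x
    by (rule summable_comparison_test'[OF sa(1), of 0]) (use BL_bound[OF \<psi>'] in auto)
  have spd: "summable (\<lambda>m. \<bar>pd i (\<psi> m c) x\<bar>)" for i c x
    by (rule summable_comparison_test'[OF decay(3), of 0]) (use BL_bound[OF p\<psi>] in auto)
  have pU: "pd i (U k c) x = pd i (U0 c) x + (\<Sum>m<k. pd i (\<psi> m c) x)" for i k c x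
  proof (induction k)
    case (Suc k)
    obtain C where C: "BL l C (NN k) (U k c)" using UB by blast
    have "U (Suc k) c = (\<lambda>x. U k c x + \<psi> k c x)" using \<psi>(2) by (simp add: fun_eq_iff)
    then have "pd i (U (Suc k) c) x = pd i (U k c) x + pd i (\<psi> k c) x"
      using pd_add[of "U k c" x "\<psi> k c" i, OF BL_differentiable[OF C] BL_differentiable[OF \<psi>']] by simp
    then show ?case using Suc by simp
  qed (simp add: UG(1))
  have UD: "(\<lambda>k. pd i (U k c) x) \<longlonglongrightarrow> D i c x" for i c x
    unfolding pU D_def by (intro tendsto_add tendsto_const summable_LIMSEQ[OF summable_rabs_cancel[OF spd]])
  obtain B0 where B0: "\<And>c x. \<bar>U0 c x\<bar> \<le> B0" "\<And>i c x. \<bar>pd i (U0 c) x\<bar> \<le> B0"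
  proof -
    obtain C1 C2 where C: "BL l C1 (NN 0) (U0 1)" "BL l C2 (NN 0) (U0 2)" using U0 by metis
    have "\<bar>U0 c x\<bar> \<le> C1 + C2 + C1 * NN 0 + C2 * NN 0" "\<bar>pd i (U0 c) x\<bar> \<le> C1 + C2 + C1 * NN 0 + C2 * NN 0" for c i x
    proof -
      have "0 \<le> C1" "0 \<le> C2" "0 \<le> C1 * NN 0" "0 \<le> C2 * NN 0" using BL_nonneg[OF C(1)] BL_nonneg[OF C(2)] by auto
      moreover have "\<bar>U0 1 x\<bar> \<le> C1" "\<bar>U0 2 x\<bar> \<le> C2" "\<bar>pd i (U0 1) x\<bar> \<le> C1 * NN 0" "\<bar>pd i (U0 2) x\<bar> \<le> C2 * NN 0"
        using BL_bound[OF C(1)] BL_bound[OF C(2)] BL_bound[OF BL_pd[OF C(1)]] BL_bound[OF BL_pd[OF C(2)]] by auto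
      ultimately show "\<bar>U0 c x\<bar> \<le> C1 + C2 + C1 * NN 0 + C2 * NN 0" "\<bar>pd i (U0 c) x\<bar> \<le> C1 + C2 + C1 * NN 0 + C2 * NN 0"
        using exhaust_2[of c] by auto
    qed
    then show ?thesis using that by blast
  qed
  \<comment> \<open>A common gradient bound for all stages and for the limit, needed as the
    dominating constant in \<open>weak_solution_limit\<close>.\<close>
  define B where "B = B0 + (\<Sum>m. 6 * wt m)"
  have Ub: "\<bar>pd i (U k c) x\<bar> \<le> B" for i k c x
  proof -
    have "\<bar>\<Sum>m<k. pd i (\<psi> m c) x\<bar> \<le> (\<Sum>m<k. 6 * wt m)"
      by (rule order_trans[OF sum_abs sum_mono]) (rule BL_bound[OF p\<psi>])
    also have "\<dots> \<le> (\<Sum>m. 6 * wt m)" by (rule sum_le_suminf[OF decay(3)]) (use seq_pos(2) in \<open>auto simp: less_imp_le\<close>)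
    finally show ?thesis unfolding pU B_def using B0(2)[of i c x] by linarith
  qed
  have Db: "\<bar>D i c x\<bar> \<le> B" for i c x
    by (rule LIMSEQ_le_const2[OF tendsto_rabs[OF UD]]) (use Ub in auto)
  have close: "\<bar>u c x - U0 c x\<bar> \<le> 4 * w0 / lam0" for c x
  proof -
    have "\<bar>\<Sum>m. \<psi> m c x\<bar> \<le> (\<Sum>m. \<bar>\<psi> m c x\<bar>)" by (rule summable_rabs[OF sp])
    also have "\<dots> \<le> (\<Sum>m. a m)" by (rule suminf_le[OF _ sp sa(1)]) (rule BL_bound[OF \<psi>'])
    also have "\<dots> \<le> 4 * w0 / lam0" using decay(2) by (simp add: a_def)
    finally show ?thesis by (simp add: u_def)
  qed
  have ub: "\<bar>u c x\<bar> \<le> B0 + 4 * w0 / lam0" for c x using close[of c x] B0(1)[of c x] by linarith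
  \<comment> \<open>Hoelder constants of the gradients of the single corrections, from
    \<open>BL_holder\<close>. They are geometric with ratio
    \<open>Q / \<sigma> * \<sigma> powr \<alpha>\<close>, which is below 1 by
    \<open>qs\<close>.\<close>
  define hc where "hc m = 2 * (6 * wt m) * (3 * lam m) powr \<alpha>" for m
  have shc: "summable hc"
  proof -
    have e: "hc m = 12 * w0 * (3 * lam0) powr \<alpha> * (Q / \<sigma> * \<sigma> powr \<alpha>) ^ m" for m
    proof -
      have "(3 * lam m) powr \<alpha> = (3 * lam0) powr \<alpha> * (\<sigma> powr \<alpha>) ^ m"
      proof -
        have "(\<sigma> ^ m) powr \<alpha> = \<sigma> powr (real m * \<alpha>)"
          by (simp only: powr_realpow[OF sigma_pos, symmetric] powr_powr)
        moreover have "(\<sigma> powr \<alpha>) ^ m = \<sigma> powr (real m * \<alpha>)" using sigma_pos by (intro powr_power) auto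
        moreover have "(3 * lam m) powr \<alpha> = (3 * lam0) powr \<alpha> * (\<sigma> ^ m) powr \<alpha>"
          unfolding lam_def mult.assoc[symmetric] by (rule powr_mult)
        ultimately show ?thesis by simp
      qed
      then show ?thesis by (simp only: hc_def wt_def power_mult_distrib) simp
    qed
    have "0 \<le> Q / \<sigma> * \<sigma> powr \<alpha>" using Q_ge sigma_pos by simp
    then show ?thesis unfolding e using qs by (intro summable_mult summable_geometric) auto
  qed
  have hold: "\<exists>C. \<forall>x y. \<bar>D i c x - D i c y\<bar> \<le> C * norm (x - y) powr \<alpha>" for i c
  proof -
    obtain C0 where C0: "BL l C0 (NN 0) (U0 c)" using U0 by blast
    let ?K = "2 * (C0 * NN 0) * (NN 0) powr \<alpha> + (\<Sum>m. hc m)"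
    have "\<bar>D i c x - D i c y\<bar> \<le> ?K * norm (x - y) powr \<alpha>" for x y
    proof -
      let ?d = "\<lambda>m. pd i (\<psi> m c) x - pd i (\<psi> m c) y"
      have b: "\<bar>?d m\<bar> \<le> hc m * norm (x - y) powr \<alpha>" for m
        unfolding hc_def by (rule BL_holder[OF p\<psi> \<alpha>])
      have sh: "summable (\<lambda>m. hc m * norm (x - y) powr \<alpha>)" using shc by (rule summable_mult2)
      have sd: "summable (\<lambda>m. \<bar>?d m\<bar>)" by (rule summable_comparison_test'[OF sh, of 0]) (use b in auto)
      have "D i c x - D i c y = (pd i (U0 c) x - pd i (U0 c) y) + (\<Sum>m. ?d m)"
        unfolding D_def using suminf_diff[of "\<lambda>m. pd i (\<psi> m c) x" "\<lambda>m. pd i (\<psi> m c) y", OF summable_rabs_cancel[OF spd] summable_rabs_cancel[OF spd]] by simp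
      moreover have "\<bar>\<Sum>m. ?d m\<bar> \<le> (\<Sum>m. hc m) * norm (x - y) powr \<alpha>"
      proof -
        have "\<bar>\<Sum>m. ?d m\<bar> \<le> (\<Sum>m. \<bar>?d m\<bar>)" by (rule summable_rabs[OF sd])
        also have "\<dots> \<le> (\<Sum>m. hc m * norm (x - y) powr \<alpha>)" by (rule suminf_le[OF b sd sh])
        also have "\<dots> = (\<Sum>m. hc m) * norm (x - y) powr \<alpha>" by (rule suminf_mult2[OF shc, symmetric])
        finally show ?thesis .
      qed
      moreover have "\<bar>pd i (U0 c) x - pd i (U0 c) y\<bar> \<le> 2 * (C0 * NN 0) * (NN 0) powr \<alpha> * norm (x - y) powr \<alpha>"
        by (rule BL_holder[OF BL_pd[OF C0] \<alpha>])
      ultimately show ?thesis unfolding distrib_right by linarith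
    qed
    then show ?thesis by blast
  qed
  have Dc: "continuous_on UNIV (D i c)" for i c
    using hold[of i c] holder_continuous[OF _ \<alpha>(1)] by blast
  define v :: "real^2 \<Rightarrow> real^2" where "v x = (\<chi> c. u c x)" for x
  have vd: "(v has_derivative (\<lambda>h. \<chi> c. h $ 1 * D 1 c x + h $ 2 * D 2 c x)) (at x)" for x
    unfolding v_def[abs_def] by (intro has_derivative_vec2 ud)
  have pdv: "partial_deriv i v = (\<lambda>x. \<chi> c. D i c x)" for i
  proof
    fix x
    show "partial_deriv i v x = (\<chi> c. D i c x)"
      using partial_deriv_eq[OF vd, of i x] exhaust_2[of i] by (auto simp: vec_eq_iff)
  qed
  have hp: "Hoelder_plane 1 \<alpha> v"
  proof -
    have b1: "bounded (range v)"
    proof -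
      have "norm (v x) \<le> (B0 + 4 * w0 / lam0) + (B0 + 4 * w0 / lam0)" for x
        unfolding v_def by (rule order_trans[OF vec2_norm_le add_mono[OF ub ub]])
      then show ?thesis unfolding bounded_iff by blast
    qed
    have b2: "v differentiable_on UNIV" using vd by (auto simp: differentiable_on_def differentiable_def)
    have b3: "Hoelder_plane 0 \<alpha> (partial_deriv i v)" for i
    proof -
      obtain C1 where C1: "\<And>x y. \<bar>D i 1 x - D i 1 y\<bar> \<le> C1 * norm (x - y) powr \<alpha>" using hold by blast
      obtain C2 where C2: "\<And>x y. \<bar>D i 2 x - D i 2 y\<bar> \<le> C2 * norm (x - y) powr \<alpha>" using hold by blast
      have "bounded (range (\<lambda>x. \<chi> c. D i c x))"
      proof -
        have "norm (\<chi> c. D i c x) \<le> B + B" for x by (rule order_trans[OF vec2_norm_le add_mono[OF Db Db]])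
        then show ?thesis unfolding bounded_iff by blast
      qed
      moreover have "norm ((\<chi> c. D i c x) - (\<chi> c. D i c y)) \<le> (C1 + C2) * norm (x - y) powr \<alpha>" for x y
      proof -
        have e: "(\<chi> c. D i c x) - (\<chi> c. D i c y) = (\<chi> c. D i c x - D i c y)" by (simp add: vec_eq_iff)
        show ?thesis unfolding e distrib_right by (rule order_trans[OF vec2_norm_le add_mono[OF C1 C2]])
      qed
      ultimately show ?thesis unfolding pdv by auto
    qed
    show ?thesis using b1 b2 b3 by simp
  qed
  have gle: "gam (Suc k) / 2 \<le> gam k" and gr: "2 * Q / \<sigma>\<^sup>2 \<le> 1 / 2" "0 \<le> 2 * Q / \<sigma>\<^sup>2" for k
  proof -
    have "4 * Q \<le> \<sigma> * \<sigma>" using Q_ge by (intro mult_mono) auto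
    then show r: "2 * Q / \<sigma>\<^sup>2 \<le> 1 / 2" using sigma_pos by (simp add: divide_le_eq power2_eq_square)
    show "0 \<le> 2 * Q / \<sigma>\<^sup>2" using Q_ge by simp
    have "gam k * (2 * Q / \<sigma>\<^sup>2) \<le> gam k * 1" using r seq_pos(3)[of k] by (intro mult_left_mono) auto
    then have "gam (Suc k) \<le> gam k" unfolding seq_Suc by simp
    then show "gam (Suc k) / 2 \<le> gam k" using seq_pos(3)[of k] by linarith
  qed
  have g0: "gam \<longlonglongrightarrow> 0"
  proof -
    have "(\<lambda>k. gam0 * (2 * Q / \<sigma>\<^sup>2) ^ k) \<longlonglongrightarrow> gam0 * 0"
      by (intro tendsto_mult_left LIMSEQ_power_zero) (use gr in auto)
    then show ?thesis by (simp add: gam_def[abs_def])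
  qed
  have GB: "\<exists>C N. BL l C N (G k c) \<and> C \<le> gam k" for k c
  proof -
    have "BL l (gam k) (NN k) (G k (oth k))" "BL l (gam (Suc k) / 2) (NN k) (G k (dir k))"
      using UG(2)[of k] unfolding state_def prod.case by blast+
    then show ?thesis using dir_oth(4)[of c k] gle[of k] by auto
  qed
  have ws: "weak_solution \<omega> fw (restrict v (closure \<omega>))"
  proof (rule weak_solution_limit[OF \<omega> ud ub Dc Db])
    show "\<exists>C N. BL l C N (U k c)" for k c using UB by blast
    show "(\<lambda>k. pd i (U k c) x) \<longlonglongrightarrow> D i c x" for i c x by (rule UD)
    show "\<bar>pd i (U k c) x\<bar> \<le> B" for k i c x by (rule Ub)
    show "\<exists>C N. BL l C N (G k c)" for k c using GB by blast
    show "\<bar>G k c x\<bar> \<le> gam k" for k c x using GB[of k c] BL_bound by (meson order_trans)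
    show "gam \<longlonglongrightarrow> 0" by (rule g0)
    show "hdet (U k 1) x + hdet (U k 2) x = f k x - pd 1 (pd 1 (G k 1)) x - pd 2 (pd 2 (G k 2)) x" for k x
      using UG(2)[of k] unfolding state_def prod.case by blast
    show "restrict v (closure \<omega>) x = (\<chi> c. u c x)" if "x \<in> \<omega>" for x
      using that closure_subset[of \<omega>] by (auto simp: v_def)
  qed (rule conv)
  show ?thesis using hp ws close by (intro exI[of _ v]) (auto simp: v_def)
qed

end

subsection \<open>Initial data and choice of parameters\<close>

text \<open>\<open>Pm_taylor\<close> needs a band-limited argument and cannot be applied to
  \<open>f\<close>. It is applied instead to \<open>Pm \<nu> f\<close> at scale \<open>\<mu>\<close>
  and to \<open>Pm \<mu> f\<close> at scale \<open>\<nu>\<close>; on subtraction the double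
  mollifications cancel because they commute.\<close>

lemma Pm_difference:
  fixes f :: "real^2 \<Rightarrow> real"
  assumes f: "f \<in> borel_measurable borel" "\<And>x. \<bar>f x\<bar> \<le> F" "\<And>x i. f (x + axis i l) = f x"
    and \<mu>: "0 < \<mu>" "\<mu> \<le> \<nu>"
  shows "\<exists>X Y. BL l (2 * (mom2 * (cP * F)) / \<mu>\<^sup>2) (4 * \<nu>) X \<and> BL l (2 * (mom2 * (cP * F)) / \<mu>\<^sup>2) (4 * \<nu>) Y \<and>
    (\<forall>x. Pm \<nu> f x = Pm \<mu> f x + pd 1 (pd 1 X) x + pd 2 (pd 2 Y) x)"
proof -
  have \<nu>: "0 < \<nu>" using \<mu> by simp
  let ?c = "mom2 * (cP * F)"
  have A: "BL l (cP * F) (4 * \<nu>) (Pm \<nu> f)" by (rule Pm_smooth[OF f \<nu>])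
  have B: "BL l (cP * F) (4 * \<mu>) (Pm \<mu> f)" by (rule Pm_smooth[OF f \<mu>(1)])
  obtain X1 Y1 where 1: "BL l (?c / \<mu>\<^sup>2) (4 * \<nu>) X1" "BL l (?c / \<mu>\<^sup>2) (4 * \<nu>) Y1"
     "\<And>x. Pm \<nu> f x = Pm \<mu> (Pm \<nu> f) x + pd 1 (pd 1 X1) x + pd 2 (pd 2 Y1) x"
    using Pm_taylor[OF A \<mu>(1)] by blast
  obtain X2 Y2 where 2: "BL l (?c / \<nu>\<^sup>2) (4 * \<mu>) X2" "BL l (?c / \<nu>\<^sup>2) (4 * \<mu>) Y2"
     "\<And>x. Pm \<mu> f x = Pm \<nu> (Pm \<mu> f) x + pd 1 (pd 1 X2) x + pd 2 (pd 2 Y2) x"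
    using Pm_taylor[OF B \<nu>] by blast
  have "0 \<le> F" using f(2)[of 0] by linarith
  then have "0 \<le> ?c" using mom2(1) cP_ge_1 by simp
  then have le: "?c / \<nu>\<^sup>2 \<le> ?c / \<mu>\<^sup>2" using \<mu> by (intro divide_left_mono power_mono mult_pos_pos) auto
  have 3: "BL l (?c / \<mu>\<^sup>2) (4 * \<nu>) X2" "BL l (?c / \<mu>\<^sup>2) (4 * \<nu>) Y2"
    using BL_mono[OF 2(1) le] BL_mono[OF 2(2) le] \<mu>(2) by auto
  have m: "BL l (?c / \<mu>\<^sup>2) (4 * \<nu>) (\<lambda>x. - 1 * X2 x)" "BL l (?c / \<mu>\<^sup>2) (4 * \<nu>) (\<lambda>x. - 1 * Y2 x)"
    using BL_cmult[OF 3(1), of "- 1"] BL_cmult[OF 3(2), of "- 1"] by simp_all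
  have e: "?c / \<mu>\<^sup>2 + ?c / \<mu>\<^sup>2 = 2 * ?c / \<mu>\<^sup>2" by (simp add: field_simps)
  have d: "dif X1" "dif Y1" "dif X2" "dif Y2" "dif (pd i X1)" "dif (pd i Y1)" "dif (pd i X2)" "dif (pd i Y2)" for i
    using BL_dif[OF 1(1)] BL_dif[OF 1(2)] BL_dif[OF 2(1)] BL_dif[OF 2(2)]
      BL_dif[OF BL_pd[OF 1(1)]] BL_dif[OF BL_pd[OF 1(2)]] BL_dif[OF BL_pd[OF 2(1)]] BL_dif[OF BL_pd[OF 2(2)]] by blast+
  have p1: "pd 1 (pd 1 (\<lambda>x. X1 x + - 1 * X2 x)) x = pd 1 (pd 1 X1) x - pd 1 (pd 1 X2) x" for x
    by (simp only: pd_dif dif_intros d pd_const; simp)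
  have p2: "pd 2 (pd 2 (\<lambda>x. Y1 x + - 1 * Y2 x)) x = pd 2 (pd 2 Y1) x - pd 2 (pd 2 Y2) x" for x
    by (simp only: pd_dif dif_intros d pd_const; simp)
  have "Pm \<nu> f x = Pm \<mu> f x + pd 1 (pd 1 (\<lambda>x. X1 x + - 1 * X2 x)) x + pd 2 (pd 2 (\<lambda>x. Y1 x + - 1 * Y2 x)) x" for x
    using 1(3)[of x] 2(3)[of x] Pm_commute[OF f(1,2), of \<mu> \<nu> x] unfolding p1 p2 by linarith
  then show ?thesis
    using BL_add[OF 1(1) m(1)] BL_add[OF 1(2) m(2)] unfolding e by blast
qed

text \<open>\<open>f\<close> is merely bounded, so nothing is claimed pointwise. Fubini moves the
  averaging onto the test function, and the correlation \<open>h\<close> of \<open>f\<close> with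
  translates of the test function is continuous at 0.\<close>

lemma Pm_weak_convergence:
  fixes f :: "real^2 \<Rightarrow> real"
  assumes f [measurable]: "f \<in> borel_measurable borel" and b: "\<And>x. \<bar>f x\<bar> \<le> F"
    and \<mu>: "\<And>k. 0 < \<mu> k" "filterlim \<mu> at_top sequentially" and \<phi>: "\<phi> \<in> test_functions \<omega>"
  shows "(\<lambda>k. \<integral>x. Pm (\<mu> k) f x * \<phi> x \<partial>lborel) \<longlonglongrightarrow> (\<integral>x. f x * \<phi> x \<partial>lborel)"
proof -
  have F: "0 \<le> F" using b[of 0] by linarith
  have \<phi>c: "continuous_on UNIV \<phi>" by (rule test_continuous[OF \<phi>])
  have \<phi>m [measurable]: "\<phi> \<in> borel_measurable borel" by (rule borel_measurable_continuous_onI[OF \<phi>c])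
  have \<phi>i: "integrable lborel \<phi>" using integrable_test_mult[OF \<phi>, of "\<lambda>x. 1"] by simp
  define h where "h t = (\<integral>z. f z * \<phi> (z + t) \<partial>lborel)" for t
  have hb: "\<bar>h t\<bar> \<le> F * (\<integral>z. \<bar>\<phi> z\<bar> \<partial>lborel)" for t
  proof -
    have i: "integrable lborel (\<lambda>z. \<phi> (z + t))" by (rule lborel_integral_translate(2)[OF \<phi>m \<phi>i])
    have i2: "integrable lborel (\<lambda>z. f z * \<phi> (z + t))"
      by (rule Bochner_Integration.integrable_bound[of _ "\<lambda>z. F * \<phi> (z + t)"])
        (use i b F in \<open>auto simp: abs_mult intro!: AE_I2 mult_right_mono\<close>)
    have "\<bar>h t\<bar> \<le> (\<integral>z. \<bar>f z * \<phi> (z + t)\<bar> \<partial>lborel)" unfolding h_def by (rule integral_abs_bound)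
    also have "\<dots> \<le> (\<integral>z. F * \<bar>\<phi> (z + t)\<bar> \<partial>lborel)"
    proof (rule integral_mono[OF integrable_abs[OF i2]])
      show "integrable lborel (\<lambda>z. F * \<bar>\<phi> (z + t)\<bar>)" using i by auto
    qed (simp add: abs_mult b mult_right_mono)
    also have "\<dots> = F * (\<integral>z. \<bar>\<phi> z\<bar> \<partial>lborel)"
      using lborel_integral_translate(1)[of "\<lambda>z. \<bar>\<phi> z\<bar>" t] by simp
    finally show ?thesis .
  qed
  have hlim: "(\<lambda>k. h (t k)) \<longlonglongrightarrow> h 0" if t: "t \<longlonglongrightarrow> 0" for t :: "nat \<Rightarrow> real^2"
  proof -
    obtain K where K: "\<And>x. \<bar>\<phi> x\<bar> \<le> K" using test_bounded[OF \<phi>] by blast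
    obtain R where R: "\<And>x. x \<in> closure {x. \<phi> x \<noteq> 0} \<Longrightarrow> norm x \<le> R"
      using compact_imp_bounded[OF test_compact(1)[OF \<phi>]] unfolding bounded_iff by blast
    obtain T where T: "\<And>k. norm (t k) \<le> T" using convergent_imp_Bseq[of t] t by (auto simp: convergent_def Bseq_def)
    have K0: "0 \<le> K" using K[of 0] by linarith
    show ?thesis unfolding h_def
    proof (rule integral_dominated_convergence[where w="\<lambda>z. F * K * indicator (cball 0 (R + T)) z"])
      show "integrable lborel (\<lambda>z::real^2. F * K * indicator (cball 0 (R + T)) z)"
        using emeasure_bounded_finite[OF bounded_cball, of "0::real^2" "R+T"]
        by (intro integrable_mult_right integrable_real_indicator) auto
      show "AE z in lborel. (\<lambda>k. f z * \<phi> (z + t k)) \<longlonglongrightarrow> f z * \<phi> (z + 0)"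
      proof (intro AE_I2 tendsto_mult_left)
        fix z
        have "(\<lambda>k. z + t k) \<longlonglongrightarrow> z + 0" by (intro tendsto_add tendsto_const t)
        moreover have "isCont \<phi> (z + 0)" using \<phi>c by (simp add: continuous_on_eq_continuous_at)
        ultimately show "(\<lambda>k. \<phi> (z + t k)) \<longlonglongrightarrow> \<phi> (z + 0)" by (rule isCont_tendsto_compose[rotated])
      qed
      show "AE z in lborel. norm (f z * \<phi> (z + t k)) \<le> F * K * indicator (cball 0 (R + T)) z" for k
      proof (rule AE_I2)
        fix z
        show "norm (f z * \<phi> (z + t k)) \<le> F * K * indicator (cball 0 (R + T)) z"
        proof (cases "z \<in> cball 0 (R + T)")
          case True
          have "\<bar>f z\<bar> * \<bar>\<phi> (z + t k)\<bar> \<le> F * K" by (intro mult_mono b K F) simp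
          then show ?thesis using True by (simp add: abs_mult)
        next
          case False
          have "norm z \<le> norm (z + t k) + norm (t k)" using norm_triangle_ineq4[of "z + t k" "t k"] by simp
          then have "norm (z + t k) > R" using False T[of k] by simp
          then have "z + t k \<notin> closure {x. \<phi> x \<noteq> 0}" using R[of "z + t k"] by (meson leD)
          from outside_support[OF this] show ?thesis using False by simp
        qed
      qed
    qed measurable
  qed
  have key: "(\<integral>x. Pm (\<mu> k) f x * \<phi> x \<partial>lborel) = (\<integral>y. kn y * h ((1 / \<mu> k) *\<^sub>R y) \<partial>lborel)" for k
  proof -
    let ?g = "\<lambda>x y. (kn y * f (x - (1 / \<mu> k) *\<^sub>R y)) * \<phi> x"
    have i1: "integrable lborel (\<lambda>y. ?g x y)" for x
      using Pm_integrable[OF f b, of x "\<mu> k"] by simp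
    have i2: "integrable lborel (\<lambda>x. \<integral>y. norm (?g x y) \<partial>lborel)"
    proof (rule Bochner_Integration.integrable_bound[of _ "\<lambda>x. F * \<phi> x"])
      have "(\<integral>y. norm (?g x y) \<partial>lborel) \<le> F * \<bar>\<phi> x\<bar>" for x
      proof -
        have "(\<integral>y. norm (?g x y) \<partial>lborel) \<le> (\<integral>y. kn y * (F * \<bar>\<phi> x\<bar>) \<partial>lborel)"
        proof (rule integral_mono)
          show "integrable lborel (\<lambda>y. norm (?g x y))" using i1[of x] by (rule integrable_norm)
          show "integrable lborel (\<lambda>y. kn y * (F * \<bar>\<phi> x\<bar>))" using kn_integrable(1) by simp
          show "norm (?g x y) \<le> kn y * (F * \<bar>\<phi> x\<bar>)" for y
            using mult_left_mono[OF mult_right_mono[OF b[of "x - (1 / \<mu> k) *\<^sub>R y"], of "\<bar>\<phi> x\<bar>"] kn_nonneg[of y]]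
            by (simp add: abs_mult kn_nonneg mult_ac)
        qed
        then show ?thesis by (simp add: kn_integral)
      qed
      then show "AE x in lborel. norm (\<integral>y. norm (?g x y) \<partial>lborel) \<le> norm (F * \<phi> x)"
        using F by (intro AE_I2) (simp add: integral_nonneg_AE abs_mult)
    qed (use \<phi>i in auto)
    have "integrable (lborel \<Otimes>\<^sub>M lborel) (\<lambda>(x, y). ?g x y)"
      by (rule lborel_pair.Fubini_integrable) (use i1 i2 in auto)
    from lborel_pair.Fubini_integral[OF this]
    have "(\<integral>y. (\<integral>x. ?g x y \<partial>lborel) \<partial>lborel) = (\<integral>x. (\<integral>y. ?g x y \<partial>lborel) \<partial>lborel)" by simp
    moreover have "(\<integral>y. ?g x y \<partial>lborel) = Pm (\<mu> k) f x * \<phi> x" for x by (simp add: Pm_def)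
    moreover have "(\<integral>x. ?g x y \<partial>lborel) = kn y * h ((1 / \<mu> k) *\<^sub>R y)" for y
    proof -
      have "(\<integral>x. ?g x y \<partial>lborel) = kn y * (\<integral>x. f (x - (1 / \<mu> k) *\<^sub>R y) * \<phi> x \<partial>lborel)"
        by (simp only: mult.assoc integral_mult_right_zero)
      also have "(\<integral>x. f (x - (1 / \<mu> k) *\<^sub>R y) * \<phi> x \<partial>lborel) = h ((1 / \<mu> k) *\<^sub>R y)"
        using lborel_integral_translate(1)[of "\<lambda>x. f (x - (1 / \<mu> k) *\<^sub>R y) * \<phi> x" "(1 / \<mu> k) *\<^sub>R y"]
        by (simp add: h_def)
      finally show ?thesis .
    qed
    ultimately show ?thesis by (simp only:)
  qed
  have hm: "h \<in> borel_measurable borel" unfolding h_def[abs_def] by measurable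
  have "(\<lambda>k. \<integral>y. kn y * h ((1 / \<mu> k) *\<^sub>R y) \<partial>lborel) \<longlonglongrightarrow> (\<integral>y. kn y * h 0 \<partial>lborel)"
  proof (rule integral_dominated_convergence[where w="\<lambda>y. kn y * (F * (\<integral>z. \<bar>\<phi> z\<bar> \<partial>lborel))"])
    note [measurable] = hm
    show "(\<lambda>y. kn y * h 0) \<in> borel_measurable lborel" by measurable
    show "(\<lambda>y. kn y * h ((1 / \<mu> k) *\<^sub>R y)) \<in> borel_measurable lborel" for k by measurable
    show "integrable lborel (\<lambda>y. kn y * (F * (\<integral>z. \<bar>\<phi> z\<bar> \<partial>lborel)))" using kn_integrable(1) by simp
    show "AE y in lborel. (\<lambda>k. kn y * h ((1 / \<mu> k) *\<^sub>R y)) \<longlonglongrightarrow> kn y * h 0"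
    proof (intro AE_I2 tendsto_mult_left hlim)
      fix y :: "real^2"
      have "(\<lambda>k. inverse (\<mu> k)) \<longlonglongrightarrow> 0" by (rule tendsto_inverse_0_at_top[OF \<mu>(2)])
      then have "(\<lambda>k. inverse (\<mu> k) *\<^sub>R y) \<longlonglongrightarrow> 0 *\<^sub>R y" by (intro tendsto_scaleR tendsto_const)
      then show "(\<lambda>k. (1 / \<mu> k) *\<^sub>R y) \<longlonglongrightarrow> 0" by (simp add: inverse_eq_divide)
    qed
    show "AE y in lborel. norm (kn y * h ((1 / \<mu> k) *\<^sub>R y)) \<le> kn y * (F * (\<integral>z. \<bar>\<phi> z\<bar> \<partial>lborel))" for k
      using hb kn_nonneg by (intro AE_I2) (simp add: abs_mult mult_left_mono)
  qed
  then show ?thesis unfolding key by (simp add: kn_integral h_def)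
qed

text \<open>The reduction to the fundamental cell \<open>[- l / 2, l / 2)\<close> in each variable.\<close>

definition red :: "real \<Rightarrow> real^2 \<Rightarrow> real^2" where
  "red l x = (\<chi> i. x $ i - l * of_int \<lfloor>(x $ i + l/2) / l\<rfloor>)"

lemma red_measurable [measurable]: "red l \<in> borel_measurable borel"
proof (rule borel_measurable_euclidean_space[THEN iffD2], rule ballI)
  fix b :: "real^2" assume "b \<in> Basis"
  then obtain i where b: "b = axis i 1" by (auto simp: Basis_vec_def)
  have "(\<lambda>x::real^2. x $ i) \<in> borel_measurable borel"
    by (rule borel_measurable_continuous_onI) (intro continuous_intros)
  then show "(\<lambda>x. red l x \<bullet> b) \<in> borel_measurable borel"
    unfolding b by (simp add: inner_axis red_def)
qed

lemma red_periodic: "0 < l \<Longrightarrow> red l (x + axis i l) = red l x"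
proof -
  assume l: "0 < l"
  have "(x + axis i l) $ j - l * of_int \<lfloor>((x + axis i l) $ j + l/2) / l\<rfloor> = x $ j - l * of_int \<lfloor>(x $ j + l/2) / l\<rfloor>" for j
  proof (cases "j = i")
    case True
    have e: "(x $ i + l + l/2) / l = (x $ i + l/2) / l + of_int 1" using l by (simp add: field_simps)
    show ?thesis unfolding True vector_add_component axis_nth e floor_add_int
      by (simp add: distrib_left)
  qed (simp add: axis_def)
  then show ?thesis by (simp add: red_def vec_eq_iff)
qed

lemma red_eq: assumes "0 < l" "\<And>i. \<bar>x $ i\<bar> < l/2" shows "red l x = x"
proof -
  have "\<lfloor>(x $ i + l/2) / l\<rfloor> = 0" for i
    using assms(1) assms(2)[of i] by (intro floor_unique) (auto simp: field_simps)
  then show ?thesis by (simp add: red_def vec_eq_iff)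
qed

text \<open>Shows that points near the corner \<open>(l/2, l/2)\<close> of the cell are reduced to
  points outside a domain lying within \<open>l/8\<close> of the origin in each coordinate. On the
  stated range only shifts by -1, 0 or 1 periods occur.\<close>

lemma red_far: assumes "0 < l" "l/8 < \<bar>x $ i\<bar>" "\<bar>x $ i\<bar> < 7*l/8" shows "l/8 < \<bar>red l x $ i\<bar>"
proof -
  define n where "n = \<lfloor>(x $ i + l/2) / l\<rfloor>"
  have 1: "l * of_int n \<le> x $ i + l/2" "x $ i + l/2 < l * (of_int n + 1)"
  proof -
    have "of_int n \<le> (x $ i + l/2) / l" "(x $ i + l/2) / l < of_int n + 1" unfolding n_def by linarith+
    then show "l * of_int n \<le> x $ i + l/2" "x $ i + l/2 < l * (of_int n + 1)"
      using assms(1) by (simp_all only: pos_le_divide_eq pos_divide_less_eq mult.commute)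
  qed
  have "l * of_int n < l * 2" using 1 assms by linarith
  moreover have "l * (-2) < l * of_int n" using 1(2)[unfolded distrib_left] assms by linarith
  ultimately have "of_int n < (2::real)" "(-2::real) < of_int n"
    using mult_less_cancel_left_pos[OF assms(1)] by blast+
  then have "n = -1 \<or> n = 0 \<or> n = 1" by linarith
  moreover have "red l x $ i = x $ i - l * of_int n" by (simp add: red_def n_def)
  ultimately show ?thesis using assms 1 by (elim disjE) simp_all
qed

text \<open>The value of the extension outside the domain is a constant adjusted to make the mean over a period vanish;
  at low frequency the mollification sees nothing but this mean.\<close>

lemma periodic_extension:
  fixes f :: "real^2 \<Rightarrow> real"
  assumes \<omega>: "open \<omega>" "\<And>x i. x \<in> \<omega> \<Longrightarrow> \<bar>x $ i\<bar> < l/8" and l: "0 < l" and f: "f \<in> L_infty \<omega>"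
  shows "\<exists>g F. g \<in> borel_measurable borel \<and> (\<forall>x. \<bar>g x\<bar> \<le> F) \<and> (\<forall>x i. g (x + axis i l) = g x) \<and>
    (\<forall>x. Pm (1 / (8 * l)) g x = 0) \<and>
    (\<forall>\<phi>\<in>test_functions \<omega>. (LINT x|lebesgue_on \<omega>. f x * \<phi> x) = (\<integral>x. g x * \<phi> x \<partial>lborel))"
proof -
  obtain C where fm: "f \<in> borel_measurable (lebesgue_on \<omega>)" and C: "AE x in lebesgue_on \<omega>. \<bar>f x\<bar> \<le> C"
    using f unfolding L_infty_def by blast
  have \<omega>m [measurable]: "\<omega> \<in> sets borel" using \<omega>(1) by simp
  have \<omega>l: "\<omega> \<in> sets lebesgue" using \<omega>(1) by simp
  define f0 where "f0 x = (if x \<in> \<omega> then f x else 0)" for x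
  have "f0 \<in> borel_measurable lebesgue"
    unfolding f0_def[abs_def] using fm \<omega>l borel_measurable_if by blast
  \<comment> \<open>A Lebesgue measurable function agrees almost everywhere with a Borel measurable
    one. The truncation below turns the essential bound into a bound at every point, as the
    mollifier lemmas require.\<close>
  then obtain g0 where g0 [measurable]: "g0 \<in> borel_measurable borel" and g0f: "AE x in lborel. f0 x = g0 x"
    using completion_ex_borel_measurable_real[of f0 lborel] by auto
  define C' where "C' = max C 0"
  define g1 where "g1 x = max (- C') (min C' (g0 x))" for x
  have g1m [measurable]: "g1 \<in> borel_measurable borel" unfolding g1_def[abs_def] by measurable
  have g1b: "\<bar>g1 x\<bar> \<le> C'" for x unfolding g1_def C'_def by auto
  define a where "a x = indicator \<omega> (red l x) * g1 (red l x)" for x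
  define b where "b x = (1 - indicator \<omega> (red l x) :: real)" for x
  \<comment> \<open>At this scale a mollification has type \<open>4 * n0 = 1 / (2 * l)\<close>,
    hence is constant by \<open>BL_low_frequency_const\<close>; vanishing at one point then
    suffices.\<close>
  define n0 where "n0 = 1 / (8 * l)"
  have n0: "0 < n0" using l by (simp add: n0_def)
  have am [measurable]: "a \<in> borel_measurable borel" unfolding a_def[abs_def] by measurable
  have bm [measurable]: "b \<in> borel_measurable borel" unfolding b_def[abs_def] by measurable
  have ab: "\<bar>a x\<bar> \<le> C'" for x using g1b[of "red l x"] by (auto simp: a_def indicator_def C'_def)
  have b0: "0 \<le> b x" "\<bar>b x\<bar> \<le> 1" for x by (auto simp: b_def indicator_def)
  have per: "a (x + axis i l) = a x" "b (x + axis i l) = b x" for x i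
    unfolding a_def b_def red_periodic[OF l] by simp_all
  \<comment> \<open>A corner of the fundamental cell. Around it \<open>b\<close> equals 1, so the
    mollification of \<open>b\<close> is positive there and can serve as a divisor.\<close>
  define x0 :: "real^2" where "x0 = (\<chi> i. l/2)"
  have "0 < Pm n0 b x0"
  proof -
    let ?U = "ball (0::real^2) (n0 * (l/8))"
    have "0 < (\<integral>y. K2 0 0 y * indicator ?U y \<partial>lborel)" using n0 l by (intro K2_integral_pos) auto
    then have "0 < (\<integral>y. kn y * indicator ?U y \<partial>lborel)"
      using Z_pos by (simp add: kn_def)
    also have "\<dots> \<le> Pm n0 b x0" unfolding Pm_def
    proof (rule integral_mono)
      show "integrable lborel (\<lambda>y. kn y * indicator ?U y)"
        using kn_integrable(1) by (intro integrable_real_mult_indicator) auto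
      show "integrable lborel (\<lambda>y. kn y * b (x0 - (1 / n0) *\<^sub>R y))" by (rule Pm_integrable[OF bm b0(2)])
      show "kn y * indicator ?U y \<le> kn y * b (x0 - (1 / n0) *\<^sub>R y)" for y
      proof (rule mult_left_mono[OF _ kn_nonneg])
        show "indicator ?U y \<le> b (x0 - (1 / n0) *\<^sub>R y)"
        proof (cases "y \<in> ?U")
          case True
          have "norm ((1 / n0) *\<^sub>R y) < l / 8" using True n0 by (simp add: field_simps)
          then have t: "\<bar>((1 / n0) *\<^sub>R y) $ 1\<bar> < l / 8" using component_le_norm_cart[of "(1 / n0) *\<^sub>R y" 1] by linarith
          have e: "(x0 - (1 / n0) *\<^sub>R y) $ 1 = l/2 - ((1 / n0) *\<^sub>R y) $ 1" by (simp add: x0_def)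
          have "l/8 < \<bar>l/2 - t\<bar>" "\<bar>l/2 - t\<bar> < 7*l/8" if "\<bar>t\<bar> < l / 8" for t :: real
            using that l by linarith+
          from this[OF t] have "l/8 < \<bar>(x0 - (1 / n0) *\<^sub>R y) $ 1\<bar>" "\<bar>(x0 - (1 / n0) *\<^sub>R y) $ 1\<bar> < 7*l/8"
            by (simp_all only: e)
          from red_far[OF l this] have "red l (x0 - (1 / n0) *\<^sub>R y) \<notin> \<omega>" using \<omega>(2) by (meson not_less_iff_gr_or_eq)
          then show ?thesis using True by (simp add: b_def)
        qed (use b0(1) in simp)
      qed
    qed
    finally show ?thesis .
  qed
  note bpos = this
  define s where "s = - (Pm n0 a x0 / Pm n0 b x0)"
  define g where "g x = a x + s * b x" for x
  have gm: "g \<in> borel_measurable borel" unfolding g_def[abs_def] by measurable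
  have gb: "\<bar>g x\<bar> \<le> C' + \<bar>s\<bar>" for x
  proof -
    have "\<bar>s * b x\<bar> \<le> \<bar>s\<bar>" using mult_left_mono[OF b0(2)[of x], of "\<bar>s\<bar>"] by (simp add: abs_mult)
    then show ?thesis using ab[of x] unfolding g_def by linarith
  qed
  have gp: "g (x + axis i l) = g x" for x i unfolding g_def per by simp
  have lin: "Pm n0 g x0 = Pm n0 a x0 + s * Pm n0 b x0"
  proof -
    have "Pm n0 g x0 = (\<integral>y. kn y * a (x0 - (1 / n0) *\<^sub>R y) + s * (kn y * b (x0 - (1 / n0) *\<^sub>R y)) \<partial>lborel)"
      unfolding Pm_def g_def by (simp add: algebra_simps)
    also have "\<dots> = Pm n0 a x0 + s * Pm n0 b x0" unfolding Pm_def
      using Pm_integrable[OF am ab, of x0 n0] Pm_integrable[OF bm b0(2), of x0 n0]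
      by (subst Bochner_Integration.integral_add) auto
    finally show ?thesis .
  qed
  then have z0: "Pm n0 g x0 = 0" using bpos by (simp add: s_def)
  have z: "Pm n0 g x = 0" for x
  proof -
    have "BL l (cP * (C' + \<bar>s\<bar>)) (4 * n0) (Pm n0 g)" by (rule Pm_smooth[OF gm gb gp n0])
    then have "Pm n0 g x = Pm n0 g x0" using l by (rule BL_low_frequency_const) (use l in \<open>simp add: n0_def\<close>)
    then show ?thesis using z0 by simp
  qed
  have "(LINT x|lebesgue_on \<omega>. f x * \<phi> x) = (\<integral>x. g x * \<phi> x \<partial>lborel)" if \<phi>: "\<phi> \<in> test_functions \<omega>" for \<phi>
  proof -
    have \<phi>0: "\<phi> x = 0" if "x \<notin> \<omega>" for x
      using outside_support[of x \<phi>] \<phi> that unfolding test_functions_def by blast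
    have \<phi>m [measurable]: "\<phi> \<in> borel_measurable borel"
      by (rule borel_measurable_continuous_onI[OF test_continuous[OF \<phi>]])
    have C0: "AE x in lborel. x \<in> \<omega> \<longrightarrow> \<bar>f x\<bar> \<le> C"
      using C \<omega>l by (simp add: AE_restrict_space_iff AE_completion_iff)
    have ae: "AE x in lborel. g0 x * \<phi> x = g x * \<phi> x"
      using C0 g0f
    proof eventually_elim
      case (elim x)
      show ?case
      proof (cases "x \<in> \<omega>")
        case True
        have "red l x = x" by (rule red_eq[OF l]) (rule order.strict_trans[OF \<omega>(2)[OF True]], use l in simp)
        then have "g x = g1 x" using True by (simp add: g_def a_def b_def)
        moreover have "g0 x = f x" using elim True by (simp add: f0_def)
        ultimately show ?thesis using elim True by (auto simp: g1_def C'_def)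
      qed (simp add: \<phi>0)
    qed
    have "(LINT x|lebesgue_on \<omega>. f x * \<phi> x) = (LINT x|lebesgue_on \<omega>. g0 x * \<phi> x)"
    proof (rule integral_cong_AE)
      show "(\<lambda>x. f x * \<phi> x) \<in> borel_measurable (lebesgue_on \<omega>)"
        by (rule borel_measurable_times[OF fm], intro measurable_restrict_space1 measurable_completion) auto
      show "(\<lambda>x. g0 x * \<phi> x) \<in> borel_measurable (lebesgue_on \<omega>)"
        by (intro measurable_restrict_space1 measurable_completion) auto
      have "AE x in lebesgue. f0 x = g0 x" using g0f by (rule AE_completion)
      then have "AE x in lebesgue. x \<in> \<omega> \<longrightarrow> f x * \<phi> x = g0 x * \<phi> x"
        by eventually_elim (auto simp: f0_def)
      then show "AE x in lebesgue_on \<omega>. f x * \<phi> x = g0 x * \<phi> x"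
        using \<omega>l by (simp add: AE_restrict_space_iff)
    qed
    also have "\<dots> = (\<integral>x. g0 x * \<phi> x \<partial>lborel)"
      by (rule lebesgue_on_test[OF \<omega>(1)]) (auto simp: \<phi>0)
    also have "\<dots> = (\<integral>x. g x * \<phi> x \<partial>lborel)" using ae gm by (intro integral_cong_AE) auto
    finally show ?thesis .
  qed
  then show ?thesis using gm gb gp z unfolding n0_def by blast
qed

text \<open>\<open>det \<nabla>\<^sup>2 u = - (\<partial>\<^sub>1\<^sub>1 (\<partial>\<^sub>2 u)\<^sup>2 + \<partial>\<^sub>2\<^sub>2 (\<partial>\<^sub>1 u)\<^sup>2) / 2 + \<partial>\<^sub>1\<^sub>2 (\<partial>\<^sub>1 u \<partial>\<^sub>2 u)\<close>\<close>

lemma hdet_divergence: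
  assumes u: "BL l C N u" and l: "0 < l"
  shows "\<exists>A B C' N'. BL l C' N' A \<and> BL l C' N' B \<and> (\<forall>x. hdet u x = pd 1 (pd 1 A) x + pd 2 (pd 2 B) x)"
proof -
  have q: "BL l (C*N*(C*N)) (N+N) (\<lambda>x. pd i u x * pd j u x)" for i j by (rule BL_mult[OF BL_pd[OF u] BL_pd[OF u]])
  \<comment> \<open>Any number of octaves is affordable here: the decomposition concerns the initial
    functions only, and the resulting constant is later absorbed by the choice of
    \<open>H0\<close>.\<close>
  obtain j where j: "N + N \<le> 2^j * (1 / (2*l))"
  proof -
    obtain j where "(N + N) * (2 * l) < 2^j" using real_arch_pow[of 2 "(N+N)*(2*l)"] by auto
    then show ?thesis using that[of j] l by (simp add: field_simps)
  qed
  have S: "0 \<le> C*N*(C*N)" using BL_nonneg[OF q] by blast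
  have "C*N*(C*N) \<le> cP * (C*N*(C*N))" using mult_right_mono[OF cP_ge_1 S] by simp
  then have G: "BL l (cP * (C*N*(C*N))) (2^j * (1 / (2*l))) (\<lambda>x. pd 1 u x * pd 2 u x)"
    using BL_mono[OF q] j by blast
  have "\<bar>pd 1 u x * pd 2 u x\<bar> \<le> C*N*(C*N)" for x by (rule BL_bound[OF q])
  from mixed_decomposition[OF l this G] obtain X Y where
    X: "BL l (64*mom2*cP*real j*(C*N*(C*N))) (2^j * (1 / (2*l))) X" and
    Y: "BL l (64*mom2*cP*real j*(C*N*(C*N))) (2^j * (1 / (2*l))) Y" and
    XY: "\<And>x. pd 1 (pd 2 (\<lambda>x. pd 1 u x * pd 2 u x)) x = pd 1 (pd 1 X) x + pd 2 (pd 2 Y) x" by blast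
  let ?N = "2^j * (1 / (2*l))" and ?D = "64*mom2*cP*real j*(C*N*(C*N))"
  have q': "BL l (C*N*(C*N)) ?N (\<lambda>x. pd i u x * pd i u x)" for i using BL_mono[OF q order.refl j] .
  have A: "BL l (?D + \<bar>-1/2\<bar> * (C*N*(C*N))) ?N (\<lambda>x. X x + (-1/2) * (pd 2 u x * pd 2 u x))"
    by (rule BL_add[OF X BL_cmult[OF q']])
  have B: "BL l (?D + \<bar>-1/2\<bar> * (C*N*(C*N))) ?N (\<lambda>x. Y x + (-1/2) * (pd 1 u x * pd 1 u x))"
    by (rule BL_add[OF Y BL_cmult[OF q']])
  have d: "dif u" "dif (pd i u)" "dif (pd i (pd k u))" "dif (pd i (pd k (pd m u)))"
    "dif X" "dif Y" "dif (pd i X)" "dif (pd i Y)" for i k m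
    using BL_dif[OF u] BL_dif[OF BL_pd[OF u]] BL_dif[OF BL_pd[OF BL_pd[OF u]]] BL_dif[OF BL_pd[OF BL_pd[OF BL_pd[OF u]]]]
      BL_dif[OF X] BL_dif[OF Y] BL_dif[OF BL_pd[OF X]] BL_dif[OF BL_pd[OF Y]] by blast+
  have "hdet u x = pd 1 (pd 1 (\<lambda>x. X x + (-1/2) * (pd 2 u x * pd 2 u x))) x
     + pd 2 (pd 2 (\<lambda>x. Y x + (-1/2) * (pd 1 u x * pd 1 u x))) x" for x
  proof -
    have c: "pd 2 (pd 1 v) y = pd 1 (pd 2 v) y" if "BL l C' N' v" for v y C' N' by (rule fun_cong[OF BL_pd_commute[OF that]])
    have c1: "pd 2 (pd 1 u) = pd 1 (pd 2 u)" using c[OF u] by blast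
    have c2: "pd 2 (pd 1 (pd 1 u)) = pd 1 (pd 1 (pd 2 u))" using c[OF BL_pd[OF u]] c1 by auto
    have c3: "pd 2 (pd 1 (pd 2 u)) = pd 1 (pd 2 (pd 2 u))" using c[OF BL_pd[OF u]] by auto
    have e1: "pd 1 (pd 1 (\<lambda>x. X x + (-1/2) * (pd 2 u x * pd 2 u x))) x = pd 1 (pd 1 X) x
        - (pd 1 (pd 1 (pd 2 u)) x * pd 2 u x + pd 1 (pd 2 u) x * pd 1 (pd 2 u) x)"
      by (simp only: pd_dif dif_intros d pd_const; simp add: algebra_simps)
    have e2: "pd 2 (pd 2 (\<lambda>x. Y x + (-1/2) * (pd 1 u x * pd 1 u x))) x = pd 2 (pd 2 Y) x
        - (pd 1 (pd 2 (pd 2 u)) x * pd 1 u x + pd 1 (pd 2 u) x * pd 1 (pd 2 u) x)"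
      by (simp only: pd_dif dif_intros d pd_const c1 c3; simp add: algebra_simps)
    have e3: "pd 1 (pd 2 (\<lambda>x. pd 1 u x * pd 2 u x)) x =
        pd 1 (pd 1 (pd 2 u)) x * pd 2 u x + pd 1 (pd 2 u) x * pd 1 (pd 2 u) x
        + pd 1 (pd 1 u) x * pd 2 (pd 2 u) x + pd 1 u x * pd 1 (pd 2 (pd 2 u)) x"
      by (simp only: pd_dif dif_intros d pd_const c1 c2 c3; simp add: algebra_simps)
    show ?thesis unfolding e1 e2 hdet_def using XY[of x] unfolding e3
      by (simp add: power2_eq_square algebra_simps)
  qed
  then show ?thesis using A B by blast
qed

section \<open>Choosing the frequencies\<close>

lemma eventually_linear_le_square:
  fixes A B D :: real
  assumes "0 < D"
  shows "eventually (\<lambda>n. A + B * real n \<le> D * (real n)\<^sup>2) sequentially"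
proof -
  obtain m :: nat where m: "(\<bar>A\<bar> + \<bar>B\<bar>) / D < real m" using reals_Archimedean2 by blast
  have "A + B * real n \<le> D * (real n)\<^sup>2" if n: "n \<ge> max 1 m" for n
  proof -
    have n': "1 \<le> real n" "real m \<le> real n" using n by auto
    have "(\<bar>A\<bar> + \<bar>B\<bar>) / D \<le> real n" using m n'(2) by linarith
    then have "\<bar>A\<bar> + \<bar>B\<bar> \<le> D * real n" by (simp only: pos_divide_le_eq[OF assms] mult.commute)
    then have "(\<bar>A\<bar> + \<bar>B\<bar>) * real n \<le> D * real n * real n" by (rule mult_right_mono) simp
    moreover have "A \<le> \<bar>A\<bar> * real n" using mult_left_mono[OF n'(1), of "\<bar>A\<bar>"] by linarith
    moreover have "B * real n \<le> \<bar>B\<bar> * real n" by (rule mult_right_mono) auto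
    ultimately show ?thesis by (simp add: power2_eq_square distrib_right mult.assoc)
  qed
  then show ?thesis unfolding eventually_sequentially by blast
qed

lemma eventually_le_linear:
  fixes A D :: real
  assumes "0 < D"
  shows "eventually (\<lambda>n. A \<le> D * real n) sequentially"
proof -
  obtain m :: nat where m: "A / D < real m" using reals_Archimedean2 by blast
  have "A \<le> D * real n" if "n \<ge> m" for n
  proof -
    have "A / D \<le> real n" using m that by (meson less_imp_le of_nat_mono order_less_le_trans)
    then show ?thesis using assms by (simp add: pos_divide_le_eq mult.commute)
  qed
  then show ?thesis unfolding eventually_sequentially by blast
qed

lemma real_le_power2: "x \<le> 2 ^ nat \<lceil>x\<rceil>" for x :: real
proof -
  have "x \<le> real (nat \<lceil>x\<rceil>)" by linarith
  also have "\<dots> \<le> 2 ^ nat \<lceil>x\<rceil>" using less_exp[of "nat \<lceil>x\<rceil>"] by (metis less_imp_le of_nat_le_iff of_nat_numeral of_nat_power)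
  finally show ?thesis .
qed

text \<open>\<open>J\<close> is the least number of octaves above \<open>1 / (2 * l)\<close> that
  reaches twice the old type. It exceeds that type by a factor 2 at most, which stays below the new
  one because \<open>\<sigma>\<close> is large, and it grows linearly in \<open>k\<close>. The
  factor \<open>(2 / 2400)^k\<close> beats this growth, so \<open>small\<close>, a condition at
  stage 0, covers all stages.\<close>

lemma dyadic_scale:
  fixes l \<sigma> lam0 w0 gam0 c :: real
  assumes l: "0 < l" and \<sigma>: "2400 \<le> \<sigma>" and pos: "0 < lam0" "0 < w0" "0 < gam0" "0 \<le> c"
    and N0: "1 \<le> 12 * l * lam0 / \<sigma>"
    and small: "4 * gam0 * (2 + c * (24 * l * lam0 / \<sigma> + 1 + \<sigma> + 1)) / w0\<^sup>2 \<le> 2400\<^sup>2 / \<sigma>^4"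
  shows "\<exists>J. 2 * (3 * (lam0 * \<sigma>^k) / \<sigma>) \<le> 2 ^ J * (1 / (2 * l)) \<and> 2 ^ J * (1 / (2 * l)) \<le> 3 * (lam0 * \<sigma>^k)
      \<and> 4 * (gam0 * (2 * 2400 / \<sigma>\<^sup>2)^k / (w0 * (2400 / \<sigma>)^k)\<^sup>2) * (2 + c * real J) \<le> 2400\<^sup>2 / \<sigma>^4"
proof -
  have s0: "0 < \<sigma>" using \<sigma> by simp
  \<comment> \<open>Twice the initial type, measured in units of \<open>1 / (2 * l)\<close>. Being
    at least 1, it keeps the overshoot below a factor 2 also in the case
    \<open>J = 0\<close>.\<close>
  define P where "P = 12 * l * lam0 / \<sigma>"
  have P1: "1 \<le> P * \<sigma>^k"
  proof -
    have "1 \<le> \<sigma>^k" using \<sigma> by (intro one_le_power) simp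
    from mult_mono[OF N0 this] show ?thesis using N0 by (simp add: P_def)
  qed
  define S where "S = {j::nat. P * \<sigma>^k \<le> 2^j}"
  obtain j0 where "P * \<sigma>^k < 2^j0" using real_arch_pow[of 2 "P * \<sigma>^k"] by auto
  then have ne: "j0 \<in> S" by (simp add: S_def)
  define J where "J = (LEAST j. P * \<sigma>^k \<le> 2^j)"
  have J1: "P * \<sigma>^k \<le> 2^J" unfolding J_def by (rule LeastI[of _ j0]) (use ne S_def in auto)
  have J2: "2^J \<le> 2 * (P * \<sigma>^k)"
  proof (cases J)
    case 0 then show ?thesis using P1 by simp
  next
    case (Suc i)
    have "\<not> P * \<sigma>^k \<le> 2^i" by (rule not_less_Least) (use Suc J_def in simp)
    then show ?thesis using Suc by simp
  qed
  have Jle: "real J \<le> 2 * P + 1 + (\<sigma> + 1) * real k"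
  proof -
    have "P \<le> 2 ^ nat \<lceil>2 * P\<rceil>" using real_le_power2[of "2*P"] N0 unfolding P_def[symmetric] by linarith
    moreover have "\<sigma>^k \<le> (2 ^ nat \<lceil>\<sigma>\<rceil>)^k" using s0 real_le_power2[of \<sigma>] by (intro power_mono) auto
    ultimately have "P * \<sigma>^k \<le> 2 ^ nat \<lceil>2 * P\<rceil> * (2 ^ nat \<lceil>\<sigma>\<rceil>)^k"
      using s0 by (intro mult_mono) auto
    also have "\<dots> = 2 ^ (nat \<lceil>2 * P\<rceil> + nat \<lceil>\<sigma>\<rceil> * k)" by (simp add: power_add power_mult)
    finally have "J \<le> nat \<lceil>2 * P\<rceil> + nat \<lceil>\<sigma>\<rceil> * k" unfolding J_def by (rule Least_le)
    then have "real J \<le> real (nat \<lceil>2 * P\<rceil>) + real (nat \<lceil>\<sigma>\<rceil>) * real k" by (simp flip: of_nat_mult of_nat_add)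
    also have "real (nat \<lceil>2 * P\<rceil>) \<le> 2 * P + 1" using N0 unfolding P_def[symmetric] by linarith
    also have "real (nat \<lceil>\<sigma>\<rceil>) * real k \<le> (\<sigma> + 1) * real k" using s0 by (intro mult_right_mono) linarith+
    finally show ?thesis by simp
  qed
  have a: "2 * (3 * (lam0 * \<sigma>^k) / \<sigma>) = P * \<sigma>^k * (1 / (2 * l))" using l s0 by (simp add: P_def field_simps)
  have b: "2 * (P * \<sigma>^k) * (1 / (2 * l)) = 12 / \<sigma> * (lam0 * \<sigma>^k)" using l s0 by (simp add: P_def field_simps)
  have "12 / \<sigma> \<le> 3" using \<sigma> by (simp add: divide_simps)
  then have b': "12 / \<sigma> * (lam0 * \<sigma>^k) \<le> 3 * (lam0 * \<sigma>^k)" using pos s0 by (intro mult_right_mono) auto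
  have G1: "2 * (3 * (lam0 * \<sigma>^k) / \<sigma>) \<le> 2 ^ J * (1 / (2 * l))" unfolding a using J1 l by (intro mult_right_mono) auto
  have "2 ^ J * (1 / (2 * l)) \<le> 2 * (P * \<sigma>^k) * (1 / (2 * l))" using J2 l by (intro mult_right_mono) auto
  then have G2: "2 ^ J * (1 / (2 * l)) \<le> 3 * (lam0 * \<sigma>^k)" using b b' by linarith
  \<comment> \<open>The powers of \<open>\<sigma>\<close> cancel in the quotient of the defect and
    the squared amplitude; the decay left over is the same for every
    \<open>\<sigma>\<close>.\<close>
  have r: "gam0 * (2 * 2400 / \<sigma>\<^sup>2)^k / (w0 * (2400 / \<sigma>)^k)\<^sup>2 = gam0 / w0\<^sup>2 * (2 / 2400)^k"
  proof -
    have "(2 * 2400 / \<sigma>\<^sup>2)^k = ((2400 / \<sigma>)^k)\<^sup>2 * (2/2400)^k"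
    proof -
      have e: "2 * 2400 / \<sigma>\<^sup>2 = (2400/\<sigma>)\<^sup>2 * (2/2400)" by (simp add: power_divide)
      show ?thesis unfolding e power_mult_distrib by (simp flip: power_mult add: mult.commute)
    qed
    then show ?thesis using s0 pos by (simp add: power_mult_distrib)
  qed
  have q: "(2 / 2400)^k * (2 + c * real J) \<le> 2 + c * (2 * P + 1 + \<sigma> + 1)"
  proof -
    have h: "(2/2400 :: real)^k \<le> (1/2)^k" by (intro power_mono) auto
    have k1: "(1/2::real)^k * real k \<le> 1"
      using less_exp[of k] by (simp add: power_divide divide_le_eq)
    have k0: "(1/2::real)^k \<le> 1" by (simp add: power_le_one)
    have P0: "0 \<le> P" using N0 unfolding P_def by simp
    have "2 + c * real J \<le> (2 + c * (2 * P + 1)) + c * (\<sigma> + 1) * real k"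
      using mult_left_mono[OF Jle pos(4)] by (simp add: algebra_simps)
    then have "(2 / 2400)^k * (2 + c * real J) \<le> (1/2)^k * ((2 + c * (2 * P + 1)) + c * (\<sigma> + 1) * real k)"
      using h pos(4) by (intro mult_mono) auto
    also have "\<dots> = (1/2)^k * (2 + c * (2 * P + 1)) + (c * (\<sigma> + 1)) * ((1/2)^k * real k)" by (simp add: algebra_simps)
    also have "\<dots> \<le> 1 * (2 + c * (2 * P + 1)) + (c * (\<sigma> + 1)) * 1"
      using k0 k1 P0 pos(4) s0 by (intro add_mono mult_right_mono mult_left_mono) auto
    finally show ?thesis by (simp add: algebra_simps)
  qed
  have "4 * (gam0 / w0\<^sup>2 * (2 / 2400)^k) * (2 + c * real J) = 4 * gam0 / w0\<^sup>2 * ((2 / 2400)^k * (2 + c * real J))" by simp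
  also have "\<dots> \<le> 4 * gam0 / w0\<^sup>2 * (2 + c * (2 * P + 1 + \<sigma> + 1))"
    using q pos by (intro mult_left_mono) auto
  also have "\<dots> = 4 * gam0 * (2 + c * (24 * l * lam0 / \<sigma> + 1 + \<sigma> + 1)) / w0\<^sup>2" by (simp add: P_def)
  finally have G3: "4 * (gam0 / w0\<^sup>2 * (2 / 2400)^k) * (2 + c * real J) \<le> 2400\<^sup>2 / \<sigma>^4" using small by linarith
  show ?thesis using G1 G2 G3 unfolding r by blast
qed

text \<open>Stone-Weierstrass for the algebra of band-limited functions, where two types are raised
  to their maximum before adding. Sines of period \<open>l\<close> separate points because
  \<open>\<bar>x $ i\<bar> \<le> l/4\<close> keeps the phase in \<open>[- pi/2, pi/2]\<close>, where
  the sine is injective.\<close>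

lemma trigonometric_approximation:
  fixes v :: "real^2 \<Rightarrow> real"
  assumes K: "compact K" "\<And>x i. x \<in> K \<Longrightarrow> \<bar>x $ i\<bar> \<le> l/4" and l: "0 < l" and v: "continuous_on K v" and e: "0 < e"
  shows "\<exists>g C N. BL l C N g \<and> (\<forall>x\<in>K. \<bar>v x - g x\<bar> < e)"
proof -
  interpret function_ring_on "{g. \<exists>C N. BL l C N g}" K
  proof
    show "compact K" by (rule K)
    show "continuous_on K f" if "f \<in> {g. \<exists>C N. BL l C N g}" for f
      using that BL_continuous continuous_on_subset by blast
    show "(\<lambda>x. f x + g x) \<in> {g. \<exists>C N. BL l C N g}" if fg: "f \<in> {g. \<exists>C N. BL l C N g}" "g \<in> {g. \<exists>C N. BL l C N g}" for f g
    proof -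
      obtain C N C' N' where 1: "BL l C N f" "BL l C' N' g" using fg by blast
      have "BL l C (max N N') f" "BL l C' (max N N') g" using BL_mono[OF 1(1)] BL_mono[OF 1(2)] by auto
      from BL_add[OF this] show ?thesis by blast
    qed
    show "(\<lambda>x. f x * g x) \<in> {g. \<exists>C N. BL l C N g}" if fg: "f \<in> {g. \<exists>C N. BL l C N g}" "g \<in> {g. \<exists>C N. BL l C N g}" for f g
      using fg BL_mult by blast
    show "(\<lambda>_. c) \<in> {g. \<exists>C N. BL l C N g}" for c using BL_const by blast
    show "\<exists>f\<in>{g. \<exists>C N. BL l C N g}. f x \<noteq> f y" if xy: "x \<in> K" "y \<in> K" "x \<noteq> y" for x y
    proof -
      obtain i where i: "x $ i \<noteq> y $ i" using xy(3) by (auto simp: vec_eq_iff)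
      let ?\<mu> = "2 * pi / l"
      let ?g = "\<lambda>x::real^2. cos (?\<mu> * x $ i + (- pi/2))"
      have "BL l 1 \<bar>?\<mu>\<bar> ?g" using l by (intro BL_cos_BL[where k=1]) simp
      moreover have "?g x \<noteq> ?g y"
      proof
        assume "?g x = ?g y"
        then have s: "sin (?\<mu> * x $ i) = sin (?\<mu> * y $ i)" by (simp add: cos_diff)
        have "\<bar>?\<mu> * z $ i\<bar> \<le> pi/2" if "z \<in> K" for z
        proof -
          have "\<bar>?\<mu> * z $ i\<bar> = ?\<mu> * \<bar>z $ i\<bar>" using l by (simp add: abs_mult)
          also have "\<dots> \<le> ?\<mu> * (l/4)" using K(2)[OF that, of i] l by (intro mult_left_mono) auto
          finally show ?thesis using l by simp
        qed
        from this[OF xy(1)] this[OF xy(2)] have "?\<mu> * x $ i = ?\<mu> * y $ i"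
          by (intro sin_inj_pi[OF _ _ _ _ s]) linarith+
        then show False using i l by simp
      qed
      ultimately show ?thesis by (intro bexI[of _ ?g] CollectI exI)
    qed
  qed
  show ?thesis using Stone_Weierstrass_basic[OF v e] by blast
qed

text \<open>The order of choices is essential: \<open>\<sigma>\<close> depends on \<alpha> alone;
  then \<open>H0\<close>, \<open>gam0\<close> and \<open>T0\<close> depend on the data, on
  \<open>\<sigma>\<close> and on \<open>\<delta>\<close>; last comes the initial frequency
  \<open>x\<close>. With \<open>w0\<close> proportional to \<open>x\<close>, none of the earlier
  constants involves \<open>x\<close>, and every remaining requirement holds once \<open>x\<close>
  is large.\<close>

lemma solution_near:
  fixes U0 :: "2 \<Rightarrow> real^2 \<Rightarrow> real" and \<omega> :: "(real^2) set"
  assumes U0: "\<And>c. BL l C1 N1 (U0 c)" and L: "l = 2 * pi * real L" "1 \<le> L"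
    and \<omega>: "open \<omega>" "bounded \<omega>" "\<And>x i. x \<in> \<omega> \<Longrightarrow> \<bar>x $ i\<bar> < l/8" and f: "f \<in> L_infty \<omega>"
    and \<alpha>: "0 < \<alpha>" "\<alpha> < 1" and \<delta>: "0 < \<delta>"
  shows "\<exists>v :: real^2 \<Rightarrow> real^2. Hoelder_plane 1 \<alpha> v \<and> weak_solution \<omega> f (restrict v (closure \<omega>)) \<and>
    (\<forall>c x. \<bar>v x $ c - U0 c x\<bar> \<le> 4 * \<delta>)"
proof -
  have l: "0 < l" using L by simp
  obtain g F where g: "g \<in> borel_measurable borel" "\<And>x. \<bar>g x\<bar> \<le> F" "\<And>x i. g (x + axis i l) = g x"
      and gz: "\<And>x. Pm (1 / (8 * l)) g x = 0"
      and gw: "\<And>\<phi>. \<phi> \<in> test_functions \<omega> \<Longrightarrow> (LINT x|lebesgue_on \<omega>. f x * \<phi> x) = (\<integral>x. g x * \<phi> x \<partial>lborel)"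
    using periodic_extension[OF \<omega>(1,3) l f] by blast
  have "\<exists>A B C' N'. BL l C' N' A \<and> BL l C' N' B \<and> (\<forall>x. hdet (U0 c) x = pd 1 (pd 1 A) x + pd 2 (pd 2 B) x)" for c
    by (rule hdet_divergence[OF U0 l])
  then obtain A B C' N' where AB0: "\<And>c. BL l (C' c) (N' c) (A c)" "\<And>c. BL l (C' c) (N' c) (B c)"
      and det: "\<And>c x. hdet (U0 c) x = pd 1 (pd 1 (A c)) x + pd 2 (pd 2 (B c)) x" by metis
  define C2 where "C2 = max (C' 1) (C' 2)"
  define N2 where "N2 = max (N' 1) (N' 2)"
  have c12: "c = 1 \<or> c = 2" for c :: 2 by (rule exhaust_2)
  have le2: "C' c \<le> C2" "N' c \<le> N2" for c using c12[of c] by (auto simp: C2_def N2_def)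
  have AB: "BL l C2 N2 (A c)" "BL l C2 N2 (B c)" for c using BL_mono[OF AB0(1) le2] BL_mono[OF AB0(2) le2] by auto
  have C2: "0 \<le> C2" using BL_nonneg[OF AB(1)] by blast
  have F: "0 \<le> F" using g(2)[of 0] by linarith
  define n0 where "n0 = 1 / (8 * l)"
  have n0: "0 < n0" using l by (simp add: n0_def)
  define c where "c = mom2 * (cP * F)"
  have c0: "0 \<le> c" using mom2(1) cP_ge_1 F by (simp add: c_def)
  \<comment> \<open>Size of the initial defects: \<open>2 * c / n0\<^sup>2\<close> from the first
    mollification of the right-hand side, and \<open>C2\<close> for the Hessian determinant of each
    component.\<close>
  define \<Gamma> where "\<Gamma> = 2 * c / n0\<^sup>2 + (C2 + C2)"
  define H1 where "H1 = C1 * N1 * N1"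
  have H1: "0 \<le> H1" using BL_nonneg[OF U0] by (simp add: H1_def)

  have "((\<lambda>n. real n powr (\<alpha> - 1)) \<longlongrightarrow> 0) sequentially"
    using \<alpha> by (intro tendsto_neg_powr filterlim_real_sequentially) simp
  then have "eventually (\<lambda>n. real n powr (\<alpha> - 1) < 1/2400) sequentially" by (rule order_tendstoD) simp
  then obtain s where s: "\<And>n. n \<ge> s \<Longrightarrow> real n powr (\<alpha> - 1) < 1/2400" unfolding eventually_sequentially by blast
  \<comment> \<open>An integer, so that with the integer \<open>ln\<close> all frequencies
    \<open>x * \<sigma>^k\<close> are integers and fit the period
    \<open>l = 2 * pi * real L\<close>.\<close>
  define sn where "sn = max s 2401"
  define \<sigma> where "\<sigma> = real sn"
  have \<sigma>: "2400 < \<sigma>" by (simp add: \<sigma>_def sn_def)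
  have \<sigma>p: "2400 / \<sigma> * \<sigma> powr \<alpha> < 1"
  proof -
    have "\<sigma> powr (\<alpha> - 1) < 1/2400" unfolding \<sigma>_def by (rule s) (simp add: sn_def)
    then show ?thesis using \<sigma> by (simp add: powr_diff)
  qed
  have s0: "0 < \<sigma>" using \<sigma> by simp

  define H0 where "H0 = max 1 (max H1 (\<Gamma> / (130 * \<delta>)))"
  define gam0 where "gam0 = 130 * H0 * \<delta> * \<sigma>\<^sup>2 / 2400"
  define T0 where "T0 = max H1 (1560 * H0 * \<sigma> / 2400)"
  define c2 where "c2 = 64 * mom2 * cP"
  have c2: "0 \<le> c2" using mom2(1) cP_ge_1 by (simp add: c2_def)
  have H0: "1 \<le> H0" "H1 \<le> H0" "\<Gamma> / (130 * \<delta>) \<le> H0" by (auto simp: H0_def)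
  have gam0: "0 < gam0" using H0(1) \<delta> s0 by (simp add: gam0_def)
  have T0: "H1 \<le> T0" "1560 * H0 * \<sigma> / 2400 \<le> T0" by (auto simp: T0_def)
  have T0p: "0 < T0" using T0(2) H0(1) s0 by (intro less_le_trans[OF _ T0(2)]) simp
  \<comment> \<open>Only lower bounds on the frequency remain. The last line is the smallness of
    \<open>gam0 / w0\<^sup>2\<close>: the logarithmic loss is bounded by a linear term, which the
    square of the frequency beats. The zero coefficients bring the other lines into the form of
    \<open>eventually_linear_le_square\<close>.\<close>
  have "eventually (\<lambda>n.
      540 * T0 * \<sigma> + 0 * real n \<le> 2400 * \<delta> * (real n)\<^sup>2 \<and>
      H1 + 0 * real n \<le> 2 * \<delta> * (real n)\<^sup>2 \<and>
      max N1 N2 \<le> 3 / \<sigma> * real n \<and>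
      n0 \<le> 1 / (2 * \<sigma>) * real n \<and>
      1 \<le> 12 * l / \<sigma> * real n \<and>
      1 \<le> 1 * real n \<and>
      32 * c * \<sigma>^6 + 0 * real n \<le> 4 * gam0 * 2400\<^sup>2 * (real n)\<^sup>2 \<and>
      4 * gam0 * \<sigma>^4 * (2 + c2 * (\<sigma> + 2)) + 4 * gam0 * \<sigma>^4 * c2 * 24 * l / \<sigma> * real n \<le> 2400\<^sup>2 * \<delta>\<^sup>2 * (real n)\<^sup>2) sequentially"
    using \<delta> s0 l gam0 by (intro eventually_conj eventually_linear_le_square eventually_le_linear) auto
  then obtain ln where "540 * T0 * \<sigma> + 0 * real ln \<le> 2400 * \<delta> * (real ln)\<^sup>2 \<and>
      H1 + 0 * real ln \<le> 2 * \<delta> * (real ln)\<^sup>2 \<and>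
      max N1 N2 \<le> 3 / \<sigma> * real ln \<and>
      n0 \<le> 1 / (2 * \<sigma>) * real ln \<and>
      1 \<le> 12 * l / \<sigma> * real ln \<and>
      1 \<le> 1 * real ln \<and>
      32 * c * \<sigma>^6 + 0 * real ln \<le> 4 * gam0 * 2400\<^sup>2 * (real ln)\<^sup>2 \<and>
      4 * gam0 * \<sigma>^4 * (2 + c2 * (\<sigma> + 2)) + 4 * gam0 * \<sigma>^4 * c2 * 24 * l / \<sigma> * real ln \<le> 2400\<^sup>2 * \<delta>\<^sup>2 * (real ln)\<^sup>2"
    using eventually_happens'[OF sequentially_bot] by blast
  then obtain x where x: "x = real ln"
     "540 * T0 * \<sigma> \<le> 2400 * \<delta> * x\<^sup>2" "H1 \<le> 2 * \<delta> * x\<^sup>2" "N1 \<le> 3 * x / \<sigma>" "N2 \<le> 3 * x / \<sigma>" "n0 \<le> x / (2 * \<sigma>)"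
     "1 \<le> 12 * l * x / \<sigma>" "1 \<le> x" "32 * c * \<sigma>^6 \<le> 4 * gam0 * 2400\<^sup>2 * x\<^sup>2"
     "4 * gam0 * \<sigma>^4 * (2 + c2 * (\<sigma> + 2)) + 4 * gam0 * \<sigma>^4 * c2 * 24 * l / \<sigma> * x \<le> 2400\<^sup>2 * \<delta>\<^sup>2 * x\<^sup>2" by auto
  have x0: "0 < x" using x(8) by simp
  \<comment> \<open>The offset makes \<open>4 * \<mu> (Suc k)\<close> equal to
    \<open>2 * (x * \<sigma>^k)\<close>, within the type that the increment of the right-hand side
    may have at stage \<open>k\<close>.\<close>
  define \<mu> where "\<mu> k = x * \<sigma>^k / (2 * \<sigma>)" for k :: nat
  have \<mu>: "0 < \<mu> k" for k using x0 s0 by (simp add: \<mu>_def)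
  define fs where "fs k = Pm (\<mu> k) g" for k
  \<comment> \<open>The displacement is governed by \<open>w0 / x = \<delta>\<close> and stays fixed
    when the frequency is raised; \<open>gam0\<close> involves \<open>w0\<close> only through this
    quotient.\<close>
  define w0 where "w0 = \<delta> * x"

  have small: "4 * gam0 * (2 + c2 * (24 * l * x / \<sigma> + 1 + \<sigma> + 1)) / w0\<^sup>2 \<le> 2400\<^sup>2 / \<sigma>^4"
  proof -
    have "4 * gam0 * (2 + c2 * (24 * l * x / \<sigma> + 1 + \<sigma> + 1)) * \<sigma>^4
        = 4 * gam0 * \<sigma>^4 * (2 + c2 * (\<sigma> + 2)) + 4 * gam0 * \<sigma>^4 * c2 * 24 * l / \<sigma> * x" by (simp add: algebra_simps)
    also have "\<dots> \<le> 2400\<^sup>2 * w0\<^sup>2" using x(10) by (simp add: w0_def power_mult_distrib)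
    finally show ?thesis using x0 \<delta> s0 by (simp add: w0_def divide_simps)
  qed
  have incr: "\<exists>X :: 2 \<Rightarrow> real^2 \<Rightarrow> real. (\<forall>i. BL l (gam0 * (2 * 2400 / \<sigma>\<^sup>2)^(k+2) / 4) (3 * (x * \<sigma>^k)) (X i)) \<and>
      (\<forall>y. fs (Suc k) y = fs k y + pd 1 (pd 1 (X 1)) y + pd 2 (pd 2 (X 2)) y)" for k
  proof -
    have "\<mu> k \<le> \<mu> (Suc k)" using x0 \<sigma> by (simp add: \<mu>_def field_simps)
    from Pm_difference[OF g \<mu> this] obtain X Y where
      XY: "BL l (2 * c / (\<mu> k)\<^sup>2) (4 * \<mu> (Suc k)) X" "BL l (2 * c / (\<mu> k)\<^sup>2) (4 * \<mu> (Suc k)) Y"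
        "\<And>y. fs (Suc k) y = fs k y + pd 1 (pd 1 X) y + pd 2 (pd 2 Y) y" unfolding c_def fs_def by blast
    have N: "4 * \<mu> (Suc k) \<le> 3 * (x * \<sigma>^k)" using x0 s0 by (simp add: \<mu>_def)
    \<comment> \<open>In \<open>\<sigma>^6\<close>, two powers come from the offset in
      \<open>\<mu>\<close> and four from the shift \<open>k + 2\<close>. The remaining powers of
      \<open>\<sigma>\<close> match the decay of the defects exactly.\<close>
    have "2 * c / (\<mu> k)\<^sup>2 = 32 * c * \<sigma>^6 / (4 * x\<^sup>2 * (\<sigma>\<^sup>2)^(k+2))"
      using x0 s0 by (simp add: \<mu>_def power_divide power_mult_distrib power_add flip: power_mult) (simp add: field_simps flip: power_mult power_add; simp add: power2_eq_square power_add[symmetric] eval_nat_numeral)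
    also have "\<dots> \<le> 4 * gam0 * 2400\<^sup>2 * x\<^sup>2 / (4 * x\<^sup>2 * (\<sigma>\<^sup>2)^(k+2))"
      using x(9) s0 by (intro divide_right_mono) auto
    also have "\<dots> = gam0 * (2 * 2400)^2 / (4 * (\<sigma>\<^sup>2)^(k+2))" using x0 by (simp add: field_simps)
    also have "\<dots> \<le> gam0 * (2 * 2400)^(k+2) / (4 * (\<sigma>\<^sup>2)^(k+2))"
      using gam0 s0 by (intro divide_right_mono mult_left_mono power_increasing) auto
    also have "\<dots> = gam0 * (2 * 2400 / \<sigma>\<^sup>2)^(k+2) / 4" by (simp add: power_divide)
    finally have C: "2 * c / (\<mu> k)\<^sup>2 \<le> gam0 * (2 * 2400 / \<sigma>\<^sup>2)^(k+2) / 4" .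
    show ?thesis
      using BL_mono[OF XY(1) C N] BL_mono[OF XY(2) C N] XY(3) by (intro exI[of _ "\<lambda>i. if i = 1 then X else Y"]) auto
  qed
  interpret sch: scheme l \<sigma> x w0 H0 T0 gam0 2400 fs
  proof
    show "gam0 * 2400 * x = 130 * H0 * w0 * \<sigma>\<^sup>2" by (simp add: gam0_def w0_def)
    show "1560 * H0 * \<sigma> \<le> T0 * 2400" using T0(2) by simp
    show "540 * T0 * \<sigma> \<le> 2400 * (w0 * x)" using x(2) by (simp add: w0_def power2_eq_square mult_ac)
    show "\<exists>z. x * \<sigma>^k * l = 2 * pi * of_int z" for k
      by (rule exI[of _ "int (ln * sn^k * L)"]) (simp add: x(1) \<sigma>_def L(1))
    show "\<exists>J. 2 * (3 * (x * \<sigma>^k) / \<sigma>) \<le> 2 ^ J * (1 / (2 * l)) \<and> 2 ^ J * (1 / (2 * l)) \<le> 3 * (x * \<sigma>^k)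
      \<and> 4 * (gam0 * (2 * 2400 / \<sigma>\<^sup>2)^k / (w0 * (2400 / \<sigma>)^k)\<^sup>2) * (2 + 64 * mom2 * cP * real J) \<le> 2400\<^sup>2 / \<sigma>^4" for k
      unfolding c2_def[symmetric]
      by (rule dyadic_scale[OF l _ x0 _ gam0 c2 x(7) small]) (use \<sigma> x0 \<delta> in \<open>auto simp: w0_def\<close>)
  qed (use l \<sigma> x0 \<delta> H0(1) T0p gam0 incr in \<open>auto simp: w0_def\<close>)

  have NN0: "sch.NN 0 = 3 * x / \<sigma>" by (simp add: sch.NN_def sch.lam_def)
  have "n0 \<le> \<mu> 0" using x(6) by (simp add: \<mu>_def)
  from Pm_difference[OF g n0 this] obtain X Y where
    XY: "BL l (2 * c / n0\<^sup>2) (4 * \<mu> 0) X" "BL l (2 * c / n0\<^sup>2) (4 * \<mu> 0) Y"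
    and XYe: "\<And>y. fs 0 y = Pm n0 g y + pd 1 (pd 1 X) y + pd 2 (pd 2 Y) y" unfolding c_def fs_def by blast
  have N\<mu>: "4 * \<mu> 0 \<le> 3 * x / \<sigma>" using x0 s0 by (simp add: \<mu>_def field_simps)
  have XY': "BL l (2 * c / n0\<^sup>2) (3 * x / \<sigma>) X" "BL l (2 * c / n0\<^sup>2) (3 * x / \<sigma>) Y"
    using BL_mono[OF XY(1) order.refl N\<mu>] BL_mono[OF XY(2) order.refl N\<mu>] .
  have AB': "BL l C2 (3 * x / \<sigma>) (A i)" "BL l C2 (3 * x / \<sigma>) (B i)" for i
    using BL_mono[OF AB(1) order.refl x(5)] BL_mono[OF AB(2) order.refl x(5)] .
  have neg: "BL l C2 (3 * x / \<sigma>) (\<lambda>y. - 1 * h y)" if "BL l C2 (3 * x / \<sigma>) h" for h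
    using BL_cmult[OF that, of "- 1"] by simp
  define G where "G i = (if i = (1::2) then (\<lambda>y. X y + (- 1 * A 1 y + - 1 * A 2 y)) else (\<lambda>y. Y y + (- 1 * B 1 y + - 1 * B 2 y)))" for i
  have G1: "BL l \<Gamma> (3 * x / \<sigma>) (G i)" for i
  proof (cases "i = 1")
    case True
    then have e: "G i = (\<lambda>y. X y + (- 1 * A 1 y + - 1 * A 2 y))" by (simp add: G_def)
    show ?thesis unfolding e \<Gamma>_def by (rule BL_add[OF XY'(1) BL_add[OF neg[OF AB'(1)] neg[OF AB'(1)]]])
  next
    case False
    then have e: "G i = (\<lambda>y. Y y + (- 1 * B 1 y + - 1 * B 2 y))" by (simp add: G_def)
    show ?thesis unfolding e \<Gamma>_def by (rule BL_add[OF XY'(2) BL_add[OF neg[OF AB'(2)] neg[OF AB'(2)]]])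
  qed
  have \<Gamma>: "\<Gamma> \<le> 130 * \<delta> * H0" using H0(3) \<delta> by (simp add: divide_le_eq mult_ac)
  have g1: "sch.gam 1 = gam0 * (2 * 2400 / \<sigma>\<^sup>2)" by (simp only: sch.gam_def power_one_right)
  have "gam0 * (2 * 2400 / \<sigma>\<^sup>2) / 2 = 130 * \<delta> * H0" using s0 by (simp add: gam0_def)
  then have q1: "\<Gamma> \<le> sch.gam 1 / 2" using \<Gamma> by (simp only: g1)
  have "sch.gam 1 / 2 \<le> sch.gam 0"
  proof -
    have "2400 * 1 \<le> \<sigma> * \<sigma>" using \<sigma> by (intro mult_mono) auto
    then have "2400 / \<sigma>\<^sup>2 \<le> 1" using s0 by (simp add: power2_eq_square)
    from mult_left_mono[OF this, of gam0] show ?thesis using gam0 unfolding g1 by (simp add: sch.gam_def mult.commute)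
  qed
  then have q0: "\<Gamma> \<le> sch.gam 0" using q1 by linarith
  have st: "sch.state 0 (U0, G)"
    unfolding sch.state_def prod.case NN0
  proof (intro conjI allI impI)
    show "\<exists>C. BL l C (3 * x / \<sigma>) (U0 i)" for i using BL_mono[OF U0 order.refl x(4)] by blast
    fix i d
    have b: "BL l H1 N1 (pd a (pd b (U0 i)))" for a b i unfolding H1_def by (rule BL_pd[OF BL_pd[OF U0]])
    show "BL l (sch.Hk 0) (3 * x / \<sigma>) (pd d (pd d (U0 i)))"
      by (rule BL_mono[OF b _ x(4)]) (simp add: sch.Hk_def H0)
    show "BL l (sch.Tk 0) (3 * x / \<sigma>) (pd i (pd d (U0 i)))"
      by (rule BL_mono[OF b _ x(4)]) (simp add: sch.Tk_def T0)
    show "BL l (2 * sch.wt 0 * sch.lam 0) (3 * x / \<sigma>) (pd i (pd i (U0 i)))"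
    proof (rule BL_mono[OF b _ x(4)])
      show "H1 \<le> 2 * sch.wt 0 * sch.lam 0"
        unfolding sch.wt_def sch.lam_def using x(3) by (simp add: w0_def power2_eq_square mult_ac)
    qed
  next
    show "BL l (sch.gam 0) (3 * x / \<sigma>) (G (sch.oth 0))" by (rule BL_mono[OF G1 q0]) simp
    show "BL l (sch.gam (Suc 0) / 2) (3 * x / \<sigma>) (G (sch.dir 0))" using BL_mono[OF G1 q1] by simp
  next
    fix y
    have d: "dif X" "dif Y" "dif (pd i X)" "dif (pd i Y)" "dif (A j)" "dif (B j)" "dif (pd i (A j))" "dif (pd i (B j))" for i j
      using BL_dif[OF XY(1)] BL_dif[OF XY(2)] BL_dif[OF BL_pd[OF XY(1)]] BL_dif[OF BL_pd[OF XY(2)]]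
        BL_dif[OF AB(1)] BL_dif[OF AB(2)] BL_dif[OF BL_pd[OF AB(1)]] BL_dif[OF BL_pd[OF AB(2)]] by blast+
    have e1: "pd 1 (pd 1 (G 1)) y = pd 1 (pd 1 X) y - (pd 1 (pd 1 (A 1)) y + pd 1 (pd 1 (A 2)) y)"
      unfolding G_def by (simp only: simp_thms if_True pd_dif dif_intros d pd_const; simp)
    have e2: "pd 2 (pd 2 (G 2)) y = pd 2 (pd 2 Y) y - (pd 2 (pd 2 (B 1)) y + pd 2 (pd 2 (B 2)) y)"
    proof -
      have "G 2 = (\<lambda>y. Y y + (- 1 * B 1 y + - 1 * B 2 y))" by (simp add: G_def)
      then show ?thesis by (simp only: pd_dif dif_intros d pd_const; simp)
    qed
    \<comment> \<open>\<open>gz\<close> says that the extension has no mean, so \<open>fs 0\<close>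
      is a sum of two pure second derivatives and can be counted among the defects together with the
      determinants.\<close>
    show "hdet (U0 1) y + hdet (U0 2) y = fs 0 y - pd 1 (pd 1 (G 1)) y - pd 2 (pd 2 (G 2)) y"
      unfolding e1 e2 XYe det using gz[of y] unfolding n0_def by simp
  qed
  have conv: "(\<lambda>k. \<integral>y. fs k y * \<phi> y \<partial>lborel) \<longlonglongrightarrow> (LINT y|lebesgue_on \<omega>. f y * \<phi> y)" if "\<phi> \<in> test_functions \<omega>" for \<phi>
    unfolding gw[OF that] fs_def
  proof (rule Pm_weak_convergence[OF g(1,2) \<mu> _ that])
    have "filterlim (\<lambda>k. \<sigma>^k) at_top sequentially"
    proof (rule filterlim_at_infinity_imp_filterlim_at_top)
      show "filterlim (\<lambda>k. \<sigma>^k) at_infinity sequentially" using \<sigma> by (intro filterlim_realpow_sequentially_gt1) simp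
      show "\<forall>\<^sub>F k in sequentially. 0 < \<sigma>^k" using s0 by simp
    qed
    then have "filterlim (\<lambda>k. x / (2 * \<sigma>) * \<sigma>^k) at_top sequentially"
      using x0 s0 by (intro filterlim_tendsto_pos_mult_at_top[OF tendsto_const]) auto
    then show "filterlim \<mu> at_top sequentially" by (simp add: \<mu>_def[abs_def] mult_ac)
  qed
  have "4 * w0 / x = 4 * \<delta>" using x0 by (simp add: w0_def)
  then show ?thesis using sch.scheme_limit[OF st \<alpha> \<sigma>p \<omega>(1,2) conv] by (simp only:)
qed

section \<open>Density\<close>

lemma weak_solution_near:
  fixes v :: "real^2 \<Rightarrow> real^2" and \<omega> :: "(real^2) set"
  assumes \<omega>: "open \<omega>" "bounded \<omega>" and f: "f \<in> L_infty \<omega>" and \<alpha>: "0 < \<alpha>" "\<alpha> < 1"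
    and v: "continuous_on (closure \<omega>) v" and e: "0 < e"
  shows "\<exists>w\<in>Hoelder_space 1 \<alpha> \<omega>. weak_solution \<omega> f w \<and> (\<forall>x\<in>closure \<omega>. norm (w x - v x) \<le> e)"
proof -
  obtain R where R: "\<And>x. x \<in> closure \<omega> \<Longrightarrow> norm x \<le> R"
    using bounded_closure[OF \<omega>(2)] unfolding bounded_iff by blast
  obtain m :: nat where m: "2 * R < real m" using reals_Archimedean2 by blast
  \<comment> \<open>Since \<open>pi > 2\<close>, the side \<open>l\<close> is at least
    \<open>4 * real L\<close>, hence above \<open>8 * R\<close>, and the closure of the domain lies
    in the box of half-side \<open>l/8\<close>.\<close>
  define L where "L = max 1 m"
  define l where "l = 2 * pi * real L"
  have L: "1 \<le> L" "2 * R < real L" using m by (auto simp: L_def)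
  have l: "0 < l" using L by (simp add: l_def)
  have "real L * 2 \<le> real L * pi" using pi_gt3 by (intro mult_left_mono) auto
  then have "R < l/8" using L(2) by (simp add: l_def mult_ac)
  then have comp: "\<bar>x $ i\<bar> < l/8" if "x \<in> closure \<omega>" for x i
    using R[OF that] component_le_norm_cart[of x i] by linarith
  have "\<exists>g C N. BL l C N g \<and> (\<forall>x\<in>closure \<omega>. \<bar>v x $ c - g x\<bar> < e/4)" for c
  proof (rule trigonometric_approximation)
    show "compact (closure \<omega>)" using \<omega>(2) by simp
    show "\<bar>x $ i\<bar> \<le> l/4" if "x \<in> closure \<omega>" for x i using comp[OF that, of i] l by linarith
    show "continuous_on (closure \<omega>) (\<lambda>x. v x $ c)" using v by (intro continuous_intros)
  qed (use l e in auto)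
  then obtain U0 C N where U0: "\<And>c. BL l (C c) (N c) (U0 c)" "\<And>c x. x \<in> closure \<omega> \<Longrightarrow> \<bar>v x $ c - U0 c x\<bar> < e/4" by metis
  have U1: "BL l (max (C 1) (C 2)) (max (N 1) (N 2)) (U0 c)" for c
    by (rule BL_mono[OF U0(1)[of c]]) (use exhaust_2[of c] in auto)
  have "\<bar>x $ i\<bar> < l/8" if "x \<in> \<omega>" for x i using comp that closure_subset by blast
  \<comment> \<open>For each component \<open>4 * (e/16)\<close> comes from the scheme and
    \<open>e/4\<close> from the approximation; the norm is at most the sum over the two components,
    hence at most \<open>e\<close>.\<close>
  then have "\<exists>w :: real^2 \<Rightarrow> real^2. Hoelder_plane 1 \<alpha> w \<and> weak_solution \<omega> f (restrict w (closure \<omega>)) \<and>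
    (\<forall>c x. \<bar>w x $ c - U0 c x\<bar> \<le> 4 * (e/16))"
    using e by (intro solution_near[OF U1 l_def L(1) \<omega> _ f \<alpha>]) auto
  then obtain w :: "real^2 \<Rightarrow> real^2" where w: "Hoelder_plane 1 \<alpha> w" "weak_solution \<omega> f (restrict w (closure \<omega>))"
    "\<And>c x. \<bar>w x $ c - U0 c x\<bar> \<le> 4 * (e/16)" by blast
  have "norm (restrict w (closure \<omega>) x - v x) \<le> e" if x: "x \<in> closure \<omega>" for x
  proof -
    have "\<bar>(w x - v x) $ c\<bar> \<le> e/2" for c
      using w(3)[of x c] U0(2)[OF x, of c] unfolding vector_minus_component by linarith
    from this[of 1] this[of 2] have "(\<Sum>c\<in>UNIV. \<bar>(w x - v x) $ c\<bar>) \<le> e" unfolding sum_2 by linarith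
    then show ?thesis using norm_le_l1_cart[of "w x - v x"] x by simp
  qed
  then show ?thesis using w unfolding Hoelder_space_def by blast
qed

lemma Hoelder_space_subset_C0:
  assumes "bounded \<omega>"
  shows "Hoelder_space 1 \<alpha> \<omega> \<subseteq> mspace (C0_space \<omega> :: (real^2 \<Rightarrow> real^2) metric)"
proof
  fix w :: "real^2 \<Rightarrow> real^2" assume "w \<in> Hoelder_space 1 \<alpha> \<omega>"
  then obtain u :: "real^2 \<Rightarrow> real^2" where u: "w = restrict u (closure \<omega>)" "u differentiable_on UNIV"
    by (auto simp: Hoelder_space_def numeral_eq_Suc One_nat_def)
  have "continuous_on (closure \<omega>) u"
    by (rule continuous_on_subset[OF differentiable_imp_continuous_on[OF u(2)] subset_UNIV])
  then have "continuous_on (closure \<omega>) w" unfolding u(1) by (rule continuous_on_eq) simp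
  then show "w \<in> mspace (C0_space \<omega>)" unfolding mspace_C0_space[OF assms] u(1) by simp
qed

theorem corollary1p2:
  fixes \<omega> :: "(real^2) set" and f :: "real^2 \<Rightarrow> real" and \<alpha> :: real
  assumes "open \<omega>" and "bounded \<omega>" and "simply_connected \<omega>"
    and "f \<in> L_infty \<omega>"
    and "0 < \<alpha>" and "\<alpha> < 1"
  shows "mtopology_of (C0_space \<omega>) closure_of {v \<in> Hoelder_space 1 \<alpha> \<omega>. weak_solution \<omega> f v}
           = mspace (C0_space \<omega>) \<and>
         (\<forall>v \<in> mspace (C0_space \<omega>).
            \<exists>w :: nat \<Rightarrow> real^2 \<Rightarrow> real^2.
              (\<forall>n. w n \<in> Hoelder_space 1 \<alpha> \<omega> \<and> weak_solution \<omega> f (w n)) \<and>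
              uniform_limit (closure \<omega>) w v sequentially)"
proof -
  let ?S = "{v \<in> Hoelder_space 1 \<alpha> \<omega>. weak_solution \<omega> f v}"
  have near: "\<exists>w\<in>?S. \<forall>x\<in>closure \<omega>. norm (w x - v x) \<le> e" if "v \<in> mspace (C0_space \<omega>)" "0 < e" for v e
    using weak_solution_near[OF assms(1,2,4,5,6) _ that(2), of v] that(1) unfolding mspace_C0_space[OF assms(2)] by blast
  have sub: "?S \<subseteq> mspace (C0_space \<omega>)" using Hoelder_space_subset_C0[OF assms(2)] by blast
  have "v \<in> mtopology_of (C0_space \<omega>) closure_of ?S" if v: "v \<in> mspace (C0_space \<omega>)" for v
    unfolding mtopology_of_def Metric_space.metric_closure_of[OF Metric_space_mspace_mdist]
  proof (intro CollectI conjI v allI impI)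
    fix r :: real assume r: "0 < r"
    obtain w where w: "w \<in> ?S" "\<And>x. x \<in> closure \<omega> \<Longrightarrow> norm (w x - v x) \<le> r/2" using near[OF v, of "r/2"] r by auto
    have "mdist (C0_space \<omega>) v w \<le> r/2" unfolding C0_space_def
      by (rule mdist_cfunspace_le) (use r w(2) in \<open>auto simp: dist_norm norm_minus_commute\<close>)
    then have "w \<in> Metric_space.mball (mspace (C0_space \<omega>)) (mdist (C0_space \<omega>)) v r"
      using v w(1) sub r by (auto simp: Metric_space.in_mball[OF Metric_space_mspace_mdist])
    then show "\<exists>y\<in>?S. y \<in> Metric_space.mball (mspace (C0_space \<omega>)) (mdist (C0_space \<omega>)) v r" using w(1) by blast
  qed
  moreover have "mtopology_of (C0_space \<omega>) closure_of ?S \<subseteq> mspace (C0_space \<omega>)"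
    using closure_of_subset_topspace[of "mtopology_of (C0_space \<omega>)"] by simp
  moreover have "\<exists>w :: nat \<Rightarrow> real^2 \<Rightarrow> real^2. (\<forall>n. w n \<in> Hoelder_space 1 \<alpha> \<omega> \<and> weak_solution \<omega> f (w n)) \<and>
      uniform_limit (closure \<omega>) w v sequentially" if v: "v \<in> mspace (C0_space \<omega>)" for v
  proof -
    have "\<forall>n. \<exists>w. w \<in> ?S \<and> (\<forall>x\<in>closure \<omega>. norm (w x - v x) \<le> inverse (real (Suc n)))"
    proof
      show "\<exists>w. w \<in> ?S \<and> (\<forall>x\<in>closure \<omega>. norm (w x - v x) \<le> inverse (real (Suc n)))" for n
        using near[OF v, of "inverse (real (Suc n))"] by (simp only: Bex_def) simp
    qed
    from choice[OF this] obtain w where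
      w: "\<And>n. w n \<in> ?S" "\<And>n x. x \<in> closure \<omega> \<Longrightarrow> norm (w n x - v x) \<le> inverse (real (Suc n))" by blast
    have "uniform_limit (closure \<omega>) w v sequentially"
    proof (rule uniform_limitI)
      fix e :: real assume "0 < e"
      then have "eventually (\<lambda>n. inverse (real (Suc n)) < e) sequentially"
        by (rule order_tendstoD(2)[OF LIMSEQ_inverse_real_of_nat])
      then show "\<forall>\<^sub>F n in sequentially. \<forall>x\<in>closure \<omega>. dist (w n x) (v x) < e"
        unfolding dist_norm
      proof eventually_elim
        case (elim n)
        then show ?case using w(2)[of _ n] by (meson le_less_trans)
      qed
    qed
    then show ?thesis using w(1) by (intro exI[of _ w]) simp
  qed
  ultimately show ?thesis by (intro conjI ballI equalityI subsetI) blast+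
qed

end
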